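(* Algorithm 1 (described in the context) runs in time polynomial in the encoding size of its input VASS $\mathcal{A}$ (counter updates written in binary). In particular, when called on a VASS of dimension $d$, the overall depth of recursion of the procedure Decompose is $<d$.
   Context: A $d$-dimensional VASS is a pair $\mathcal{A}=(Q,T)$ with $Q$ a finite nonempty set of states and $T\subseteq Q\times\mathbb{Z}^d\times Q$ a finite set of transitions such that every state has an outgoing transition. A sub-VASS is a VASS $(Q',T')$ with $Q'\subseteq Q$, $T'\subseteq T$. $\mathcal{A}$ is strongly connected if there is a finite (nonempty) path between any two states; an SCC of a graph $(Q,T')$ is a maximal strongly connected sub-VASS of it. A linear map is $f(p\mathbf{v})=\mathbf{c}_f^\top\mathbf{v}+\mathbf{w}_f(p)$ with $\mathbf{c}_f\in\mathbb{Q}^d$, $\mathbf{w}_f\in\mathbb{Q}^Q$. A transition $(p,\mathbf{u},q)$ is $f$-ranked if $\mathbf{c}_f^\top\mathbf{u}+\mathbf{w}_f(q)\le\mathbf{w}_f(p)-1$ and $f$-neutral if $\mathbf{c}_f^\top\mathbf{u}+\mathbf{w}_f(q)=\mathbf{w}_f(p)$. A quasi-ranking function (QRF) is a linear map $f$ with $\mathbf{c}_f\ge\vec0$ such that every transition is $f$-ranked or $f$-neutral; it is positive if $\mathbf{c}_f>\vec 0$ componentwise. Algorithm 1: input a strongly connected $d$-dimensional VASS $\mathcal{A}$ with at least one transition. Set $\mathit{tight}:=\mathit{true}$ if a positive QRF for $\mathcal{A}$ exists, otherwise $\mathit{false}$. Let $k:=\mathrm{Decompose}(\mathcal{A})$;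 if $k=\infty$ return "non-terminating", otherwise return $(k,\mathit{tight})$. Procedure $\mathrm{Decompose}(\mathcal{A})$: let $f$ be a QRF for $\mathcal{A}$ maximizing the number of $f$-ranked transitions; let $T_f$ be the set of $f$-neutral transitions; if $T_f$ contains all transitions of $\mathcal{A}$ return $\infty$; if $T_f=\emptyset$ return $1$; otherwise let $\mathcal{A}_1,\dots,\mathcal{A}_\ell$ be all SCCs of $(Q,T_f)$ and return $1+\max(\mathrm{Decompose}(\mathcal{A}_1),\dots,\mathrm{Decompose}(\mathcal{A}_\ell))$.
   Formalization: The depth bound < d fails for some non-terminating inputs (d=1, one state, loops -1 and 0: depth 1). It is proved whenever the answer is not "non-terminating"; in general every call has depth < d, except that calls returning ∞ at once may have depth d. *)

theory Defs
  imports
    "Jordan_Normal_Form.Matrix"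
    "HOL-Computational_Algebra.Polynomial"
    "HOL-Library.Extended_Nat"
    "HOL-Library.Log_Nat"
begin

section \<open>Vector addition systems with states\<close>

type_synonym 'q transition = "'q \<times> int vec \<times> 'q"

type_synonym 'q vass = "'q set \<times> 'q transition set"

definition is_vass :: "nat \<Rightarrow> 'q vass \<Rightarrow> bool" where
  "is_vass d A \<longleftrightarrow> (case A of (Q, T) \<Rightarrow>
     finite Q \<and> Q \<noteq> {} \<and> finite T \<and> T \<subseteq> Q \<times> carrier_vec d \<times> Q \<and>
     (\<forall>p\<in>Q. \<exists>u q. (p, u, q) \<in> T))"

definition strongly_connected :: "'q vass \<Rightarrow> bool" where
  "strongly_connected A \<longleftrightarrow> (case A of (Q, T) \<Rightarrow>
     \<forall>p\<in>Q. \<forall>q\<in>Q. (p, q) \<in> {(r, s). \<exists>u. (r, u, s) \<in> T}\<^sup>+)"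

text \<open>The graph \<open>G\<close> below need not be a VASS itself: removing transitions
  may leave states without outgoing transitions.\<close>

definition sub_vass :: "nat \<Rightarrow> 'q vass \<Rightarrow> 'q vass \<Rightarrow> bool" where
  "sub_vass d B G \<longleftrightarrow> is_vass d B \<and> fst B \<subseteq> fst G \<and> snd B \<subseteq> snd G"

definition sccs :: "nat \<Rightarrow> 'q vass \<Rightarrow> 'q vass set" where
  "sccs d G = {B. sub_vass d B G \<and> strongly_connected B \<and>
     (\<forall>C. sub_vass d C G \<longrightarrow> strongly_connected C \<longrightarrow> sub_vass d B C \<longrightarrow> C = B)}"


section \<open>Quasi-ranking functions\<close>

text \<open>A pair \<open>(c, w)\<close> stands for the linear map sending the configuration
  \<open>p v\<close> to \<open>c \<bullet> v + w p\<close>. Values of \<open>w\<close> outside the states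
  of the VASS at hand play no role.\<close>

type_synonym 'q linear_map = "rat vec \<times> ('q \<Rightarrow> rat)"

definition ranked :: "'q linear_map \<Rightarrow> 'q transition \<Rightarrow> bool" where
  "ranked f e \<longleftrightarrow> (case f of (c, w) \<Rightarrow> case e of (p, u, q) \<Rightarrow>
     c \<bullet> map_vec rat_of_int u + w q \<le> w p - 1)"

definition neutral :: "'q linear_map \<Rightarrow> 'q transition \<Rightarrow> bool" where
  "neutral f e \<longleftrightarrow> (case f of (c, w) \<Rightarrow> case e of (p, u, q) \<Rightarrow>
     c \<bullet> map_vec rat_of_int u + w q = w p)"

definition QRF :: "nat \<Rightarrow> 'q vass \<Rightarrow> 'q linear_map \<Rightarrow> bool" where
  "QRF d A f \<longleftrightarrow> fst f \<in> carrier_vec d \<and> 0\<^sub>v d \<le> fst f \<and>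
     (\<forall>e\<in>snd A. ranked f e \<or> neutral f e)"

definition positive_QRF :: "nat \<Rightarrow> 'q vass \<Rightarrow> 'q linear_map \<Rightarrow> bool" where
  "positive_QRF d A f \<longleftrightarrow> QRF d A f \<and> (\<forall>i<d. 0 < fst f $ i)"

definition maximal_QRF :: "nat \<Rightarrow> 'q vass \<Rightarrow> 'q linear_map \<Rightarrow> bool" where
  "maximal_QRF d A f \<longleftrightarrow> QRF d A f \<and>
     (\<forall>g. QRF d A g \<longrightarrow> card {e \<in> snd A. ranked g e} \<le> card {e \<in> snd A. ranked f e})"

definition neutral_transitions :: "'q vass \<Rightarrow> 'q linear_map \<Rightarrow> 'q transition set" where
  "neutral_transitions A f = {e \<in> snd A. neutral f e}"


section \<open>The algorithm\<close>

text \<open>\<open>Decompose\<close> may choose any maximal QRF, so it is modelled by its execution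
  trees: a node \<open>Call A f ts\<close> is a call with argument \<open>A\<close> choosing
  \<open>f\<close> and issuing the recursive calls \<open>ts\<close>.\<close>

datatype 'q call = Call (arg: "'q vass") (chosen: "'q linear_map") (subcalls: "'q call list")

fun decompose_run :: "nat \<Rightarrow> 'q call \<Rightarrow> bool" where
  "decompose_run d (Call A f ts) \<longleftrightarrow> maximal_QRF d A f \<and>
     (let T\<^sub>f = neutral_transitions A f in
      if T\<^sub>f = snd A \<or> T\<^sub>f = {} then ts = []
      else distinct (map arg ts) \<and> set (map arg ts) = sccs d (fst A, T\<^sub>f) \<and>
           (\<forall>t\<in>set ts. decompose_run d t))"

fun return_value :: "'q call \<Rightarrow> enat" where
  "return_value (Call A f ts) =
     (let T\<^sub>f = neutral_transitions A f in
      if T\<^sub>f = snd A then \<infinity>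
      else if T\<^sub>f = {} then 1
      else 1 + Max (set (map return_value ts)))"

text \<open>The initial call is at depth \<open>0\<close>.\<close>

fun calls_at :: "'q call \<Rightarrow> (nat \<times> 'q call) set" where
  "calls_at (Call A f ts) =
     insert (0, Call A f ts) ((\<lambda>(j, s). (Suc j, s)) ` (\<Union>t\<in>set ts. calls_at t))"

definition recursion_depth :: "'q call \<Rightarrow> nat" where
  "recursion_depth t = Max (fst ` calls_at t)"

datatype verdict = Non_terminating | Bound nat bool

definition algorithm_run :: "nat \<Rightarrow> 'q vass \<Rightarrow> 'q call \<Rightarrow> verdict \<Rightarrow> bool" where
  "algorithm_run d A t r \<longleftrightarrow> arg t = A \<and> decompose_run d t \<and>
     r = (case return_value t of
            \<infinity> \<Rightarrow> Non_terminating
          | enat k \<Rightarrow> Bound k (\<exists>f. positive_QRF d A f))"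


text \<open>A call that answers \<open>\<infinity>\<close> at once may occur at depth \<open>d\<close>: in dimension \<open>1\<close>,
  consider a single state with loops of effect \<open>-1\<close> and \<open>0\<close>. Hence the recursion depth is
  below \<open>d\<close> only if such calls are left out of account.\<close>

lemma depth_equal_to_dimension:
  defines "e \<equiv> \<lambda>z. (0 :: nat, vec_of_list [z :: int], 0 :: nat)"
  shows "\<exists>t. is_vass 1 ({0}, {e (-1), e 0}) \<and> strongly_connected ({0}, {e (-1), e 0}) \<and>
    algorithm_run 1 ({0}, {e (-1), e 0}) t Non_terminating \<and> recursion_depth t = 1"
proof -
  define f where "f = (vec_of_list [1 :: rat], \<lambda>_ :: nat. 0 :: rat)"
  define A where "A = ({0 :: nat}, {e (-1), e 0})"
  define B where "B = ({0 :: nat}, {e 0})"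
  have sp: "c \<bullet> map_vec rat_of_int (vCons z vNil) = c $ 0 * of_int z" for c z
    by (simp add: scalar_prod_def)
  have car: "vCons x vNil \<in> carrier_vec (Suc 0)" for x
    by (rule carrier_vecI) simp
  have ne: "e (-1) \<noteq> e 0"
    unfolding e_def using arg_cong[of "vec_of_list [-1 :: int]" "vec_of_list [0]" "\<lambda>v. v $ 0"]
    by auto
  have r0: "\<not> ranked g (e 0)" and n0: "neutral g (e 0)" for g
    by (auto simp: ranked_def neutral_def e_def sp split: prod.splits)
  have r1: "ranked f (e (-1))" and n1: "\<not> neutral f (e (-1))"
    by (auto simp: ranked_def neutral_def e_def sp f_def)
  have va: "is_vass 1 A" and vb: "is_vass 1 B"
    by (auto simp: is_vass_def A_def B_def e_def car)
  have sc: "strongly_connected A" "strongly_connected B"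
    by (auto simp: strongly_connected_def A_def B_def e_def intro!: r_into_trancl)
  have q: "QRF 1 A f" "QRF 1 B f"
    by (simp_all add: QRF_def A_def B_def r1 n0) (simp_all add: f_def less_eq_vec_def car)
  have m: "maximal_QRF 1 A f" "maximal_QRF 1 B f"
  proof -
    have "{x \<in> snd A. ranked g x} \<subseteq> {x \<in> snd A. ranked f x}"
      "{x \<in> snd B. ranked g x} \<subseteq> {x \<in> snd B. ranked f x}" for g
      by (auto simp: A_def B_def r0 r1)
    moreover have "finite {x \<in> snd A. ranked f x}" "finite {x \<in> snd B. ranked f x}"
      by (auto simp: A_def B_def)
    ultimately show "maximal_QRF 1 A f" "maximal_QRF 1 B f"
      unfolding maximal_QRF_def using q by (blast intro: card_mono)+
  qed
  have nA: "neutral_transitions A f = {e 0}" and nB: "neutral_transitions B f = {e 0}"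
    by (auto simp: neutral_transitions_def A_def B_def n0 n1)
  have eq: "C = B" if "sub_vass 1 C B" for C
  proof -
    obtain Q T where C: "C = (Q, T)" by (cases C)
    have sub: "Q \<subseteq> {0}" "T \<subseteq> {e 0}" "Q \<noteq> {}" and out: "\<forall>p\<in>Q. \<exists>u q. (p, u, q) \<in> T"
      using that by (simp_all add: C B_def sub_vass_def is_vass_def)
    have "Q = {0}" using sub by blast
    moreover from this have "T \<noteq> {}" using out by blast
    ultimately show ?thesis using sub(2) by (simp add: C B_def subset_singleton_iff)
  qed
  have scc: "sccs 1 B = {B}"
  proof -
    have "sub_vass 1 B B" using vb by (simp add: sub_vass_def)
    thus ?thesis unfolding sccs_def using eq sc(2) by blast
  qed
  have AB: "(fst A, {e 0}) = B" by (simp add: A_def B_def)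
  have sA: "snd A = {e (-1), e 0}" and sB: "snd B = {e 0}" by (auto simp: A_def B_def)
  let ?t = "Call A f [Call B f []]"
  have "decompose_run 1 ?t" "return_value ?t = \<infinity>"
    by (simp_all add: Let_def m nA nB scc AB sA sB ne del: One_nat_def)
  hence "algorithm_run 1 A ?t Non_terminating"
    by (simp add: algorithm_run_def)
  moreover have "recursion_depth ?t = 1" by (simp add: recursion_depth_def)
  ultimately show ?thesis using va sc(1) by (fold A_def) (intro exI[of _ ?t] conjI)
qed


section \<open>Random access machines with logarithmic cost\<close>

text \<open>Programs are random access machine programs in structured form. The memory maps
  addresses to integers. Every operation is charged at least the number of bits of all
  addresses and integers it handles (multiplication and division are charged the product of
  the lengths), so that polynomial time here is polynomial time on Turing machines.\<close>

type_synonym memory = "int \<Rightarrow> int"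

datatype expr =
    Const int
  | Cell expr
  | Add expr expr
  | Sub expr expr
  | Mul expr expr
  | Div expr expr

definition bits :: "int \<Rightarrow> nat" where
  "bits z = floorlog 2 (nat \<bar>z\<bar>) + 1"

fun eval :: "memory \<Rightarrow> expr \<Rightarrow> int" where
  "eval m (Const z) = z"
| "eval m (Cell a) = m (eval m a)"
| "eval m (Add a b) = eval m a + eval m b"
| "eval m (Sub a b) = eval m a - eval m b"
| "eval m (Mul a b) = eval m a * eval m b"
| "eval m (Div a b) = eval m a div eval m b"

fun expr_cost :: "memory \<Rightarrow> expr \<Rightarrow> nat" where
  "expr_cost m (Const z) = bits z"
| "expr_cost m (Cell a) = expr_cost m a + bits (eval m a) + bits (m (eval m a))"
| "expr_cost m (Add a b) = expr_cost m a + expr_cost m b + bits (eval m a) + bits (eval m b)"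
| "expr_cost m (Sub a b) = expr_cost m a + expr_cost m b + bits (eval m a) + bits (eval m b)"
| "expr_cost m (Mul a b) = expr_cost m a + expr_cost m b + bits (eval m a) * bits (eval m b)"
| "expr_cost m (Div a b) = expr_cost m a + expr_cost m b + bits (eval m a) * bits (eval m b)"

datatype program =
    Skip
  | Store expr expr
  | Seq program program
  | If expr program program
  | While expr program

text \<open>\<open>exec P m n m'\<close>: started in memory \<open>m\<close>, program \<open>P\<close> halts
  in memory \<open>m'\<close> after running for time \<open>n\<close>. Tests succeed on positive values.\<close>

inductive exec :: "program \<Rightarrow> memory \<Rightarrow> nat \<Rightarrow> memory \<Rightarrow> bool" where
  skip: "exec Skip m 1 m"
| store: "exec (Store a b) m
     (1 + expr_cost m a + expr_cost m b + bits (eval m a) + bits (eval m b))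
     (m(eval m a := eval m b))"
| seq: "exec P m n m' \<Longrightarrow> exec R m' n' m'' \<Longrightarrow> exec (Seq P R) m (n + n') m''"
| if_true: "eval m b > 0 \<Longrightarrow> exec P m n m' \<Longrightarrow> exec (If b P R) m (1 + expr_cost m b + n) m'"
| if_false: "\<not> eval m b > 0 \<Longrightarrow> exec R m n m' \<Longrightarrow> exec (If b P R) m (1 + expr_cost m b + n) m'"
| while_false: "\<not> eval m b > 0 \<Longrightarrow> exec (While b P) m (1 + expr_cost m b) m"
| while_true: "eval m b > 0 \<Longrightarrow> exec P m n m' \<Longrightarrow> exec (While b P) m' n' m'' \<Longrightarrow>
     exec (While b P) m (1 + expr_cost m b + n + n') m''"

text \<open>Cell \<open>0\<close> holds the length of the input, and eventually of the output; the
  items follow in the cells \<open>1, 2, \<dots>\<close>\<close>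

definition input_memory :: "int list \<Rightarrow> memory" where
  "input_memory xs = (\<lambda>i.
     if i = 0 then int (length xs)
     else if 1 \<le> i \<and> i \<le> int (length xs) then xs ! nat (i - 1)
     else 0)"

definition holds_output :: "memory \<Rightarrow> int list \<Rightarrow> bool" where
  "holds_output m ys \<longleftrightarrow> m 0 = int (length ys) \<and> (\<forall>i<length ys. m (int i + 1) = ys ! i)"


section \<open>Encodings\<close>

definition encoding_size :: "int list \<Rightarrow> nat" where
  "encoding_size xs = sum_list (map bits xs)"

text \<open>States are named by natural numbers. Sets may be listed in any order, so encoding is
  a relation.\<close>

definition encode_transition :: "nat transition \<Rightarrow> int list" where
  "encode_transition e = (case e of (p, u, q) \<Rightarrow> int p # list_of_vec u @ [int q])"

definition encode_listing :: "nat \<Rightarrow> nat list \<Rightarrow> nat transition list \<Rightarrow> int list" where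
  "encode_listing d Qs Ts =
     [int d, int (length Qs)] @ map int Qs @ [int (length Ts)] @ concat (map encode_transition Ts)"

definition listing :: "nat vass \<Rightarrow> nat list \<Rightarrow> nat transition list \<Rightarrow> bool" where
  "listing A Qs Ts \<longleftrightarrow> distinct Qs \<and> set Qs = fst A \<and> distinct Ts \<and> set Ts = snd A"

definition encodes_vass :: "nat \<Rightarrow> nat vass \<Rightarrow> int list \<Rightarrow> bool" where
  "encodes_vass d A xs \<longleftrightarrow> (\<exists>Qs Ts. listing A Qs Ts \<and> xs = encode_listing d Qs Ts)"

definition encode_rat :: "rat \<Rightarrow> int list" where
  "encode_rat r = [fst (quotient_of r), snd (quotient_of r)]"

inductive encodes_call :: "nat \<Rightarrow> nat call \<Rightarrow> int list \<Rightarrow> bool" for d where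
  "listing A Qs Ts \<Longrightarrow> length yss = length ts \<Longrightarrow>
   (\<And>i. i < length ts \<Longrightarrow> encodes_call d (ts ! i) (yss ! i)) \<Longrightarrow>
   encodes_call d (Call A (c, w) ts)
     (encode_listing d Qs Ts @ concat (map encode_rat (list_of_vec c)) @
      concat (map (\<lambda>q. encode_rat (w q)) Qs) @ [int (length ts)] @ concat yss)"

fun encode_verdict :: "verdict \<Rightarrow> int list" where
  "encode_verdict Non_terminating = [0]"
| "encode_verdict (Bound k tight) = [1, int k, of_bool tight]"

text \<open>A program implements the algorithm on the input \<open>xs\<close> within time \<open>b\<close> if it
  performs one of the possible runs: besides the verdict it has to write down the protocol of
  the calls of \<open>Decompose\<close> with the QRFs computed there. A program that obtains the
  verdict in some unrelated way does not count.\<close>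

definition performs_algorithm :: "program \<Rightarrow> nat \<Rightarrow> nat vass \<Rightarrow> int list \<Rightarrow> nat \<Rightarrow> bool" where
  "performs_algorithm P d A xs b \<longleftrightarrow> (\<exists>n m t r ys.
     exec P (input_memory xs) n m \<and> n \<le> b \<and>
     algorithm_run d A t r \<and> encodes_call d t ys \<and> holds_output m (encode_verdict r @ ys))"

end

theory Submission imports Defs "Jordan_Normal_Form.Determinant" "HOL-Library.While_Combinator" begin

text \<open>
  \<^emph>\<open>Depth.\<close> In a chain of nested calls with QRFs \<open>f\<^sub>0, f\<^sub>1, \<dots>\<close>, strong connectivity puts some
  \<open>f\<^sub>i\<close>-ranked transition on a cycle of the \<open>i\<close>-th argument. The effect \<open>u\<^sub>i\<close> of that cycle satisfies
  \<open>c\<^sub>i \<bullet> u\<^sub>i < 0\<close>, and \<open>c\<^sub>l \<bullet> u\<^sub>i = 0\<close> for \<open>l < i\<close> since \<open>f\<^sub>l\<close> is neutral on the \<open>i\<close>-th argument.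
  Such a triangular system has at most \<open>d\<close> members.

  \<^emph>\<open>Time.\<close> Up to scaling, a maximal QRF is a solution of maximal support of a homogeneous system of
  linear inequalities with integer coefficients. It is found by a perceptron algorithm with
  rescaling in the style of Chubanov. Every recursive call has fewer transitions than its parent and
  the arguments of sibling calls are disjoint, so there are fewer than twice as many calls as
  transitions. No program is written down for all this: the functions on (encoded) trees
  that a machine with a heap computes in polynomial time are closed under composition, pairing,
  conditionals and loops whose number of rounds and whose states are polynomially bounded, and the
  algorithm is a function of this kind.
\<close>

section \<open>Polynomial-time functions on random access machines\<close>

text \<open>Counting ranked transitions may be replaced by maximal support because solutions form a
  convex cone: a sum of two solutions is positive wherever one of them is, so a single solution
  attains all supports at once, and a large multiple raises its positive values to at least 1. Since
  the coefficients of the linear map are among the rows, the same solution decides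
  \<open>tight\<close>. The obstacle to polynomial time is the growth of numbers under exact
  rational arithmetic. There is no rounding: the matrix of a state solves a linear system with short
  integer coefficients, so Cramer's rule bounds its entries however many updates led to it. The
  depth bound is strict because a call that ranks some transition adds a covector and a cycle of its
  own to those of its ancestors; a call that ranks none adds nothing and may occur at depth d. A
  nonempty set of neutral transitions might have no component at all, leaving a maximum over the
  empty set. Maximality excludes this: neutral transitions without cycles could be ranked as
  well.\<close>

lemma bits_le_Suc_iff: "bits z \<le> Suc k \<longleftrightarrow> \<bar>z\<bar> < 2 ^ k"
proof -
  have "bits z \<le> Suc k \<longleftrightarrow> nat \<bar>z\<bar> < 2 ^ k"
    by (simp add: bits_def floorlog_le_iff)
  also have "\<dots> \<longleftrightarrow> \<bar>z\<bar> < 2 ^ k" by (simp add: nat_less_iff)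
  finally show ?thesis .
qed

lemma bits_ge_1 [simp]: "1 \<le> bits z" "Suc 0 \<le> bits z" "0 < bits z"
  by (simp_all add: bits_def)

lemma abs_less_bits: "\<bar>z\<bar> < 2 ^ (bits z - 1)"
  using bits_le_Suc_iff[of z "bits z - 1"] by simp

lemma bits_mono: "\<bar>a\<bar> \<le> \<bar>b\<bar> \<Longrightarrow> bits a \<le> bits b"
  by (simp add: bits_def floorlog_mono nat_mono)

lemma bits_minus [simp]: "bits (- a) = bits a" by (simp add: bits_def)

lemma bits_add: "bits (a + b) \<le> bits a + bits b"
proof -
  define k l where "k = bits a - 1" and "l = bits b - 1"
  have "\<bar>a\<bar> < 2 ^ k" "\<bar>b\<bar> < 2 ^ l" by (simp_all add: k_def l_def abs_less_bits[simplified])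
  moreover have "(2::int) ^ k \<le> 2 ^ (k + l)" "(2::int) ^ l \<le> 2 ^ (k + l)" by simp_all
  moreover have "(2::int) ^ (k + l + 1) = 2 ^ (k + l) + 2 ^ (k + l)" by simp
  ultimately have "\<bar>a + b\<bar> < 2 ^ (k + l + 1)" by linarith
  hence "bits (a + b) \<le> Suc (k + l + 1)" by (simp only: bits_le_Suc_iff)
  moreover have "Suc (k + l + 1) = bits a + bits b"
    using bits_ge_1(1)[of a] bits_ge_1(1)[of b] unfolding k_def l_def by linarith
  ultimately show ?thesis by simp
qed

lemma bits_diff: "bits (a - b) \<le> bits a + bits b"
  using bits_add[of a "-b"] by simp

lemma bits_mult: "bits (a * b) \<le> bits a + bits b"
proof -
  define k l where "k = bits a - 1" and "l = bits b - 1"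
  have "\<bar>a\<bar> < 2 ^ k" "\<bar>b\<bar> < 2 ^ l" by (simp_all add: k_def l_def abs_less_bits[simplified])
  hence "\<bar>a * b\<bar> < 2 ^ (k + l)"
    by (simp add: abs_mult power_add mult_strict_mono)
  hence "bits (a * b) \<le> Suc (k + l)" by (simp only: bits_le_Suc_iff)
  moreover have "Suc (k + l) \<le> bits a + bits b"
    using bits_ge_1(1)[of a] bits_ge_1(1)[of b] unfolding k_def l_def by linarith
  ultimately show ?thesis by simp
qed

lemma abs_div_le: "\<bar>a div b\<bar> \<le> \<bar>a\<bar>" for a b :: int
proof -
  have pos: "\<bar>a div b\<bar> \<le> \<bar>a\<bar>" if "b > 0" for a b :: int
  proof (cases "a \<ge> 0")
    case True
    have "a div b \<le> a div 1" by (rule zdiv_mono2) (use True that in auto)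
    moreover have "0 \<le> a div b" using True that by (simp add: pos_imp_zdiv_nonneg_iff)
    ultimately show ?thesis by simp
  next
    case False
    have "a div 1 \<le> a div b" by (rule zdiv_mono2_neg) (use False that in auto)
    moreover have "a div b < 0" using False that by (simp add: pos_imp_zdiv_neg_iff)
    ultimately show ?thesis using False by simp
  qed
  from pos[of b a] pos[of "-b" "-a"] show ?thesis by (cases b "0::int" rule: linorder_cases) auto
qed

lemma bits_div: "bits (a div b) \<le> bits a"
  by (rule bits_mono[OF abs_div_le])

lemma bits_le_abs: "bits z \<le> nat \<bar>z\<bar> + 1"
proof -
  have "\<bar>z\<bar> < 2 ^ nat \<bar>z\<bar>" using of_nat_less_two_power[of "nat \<bar>z\<bar>", where 'a = int] by simp
  thus ?thesis using bits_le_Suc_iff by (metis Suc_eq_plus1)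
qed

lemma bits_of_nat_le: "bits (int n) \<le> n + 1"
  using bits_le_abs[of "int n"] by simp

lemma bits_power: "bits (a ^ n) \<le> n * bits a + 2"
proof (induction n)
  case 0 show ?case using bits_le_abs[of 1] by simp
next
  case (Suc n) thus ?case using bits_mult[of a "a ^ n"] by simp
qed

text \<open>The base \<open>s + 2\<close> is at least 2 even for \<open>s = 0\<close>, so constants
  (by \<open>c \<le> 2 ^ c\<close>), sums and products are all absorbed by a larger
  exponent.\<close>

definition polyb :: "(nat \<Rightarrow> nat) \<Rightarrow> bool" where
  "polyb p \<longleftrightarrow> (\<exists>e. \<forall>s. p s \<le> (s + 2) ^ e)"

lemma polyb_const [intro, simp]: "polyb (\<lambda>_. c)"
proof -
  have "c \<le> (s + 2) ^ c" for s
    using less_exp[of c] power_mono[of 2 "s+2" c] by simp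
  thus ?thesis unfolding polyb_def by blast
qed

lemma polyb_id [intro, simp]: "polyb (\<lambda>s. s)"
  unfolding polyb_def by (rule exI[of _ 1]) simp

lemma polyb_add [intro]: assumes "polyb p" "polyb q" shows "polyb (\<lambda>s. p s + q s)"
proof -
  obtain e f where e: "\<And>s. p s \<le> (s + 2) ^ e" "\<And>s. q s \<le> (s + 2) ^ f"
    using assms unfolding polyb_def by blast
  have "p s + q s \<le> (s + 2) ^ (e + f + 1)" for s
  proof -
    have "(s + 2) ^ e \<le> (s + 2) ^ (e + f)" "(s + 2) ^ f \<le> (s + 2) ^ (e + f)"
      by (simp_all add: power_increasing)
    hence "p s + q s \<le> 2 * (s + 2) ^ (e + f)" using e[of s] by linarith
    also have "\<dots> \<le> (s + 2) * (s + 2) ^ (e + f)" by (rule mult_right_mono) auto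
    finally show ?thesis by simp
  qed
  thus ?thesis unfolding polyb_def by blast
qed

lemma polyb_mult [intro]: assumes "polyb p" "polyb q" shows "polyb (\<lambda>s. p s * q s)"
proof -
  obtain e f where e: "\<And>s. p s \<le> (s + 2) ^ e" "\<And>s. q s \<le> (s + 2) ^ f"
    using assms unfolding polyb_def by blast
  have "p s * q s \<le> (s + 2) ^ (e + f)" for s
    unfolding power_add by (rule mult_mono[OF e]) auto
  thus ?thesis unfolding polyb_def by blast
qed

lemma polyb_power [intro]: assumes "polyb p" shows "polyb (\<lambda>s. p s ^ e)"
  by (induction e) (auto intro: assms)

lemma polyb_Suc [intro]: "polyb p \<Longrightarrow> polyb (\<lambda>s. Suc (p s))"
  using polyb_add[of p "\<lambda>_. 1"] by simp

lemma polyb_mono: "polyb q \<Longrightarrow> (\<And>s. p s \<le> q s) \<Longrightarrow> polyb p"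
  unfolding polyb_def by (meson le_trans)

section \<open>Binary trees as values and their representation on a write-once heap\<close>

datatype val = Num int | Pr val val

fun vsize :: "val \<Rightarrow> nat" where
  "vsize (Num z) = bits z"
| "vsize (Pr a b) = vsize a + vsize b + 1"

lemma vsize_pos [simp]: "0 < vsize v" "Suc 0 \<le> vsize v" by (cases v; simp add: Suc_leI)+

text \<open>Register \<open>k\<close> lives at the odd negative address \<open>ra k\<close>; register \<open>0\<close> is the
  heap pointer, and heap cell \<open>p\<close> is the even negative address \<open>ha p\<close>. The heap
  is write-once: a word below the heap pointer keeps denoting the same value forever.\<close>

definition ra :: "nat \<Rightarrow> int" where "ra k = - 2 * int k - 1"
definition ha :: "int \<Rightarrow> int" where "ha p = - 2 * p - 2"

lemma ra_ha_simps [simp]: "ra k \<noteq> ha p" "ha p \<noteq> ra k" "ra j = ra k \<longleftrightarrow> j = k" "ha p = ha q \<longleftrightarrow> p = q"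
  unfolding ra_def ha_def by presburger+

text \<open>A number is the word itself, a pair is the address of two adjacent heap cells. Words
  carry no tag: the same word may be read as a number or as a pair, and the value that is meant
  decides. Both cells have to lie below the heap pointer, which is why later allocations cannot
  destroy a representation.\<close>

fun rep :: "memory \<Rightarrow> int \<Rightarrow> val \<Rightarrow> bool" where
  "rep m w (Num z) \<longleftrightarrow> w = z"
| "rep m w (Pr a b) \<longleftrightarrow> 0 \<le> w \<and> w + 1 < m (ra 0) \<and> rep m (m (ha w)) a \<and> rep m (m (ha (w + 1))) b"

text \<open>Register 0, the heap pointer, is exempt because it may grow. Nothing is said about
  addresses from 0 on, where input and output live, so that writing the output counts as keeping the
  heap.\<close>

definition keeps :: "nat \<Rightarrow> memory \<Rightarrow> memory \<Rightarrow> bool" where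
  "keeps k m m' \<longleftrightarrow> m (ra 0) \<le> m' (ra 0) \<and> (\<forall>j. 0 < j \<and> j < k \<longrightarrow> m' (ra j) = m (ra j)) \<and>
     (\<forall>p. 0 \<le> p \<and> p < m (ra 0) \<longrightarrow> m' (ha p) = m (ha p))"

lemma keeps_trans: "keeps k m m' \<Longrightarrow> keeps l m' m'' \<Longrightarrow> k \<le> l \<Longrightarrow> keeps k m m''"
  unfolding keeps_def by (smt (verit) order.strict_trans2)

lemma keeps_refl [simp]: "keeps k m m" by (simp add: keeps_def)

lemma keeps_mono: "keeps l m m' \<Longrightarrow> k \<le> l \<Longrightarrow> keeps k m m'"
  unfolding keeps_def by auto

lemma keeps_reg: "keeps k m m' \<Longrightarrow> 0 < j \<Longrightarrow> j < k \<Longrightarrow> m' (ra j) = m (ra j)"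
  unfolding keeps_def by auto

lemma keeps_hp: "keeps k m m' \<Longrightarrow> m (ra 0) \<le> m' (ra 0)"
  unfolding keeps_def by auto

lemma rep_keeps: "rep m w v \<Longrightarrow> keeps k m m' \<Longrightarrow> rep m' w v"
  by (induction v arbitrary: w) (auto simp: keeps_def)

lemma keeps_upd_reg: "0 < j \<Longrightarrow> k \<le> j \<Longrightarrow> keeps k m (m(ra j := z))"
  by (auto simp: keeps_def)

lemma rep_bits: "rep m w v \<Longrightarrow> bits w \<le> vsize v + bits (m (ra 0))"
proof (cases v)
  case (Pr a b)
  assume "rep m w v"
  hence "\<bar>w\<bar> \<le> \<bar>m (ra 0)\<bar>" using Pr by simp
  from bits_mono[OF this] show ?thesis by simp
qed simp

text \<open>The total length of the values of all subexpressions. Its square dominates the cost, and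
  unlike the cost it contains no products of lengths, so the estimates for concrete programs reduce
  to linear arithmetic.\<close>

fun esum :: "memory \<Rightarrow> expr \<Rightarrow> nat" where
  "esum m (Const z) = bits z"
| "esum m (Cell a) = esum m a + bits (m (eval m a))"
| "esum m (Add a b) = esum m a + esum m b + bits (eval m a + eval m b)"
| "esum m (Sub a b) = esum m a + esum m b + bits (eval m a - eval m b)"
| "esum m (Mul a b) = esum m a + esum m b + bits (eval m a * eval m b)"
| "esum m (Div a b) = esum m a + esum m b + bits (eval m a div eval m b)"

lemma bits_eval_le_esum: "bits (eval m e) \<le> esum m e" by (cases e) auto

lemma square_bound3:
  fixes x y z :: nat
  assumes "1 \<le> z" shows "x * x + y * y + x + y + x * y \<le> (x + y + z) * (x + y + z)"
proof -
  obtain z' where "z = Suc z'" using assms by (cases z) auto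
  thus ?thesis by (simp add: algebra_simps)
qed

lemma expr_cost_le_esum: "expr_cost m e \<le> esum m e * esum m e"
proof (induction e)
  case (Const z) show ?case using bits_ge_1(1)[of z] by simp
next
  case (Cell e)
  let ?x = "esum m e" and ?z = "bits (m (eval m e))"
  obtain z' where z: "?z = Suc z'" by (cases ?z) (use bits_ge_1(3)[of "m (eval m e)"] in auto)
  have "expr_cost m (Cell e) \<le> ?x * ?x + ?x + ?z" using Cell bits_eval_le_esum[of m e] by simp
  also have "\<dots> \<le> (?x + ?z) * (?x + ?z)" unfolding z by (simp add: algebra_simps)
  finally show ?case by simp
next
  case (Add a b)
  let ?z = "bits (eval m a + eval m b)"
  have "expr_cost m (Add a b) \<le> esum m a * esum m a + esum m b * esum m b + esum m a + esum m b"
    using Add bits_eval_le_esum[of m a] bits_eval_le_esum[of m b] by simp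
  thus ?case using square_bound3[of ?z "esum m a" "esum m b"] by simp
next
  case (Sub a b)
  let ?z = "bits (eval m a - eval m b)"
  have "expr_cost m (Sub a b) \<le> esum m a * esum m a + esum m b * esum m b + esum m a + esum m b"
    using Sub bits_eval_le_esum[of m a] bits_eval_le_esum[of m b] by simp
  thus ?case using square_bound3[of ?z "esum m a" "esum m b"] by simp
next
  case (Mul a b)
  let ?z = "bits (eval m a * eval m b)"
  have "expr_cost m (Mul a b) \<le> esum m a * esum m a + esum m b * esum m b + esum m a * esum m b"
    using Mul mult_mono[OF bits_eval_le_esum[of m a] bits_eval_le_esum[of m b]] by simp
  thus ?case using square_bound3[of ?z "esum m a" "esum m b"] by simp
next
  case (Div a b)
  let ?z = "bits (eval m a div eval m b)"
  have "expr_cost m (Div a b) \<le> esum m a * esum m a + esum m b * esum m b + esum m a * esum m b"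
    using Div mult_mono[OF bits_eval_le_esum[of m a] bits_eval_le_esum[of m b]] by simp
  thus ?case using square_bound3[of ?z "esum m a" "esum m b"] by simp
qed

lemma exec_store:
  assumes "a' = eval m a" "z = eval m b" "esum m a + esum m b + 1 \<le> s"
  shows "\<exists>n\<le>s * s. exec (Store a b) m n (m(a' := z))"
proof -
  let ?n = "1 + expr_cost m a + expr_cost m b + bits (eval m a) + bits (eval m b)"
  let ?x = "esum m a" and ?y = "esum m b"
  have "?n \<le> 1 + ?x * ?x + ?y * ?y + ?x + ?y"
    using expr_cost_le_esum[of m a] expr_cost_le_esum[of m b]
      bits_eval_le_esum[of m a] bits_eval_le_esum[of m b] by linarith
  also have "\<dots> \<le> (?x + ?y + 1) * (?x + ?y + 1)" by (simp add: algebra_simps)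
  also have "\<dots> \<le> s * s" using assms(3) by (intro mult_mono) auto
  finally show ?thesis using exec.store[of a b m] assms by auto
qed

section \<open>Access to registers and heap cells\<close>

definition rg :: "nat \<Rightarrow> expr" where "rg k = Cell (Const (ra k))"
definition haddr :: "expr \<Rightarrow> expr" where "haddr e = Sub (Const (-2)) (Mul (Const 2) e)"

lemma eval_rg [simp]: "eval m (rg k) = m (ra k)" by (simp add: rg_def)
lemma eval_haddr [simp]: "eval m (haddr e) = ha (eval m e)" by (simp add: haddr_def ha_def)
lemma esum_rg [simp]: "esum m (rg k) = bits (ra k) + bits (m (ra k))" by (simp add: rg_def)

lemma bits_small: "bits 0 \<le> 2" "bits 1 \<le> 2" "bits 2 \<le> 3" "bits (-2) \<le> 3" "bits (- 1) \<le> 2"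
  using bits_le_abs[of 0] bits_le_abs[of 1] bits_le_abs[of 2] by simp_all

lemma bits_ha: "bits (ha w) \<le> bits w + 6"
  using bits_diff[of "-2 * w" 2] bits_mult[of "-2" w] bits_small(3,4) unfolding ha_def
  by (simp del: bits_minus mult_minus_left)

lemma esum_haddr: "esum m (haddr e) \<le> esum m e + 2 * bits (eval m e) + 15"
proof -
  have "ha (eval m e) = - 2 - 2 * eval m e" by (simp add: ha_def)
  thus ?thesis using bits_small(3) bits_mult[of 2 "eval m e"] bits_ha[of "eval m e"]
    by (simp add: haddr_def)
qed

definition runs :: "nat \<Rightarrow> program \<Rightarrow> (nat \<Rightarrow> nat) \<Rightarrow> memory \<Rightarrow> val \<Rightarrow> val \<Rightarrow> bool" where
  "runs k P B m v v' \<longleftrightarrow> (\<exists>n m'. exec P m n m' \<and> n \<le> B (vsize v + bits (m (ra 0))) \<and>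
     m' (ra 0) \<le> m (ra 0) + int (B (vsize v)) \<and> keeps k m m' \<and> rep m' (m' (ra k)) v')"

lemma runs_mono: "runs k P B m v v' \<Longrightarrow> (\<And>s. B s \<le> B' s) \<Longrightarrow> runs k P B' m v v'"
  unfolding runs_def by (smt (verit, ccfv_threshold) le_trans of_nat_mono)

section \<open>Polynomial-time functions on encoded data\<close>

class enc =
  fixes enc :: "'a \<Rightarrow> val"

abbreviation sz :: "'a::enc \<Rightarrow> nat" where "sz x \<equiv> vsize (enc x)"

definition good :: "nat \<Rightarrow> memory \<Rightarrow> val \<Rightarrow> bool" where
  "good k m v \<longleftrightarrow> 0 \<le> m (ra 0) \<and> rep m (m (ra k)) v"

text \<open>Argument and result are in register \<open>k\<close>, and the program leaves the registers below \<open>k\<close>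
  alone. Its time may depend on the length of the heap pointer, whereas the number of heap cells it
  allocates may not: this keeps the heap pointer short when programs are composed.\<close>

definition pt :: "'a::enc set \<Rightarrow> ('a \<Rightarrow> 'b::enc) \<Rightarrow> bool" where
  "pt D f \<longleftrightarrow> (\<exists>B. polyb B \<and> (\<forall>x\<in>D. sz (f x) \<le> B (sz x))) \<and>
     (\<forall>k\<ge>1. \<exists>P B. polyb B \<and>
       (\<forall>x\<in>D. \<forall>m. good k m (enc x) \<longrightarrow> runs k P B m (enc x) (enc (f x))))"

lemma ptI:
  assumes "polyb B" "\<And>x. x \<in> D \<Longrightarrow> sz (f x) \<le> B (sz x)"
    "\<And>k. 1 \<le> k \<Longrightarrow> \<exists>P B. polyb B \<and>
     (\<forall>x\<in>D. \<forall>m. good k m (enc x) \<longrightarrow> runs k P B m (enc x) (enc (f x)))"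
  shows "pt D f"
  unfolding pt_def
proof (intro conjI allI impI)
  show "\<exists>B. polyb B \<and> (\<forall>x\<in>D. sz (f x) \<le> B (sz x))" using assms(1,2) by blast
qed (rule assms(3))

lemma ptE:
  assumes "pt D f" "1 \<le> k"
  obtains P e where "\<And>x m. x \<in> D \<Longrightarrow> good k m (enc x) \<Longrightarrow>
    runs k P (\<lambda>s. (s + 2) ^ e) m (enc x) (enc (f x))"
proof -
  obtain P B where PB: "polyb B"
     "\<And>x m. x \<in> D \<Longrightarrow> good k m (enc x) \<Longrightarrow> runs k P B m (enc x) (enc (f x))"
    using assms(1)[unfolded pt_def, THEN conjunct2, rule_format, OF assms(2)] by auto
  then obtain e where e: "\<And>s. B s \<le> (s + 2) ^ e" unfolding polyb_def by blast
  show ?thesis by (rule that[of P e]) (rule runs_mono[OF PB(2) e])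
qed

lemma pt_size:
  assumes "pt D f"
  obtains e where "\<And>x. x \<in> D \<Longrightarrow> sz (f x) \<le> (sz x + 2) ^ e"
proof -
  obtain B where B: "polyb B" "\<And>x. x \<in> D \<Longrightarrow> sz (f x) \<le> B (sz x)" using assms unfolding pt_def by blast
  then obtain e where "\<And>s. B s \<le> (s + 2) ^ e" unfolding polyb_def by blast
  with B(2) have "\<And>x. x \<in> D \<Longrightarrow> sz (f x) \<le> (sz x + 2) ^ e" using le_trans by blast
  thus ?thesis by (rule that)
qed

lemma pt_subset: "pt E f \<Longrightarrow> D \<subseteq> E \<Longrightarrow> pt D f"
  unfolding pt_def by (simp add: subset_iff) metis

lemma pt_cong: "pt D f \<Longrightarrow> (\<And>x. x \<in> D \<Longrightarrow> f x = g x) \<Longrightarrow> pt D g"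
  unfolding pt_def by simp

lemma pt_id: "pt D (\<lambda>x. x)"
proof (rule ptI[of "\<lambda>s. s"])
  fix k :: nat assume "1 \<le> k"
  have "runs k Skip (\<lambda>s. s) m v v" if "good k m v" for m v
    using that exec.skip[of m] unfolding runs_def good_def
    by (intro exI[of _ 1] exI[of _ m]) (auto simp: Suc_leI)
  thus "\<exists>P B. polyb B \<and> (\<forall>x\<in>D. \<forall>m. good k m (enc x) \<longrightarrow> runs k P B m (enc x) (enc x))"
    by blast
qed auto

text \<open>The second program starts with a larger heap pointer. As the allocation of the first one
  is bounded by the size of its argument alone, the pointer grows by at most some polynomial value
  \<open>p\<close>, hence its length by at most \<open>p + 1\<close>. This crude bound, without a
  logarithm, keeps the time of the second program polynomial.\<close>

lemma pt_comp:
  fixes f :: "'a::enc \<Rightarrow> 'b::enc" and g :: "'b \<Rightarrow> 'c::enc"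
  assumes "pt E g" "pt D f" "\<And>x. x \<in> D \<Longrightarrow> f x \<in> E"
  shows "pt D (\<lambda>x. g (f x))"
proof -
  obtain b1 where b1: "\<And>x. x \<in> D \<Longrightarrow> sz (f x) \<le> (sz x + 2) ^ b1" by (rule pt_size[OF assms(2)]) blast
  obtain b2 where b2: "\<And>x. x \<in> E \<Longrightarrow> sz (g x) \<le> (sz x + 2) ^ b2" by (rule pt_size[OF assms(1)]) blast
  show ?thesis
  proof (rule ptI[of "\<lambda>s. ((s + 2) ^ b1 + 2) ^ b2"])
    fix x assume x: "x \<in> D"
    have "sz (g (f x)) \<le> (sz (f x) + 2) ^ b2" using b2 assms(3) x by blast
    also have "\<dots> \<le> ((sz x + 2) ^ b1 + 2) ^ b2" by (rule power_mono) (use b1[OF x] in auto)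
    finally show "sz (g (f x)) \<le> ((sz x + 2) ^ b1 + 2) ^ b2" .
  next
    fix k :: nat assume k: "1 \<le> k"
    obtain P e where P: "\<And>x m. x \<in> D \<Longrightarrow> good k m (enc x) \<Longrightarrow>
      runs k P (\<lambda>s. (s + 2) ^ e) m (enc x) (enc (f x))" by (rule ptE[OF assms(2) k]) blast
    obtain R e' where R: "\<And>x m. x \<in> E \<Longrightarrow> good k m (enc x) \<Longrightarrow>
      runs k R (\<lambda>s. (s + 2) ^ e') m (enc x) (enc (g x))" by (rule ptE[OF assms(1) k]) blast
    define B where "B = (\<lambda>s::nat. (s + 2) ^ e + ((s + 2) ^ b1 + (s + ((s + 2) ^ e + 1)) + 2) ^ e')"
    have "runs k (Seq P R) B m (enc x) (enc (g (f x)))" if x: "x \<in> D" and m: "good k m (enc x)" for x m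
    proof -
      let ?s = "sz x" and ?h = "m (ra 0)"
      obtain n m' where 1: "exec P m n m'" "n \<le> (?s + bits ?h + 2) ^ e"
        "m' (ra 0) \<le> ?h + int ((?s + 2) ^ e)" "keeps k m m'" "rep m' (m' (ra k)) (enc (f x))"
        using P[OF x m] unfolding runs_def by blast
      have h0: "0 \<le> ?h" "?h \<le> m' (ra 0)" using m 1(4) unfolding good_def keeps_def by auto
      have "good k m' (enc (f x))" using 1 h0 unfolding good_def by auto
      from R[OF assms(3)[OF x] this] obtain n' m'' where 2: "exec R m' n' m''"
        "n' \<le> (sz (f x) + bits (m' (ra 0)) + 2) ^ e'"
        "m'' (ra 0) \<le> m' (ra 0) + int ((sz (f x) + 2) ^ e')" "keeps k m' m''"
        "rep m'' (m'' (ra k)) (enc (g (f x)))" unfolding runs_def by blast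
      have "bits (m' (ra 0)) \<le> bits (?h + int ((?s + 2) ^ e))" using 1(3) h0 by (intro bits_mono) auto
      also have "\<dots> \<le> bits ?h + ((?s + 2) ^ e + 1)"
        using bits_add[of ?h "int ((?s + 2) ^ e)"] bits_of_nat_le[of "(?s + 2) ^ e"] by linarith
      finally have bh: "bits (m' (ra 0)) \<le> bits ?h + ((?s + 2) ^ e + 1)" .
      let ?S = "?s + bits ?h"
      have mon: "(?s + 2) ^ a \<le> (?S + 2) ^ a" for a by (rule power_mono) auto
      have "n' \<le> ((?S + 2) ^ b1 + (?S + ((?S + 2) ^ e + 1)) + 2) ^ e'"
        by (rule order.trans[OF 2(2) power_mono])
          (use b1[OF x] bh mon[of b1] mon[of e] in linarith, simp)
      hence t: "n + n' \<le> B ?S" using 1(2) unfolding B_def by linarith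
      have "(sz (f x) + 2) ^ e' \<le> ((?s + 2) ^ b1 + (?s + ((?s + 2) ^ e + 1)) + 2) ^ e'"
        by (rule power_mono) (use b1[OF x] in auto)
      hence a: "m'' (ra 0) \<le> ?h + int (B ?s)"
        using 2(3) 1(3) unfolding B_def of_nat_add by linarith
      have "exec (Seq P R) m (n + n') m''" by (rule exec.seq[OF 1(1) 2(1)])
      thus ?thesis unfolding runs_def using t a keeps_trans[OF 1(4) 2(4)] 2(5) by blast
    qed
    moreover have "polyb B" unfolding B_def by (intro polyb_add polyb_power polyb_id polyb_const)
    ultimately show "\<exists>P B. polyb B \<and> (\<forall>x\<in>D. \<forall>m. good k m (enc x) \<longrightarrow> runs k P B m (enc x) (enc (g (f x))))"
      by blast
  qed (intro polyb_add polyb_power polyb_id polyb_const)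
qed

section \<open>Execution with an upper bound on the time\<close>

definition ex :: "program \<Rightarrow> memory \<Rightarrow> nat \<Rightarrow> memory \<Rightarrow> bool" where
  "ex P m t m' \<longleftrightarrow> (\<exists>n\<le>t. exec P m n m')"

lemma ex_seq: "ex P m t m' \<Longrightarrow> ex R m' t' m'' \<Longrightarrow> ex (Seq P R) m (t + t') m''"
  unfolding ex_def using exec.seq add_mono by meson

lemma ex_mono: "ex P m t m' \<Longrightarrow> t \<le> t' \<Longrightarrow> ex P m t' m'"
  unfolding ex_def using le_trans by blast

lemma ex_store:
  "esum m a + esum m b + 1 \<le> s \<Longrightarrow> ex (Store a b) m (s * s) (m(eval m a := eval m b))"
  unfolding ex_def using exec_store by blast

lemma ex_set_reg:
  "bits (ra j) + esum m b + 1 \<le> s \<Longrightarrow> ex (Store (Const (ra j)) b) m (s * s) (m(ra j := eval m b))"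
  using ex_store[of m "Const (ra j)" b s] by simp

lemma ex_if_true: "eval m b > 0 \<Longrightarrow> ex P m t m' \<Longrightarrow> 1 + esum m b * esum m b \<le> s \<Longrightarrow> ex (If b P R) m (s + t) m'"
  unfolding ex_def by (meson add_mono exec.if_true expr_cost_le_esum le_trans order_refl)

lemma ex_if_false: "\<not> eval m b > 0 \<Longrightarrow> ex R m t m' \<Longrightarrow> 1 + esum m b * esum m b \<le> s \<Longrightarrow> ex (If b P R) m (s + t) m'"
  unfolding ex_def by (meson add_mono exec.if_false expr_cost_le_esum le_trans order_refl)

lemma ex_while_false: "\<not> eval m b > 0 \<Longrightarrow> 1 + esum m b * esum m b \<le> s \<Longrightarrow> ex (While b P) m s m"
  unfolding ex_def by (meson add_mono exec.while_false expr_cost_le_esum le_trans order_refl)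

lemma ex_while_true: "eval m b > 0 \<Longrightarrow> ex P m t m' \<Longrightarrow> ex (While b P) m' t' m'' \<Longrightarrow>
   1 + esum m b * esum m b \<le> s \<Longrightarrow> ex (While b P) m (s + t + t') m''"
  unfolding ex_def by (meson add_mono exec.while_true expr_cost_le_esum le_trans order_refl)

lemma runsE:
  assumes "runs k P B m v v'"
  obtains m' where "ex P m (B (vsize v + bits (m (ra 0)))) m'"
    "m' (ra 0) \<le> m (ra 0) + int (B (vsize v))" "keeps k m m'" "rep m' (m' (ra k)) v'"
proof -
  obtain n m' where "exec P m n m'" "n \<le> B (vsize v + bits (m (ra 0)))"
    "m' (ra 0) \<le> m (ra 0) + int (B (vsize v))" "keeps k m m'" "rep m' (m' (ra k)) v'"
    using assms[unfolded runs_def] by (elim exE conjE)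
  thus ?thesis by (intro that[of m']) (auto simp: ex_def)
qed

lemma runsI:
  assumes "ex P m t m'" "t \<le> B (vsize v + bits (m (ra 0)))"
    "m' (ra 0) \<le> m (ra 0) + int (B (vsize v))" "keeps k m m'" "rep m' (m' (ra k)) v'"
  shows "runs k P B m v v'"
proof -
  obtain n where "exec P m n m'" "n \<le> t" using assms(1) unfolding ex_def by blast
  thus ?thesis using assms(2-) unfolding runs_def by (intro exI[of _ n] exI[of _ m']) auto
qed

lemma bits_hp_le:
  "0 \<le> h \<Longrightarrow> h \<le> h' \<Longrightarrow> h' \<le> h + int a \<Longrightarrow> bits h' \<le> bits h + a + 1"
  using bits_mono[of h' "h + int a"] bits_add[of h "int a"] bits_of_nat_le[of a] by linarith

section \<open>Binary operations: pairing and arithmetic\<close>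

instantiation val :: enc begin
definition enc_val :: "val \<Rightarrow> val" where [simp]: "enc_val v = v"
instance ..
end

lemma pt_enc: "pt D (\<lambda>x. enc (f x)) \<longleftrightarrow> pt D f"
  unfolding pt_def by simp

text \<open>The operands are expected in the registers \<open>k\<close> and \<open>Suc k\<close>,
  the result is left in \<open>k\<close>. The allowance of two heap cells is what building a pair
  takes; \<open>ok\<close> expresses that the operands have the right shape.\<close>

definition binop :: "(val \<Rightarrow> val \<Rightarrow> bool) \<Rightarrow> (val \<Rightarrow> val \<Rightarrow> val) \<Rightarrow> bool" where
  "binop ok bop \<longleftrightarrow> (\<forall>a b. ok a b \<longrightarrow> vsize (bop a b) \<le> vsize a + vsize b + 1) \<and>
    (\<forall>k\<ge>1. \<exists>R B. polyb B \<and> (\<forall>a b m. 0 \<le> m (ra 0) \<and> ok a b \<and>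
       rep m (m (ra k)) a \<and> rep m (m (ra (Suc k))) b \<longrightarrow>
       (\<exists>m'. ex R m (B (vsize a + vsize b + bits (m (ra 0)))) m' \<and> m' (ra 0) \<le> m (ra 0) + 2 \<and>
         keeps k m m' \<and> rep m' (m' (ra k)) (bop a b))))"

text \<open>The argument stays in register \<open>k\<close> while \<open>f\<close> is evaluated in
  \<open>k + 1\<close> and then \<open>g\<close> in \<open>k + 2\<close>. A program for a register
  leaves the lower ones alone, so neither the argument nor the first result is lost. Finally both
  results move down by one register.\<close>

lemma pt_binop:
  fixes f g :: "'a::enc \<Rightarrow> val"
  assumes op: "binop ok bop" and f: "pt D f" and g: "pt D g"
    and ok: "\<And>x. x \<in> D \<Longrightarrow> ok (f x) (g x)"
  shows "pt D (\<lambda>x. bop (f x) (g x))"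
proof -
  obtain b1 where b1: "\<And>x. x \<in> D \<Longrightarrow> vsize (f x) \<le> (sz x + 2) ^ b1" using pt_size[OF f] by auto
  obtain b2 where b2: "\<And>x. x \<in> D \<Longrightarrow> vsize (g x) \<le> (sz x + 2) ^ b2" using pt_size[OF g] by auto
  show ?thesis
  proof (rule ptI[of "\<lambda>s. (s + 2) ^ b1 + (s + 2) ^ b2 + 1"])
    fix x assume x: "x \<in> D"
    have "vsize (bop (f x) (g x)) \<le> vsize (f x) + vsize (g x) + 1" using op ok[OF x] unfolding binop_def by blast
    thus "sz (bop (f x) (g x)) \<le> (sz x + 2) ^ b1 + (sz x + 2) ^ b2 + 1" using b1[OF x] b2[OF x] by simp
  next
    fix k :: nat assume k: "1 \<le> k"
    obtain P e1 where P: "\<And>x m. x \<in> D \<Longrightarrow> good (k+1) m (enc x) \<Longrightarrow>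
      runs (k+1) P (\<lambda>s. (s + 2) ^ e1) m (enc x) (f x)" using ptE[OF f, of "k+1"] k by auto
    obtain Q e2 where Q: "\<And>x m. x \<in> D \<Longrightarrow> good (k+2) m (enc x) \<Longrightarrow>
      runs (k+2) Q (\<lambda>s. (s + 2) ^ e2) m (enc x) (g x)" using ptE[OF g, of "k+2"] k by auto
    obtain R BR where BR: "polyb BR" and R: "\<forall>a b m. 0 \<le> m (ra 0) \<and> ok a b \<and>
        rep m (m (ra k)) a \<and> rep m (m (ra (Suc k))) b \<longrightarrow>
       (\<exists>m'. ex R m (BR (vsize a + vsize b + bits (m (ra 0)))) m' \<and> m' (ra 0) \<le> m (ra 0) + 2 \<and>
         keeps k m m' \<and> rep m' (m' (ra k)) (bop a b))"
      using op[unfolded binop_def, THEN conjunct2, rule_format, OF k] by (elim exE conjE)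
    obtain e3 where e3: "\<And>s. BR s \<le> (s + 2) ^ e3" using BR unfolding polyb_def by blast
    define c where "c = bits (ra k) + bits (ra (k+1)) + bits (ra (k+2)) + 10"
    define U where "U = (\<lambda>s::nat. s + (s + 2) ^ e1 + (s + 2) ^ e2 + (s + 2) ^ b1 + (s + 2) ^ b2 + c)"
    define B where "B = (\<lambda>s. U s * U s + U s + U s * U s + (2 * U s + 2) ^ e2
      + (3 * U s) * (3 * U s) + (3 * U s) * (3 * U s) + (3 * U s + 2) ^ e3 + U s + 2)"
    define Pg where "Pg = Seq (Seq (Seq (Seq (Seq (Seq (Store (Const (ra (k+1))) (rg k)) P)
       (Store (Const (ra (k+2))) (rg k))) Q)
       (Store (Const (ra k)) (rg (k+1)))) (Store (Const (ra (k+1))) (rg (k+2)))) R"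
    have "runs k Pg B m (enc x) (bop (f x) (g x))" if x: "x \<in> D" and m: "good k m (enc x)" for x m
    proof -
      let ?s = "sz x" and ?h = "m (ra 0)"
      let ?S = "?s + bits ?h"
      have h0: "0 \<le> ?h" and r0: "rep m (m (ra k)) (enc x)" using m unfolding good_def by auto
      have mon: "(?s + 2) ^ a \<le> (?S + 2) ^ a" for a by (rule power_mono) auto
      have bk: "bits (m (ra k)) \<le> ?S" using rep_bits[OF r0] .
      define m1 where "m1 = m(ra (k+1) := m (ra k))"
      have e1: "ex (Store (Const (ra (k+1))) (rg k)) m (U ?S * U ?S) m1"
        using ex_set_reg[of "k+1" m "rg k" "U ?S"] bk unfolding m1_def U_def c_def by simp
      have k1: "keeps (k+1) m m1" unfolding m1_def by (rule keeps_upd_reg) auto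
      have h1: "m1 (ra 0) = ?h" unfolding m1_def by simp
      have "good (k+1) m1 (enc x)" using rep_keeps[OF r0 k1] h0 h1 unfolding good_def m1_def by simp
      from runsE[OF P[OF x this]] obtain m2 where 2: "ex P m1 ((?S + 2) ^ e1) m2"
        "m2 (ra 0) \<le> ?h + int ((?s + 2) ^ e1)" "keeps (k+1) m1 m2" "rep m2 (m2 (ra (k+1))) (f x)"
        unfolding h1 .
      have k2: "keeps (k+1) m m2" using keeps_trans[OF k1 2(3)] by simp
      have h2: "?h \<le> m2 (ra 0)" using keeps_hp[OF k2] .
      have rk2: "m2 (ra k) = m (ra k)" using keeps_reg[OF k2, of k] k by simp
      have bh2: "bits (m2 (ra 0)) \<le> bits ?h + (?s + 2) ^ e1 + 1" by (rule bits_hp_le[OF h0 h2 2(2)])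
      define m3 where "m3 = m2(ra (k+2) := m (ra k))"
      have e3': "ex (Store (Const (ra (k+2))) (rg k)) m2 (U ?S * U ?S) m3"
        using ex_set_reg[of "k+2" m2 "rg k" "U ?S"] bk unfolding m3_def U_def c_def by (simp add: rk2)
      have k3: "keeps (k+2) m2 m3" unfolding m3_def by (rule keeps_upd_reg) auto
      have h3: "m3 (ra 0) = m2 (ra 0)" unfolding m3_def by simp
      have kk3: "keeps (k+1) m m3" using keeps_trans[OF k2 k3] by simp
      have "good (k+2) m3 (enc x)" using rep_keeps[OF r0 kk3] h0 h2 h3 unfolding good_def m3_def by simp
      from runsE[OF Q[OF x this]] obtain m4 where 4: "ex Q m3 ((?s + bits (m2 (ra 0)) + 2) ^ e2) m4"
        "m4 (ra 0) \<le> m2 (ra 0) + int ((?s + 2) ^ e2)" "keeps (k+2) m3 m4" "rep m4 (m4 (ra (k+2))) (g x)"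
        unfolding h3 .
      have k4: "keeps (k+2) m2 m4" using keeps_trans[OF k3 4(3)] by simp
      have kk4: "keeps (k+1) m m4" using keeps_trans[OF k2 k4] by simp
      have rk4: "m4 (ra (k+1)) = m2 (ra (k+1))" using keeps_reg[OF k4, of "k+1"] k by simp
      have h4: "?h \<le> m4 (ra 0)" using keeps_hp[OF kk4] .
      have h4': "m4 (ra 0) \<le> ?h + int ((?s + 2) ^ e1 + (?s + 2) ^ e2)" using 2(2) 4(2) by simp
      have bh4: "bits (m4 (ra 0)) \<le> bits ?h + ((?s + 2) ^ e1 + (?s + 2) ^ e2) + 1"
        by (rule bits_hp_le[OF h0 h4 h4'])
      have rf: "rep m4 (m4 (ra (k+1))) (f x)" using rep_keeps[OF 2(4) k4] rk4 by simp
      define m5 where "m5 = m4(ra k := m4 (ra (k+1)))"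
      define m6 where "m6 = m5(ra (k+1) := m4 (ra (k+2)))"
      define X1 X2 Y1 Y2 where XY: "X1 = (?S + 2) ^ e1" "X2 = (?S + 2) ^ e2" "Y1 = (?S + 2) ^ b1" "Y2 = (?S + 2) ^ b2"
      have U: "U ?S = ?S + X1 + X2 + Y1 + Y2 + c" unfolding U_def XY ..
      have X: "vsize (f x) \<le> Y1" "vsize (g x) \<le> Y2" "bits (m4 (ra 0)) \<le> bits ?h + (X1 + X2) + 1"
        unfolding XY using order.trans[OF b1[OF x] mon] order.trans[OF b2[OF x] mon]
          order.trans[OF bh4] mon[of e1] mon[of e2] by auto
      have vf: "vsize (f x) + bits (m4 (ra 0)) \<le> 2 * U ?S" "vsize (g x) + bits (m4 (ra 0)) \<le> 2 * U ?S"
        "vsize (f x) + vsize (g x) + bits (m4 (ra 0)) \<le> 3 * U ?S"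
        using X unfolding U c_def by auto
      have cU: "c \<le> U ?S" unfolding U_def by simp
      have b5: "bits (ra k) + (bits (ra (k+1)) + bits (m4 (ra (k+1)))) + 1 \<le> 3 * U ?S"
        using rep_bits[OF rf] vf cU unfolding c_def by linarith
      have e5: "ex (Store (Const (ra k)) (rg (k+1))) m4 ((3 * U ?S) * (3 * U ?S)) m5"
        using ex_set_reg[of k m4 "rg (k+1)" "3 * U ?S"] b5 unfolding m5_def by simp
      have b6: "bits (ra (k+1)) + (bits (ra (k+2)) + bits (m4 (ra (k+2)))) + 1 \<le> 3 * U ?S"
        using rep_bits[OF 4(4)] vf cU unfolding c_def by linarith
      have "m5 (ra (k+2)) = m4 (ra (k+2))" unfolding m5_def by simp
      hence e6: "ex (Store (Const (ra (k+1))) (rg (k+2))) m5 ((3 * U ?S) * (3 * U ?S)) m6"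
        using ex_set_reg[of "k+1" m5 "rg (k+2)" "3 * U ?S"] b6 unfolding m6_def by simp
      have k56: "keeps k m4 m5" "keeps k m5 m6" using k unfolding m5_def m6_def by (auto intro!: keeps_upd_reg)
      have k6: "keeps k m4 m6" using keeps_trans[OF k56] by simp
      have h6: "m6 (ra 0) = m4 (ra 0)" using k unfolding m6_def m5_def by simp
      have r6: "rep m6 (m6 (ra k)) (f x)" "rep m6 (m6 (ra (Suc k))) (g x)"
        using rep_keeps[OF rf k6] rep_keeps[OF 4(4) k6] unfolding m6_def m5_def by simp_all
      obtain m7 where 7: "ex R m6 (BR (vsize (f x) + vsize (g x) + bits (m4 (ra 0)))) m7"
        "m7 (ra 0) \<le> m4 (ra 0) + 2" "keeps k m6 m7" "rep m7 (m7 (ra k)) (bop (f x) (g x))"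
        using R[rule_format, of m6 "f x" "g x"] ok[OF x] r6 h0 h4 unfolding h6 by auto
      have k7: "keeps k m m7"
        using keeps_trans[OF keeps_mono[OF kk4] keeps_trans[OF k6 7(3)], of k] by simp
      have t7: "BR (vsize (f x) + vsize (g x) + bits (m4 (ra 0))) \<le> (3 * U ?S + 2) ^ e3"
        using e3 by (rule order.trans) (intro power_mono, use vf in auto)
      have t4: "(?s + bits (m2 (ra 0)) + 2) ^ e2 \<le> (2 * U ?S + 2) ^ e2"
        by (rule power_mono) (use bh2 mon[of e1] in \<open>simp_all add: U_def c_def\<close>)
      have t2: "(?S + 2) ^ e1 \<le> U ?S" unfolding U_def by simp
      show ?thesis
      proof (rule runsI)
        show "ex Pg m (U ?S * U ?S + (?S + 2) ^ e1 + U ?S * U ?S + (?s + bits (m2 (ra 0)) + 2) ^ e2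
          + (3 * U ?S) * (3 * U ?S) + (3 * U ?S) * (3 * U ?S)
          + BR (vsize (f x) + vsize (g x) + bits (m4 (ra 0)))) m7"
          unfolding Pg_def
          by (rule ex_seq[OF ex_seq[OF ex_seq[OF ex_seq[OF ex_seq[OF ex_seq[OF e1 2(1)] e3'] 4(1)] e5] e6] 7(1)])
        show "U ?S * U ?S + (?S + 2) ^ e1 + U ?S * U ?S + (?s + bits (m2 (ra 0)) + 2) ^ e2
          + (3 * U ?S) * (3 * U ?S) + (3 * U ?S) * (3 * U ?S)
          + BR (vsize (f x) + vsize (g x) + bits (m4 (ra 0))) \<le> B ?S"
          unfolding B_def using t2 t4 t7 by linarith
        have "(?s + 2) ^ e1 + (?s + 2) ^ e2 \<le> U ?s" "U ?s + 2 \<le> B ?s" unfolding U_def B_def by simp_all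
        hence "int ((?s + 2) ^ e1 + (?s + 2) ^ e2) + 2 \<le> int (B ?s)" by linarith
        thus "m7 (ra 0) \<le> ?h + int (B ?s)" using 7(2) h4' by linarith
      qed (use k7 7(4) in auto)
    qed
    moreover have "polyb B" unfolding B_def U_def
      by (intro polyb_add polyb_mult polyb_power polyb_id polyb_const)
    ultimately show "\<exists>P B. polyb B \<and> (\<forall>x\<in>D. \<forall>m. good k m (enc x) \<longrightarrow> runs k P B m (enc x) (enc (bop (f x) (g x))))"
      by auto
  qed (intro polyb_add polyb_power polyb_id polyb_const)
qed

lemma binop_Pr: "binop (\<lambda>_ _. True) Pr"
  unfolding binop_def
proof (intro conjI allI impI)
  fix k :: nat assume k: "1 \<le> k"
  define c where "c = bits (ra k) + bits (ra (Suc k)) + bits (ra 0) + 30"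
  define u where "u = (\<lambda>s. 7 * (s + c))"
  define R where "R = Seq (Seq (Seq (Store (haddr (rg 0)) (rg k)) (Store (haddr (Add (rg 0) (Const 1))) (rg (Suc k))))
     (Store (Const (ra k)) (rg 0))) (Store (Const (ra 0)) (Add (rg 0) (Const 2)))"
  have "\<exists>m'. ex R m (4 * (u (vsize a + vsize b + bits (m (ra 0))) * u (vsize a + vsize b + bits (m (ra 0))))) m' \<and>
      m' (ra 0) \<le> m (ra 0) + 2 \<and> keeps k m m' \<and> rep m' (m' (ra k)) (Pr a b)"
    if h: "0 \<le> m (ra 0)" and ra: "rep m (m (ra k)) a" and rb: "rep m (m (ra (Suc k))) b" for a b m
  proof -
    let ?h = "m (ra 0)" let ?S = "vsize a + vsize b + bits ?h"
    have ba: "bits (m (ra k)) \<le> ?S" and bb: "bits (m (ra (Suc k))) \<le> ?S"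
      using rep_bits[OF ra] rep_bits[OF rb] by simp_all
    have b1: "bits (?h + 1) \<le> bits ?h + 2" and b2: "bits (?h + 2) \<le> bits ?h + 3"
      using bits_add[of ?h 1] bits_add[of ?h 2] bits_small by - linarith+
    define m1 where "m1 = m(ha ?h := m (ra k))"
    define m2 where "m2 = m1(ha (?h + 1) := m (ra (Suc k)))"
    define m3 where "m3 = m2(ra k := ?h)"
    define m4 where "m4 = m3(ra 0 := ?h + 2)"
    have e1: "ex (Store (haddr (rg 0)) (rg k)) m (u ?S * u ?S) m1"
      using ex_store[of m "haddr (rg 0)" "rg k" "u ?S"] esum_haddr[of m "rg 0"] ba
      unfolding m1_def u_def c_def by simp
    have r1: "m1 (ra j) = m (ra j)" for j unfolding m1_def by simp
    have r2: "m2 (ra j) = m (ra j)" for j unfolding m2_def by (simp add: r1)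
    have e2: "ex (Store (haddr (Add (rg 0) (Const 1))) (rg (Suc k))) m1 (u ?S * u ?S) m2"
      using ex_store[of m1 "haddr (Add (rg 0) (Const 1))" "rg (Suc k)" "u ?S"]
        esum_haddr[of m1 "Add (rg 0) (Const 1)"] bb b1 bits_small
      unfolding m2_def u_def c_def by (simp add: r1)
    have e3: "ex (Store (Const (ra k)) (rg 0)) m2 (u ?S * u ?S) m3"
      using ex_set_reg[of k m2 "rg 0" "u ?S"] unfolding m3_def u_def c_def by (simp add: r2)
    have m30: "m3 (ra 0) = ?h" using k unfolding m3_def by (simp add: r2)
    have e4: "ex (Store (Const (ra 0)) (Add (rg 0) (Const 2))) m3 (u ?S * u ?S) m4"
      using ex_set_reg[of 0 m3 "Add (rg 0) (Const 2)" "u ?S"] b2 bits_small unfolding m4_def u_def c_def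
      by (simp add: m30)
    have kp: "keeps k m m4" using k h
      unfolding keeps_def m4_def m3_def m2_def m1_def by auto
    have "ex R m (u ?S * u ?S + u ?S * u ?S + u ?S * u ?S + u ?S * u ?S) m4"
      unfolding R_def by (rule ex_seq[OF ex_seq[OF ex_seq[OF e1 e2] e3] e4])
    moreover have "m4 (ra 0) = ?h + 2" "m4 (ra k) = ?h" using k unfolding m4_def m3_def by auto
    moreover have "rep m4 ?h (Pr a b)"
      using h k rep_keeps[OF ra kp] rep_keeps[OF rb kp] unfolding m4_def m3_def m2_def m1_def by simp
    ultimately show ?thesis using kp by (intro exI[of _ m4]) (auto elim!: ex_mono)
  qed
  moreover have "polyb (\<lambda>s. 4 * (u s * u s))" unfolding u_def
    by (intro polyb_add polyb_mult polyb_power polyb_id polyb_const)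
  ultimately show "\<exists>R B. polyb B \<and> (\<forall>a b m. 0 \<le> m (ra 0) \<and> True \<and> rep m (m (ra k)) a \<and> rep m (m (ra (Suc k))) b \<longrightarrow>
       (\<exists>m'. ex R m (B (vsize a + vsize b + bits (m (ra 0)))) m' \<and> m' (ra 0) \<le> m (ra 0) + 2 \<and>
         keeps k m m' \<and> rep m' (m' (ra k)) (Pr a b)))"
    by (intro exI[of _ R] exI[of _ "\<lambda>s. 4 * (u s * u s)"]) blast
qed simp

fun nval :: "val \<Rightarrow> int" where "nval (Num z) = z" | "nval (Pr a b) = 0"

definition isnum :: "val \<Rightarrow> val \<Rightarrow> bool" where "isnum a b \<longleftrightarrow> (\<exists>y z. a = Num y \<and> b = Num z)"

lemma binop_arith:
  assumes ev: "\<And>m a b. eval m (C a b) = F (eval m a) (eval m b)"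
    and es: "\<And>m a b. esum m (C a b) = esum m a + esum m b + bits (F (eval m a) (eval m b))"
    and bb: "\<And>y z. bits (F y z) \<le> bits y + bits z"
  shows "binop isnum (\<lambda>a b. Num (F (nval a) (nval b)))"
  unfolding binop_def
proof (intro conjI allI impI)
  fix a b assume "isnum a b"
  thus "vsize (Num (F (nval a) (nval b))) \<le> vsize a + vsize b + 1"
    using bb[of "nval a" "nval b"] by (auto simp: isnum_def)
next
  fix k :: nat assume k: "1 \<le> k"
  define c where "c = bits (ra k) + bits (ra k) + bits (ra (Suc k)) + 1"
  define R where "R = Store (Const (ra k)) (C (rg k) (rg (Suc k)))"
  have "\<exists>m'. ex R m ((2 * (vsize a + vsize b + bits (m (ra 0))) + c) * (2 * (vsize a + vsize b + bits (m (ra 0))) + c)) m' \<and>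
      m' (ra 0) \<le> m (ra 0) + 2 \<and> keeps k m m' \<and> rep m' (m' (ra k)) (Num (F (nval a) (nval b)))"
    if h: "isnum a b" and ra: "rep m (m (ra k)) a" and rb: "rep m (m (ra (Suc k))) b" for a b m
  proof -
    obtain y z where a: "a = Num y" "m (ra k) = y" and b: "b = Num z" "m (ra (Suc k)) = z"
      using h ra rb by (auto simp: isnum_def)
    have "ex R m ((2 * (vsize a + vsize b + bits (m (ra 0))) + c) * (2 * (vsize a + vsize b + bits (m (ra 0))) + c)) (m(ra k := F y z))"
      using ex_set_reg[of k m "C (rg k) (rg (Suc k))" "2 * (vsize a + vsize b + bits (m (ra 0))) + c"] bb[of y z]
      unfolding R_def by (simp add: es ev a b c_def)
    thus ?thesis using k by (intro exI[of _ "m(ra k := F y z)"]) (auto simp: a b intro!: keeps_upd_reg)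
  qed
  moreover have "polyb (\<lambda>s. (2 * s + c) * (2 * s + c))"
    by (intro polyb_add polyb_mult polyb_power polyb_id polyb_const)
  ultimately show "\<exists>R B. polyb B \<and> (\<forall>a b m. 0 \<le> m (ra 0) \<and> isnum a b \<and> rep m (m (ra k)) a \<and> rep m (m (ra (Suc k))) b \<longrightarrow>
       (\<exists>m'. ex R m (B (vsize a + vsize b + bits (m (ra 0)))) m' \<and> m' (ra 0) \<le> m (ra 0) + 2 \<and>
         keeps k m m' \<and> rep m' (m' (ra k)) (Num (F (nval a) (nval b)))))"
    by (intro exI[of _ R] exI[of _ "\<lambda>s. (2 * s + c) * (2 * s + c)"]) blast
qed

lemma binop_add: "binop isnum (\<lambda>a b. Num (nval a + nval b))"
  by (rule binop_arith[of Add]) (auto simp: bits_add)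
lemma binop_sub: "binop isnum (\<lambda>a b. Num (nval a - nval b))"
  by (rule binop_arith[of Sub]) (auto simp: bits_diff)
lemma binop_mul: "binop isnum (\<lambda>a b. Num (nval a * nval b))"
  by (rule binop_arith[of Mul]) (auto simp: bits_mult)
lemma binop_div: "binop isnum (\<lambda>a b. Num (nval a div nval b))"
  by (rule binop_arith[of Div]) (auto intro: le_trans[OF bits_div])

fun vfst :: "val \<Rightarrow> val" where "vfst (Pr a b) = a" | "vfst v = v"
fun vsnd :: "val \<Rightarrow> val" where "vsnd (Pr a b) = b" | "vsnd v = v"

lemma pt_unop:
  fixes op :: "val \<Rightarrow> val"
  assumes sz: "\<And>v. v \<in> E \<Longrightarrow> vsize (op v) \<le> vsize v + c0"
    and rep: "\<And>k m v. v \<in> E \<Longrightarrow> rep m (m (ra k)) v \<Longrightarrow> rep m (eval m (xp k)) (op v)"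
    and es: "\<And>k m v. v \<in> E \<Longrightarrow> rep m (m (ra k)) v \<Longrightarrow> esum m (xp k) \<le> 10 * (vsize v + bits (m (ra 0)) + c k)"
  shows "pt E op"
proof (rule ptI[of "\<lambda>s. s + c0"])
  fix k :: nat assume k: "1 \<le> k"
  define u where "u = (\<lambda>s. 10 * (s + c k) + bits (ra k) + 1)"
  have "runs k (Store (Const (ra k)) (xp k)) (\<lambda>s. u s * u s) m v (op v)" if v: "v \<in> E" and m: "good k m v" for v m
  proof -
    have r: "rep m (m (ra k)) v" using m unfolding good_def by simp
    have "ex (Store (Const (ra k)) (xp k)) m (u (vsize v + bits (m (ra 0))) * u (vsize v + bits (m (ra 0))))
       (m(ra k := eval m (xp k)))"
      using es[OF v r] by (intro ex_set_reg) (simp add: u_def)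
    moreover have kp: "keeps k m (m(ra k := eval m (xp k)))" using k by (intro keeps_upd_reg) auto
    ultimately show ?thesis using rep_keeps[OF rep[OF v r] kp] k by (intro runsI) auto
  qed
  moreover have "polyb (\<lambda>s. u s * u s)" unfolding u_def
    by (intro polyb_add polyb_mult polyb_power polyb_id polyb_const)
  ultimately show "\<exists>P B. polyb B \<and> (\<forall>x\<in>E. \<forall>m. good k m (enc x) \<longrightarrow> runs k P B m (enc x) (enc (op x)))"
    by auto
qed (use sz in auto)

lemma pt_num: "pt D (\<lambda>_. Num z)"
proof -
  have "pt UNIV (\<lambda>_::val. Num z)"
    by (rule pt_unop[where xp = "\<lambda>_. Const z" and c = "\<lambda>_. bits z" and ?c0.0 = "bits z"]) auto
  from pt_comp[OF this, of D "\<lambda>x. enc x"] show ?thesis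
    using pt_id[of D] by (simp add: pt_enc[of D "\<lambda>x. x"])
qed

lemma pt_vfst: "pt D f \<Longrightarrow> (\<And>x. x \<in> D \<Longrightarrow> \<exists>a b. f x = Pr a b) \<Longrightarrow> pt D (\<lambda>x. vfst (f x))"
proof -
  have "pt {v. \<exists>a b. v = Pr a b} vfst"
  proof (rule pt_unop[where xp = "\<lambda>k. Cell (haddr (rg k))" and c = "\<lambda>k. 15 + bits (ra k)"])
    fix k m v assume v: "v \<in> {v. \<exists>a b. v = Pr a b}" and r: "rep m (m (ra k)) v"
    then obtain a b where [simp]: "v = Pr a b" by auto
    have ra: "rep m (m (ha (m (ra k)))) a" using r by simp
    show "esum m (Cell (haddr (rg k))) \<le> 10 * (vsize v + bits (m (ra 0)) + (15 + bits (ra k)))"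
      using esum_haddr[of m "rg k"] rep_bits[OF r] rep_bits[OF ra] by simp
  qed auto
  thus "pt D f \<Longrightarrow> (\<And>x. x \<in> D \<Longrightarrow> \<exists>a b. f x = Pr a b) \<Longrightarrow> pt D (\<lambda>x. vfst (f x))"
    by (rule pt_comp) auto
qed

lemma pt_vsnd: "pt D f \<Longrightarrow> (\<And>x. x \<in> D \<Longrightarrow> \<exists>a b. f x = Pr a b) \<Longrightarrow> pt D (\<lambda>x. vsnd (f x))"
proof -
  have "pt {v. \<exists>a b. v = Pr a b} vsnd"
  proof (rule pt_unop[where xp = "\<lambda>k. Cell (haddr (Add (rg k) (Const 1)))" and c = "\<lambda>k. 25 + bits (ra k)"])
    fix k m v assume v: "v \<in> {v. \<exists>a b. v = Pr a b}" and r: "rep m (m (ra k)) v"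
    then obtain a b where [simp]: "v = Pr a b" by auto
    have rb: "rep m (m (ha (m (ra k) + 1))) b" using r by simp
    show "esum m (Cell (haddr (Add (rg k) (Const 1)))) \<le> 10 * (vsize v + bits (m (ra 0)) + (25 + bits (ra k)))"
      using esum_haddr[of m "Add (rg k) (Const 1)"] rep_bits[OF r] rep_bits[OF rb]
        bits_add[of "m (ra k)" 1] bits_small(2) by simp
  qed auto
  thus "pt D f \<Longrightarrow> (\<And>x. x \<in> D \<Longrightarrow> \<exists>a b. f x = Pr a b) \<Longrightarrow> pt D (\<lambda>x. vsnd (f x))"
    by (rule pt_comp) auto
qed


section \<open>Conditionals and loops\<close>

instantiation bool :: enc begin
definition enc_bool :: "bool \<Rightarrow> val" where "enc_bool b = Num (of_bool b)"
instance ..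
end

lemma esum_rg_bool: "m (ra k) = of_bool b \<Longrightarrow> 1 + esum m (rg k) * esum m (rg k) \<le> 1 + (bits (ra k) + 2) * (bits (ra k) + 2)"
proof -
  assume "m (ra k) = of_bool b"
  hence "esum m (rg k) \<le> bits (ra k) + 2" using bits_small(1,2) by (cases b) auto
  from mult_mono[OF this this] show ?thesis by simp
qed

text \<open>Each branch has to be polynomial only where it is taken. This lets a test guard a
  partial operation such as \<open>nth\<close>.\<close>

lemma pt_If:
  fixes f g :: "'a::enc \<Rightarrow> 'b::enc"
  assumes c: "pt D c" and f: "pt {x \<in> D. c x} f" and g: "pt {x \<in> D. \<not> c x} g"
  shows "pt D (\<lambda>x. if c x then f x else g x)"
proof -
  obtain b1 where b1: "\<And>x. x \<in> {x \<in> D. c x} \<Longrightarrow> sz (f x) \<le> (sz x + 2) ^ b1" using pt_size[OF f] by blast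
  obtain b2 where b2: "\<And>x. x \<in> {x \<in> D. \<not> c x} \<Longrightarrow> sz (g x) \<le> (sz x + 2) ^ b2" using pt_size[OF g] by blast
  show ?thesis
  proof (rule ptI[of "\<lambda>s. (s + 2) ^ b1 + (s + 2) ^ b2"])
    fix x assume x: "x \<in> D"
    show "sz (if c x then f x else g x) \<le> (sz x + 2) ^ b1 + (sz x + 2) ^ b2"
      using b1[of x] b2[of x] x by (cases "c x") (auto simp: trans_le_add1 trans_le_add2)
  next
    fix k :: nat assume k: "1 \<le> k"
    obtain C e1 where C: "\<And>x m. x \<in> D \<Longrightarrow> good (k+1) m (enc x) \<Longrightarrow>
      runs (k+1) C (\<lambda>s. (s + 2) ^ e1) m (enc x) (enc (c x))" by (rule ptE[OF c, of "k+1"]) auto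
    obtain F e2 where F: "\<And>x m. x \<in> {x \<in> D. c x} \<Longrightarrow> good k m (enc x) \<Longrightarrow>
      runs k F (\<lambda>s. (s + 2) ^ e2) m (enc x) (enc (f x))" by (rule ptE[OF f k]) blast
    obtain G e3 where G: "\<And>x m. x \<in> {x \<in> D. \<not> c x} \<Longrightarrow> good k m (enc x) \<Longrightarrow>
      runs k G (\<lambda>s. (s + 2) ^ e3) m (enc x) (enc (g x))" by (rule ptE[OF g k]) blast
    define c1 where "c1 = bits (ra k) + bits (ra (k+1)) + 1"
    define c2 where "c2 = 1 + (bits (ra (k+1)) + 2) * (bits (ra (k+1)) + 2)"
    define B where "B = (\<lambda>s::nat. (s + c1) * (s + c1) + (s + 2) ^ e1 + (c2 + ((s + (s + 2) ^ e1 + 3) ^ e2 + (s + (s + 2) ^ e1 + 3) ^ e3)))"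
    define Pg where "Pg = Seq (Seq (Store (Const (ra (k+1))) (rg k)) C) (If (rg (k+1)) F G)"
    have "runs k Pg B m (enc x) (enc (if c x then f x else g x))" if x: "x \<in> D" and m: "good k m (enc x)" for x m
    proof -
      let ?s = "sz x" and ?h = "m (ra 0)"
      let ?S = "?s + bits ?h"
      have h0: "0 \<le> ?h" and r0: "rep m (m (ra k)) (enc x)" using m unfolding good_def by auto
      have mon: "(?s + 2) ^ a \<le> (?S + 2) ^ a" for a by (rule power_mono) auto
      have bk: "bits (m (ra k)) \<le> ?S" using rep_bits[OF r0] .
      define m1 where "m1 = m(ra (k+1) := m (ra k))"
      have e1: "ex (Store (Const (ra (k+1))) (rg k)) m ((?S + c1) * (?S + c1)) m1"
        using ex_set_reg[of "k+1" m "rg k" "?S + c1"] bk unfolding m1_def c1_def by simp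
      have k1: "keeps (k+1) m m1" unfolding m1_def by (rule keeps_upd_reg) auto
      have h1: "m1 (ra 0) = ?h" unfolding m1_def by simp
      have "good (k+1) m1 (enc x)" using rep_keeps[OF r0 k1] h0 h1 unfolding good_def m1_def by simp
      from runsE[OF C[OF x this]] obtain m2 where 2: "ex C m1 ((?S + 2) ^ e1) m2"
        "m2 (ra 0) \<le> ?h + int ((?s + 2) ^ e1)" "keeps (k+1) m1 m2" "rep m2 (m2 (ra (k+1))) (enc (c x))"
        unfolding h1 .
      have k2: "keeps (k+1) m m2" using keeps_trans[OF k1 2(3)] by simp
      have h2: "?h \<le> m2 (ra 0)" using keeps_hp[OF k2] .
      have rk2: "m2 (ra k) = m (ra k)" using keeps_reg[OF k2, of k] k by simp
      have bh2: "bits (m2 (ra 0)) \<le> bits ?h + (?s + 2) ^ e1 + 1" by (rule bits_hp_le[OF h0 h2 2(2)])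
      have g2: "good k m2 (enc x)" using rep_keeps[OF r0 k2] h0 h2 rk2 unfolding good_def by simp
      have rc: "m2 (ra (k+1)) = of_bool (c x)" using 2(4) by (simp add: enc_bool_def)
      have pw: "(?s + bits (m2 (ra 0)) + 2) ^ e \<le> (?S + (?S + 2) ^ e1 + 3) ^ e" for e
        by (rule power_mono) (use bh2 mon[of e1] in auto)
      have pw2: "(?s + 2) ^ e \<le> (?s + (?s + 2) ^ e1 + 3) ^ e" for e by (rule power_mono) auto
      obtain t m3 where 3: "ex (If (rg (k+1)) F G) m2 (c2 + t) m3"
        "t \<le> (?S + (?S + 2) ^ e1 + 3) ^ e2 + (?S + (?S + 2) ^ e1 + 3) ^ e3"
        "m3 (ra 0) \<le> m2 (ra 0) + int ((?s + (?s + 2) ^ e1 + 3) ^ e2 + (?s + (?s + 2) ^ e1 + 3) ^ e3)"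
        "keeps k m2 m3" "rep m3 (m3 (ra k)) (enc (if c x then f x else g x))"
      proof (cases "c x")
        case True
        obtain m3 where 3: "ex F m2 ((?s + bits (m2 (ra 0)) + 2) ^ e2) m3"
        "m3 (ra 0) \<le> m2 (ra 0) + int ((?s + 2) ^ e2)" "keeps k m2 m3" "rep m3 (m3 (ra k)) (enc (f x))"
          using runsE[OF F[OF _ g2]] x True by auto
        have "ex (If (rg (k+1)) F G) m2 (c2 + (?s + bits (m2 (ra 0)) + 2) ^ e2) m3"
          unfolding c2_def by (rule ex_if_true[OF _ 3(1) esum_rg_bool[of m2 "k+1" "c x", OF rc]]) (use rc True in simp)
        thus ?thesis
        proof (rule that)
          show "m3 (ra 0) \<le> m2 (ra 0) + int ((?s + (?s + 2) ^ e1 + 3) ^ e2 + (?s + (?s + 2) ^ e1 + 3) ^ e3)"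
            using 3(2) order.trans[OF pw2[of e2] le_add1] of_nat_mono by (smt (verit))
        qed (use 3 True pw[of e2] in \<open>auto intro: trans_le_add1\<close>)
      next
        case False
        obtain m3 where 3: "ex G m2 ((?s + bits (m2 (ra 0)) + 2) ^ e3) m3"
        "m3 (ra 0) \<le> m2 (ra 0) + int ((?s + 2) ^ e3)" "keeps k m2 m3" "rep m3 (m3 (ra k)) (enc (g x))"
          using runsE[OF G[OF _ g2]] x False by auto
        have "ex (If (rg (k+1)) F G) m2 (c2 + (?s + bits (m2 (ra 0)) + 2) ^ e3) m3"
          unfolding c2_def by (rule ex_if_false[OF _ 3(1) esum_rg_bool[of m2 "k+1" "c x", OF rc]]) (use rc False in simp)
        thus ?thesis
        proof (rule that)
          show "m3 (ra 0) \<le> m2 (ra 0) + int ((?s + (?s + 2) ^ e1 + 3) ^ e2 + (?s + (?s + 2) ^ e1 + 3) ^ e3)"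
            using 3(2) order.trans[OF pw2[of e3] le_add2] of_nat_mono by (smt (verit))
        qed (use 3 False pw[of e3] in \<open>auto intro: trans_le_add2\<close>)
      qed
      show ?thesis
      proof (rule runsI)
        show "ex Pg m ((?S + c1) * (?S + c1) + (?S + 2) ^ e1 + (c2 + t)) m3"
          unfolding Pg_def by (rule ex_seq[OF ex_seq[OF e1 2(1)] 3(1)])
        show "(?S + c1) * (?S + c1) + (?S + 2) ^ e1 + (c2 + t) \<le> B ?S"
          unfolding B_def using 3(2) by linarith
        have "(?s + 2) ^ e1 + ((?s + (?s + 2) ^ e1 + 3) ^ e2 + (?s + (?s + 2) ^ e1 + 3) ^ e3) \<le> B ?s"
          unfolding B_def by simp
        thus "m3 (ra 0) \<le> ?h + int (B ?s)" using 3(3) 2(2) by linarith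
      qed (use keeps_trans[OF keeps_mono[OF k2] 3(4), of k] 3(5) in auto)
    qed
    moreover have "polyb B" unfolding B_def
      by (intro polyb_add polyb_mult polyb_power polyb_id polyb_const)
    ultimately show "\<exists>P B. polyb B \<and> (\<forall>x\<in>D. \<forall>m. good k m (enc x) \<longrightarrow> runs k P B m (enc x) (enc (if c x then f x else g x)))"
      by blast
  qed (intro polyb_add polyb_power polyb_id polyb_const)
qed

text \<open>Invariant and measure refer to the initial state \<open>x\<close> as well as to the
  current state \<open>y\<close>. Sizes and the number of rounds are thus bounded by the size of
  \<open>x\<close> once and for all; a bound for one round in terms of the previous state would
  compound to an exponential one.\<close>

lemma pt_while:
  fixes f :: "'a::enc \<Rightarrow> 'a" and \<mu> :: "'a \<Rightarrow> 'a \<Rightarrow> nat"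
  assumes c: "pt E c" and f: "pt {x \<in> E. c x} f" and p: "polyb p"
    and I0: "\<And>x. x \<in> D \<Longrightarrow> I x x \<and> \<mu> x x \<le> p (sz x)"
    and I1: "\<And>x y. x \<in> D \<Longrightarrow> I x y \<Longrightarrow> c y \<Longrightarrow> I x (f y) \<and> \<mu> x (f y) < \<mu> x y"
    and I2: "\<And>x y. x \<in> D \<Longrightarrow> I x y \<Longrightarrow> y \<in> E \<and> sz y \<le> p (sz x)"
  shows "pt D (while c f)"
proof -
  obtain pe where pe: "\<And>s. p s \<le> (s + 2) ^ pe" using p unfolding polyb_def by blast
  have I0: "\<And>x. x \<in> D \<Longrightarrow> I x x \<and> \<mu> x x \<le> (sz x + 2) ^ pe"
    and I2: "\<And>x y. x \<in> D \<Longrightarrow> I x y \<Longrightarrow> y \<in> E \<and> sz y \<le> (sz x + 2) ^ pe"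
    using I0 I2 pe le_trans by blast+
  have wh: "I x (while c f y)" if "x \<in> D" "I x y" for x y
    using that
  proof (induction "\<mu> x y" arbitrary: y rule: less_induct)
    case less show ?case using less(1)[of "f y"] less(2,3) I1[OF less(2,3)]
      by (subst while_unfold) auto
  qed
  show ?thesis
  proof (rule ptI[of "\<lambda>s. (s + 2) ^ pe"])
    fix x assume x: "x \<in> D"
    show "sz (while c f x) \<le> (sz x + 2) ^ pe" using I2[OF x wh[OF x]] I0[OF x] by blast
  next
    fix k :: nat assume k: "1 \<le> k"
    obtain C e1 where C: "\<And>x m. x \<in> E \<Longrightarrow> good (k+1) m (enc x) \<Longrightarrow>
      runs (k+1) C (\<lambda>s. (s + 2) ^ e1) m (enc x) (enc (c x))" by (rule ptE[OF c, of "k+1"]) auto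
    obtain F e2 where F: "\<And>x m. x \<in> {x \<in> E. c x} \<Longrightarrow> good k m (enc x) \<Longrightarrow>
      runs k F (\<lambda>s. (s + 2) ^ e2) m (enc x) (enc (f x))" by (rule ptE[OF f k]) blast
    define c1 where "c1 = bits (ra k) + bits (ra (k+1)) + 1"
    define c2 where "c2 = 1 + (bits (ra (k+1)) + 2) * (bits (ra (k+1)) + 2)"
    \<comment> \<open>bounds for the sizes of the states, the allocation of one round, the total allocation, the
      bits of a size together with a heap pointer, and the time of one round\<close>
    define q where "q = (\<lambda>s::nat. (s + 2) ^ pe)"
    define al where "al = (\<lambda>s. (q s + 2) ^ e1 + (q s + 2) ^ e2)"
    define tl where "tl = (\<lambda>s. (q s + 2) * al s)"
    define sb where "sb = (\<lambda>s. q s + (s + tl s + 1) + c1)"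
    define tm where "tm = (\<lambda>s. (sb s + 2) ^ e2 + (sb s * sb s + (sb s + 2) ^ e1) + c2)"
    define B where "B = (\<lambda>s. (q s + 2) * tm s + tl s)"
    define Cd where "Cd = Seq (Store (Const (ra (k+1))) (rg k)) C"
    define W where "W = While (rg (k+1)) (Seq F Cd)"
    have "runs k (Seq Cd W) B m (enc x) (enc (while c f x))" if x: "x \<in> D" and m: "good k m (enc x)" for x m
    proof -
      let ?s = "sz x" and ?h = "m (ra 0)"
      define \<tau> where "\<tau> = ?s + bits ?h"
      define A where "A = int (al ?s)"
      \<comment> \<open>An upper bound for the heap pointer throughout the run: there are at most
        \<open>q\<close> rounds besides the initial test, each allocating at most \<open>A\<close>
        cells, where \<open>A\<close> depends on the size of \<open>x\<close> only.\<close>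
      define H where "H = ?h + int (q ?s + 2) * A"
      have h0: "0 \<le> ?h" using m unfolding good_def by auto
      have qmon: "q ?s \<le> q \<tau>" unfolding q_def \<tau>_def by (rule power_mono) auto
      have almon: "al ?s \<le> al \<tau>" unfolding al_def by (intro add_mono power_mono) (use qmon in auto)
      have tlmon: "tl ?s \<le> tl \<tau>" unfolding tl_def by (intro mult_mono add_mono) (use qmon almon in auto)
      have A0: "0 \<le> A" unfolding A_def by simp
      have bH: "bits h \<le> bits ?h + tl ?s + 1" if "0 \<le> h" "h \<le> H" for h
      proof -
        have "bits h \<le> bits (?h + int (tl ?s))" by (rule bits_mono) (use that h0 in \<open>simp add: H_def A_def tl_def algebra_simps\<close>)
        thus ?thesis using bits_add[of ?h "int (tl ?s)"] bits_of_nat_le[of "tl ?s"] by linarith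
      qed
      have bsb: "sz y + bits h + c1 \<le> sb \<tau>" if "I x y" "0 \<le> h" "h \<le> H" for y h
      proof -
        have "sz y \<le> q ?s" using I2[OF x that(1)] unfolding q_def by simp
        thus ?thesis using bH[OF that(2,3)] qmon tlmon unfolding sb_def \<tau>_def by linarith
      qed
      have cond: "\<exists>m'. ex Cd m1 (sb \<tau> * sb \<tau> + (sb \<tau> + 2) ^ e1) m' \<and> m' (ra 0) \<le> m1 (ra 0) + int ((q ?s + 2) ^ e1) \<and>
          keeps (k+1) m1 m' \<and> m' (ra (k+1)) = of_bool (c y)"
        if y: "I x y" and g: "good k m1 (enc y)" and hH: "m1 (ra 0) \<le> H" for y m1
      proof -
        have r0: "rep m1 (m1 (ra k)) (enc y)" and h1: "0 \<le> m1 (ra 0)" using g unfolding good_def by auto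
        define m2 where "m2 = m1(ra (k+1) := m1 (ra k))"
        have e1: "ex (Store (Const (ra (k+1))) (rg k)) m1 (sb \<tau> * sb \<tau>) m2"
          using ex_set_reg[of "k+1" m1 "rg k" "sb \<tau>"] rep_bits[OF r0] bsb[OF y h1 hH]
          unfolding m2_def c1_def by simp
        have k1: "keeps (k+1) m1 m2" unfolding m2_def by (rule keeps_upd_reg) auto
        have h2: "m2 (ra 0) = m1 (ra 0)" unfolding m2_def by simp
        have "good (k+1) m2 (enc y)" using rep_keeps[OF r0 k1] h1 h2 unfolding good_def m2_def by simp
        from runsE[OF C[OF _ this]] I2[OF x y] obtain m3 where 3: "ex C m2 ((sz y + bits (m1 (ra 0)) + 2) ^ e1) m3"
          "m3 (ra 0) \<le> m1 (ra 0) + int ((sz y + 2) ^ e1)" "keeps (k+1) m2 m3" "rep m3 (m3 (ra (k+1))) (enc (c y))"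
          unfolding h2 by blast
        have "(sz y + bits (m1 (ra 0)) + 2) ^ e1 \<le> (sb \<tau> + 2) ^ e1"
          by (rule power_mono) (use bsb[OF y h1 hH] in auto)
        hence "ex Cd m1 (sb \<tau> * sb \<tau> + (sb \<tau> + 2) ^ e1) m3" unfolding Cd_def
          by (intro ex_mono[OF ex_seq[OF e1 3(1)]]) auto
        moreover have "(sz y + 2) ^ e1 \<le> (q ?s + 2) ^ e1" by (rule power_mono) (use I2[OF x y] in \<open>auto simp: q_def\<close>)
        hence "m3 (ra 0) \<le> m1 (ra 0) + int ((q ?s + 2) ^ e1)" using 3(2) of_nat_mono by (smt (verit))
        ultimately show ?thesis using keeps_trans[OF k1 3(3)] 3(4) by (intro exI[of _ m3]) (simp add: enc_bool_def)
      qed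
      have loop: "\<exists>m'. ex W m1 ((\<mu> x y + 1) * tm \<tau>) m' \<and> m' (ra 0) \<le> m1 (ra 0) + int (\<mu> x y) * A \<and>
          keeps k m1 m' \<and> rep m' (m' (ra k)) (enc (while c f y))"
        if "I x y" "good k m1 (enc y)" "m1 (ra (k+1)) = of_bool (c y)"
          "m1 (ra 0) + int (\<mu> x y) * A \<le> H" for y m1
        using that
      proof (induction "\<mu> x y" arbitrary: y m1 rule: less_induct)
        case less
        note y = less.prems(1) and g = less.prems(2) and rc = less.prems(3) and hH = less.prems(4)
        have es: "1 + esum m1 (rg (k+1)) * esum m1 (rg (k+1)) \<le> c2" unfolding c2_def by (rule esum_rg_bool[of m1 "k+1" "c y", OF rc])
        have h1: "0 \<le> m1 (ra 0)" using g unfolding good_def by auto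
        have hH1: "m1 (ra 0) \<le> H" using hH mult_nonneg_nonneg[of "int (\<mu> x y)" A] A0 by linarith
        show ?case
        proof (cases "c y")
          case False
          have "ex W m1 c2 m1" unfolding W_def by (rule ex_while_false[OF _ es]) (use rc False in simp)
          moreover have "c2 \<le> (\<mu> x y + 1) * tm \<tau>" unfolding tm_def by simp
          ultimately show ?thesis using g A0 False unfolding good_def
            by (intro exI[of _ m1]) (auto simp: while_unfold[of c f y] intro: ex_mono)
        next
          case True
          have fy: "I x (f y)" "\<mu> x (f y) < \<mu> x y" using I1[OF x y True] by auto
          obtain m2 where 2: "ex F m1 ((sz y + bits (m1 (ra 0)) + 2) ^ e2) m2"
            "m2 (ra 0) \<le> m1 (ra 0) + int ((sz y + 2) ^ e2)" "keeps k m1 m2" "rep m2 (m2 (ra k)) (enc (f y))"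
            using runsE[OF F[OF _ g]] I2[OF x y] True by auto
          have "(sz y + 2) ^ e2 \<le> (q ?s + 2) ^ e2" by (rule power_mono) (use I2[OF x y] in \<open>auto simp: q_def\<close>)
          hence a2: "m2 (ra 0) \<le> m1 (ra 0) + int ((q ?s + 2) ^ e2)" using 2(2) of_nat_mono by (smt (verit))
          have t2: "(sz y + bits (m1 (ra 0)) + 2) ^ e2 \<le> (sb \<tau> + 2) ^ e2"
            by (rule power_mono) (use bsb[OF y h1 hH1] in auto)
          have h2: "m1 (ra 0) \<le> m2 (ra 0)" using keeps_hp[OF 2(3)] .
          have g2: "good k m2 (enc (f y))" using 2(4) h1 h2 unfolding good_def by simp
          have AA: "A = int ((q ?s + 2) ^ e1) + int ((q ?s + 2) ^ e2)" unfolding A_def al_def by simp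
          have mu: "int (\<mu> x (f y)) * A + A \<le> int (\<mu> x y) * A"
          proof -
            have "(int (\<mu> x (f y)) + 1) * A \<le> int (\<mu> x y) * A" using fy(2) A0 by (intro mult_right_mono) auto
            thus ?thesis by (simp add: algebra_simps)
          qed
          have nn: "0 \<le> int (\<mu> x (f y)) * A" "0 \<le> int ((q ?s + 2) ^ e1)" using A0 by auto
          obtain m3 where 3: "ex Cd m2 (sb \<tau> * sb \<tau> + (sb \<tau> + 2) ^ e1) m3"
            "m3 (ra 0) \<le> m2 (ra 0) + int ((q ?s + 2) ^ e1)" "keeps (k+1) m2 m3" "m3 (ra (k+1)) = of_bool (c (f y))"
            using cond[OF fy(1) g2] a2 AA mu nn hH by auto
          have a3: "m3 (ra 0) \<le> m1 (ra 0) + A" using 3(2) a2 AA by linarith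
          have rk: "m3 (ra k) = m2 (ra k)" using keeps_reg[OF 3(3), of k] k by simp
          have g3: "good k m3 (enc (f y))" using rep_keeps[OF 2(4) 3(3)] rk h1 h2 keeps_hp[OF 3(3)]
            unfolding good_def by simp
          have h3: "m3 (ra 0) + int (\<mu> x (f y)) * A \<le> H" using a3 mu hH by linarith
          obtain m4 where 4: "ex W m3 ((\<mu> x (f y) + 1) * tm \<tau>) m4"
            "m4 (ra 0) \<le> m3 (ra 0) + int (\<mu> x (f y)) * A" "keeps k m3 m4" "rep m4 (m4 (ra k)) (enc (while c f (f y)))"
            using less.hyps[OF fy(2,1) g3 3(4) h3] by blast
          have "ex W m1 (c2 + ((sz y + bits (m1 (ra 0)) + 2) ^ e2 + (sb \<tau> * sb \<tau> + (sb \<tau> + 2) ^ e1)) + (\<mu> x (f y) + 1) * tm \<tau>) m4"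
            unfolding W_def by (rule ex_while_true[OF _ ex_seq[OF 2(1) 3(1)] 4(1)[unfolded W_def] es]) (use rc True in simp)
          moreover have "c2 + ((sz y + bits (m1 (ra 0)) + 2) ^ e2 + (sb \<tau> * sb \<tau> + (sb \<tau> + 2) ^ e1)) + (\<mu> x (f y) + 1) * tm \<tau>
             \<le> (\<mu> x y + 1) * tm \<tau>"
          proof -
            have "c2 + ((sz y + bits (m1 (ra 0)) + 2) ^ e2 + (sb \<tau> * sb \<tau> + (sb \<tau> + 2) ^ e1)) \<le> tm \<tau>"
              unfolding tm_def using t2 by simp
            moreover have "tm \<tau> + (\<mu> x (f y) + 1) * tm \<tau> \<le> (\<mu> x y + 1) * tm \<tau>"
            proof -
              have "(\<mu> x (f y) + 2) * tm \<tau> \<le> (\<mu> x y + 1) * tm \<tau>" using fy(2) by (intro mult_right_mono) auto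
              thus ?thesis by (simp add: algebra_simps)
            qed
            ultimately show ?thesis by linarith
          qed
          ultimately have "ex W m1 ((\<mu> x y + 1) * tm \<tau>) m4" by (rule ex_mono)
          moreover have "m4 (ra 0) \<le> m1 (ra 0) + int (\<mu> x y) * A" using 4(2) a3 mu by linarith
          moreover have "keeps k m1 m4"
            by (rule keeps_trans[OF 2(3) keeps_trans[OF keeps_mono[OF 3(3), of k] 4(3)]]) auto
          moreover have "while c f y = while c f (f y)" using True by (subst while_unfold) simp
          ultimately show ?thesis using 4(4) by (intro exI[of _ m4]) simp
        qed
      qed
      have Ix: "I x x" and mux: "\<mu> x x \<le> q ?s" using I0[OF x] unfolding q_def by auto
      have "int (q ?s) * A \<ge> 0" using A0 by simp
      moreover have "int (\<mu> x x) * A \<le> int (q ?s) * A" using mux A0 by (intro mult_right_mono) auto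
      moreover have H: "H = ?h + int (q ?s) * A + 2 * A" unfolding H_def by (simp add: algebra_simps)
      ultimately have hH: "?h \<le> H" "?h + int (\<mu> x x) * A + A \<le> H" using A0 by linarith+
      obtain m2 where 2: "ex Cd m (sb \<tau> * sb \<tau> + (sb \<tau> + 2) ^ e1) m2" "m2 (ra 0) \<le> ?h + int ((q ?s + 2) ^ e1)"
          "keeps (k+1) m m2" "m2 (ra (k+1)) = of_bool (c x)"
        using cond[OF Ix m hH(1)] by blast
      have "(q ?s + 2) ^ e1 \<le> al ?s" unfolding al_def by simp
      hence a2: "m2 (ra 0) \<le> ?h + A" using 2(2) unfolding A_def by linarith
      have rk: "m2 (ra k) = m (ra k)" using keeps_reg[OF 2(3), of k] k by simp
      have g2: "good k m2 (enc x)" using m rep_keeps[OF _ 2(3)] rk keeps_hp[OF 2(3)] h0 unfolding good_def by simp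
      have "m2 (ra 0) + int (\<mu> x x) * A \<le> H" using a2 hH(2) by linarith
      from loop[OF Ix g2 2(4) this] obtain m3 where 3: "ex W m2 ((\<mu> x x + 1) * tm \<tau>) m3"
        "m3 (ra 0) \<le> m2 (ra 0) + int (\<mu> x x) * A" "keeps k m2 m3" "rep m3 (m3 (ra k)) (enc (while c f x))" by blast
      show ?thesis
      proof (rule runsI)
        show "ex (Seq Cd W) m (sb \<tau> * sb \<tau> + (sb \<tau> + 2) ^ e1 + (\<mu> x x + 1) * tm \<tau>) m3"
          by (rule ex_seq[OF 2(1) 3(1)])
        have "sb \<tau> * sb \<tau> + (sb \<tau> + 2) ^ e1 \<le> tm \<tau>" unfolding tm_def by simp
        moreover have "(\<mu> x x + 1) * tm \<tau> \<le> (q \<tau> + 1) * tm \<tau>" using mux qmon by (intro mult_right_mono) auto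
        moreover have "(q \<tau> + 2) * tm \<tau> = tm \<tau> + (q \<tau> + 1) * tm \<tau>" by simp
        ultimately have "sb \<tau> * sb \<tau> + (sb \<tau> + 2) ^ e1 + (\<mu> x x + 1) * tm \<tau> \<le> (q \<tau> + 2) * tm \<tau>"
          by linarith
        thus "sb \<tau> * sb \<tau> + (sb \<tau> + 2) ^ e1 + (\<mu> x x + 1) * tm \<tau> \<le> B (?s + bits ?h)"
          unfolding B_def \<tau>_def by simp
        have "m3 (ra 0) \<le> H" using 3(2) a2 hH(2) by linarith
        also have "\<dots> \<le> ?h + int (B ?s)" unfolding H_def B_def tl_def A_def by (simp add: algebra_simps)
        finally show "m3 (ra 0) \<le> ?h + int (B ?s)" .
      qed (use keeps_trans[OF keeps_mono[OF 2(3)] 3(3), of k] 3(4) in auto)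
    qed
    moreover have "polyb B" unfolding B_def tm_def sb_def tl_def al_def q_def
      by (intro polyb_add polyb_mult polyb_power polyb_id polyb_const)
    ultimately show "\<exists>P B. polyb B \<and> (\<forall>x\<in>D. \<forall>m. good k m (enc x) \<longrightarrow> runs k P B m (enc x) (enc (while c f x)))"
      by blast
  qed (intro polyb_add polyb_power polyb_id polyb_const)
qed

section \<open>Encodings of numbers, pairs, lists, rationals and vectors\<close>

instantiation int :: enc begin
definition enc_int :: "int \<Rightarrow> val" where "enc_int z = Num z"
instance ..
end

instantiation nat :: enc begin
definition enc_nat :: "nat \<Rightarrow> val" where "enc_nat n = Num (int n)"
instance ..
end

instantiation prod :: (enc, enc) enc begin
definition enc_prod :: "'a \<times> 'b \<Rightarrow> val" where "enc_prod p = Pr (enc (fst p)) (enc (snd p))"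
instance ..
end

text \<open>The empty list is a pair too, so that the tag 0 or 1 in the first component can be
  inspected without knowing which case is present.\<close>

instantiation list :: (enc) enc begin
primrec enc_list :: "'a list \<Rightarrow> val" where
  "enc_list [] = Pr (Num 0) (Num 0)"
| "enc_list (x # xs) = Pr (Num 1) (Pr (enc x) (enc_list xs))"
instance ..
end

instantiation rat :: enc begin
definition enc_rat :: "rat \<Rightarrow> val" where "enc_rat r = enc (quotient_of r)"
instance ..
end

instantiation vec :: (enc) enc begin
definition enc_vec :: "'a vec \<Rightarrow> val" where "enc_vec v = enc (list_of_vec v)"
instance ..
end

lemma bits_0 [simp]: "bits 0 = 1" by (simp add: bits_def floorlog_def)
lemma bits_1 [simp]: "bits 1 = 2" by (simp add: bits_def floorlog_def)

lemma sz_list: "sz xs = (\<Sum>x\<leftarrow>xs. sz x + 4) + 3"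
  by (induction xs) auto

lemma sz_prod: "sz p = sz (fst p) + sz (snd p) + 1" by (simp add: enc_prod_def)

lemma sz_Pair [simp]: "sz (a, b) = sz a + sz b + 1" by (simp add: enc_prod_def)

lemma length_le_sz: "length xs \<le> sz xs" by (induction xs) auto

lemma sz_member: "x \<in> set xs \<Longrightarrow> sz x \<le> sz xs" by (induction xs) auto

lemma sz_append: "sz (xs @ ys) \<le> sz xs + sz ys" by (simp add: sz_list)

lemma sz_suffix: "sz ys \<le> sz (xs @ ys)" by (simp add: sz_list)

lemma sz_list_le: "(\<And>x. x \<in> set xs \<Longrightarrow> sz x \<le> b) \<Longrightarrow> sz xs \<le> length xs * (b + 4) + 3"
proof (induction xs)
  case (Cons x xs)
  have "sz x \<le> b" "sz xs \<le> length xs * (b + 4) + 3" using Cons by auto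
  thus ?case by simp
qed simp

section \<open>Closure rules for arithmetic, comparisons and Boolean connectives\<close>

named_theorems pt_intros

lemmas pt_var [pt_intros] = pt_id

lemma pt_val_const: "pt D (\<lambda>_. v)" for v :: val
  by (induction v) (auto intro: pt_num pt_binop[OF binop_Pr])

lemma pt_const [pt_intros]: "pt D (\<lambda>_. c)"
  using pt_val_const[of D "enc c"] by (simp only: pt_enc)

text \<open>Conversions between types whose encodings coincide are free: from naturals to integers,
  between vectors and lists, between a rational and its reduced fraction.\<close>

lemma pt_recode: "pt D f \<Longrightarrow> (\<And>x. x \<in> D \<Longrightarrow> enc (g x) = enc (f x)) \<Longrightarrow> pt D g"
  unfolding pt_def by simp

lemma pt_encI: "pt D f \<Longrightarrow> pt D (\<lambda>x. enc (f x))"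
  by (simp only: pt_enc)

lemma pt_Pair [pt_intros]: assumes "pt D f" "pt D g" shows "pt D (\<lambda>x. (f x, g x))"
proof (rule pt_recode)
  show "pt D (\<lambda>x. Pr (enc (f x)) (enc (g x)))"
    by (rule pt_binop[OF binop_Pr]) (use assms pt_encI in auto)
qed (simp add: enc_prod_def)

lemma pt_fst [pt_intros]: assumes "pt D f" shows "pt D (\<lambda>x. fst (f x))"
proof (rule pt_recode)
  show "pt D (\<lambda>x. vfst (enc (f x)))"
    by (rule pt_vfst[OF pt_encI[OF assms]]) (simp add: enc_prod_def)
qed (simp add: enc_prod_def)

lemma pt_snd [pt_intros]: assumes "pt D f" shows "pt D (\<lambda>x. snd (f x))"
proof (rule pt_recode)
  show "pt D (\<lambda>x. vsnd (enc (f x)))"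
    by (rule pt_vsnd[OF pt_encI[OF assms]]) (simp add: enc_prod_def)
qed (simp add: enc_prod_def)

lemma pt_comp2:
  assumes "pt E (\<lambda>p. h (fst p) (snd p))" "pt D f" "pt D g" "\<And>x. x \<in> D \<Longrightarrow> (f x, g x) \<in> E"
  shows "pt D (\<lambda>x. h (f x) (g x))"
  using pt_comp[OF assms(1) pt_Pair[OF assms(2,3)] assms(4)] by simp

lemma pt_arith:
  assumes "binop isnum (\<lambda>a b. Num (F (nval a) (nval b)))" "pt D f" "pt D g"
  shows "pt D (\<lambda>x. F (f x) (g x) :: int)"
proof (rule pt_recode)
  show "pt D (\<lambda>x. Num (F (nval (enc (f x))) (nval (enc (g x)))))"
    by (rule pt_binop[OF assms(1) pt_encI[OF assms(2)] pt_encI[OF assms(3)]]) (simp add: isnum_def enc_int_def)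
qed (simp add: enc_int_def)

lemmas pt_int_add [pt_intros] = pt_arith[OF binop_add]
lemmas pt_int_diff [pt_intros] = pt_arith[OF binop_sub]
lemmas pt_int_mult [pt_intros] = pt_arith[OF binop_mul]
lemmas pt_int_div [pt_intros] = pt_arith[OF binop_div]

lemma pt_int_mod [pt_intros]: "pt D f \<Longrightarrow> pt D g \<Longrightarrow> pt D (\<lambda>x. f x mod g x :: int)"
  unfolding minus_mult_div_eq_mod[symmetric] by (intro pt_intros)

lemma pt_int_uminus [pt_intros]: "pt D f \<Longrightarrow> pt D (\<lambda>x. - f x :: int)"
  using pt_int_diff[OF pt_const[of D 0], of f] by simp

text \<open>A comparison has to be obtained as an arithmetic value. Since \<open>z * z + 1\<close>
  exceeds the absolute value of \<open>z\<close>, the rounded quotient of \<open>- z\<close> by it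
  is -1 for positive \<open>z\<close> and 0 otherwise.\<close>

lemma pt_int_pos: assumes "pt D f" shows "pt D (\<lambda>x. 0 < (f x :: int))"
proof (rule pt_recode)
  show "pt D (\<lambda>x. - ((- f x) div (f x * f x + 1)))" by (intro pt_intros assms)
  fix x
  have "- ((- z) div (z * z + 1)) = of_bool (0 < z)" for z :: int
  proof (cases "0 < z")
    case True
    have "(- z) div (z * z + 1) = -1"
    proof (rule int_div_pos_eq)
      show "- z = (z * z + 1) * - 1 + (z * z + 1 - z)" by simp
      have "1 * z \<le> z * z" using True by (intro mult_right_mono) auto
      thus "0 \<le> z * z + 1 - z" by simp
      show "z * z + 1 - z < z * z + 1" using True by simp
    qed
    thus ?thesis using True by simp
  next
    case False
    have "- z < z * z + 1"
    proof (cases "z = 0")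
      case False
      have "1 * -z \<le> (-z) * (-z)" by (rule mult_right_mono) (use False \<open>\<not> 0 < z\<close> in auto)
      thus ?thesis by simp
    qed simp
    hence "(- z) div (z * z + 1) = 0" using False by (intro div_pos_pos_trivial) auto
    thus ?thesis using False by simp
  qed
  thus "enc (0 < f x) = enc (- ((- f x) div (f x * f x + 1)))" by (simp add: enc_bool_def enc_int_def)
qed

lemma pt_int_less [pt_intros]: assumes "pt D f" "pt D g" shows "pt D (\<lambda>x. f x < (g x :: int))"
  using pt_int_pos[OF pt_int_diff[OF assms(2,1)]] by simp

lemma pt_If' [pt_intros]: "pt D c \<Longrightarrow> pt D f \<Longrightarrow> pt D g \<Longrightarrow> pt D (\<lambda>x. if c x then f x else g x)"
  by (rule pt_If) (auto elim: pt_subset)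

lemma pt_Not [pt_intros]: "pt D c \<Longrightarrow> pt D (\<lambda>x. \<not> c x)"
  by (rule pt_cong[OF pt_If'[of D c "\<lambda>_. False" "\<lambda>_. True"]]) (auto intro: pt_const)

lemma pt_conj [pt_intros]: "pt D c \<Longrightarrow> pt D d \<Longrightarrow> pt D (\<lambda>x. c x \<and> d x)"
  by (rule pt_cong[OF pt_If'[of D c d "\<lambda>_. False"]]) (auto intro: pt_const)

lemma pt_disj [pt_intros]: "pt D c \<Longrightarrow> pt D d \<Longrightarrow> pt D (\<lambda>x. c x \<or> d x)"
  by (rule pt_cong[OF pt_If'[of D c "\<lambda>_. True" d]]) (auto intro: pt_const)

lemma pt_int_le [pt_intros]: "pt D f \<Longrightarrow> pt D g \<Longrightarrow> pt D (\<lambda>x. f x \<le> (g x :: int))"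
  unfolding not_less[symmetric] by (intro pt_intros)

lemma pt_int_eq [pt_intros]: "pt D f \<Longrightarrow> pt D g \<Longrightarrow> pt D (\<lambda>x. f x = (g x :: int))"
  unfolding order_eq_iff by (intro pt_intros)

lemma pt_of_nat [pt_intros]: "pt D f \<Longrightarrow> pt D (\<lambda>x. int (f x))"
  by (erule pt_recode) (simp add: enc_int_def enc_nat_def)

lemma pt_of_int_nat: "pt D (\<lambda>x. int (f x)) \<Longrightarrow> pt D f"
  by (erule pt_recode) (simp add: enc_int_def enc_nat_def)

lemma pt_nat [pt_intros]: "pt D f \<Longrightarrow> pt D (\<lambda>x. nat (f x))"
proof (rule pt_of_int_nat)
  assume "pt D f"
  hence "pt D (\<lambda>x. if f x < 0 then 0 else f x)" by (intro pt_intros)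
  thus "pt D (\<lambda>x. int (nat (f x)))" by (rule pt_cong) auto
qed

lemma pt_nat_add [pt_intros]: "pt D f \<Longrightarrow> pt D g \<Longrightarrow> pt D (\<lambda>x. f x + g x :: nat)"
  by (rule pt_of_int_nat) (simp only: of_nat_add, intro pt_intros)
lemma pt_nat_mult [pt_intros]: "pt D f \<Longrightarrow> pt D g \<Longrightarrow> pt D (\<lambda>x. f x * g x :: nat)"
  by (rule pt_of_int_nat) (simp only: of_nat_mult, intro pt_intros)
lemma pt_Suc [pt_intros]: "pt D f \<Longrightarrow> pt D (\<lambda>x. Suc (f x))"
  using pt_nat_add[OF _ pt_const[of D 1]] by simp
lemma pt_nat_less [pt_intros]: "pt D f \<Longrightarrow> pt D g \<Longrightarrow> pt D (\<lambda>x. f x < (g x :: nat))"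
  by (simp only: of_nat_less_iff[where 'a = int, symmetric], intro pt_intros)
lemma pt_nat_le [pt_intros]: "pt D f \<Longrightarrow> pt D g \<Longrightarrow> pt D (\<lambda>x. f x \<le> (g x :: nat))"
  by (simp only: of_nat_le_iff[where 'a = int, symmetric], intro pt_intros)
lemma pt_nat_eq [pt_intros]: "pt D f \<Longrightarrow> pt D g \<Longrightarrow> pt D (\<lambda>x. f x = (g x :: nat))"
  unfolding order_eq_iff by (intro pt_intros)
lemma pt_max [pt_intros]: "pt D f \<Longrightarrow> pt D g \<Longrightarrow> pt D (\<lambda>x. max (f x) (g x :: nat))"
  unfolding max_def by (intro pt_intros)

section \<open>Operations on lists\<close>

lemma pt_Cons [pt_intros]:
  assumes "pt D f" "pt D g" shows "pt D (\<lambda>x. f x # g x)"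
proof (rule pt_recode)
  show "pt D (\<lambda>x. (1::int, (f x, g x)))" by (intro pt_intros assms)
qed (simp add: enc_prod_def enc_int_def)

lemma pt_nonempty: "pt D f \<Longrightarrow> pt D (\<lambda>x. f x \<noteq> [])"
proof -
  assume "pt D f"
  hence "pt D (\<lambda>x. enc (f x))" by (rule pt_encI)
  moreover have "\<exists>a b. enc (f x) = Pr a b" for x by (cases "f x") auto
  ultimately have "pt D (\<lambda>x. vfst (enc (f x)))" by (rule pt_vfst)
  thus ?thesis
  proof (rule pt_recode)
    show "enc (f x \<noteq> []) = enc (vfst (enc (f x)))" for x by (cases "f x") (auto simp: enc_bool_def)
  qed
qed

lemma pt_null [pt_intros]: "pt D f \<Longrightarrow> pt D (\<lambda>x. f x = [])"
  using pt_Not[OF pt_nonempty] by simp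

lemma pt_hd: assumes "pt D f" "\<And>x. x \<in> D \<Longrightarrow> f x \<noteq> []" shows "pt D (\<lambda>x. hd (f x))"
proof -
  have pr: "enc xs = Pr (Num 1) (Pr (enc (hd xs)) (enc (tl xs)))" if "xs \<noteq> []" for xs :: "'b list"
    using that by (cases xs) auto
  have "pt D (\<lambda>x. vfst (vsnd (enc (f x))))"
    by (intro pt_vfst pt_vsnd) (use assms pr pt_encI in auto)
  thus ?thesis by (rule pt_recode) (use assms pr in auto)
qed

lemma pt_tl [pt_intros]: assumes "pt D f" shows "pt D (\<lambda>x. tl (f x))"
proof -
  have pr: "enc xs = Pr (Num 1) (Pr (enc (hd xs)) (enc (tl xs)))" if "xs \<noteq> []" for xs :: "'b list"
    using that by (cases xs) auto
  have "pt {x \<in> D. f x \<noteq> []} (\<lambda>x. vsnd (vsnd (enc (f x))))"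
    by (intro pt_vsnd) (use assms pr in \<open>auto intro!: pt_encI elim: pt_subset\<close>)
  hence "pt {x \<in> D. f x \<noteq> []} (\<lambda>x. tl (f x))" by (rule pt_recode) (use pr in auto)
  moreover have "pt {x \<in> D. \<not> f x \<noteq> []} (\<lambda>x. [])" by (rule pt_const)
  ultimately have "pt D (\<lambda>x. if f x \<noteq> [] then tl (f x) else [])"
    by (intro pt_If pt_nonempty assms)
  thus ?thesis by (rule pt_cong) auto
qed

text \<open>A loop whose state consists of the parameter, the rest of the list and the accumulator.
  The accumulator has to be bounded after every prefix in terms of the initial parameter, because a
  polynomial bound on a single step could compound.\<close>

lemma pt_fold:
  fixes f :: "'s::enc \<Rightarrow> 'x::enc \<Rightarrow> 'a::enc \<Rightarrow> 'a"
  assumes xs: "pt D xs" and i: "pt D i" and f: "pt E (\<lambda>p. f (fst p) (fst (snd p)) (snd (snd p)))"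
    and dom: "\<And>s ys y zs. s \<in> D \<Longrightarrow> xs s = ys @ y # zs \<Longrightarrow> (s, y, fold (f s) ys (i s)) \<in> E"
    and p: "polyb p"
    and size: "\<And>s ys zs. s \<in> D \<Longrightarrow> xs s = ys @ zs \<Longrightarrow> sz (fold (f s) ys (i s)) \<le> p (sz s)"
  shows "pt D (\<lambda>s. fold (f s) (xs s) (i s))"
proof -
  obtain pe where pe: "\<And>s. p s \<le> (s + 2) ^ pe" using p unfolding polyb_def by blast
  define c :: "'s \<times> 'x list \<times> 'a \<Rightarrow> bool" where "c = (\<lambda>q. fst (snd q) \<noteq> [])"
  define g :: "'s \<times> 'x list \<times> 'a \<Rightarrow> 's \<times> 'x list \<times> 'a"
    where "g = (\<lambda>q. (fst q, tl (fst (snd q)), f (fst q) (hd (fst (snd q))) (snd (snd q))))"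
  define J where "J s q \<longleftrightarrow> fst q = s \<and> (\<exists>ys. xs s = ys @ fst (snd q) \<and> snd (snd q) = fold (f s) ys (i s))" for s q
  define E' where "E' = {q. fst q \<in> D \<and> J (fst q) q}"
  define D' where "D' = (\<lambda>s. (s, xs s, i s)) ` D"
  have res: "while c g (s, r, a) = (s, [], fold (f s) r a)" for s r a
    by (induction r arbitrary: a) (subst while_unfold, simp add: c_def g_def)+
  have "pt D' (while c g)"
  proof (rule pt_while[where E = E' and I = "\<lambda>x y. J (fst x) y" and \<mu> = "\<lambda>x y. length (fst (snd y))"
      and p = "\<lambda>s. s + (s + 2) ^ pe + 2"])
    show "pt E' c" unfolding c_def by (intro pt_nonempty pt_intros)
    have "pt {x \<in> E'. c x} (\<lambda>q. f (fst q) (hd (fst (snd q))) (snd (snd q)))"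
    proof -
      have "pt {x \<in> E'. c x} (\<lambda>q. (fst q, hd (fst (snd q)), snd (snd q)))"
        by (intro pt_intros pt_hd) (auto simp: c_def)
      from pt_comp[OF f this] show ?thesis
        using dom by (fastforce simp: E'_def J_def c_def neq_Nil_conv)
    qed
    thus "pt {x \<in> E'. c x} g" unfolding g_def by (intro pt_intros)
    show "polyb (\<lambda>s. s + (s + 2) ^ pe + 2)" by (intro polyb_add polyb_power polyb_id polyb_const)
  next
    fix x assume "x \<in> D'"
    then obtain s where s: "s \<in> D" "x = (s, xs s, i s)" by (auto simp: D'_def)
    have "length (xs s) \<le> sz (xs s)" by (rule length_le_sz)
    thus "J (fst x) x \<and> length (fst (snd x)) \<le> sz x + (sz x + 2) ^ pe + 2"
      by (auto simp: J_def s)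
  next
    fix x y assume x: "x \<in> D'" and "J (fst x) y" "c y"
    then obtain ys r rs a where y: "y = (fst x, r # rs, a)" "xs (fst x) = ys @ r # rs" "a = fold (f (fst x)) ys (i (fst x))"
      by (cases y) (auto simp: J_def c_def neq_Nil_conv)
    show "J (fst x) (g y) \<and> length (fst (snd (g y))) < length (fst (snd y))"
      using y by (auto simp: J_def g_def intro!: exI[of _ "ys @ [r]"])
  next
    fix x y assume x: "x \<in> D'" and J: "J (fst x) y"
    obtain s where s: "s \<in> D" "x = (s, xs s, i s)" using x by (auto simp: D'_def)
    obtain ys r where y: "y = (s, r, fold (f s) ys (i s))" "xs s = ys @ r" using J s by (cases y) (auto simp: J_def)
    have "sz r \<le> sz (xs s)" using y sz_suffix by metis
    moreover have "sz (fold (f s) ys (i s)) \<le> (sz s + 2) ^ pe"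
      using size[OF s(1) y(2)] pe le_trans by blast
    moreover have "(sz s + 2) ^ pe \<le> (sz x + 2) ^ pe" unfolding s by (rule power_mono) auto
    moreover have "y \<in> E'" using y s(1) by (auto simp: E'_def J_def)
    ultimately show "y \<in> E' \<and> sz y \<le> sz x + (sz x + 2) ^ pe + 2"
      unfolding y s by simp
  qed
  hence "pt D (\<lambda>s. while c g (s, xs s, i s))"
    by (rule pt_comp) (auto simp: D'_def intro!: pt_intros xs i)
  hence "pt D (\<lambda>s. snd (snd (while c g (s, xs s, i s))))" by (intro pt_intros)
  thus ?thesis by (simp add: res)
qed

lemma pt_size_fun:
  assumes "pt D f"
  obtains e where "\<And>x. x \<in> D \<Longrightarrow> sz (f x) \<le> (sz x + 2) ^ e"
  using pt_size[OF assms] by blast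

lemma sz_rev [simp]: "sz (rev xs) = sz xs"
  by (simp add: sz_list flip: rev_map)

lemma fold_Cons: "fold (#) xs ys = rev xs @ ys"
  by (induction xs arbitrary: ys) auto

lemma pt_rev [pt_intros]: assumes "pt D xs" shows "pt D (\<lambda>s. rev (xs s))"
proof -
  obtain e where e: "\<And>x. x \<in> D \<Longrightarrow> sz (xs x) \<le> (sz x + 2) ^ e" by (rule pt_size_fun[OF assms]) blast
  have "pt D (\<lambda>s. fold (\<lambda>x a. x # a) (xs s) [])"
  proof (rule pt_fold[where E = UNIV and p = "\<lambda>s. (s + 2) ^ e" and f = "\<lambda>_ x a. x # a" and i = "\<lambda>_. []", OF assms])
    fix s ys zs assume "s \<in> D" "xs s = ys @ zs"
    moreover from this have "sz ys \<le> sz (xs s)" by (simp add: sz_list)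
    ultimately show "sz (fold (#) ys []) \<le> (sz s + 2) ^ e" using e[of s] by (simp add: fold_Cons)
  qed (auto intro!: pt_intros polyb_power polyb_add polyb_Suc)
  thus ?thesis by (simp add: fold_Cons)
qed

lemma pt_map [pt_intros]:
  fixes f :: "'s::enc \<Rightarrow> 'a::enc \<Rightarrow> 'b::enc"
  assumes xs: "pt D xs" and f: "pt {(s, x). s \<in> D \<and> x \<in> set (xs s)} (\<lambda>p. f (fst p) (snd p))"
  shows "pt D (\<lambda>s. map (f s) (xs s))"
proof -
  obtain e where e: "\<And>x. x \<in> D \<Longrightarrow> sz (xs x) \<le> (sz x + 2) ^ e" by (rule pt_size_fun[OF xs]) blast
  obtain e' where e': "\<And>p. p \<in> {(s, x). s \<in> D \<and> x \<in> set (xs s)} \<Longrightarrow> sz (f (fst p) (snd p)) \<le> (sz p + 2) ^ e'"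
    using pt_size_fun[OF f] by blast
  have fr: "fold (\<lambda>x a. f s x # a) ys a = rev (map (f s) ys) @ a" for s ys a by (induction ys arbitrary: a) auto
  define q where "q = (\<lambda>s::nat. (s + 2) ^ e * ((s + (s + 2) ^ e + 1 + 2) ^ e' + 4) + 3)"
  have "pt D (\<lambda>s. fold (\<lambda>x a. f s x # a) (xs s) [])"
  proof (rule pt_fold[where E = "{(s, x, a). s \<in> D \<and> x \<in> set (xs s)}" and p = q and f = "\<lambda>s x a. f s x # a" and i = "\<lambda>_. []", OF xs pt_const])
    have "pt {(s, x, a). s \<in> D \<and> x \<in> set (xs s)} (\<lambda>p. f (fst p) (fst (snd p)))"
      by (rule pt_comp2[OF f]) (auto intro!: pt_intros)
    thus "pt {(s, x, a). s \<in> D \<and> x \<in> set (xs s)} (\<lambda>p. f (fst p) (fst (snd p)) # snd (snd p))"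
      by (intro pt_intros)
    fix s ys zs assume s: "s \<in> D" "xs s = ys @ zs"
    have "sz (map (f s) ys) \<le> length (map (f s) ys) * ((sz s + (sz s + 2) ^ e + 1 + 2) ^ e' + 4) + 3"
    proof (rule sz_list_le)
      fix y assume "y \<in> set (map (f s) ys)"
      then obtain x where x: "x \<in> set ys" "y = f s x" by auto
      have "sz x \<le> sz (xs s)" using x s by (intro sz_member) auto
      have "sz y \<le> (sz (s, x) + 2) ^ e'" using e'[of "(s, x)"] x s by auto
      also have "\<dots> \<le> (sz s + (sz s + 2) ^ e + 1 + 2) ^ e'"
        by (rule power_mono) (use \<open>sz x \<le> sz (xs s)\<close> e[OF s(1)] in auto)
      finally show "sz y \<le> (sz s + (sz s + 2) ^ e + 1 + 2) ^ e'" .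
    qed
    also have "\<dots> \<le> q (sz s)"
    proof -
      have "length (map (f s) ys) \<le> length (xs s)" using s by simp
      also have "\<dots> \<le> (sz s + 2) ^ e" using length_le_sz[of "xs s"] e[OF s(1)] by simp
      finally show ?thesis unfolding q_def by (intro add_mono mult_mono) auto
    qed
    finally show "sz (fold (\<lambda>x a. f s x # a) ys []) \<le> q (sz s)" by (simp add: fr)
  next
    show "polyb q" unfolding q_def by (intro polyb_add polyb_mult polyb_power polyb_id polyb_const)
  qed auto
  from pt_rev[OF this] show ?thesis by (simp add: fr)
qed

lemma sz_filter: "sz (filter P xs) \<le> sz xs" by (induction xs) auto

lemma pt_filter [pt_intros]:
  fixes P :: "'s::enc \<Rightarrow> 'a::enc \<Rightarrow> bool"
  assumes xs: "pt D xs" and P: "pt {(s, x). s \<in> D \<and> x \<in> set (xs s)} (\<lambda>p. P (fst p) (snd p))"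
  shows "pt D (\<lambda>s. filter (P s) (xs s))"
proof -
  obtain e where e: "\<And>x. x \<in> D \<Longrightarrow> sz (xs x) \<le> (sz x + 2) ^ e" by (rule pt_size_fun[OF xs]) blast
  have fr: "fold (\<lambda>x a. if P s x then x # a else a) ys a = rev (filter (P s) ys) @ a" for s ys a
    by (induction ys arbitrary: a) auto
  have "pt D (\<lambda>s. fold (\<lambda>x a. if P s x then x # a else a) (xs s) [])"
  proof (rule pt_fold[where E = "{(s, x, a). s \<in> D \<and> x \<in> set (xs s)}" and p = "\<lambda>s. (s + 2) ^ e"
        and f = "\<lambda>s x a. if P s x then x # a else a" and i = "\<lambda>_. []", OF xs pt_const])
    have "pt {(s, x, a). s \<in> D \<and> x \<in> set (xs s)} (\<lambda>p. P (fst p) (fst (snd p)))"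
      by (rule pt_comp2[OF P]) (auto intro!: pt_intros)
    thus "pt {(s, x, a). s \<in> D \<and> x \<in> set (xs s)}
      (\<lambda>p. if P (fst p) (fst (snd p)) then fst (snd p) # snd (snd p) else snd (snd p))"
      by (intro pt_intros)
    fix s ys zs assume s: "s \<in> D" "xs s = ys @ zs"
    have "sz (filter (P s) ys) \<le> sz ys" by (rule sz_filter)
    also have "\<dots> \<le> sz (xs s)" using s by (simp add: sz_list)
    finally show "sz (fold (\<lambda>x a. if P s x then x # a else a) ys []) \<le> (sz s + 2) ^ e"
      using e[OF s(1)] by (simp add: fr)
  next
    show "polyb (\<lambda>s. (s + 2) ^ e)" by (intro polyb_add polyb_mult polyb_power polyb_id polyb_const)
  qed auto
  from pt_rev[OF this] show ?thesis by (simp add: fr)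
qed

lemma pt_Ball [pt_intros]:
  assumes "pt D xs" "pt {(s, x). s \<in> D \<and> x \<in> set (xs s)} (\<lambda>p. P (fst p) (snd p))"
  shows "pt D (\<lambda>s. \<forall>x\<in>set (xs s). P s x)"
proof -
  have "pt D (\<lambda>s. filter (\<lambda>x. \<not> P s x) (xs s) = [])" by (intro pt_intros assms)
  thus ?thesis by (simp add: filter_empty_conv)
qed

lemma pt_Bex [pt_intros]:
  assumes "pt D xs" "pt {(s, x). s \<in> D \<and> x \<in> set (xs s)} (\<lambda>p. P (fst p) (snd p))"
  shows "pt D (\<lambda>s. \<exists>x\<in>set (xs s). P s x)"
proof -
  have "pt D (\<lambda>s. filter (P s) (xs s) \<noteq> [])" by (intro pt_intros assms)
  thus ?thesis by (simp add: filter_empty_conv)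
qed

lemma pt_append [pt_intros]:
  assumes "pt D xs" "pt D ys" shows "pt D (\<lambda>s. xs s @ ys s)"
proof -
  obtain e where e: "\<And>x. x \<in> D \<Longrightarrow> sz (xs x) \<le> (sz x + 2) ^ e" by (rule pt_size_fun[OF assms(1)]) blast
  obtain e' where e': "\<And>x. x \<in> D \<Longrightarrow> sz (ys x) \<le> (sz x + 2) ^ e'" by (rule pt_size_fun[OF assms(2)]) blast
  have "pt D (\<lambda>s. fold (\<lambda>x a. x # a) (rev (xs s)) (ys s))"
  proof (rule pt_fold[where E = UNIV and p = "\<lambda>s. (s + 2) ^ e + (s + 2) ^ e'" and f = "\<lambda>_ x a. x # a", OF pt_rev[OF assms(1)] assms(2)])
    fix s us zs assume s: "s \<in> D" "rev (xs s) = us @ zs"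
    have "sz us \<le> sz (rev (xs s))" unfolding s by (simp add: sz_list)
    thus "sz (fold (#) us (ys s)) \<le> (sz s + 2) ^ e + (sz s + 2) ^ e'"
      using e[OF s(1)] e'[OF s(1)] sz_append[of "rev us" "ys s"] by (simp add: fold_Cons)
  qed (auto intro!: pt_intros polyb_power polyb_add polyb_Suc)
  thus ?thesis by (simp add: fold_Cons)
qed

lemma sz_nat_le: "sz (n::nat) \<le> n + 1" using bits_of_nat_le[of n] by (simp add: enc_nat_def)

lemma pt_length [pt_intros]: assumes "pt D xs" shows "pt D (\<lambda>s. length (xs s))"
proof -
  obtain e where e: "\<And>x. x \<in> D \<Longrightarrow> sz (xs x) \<le> (sz x + 2) ^ e" by (rule pt_size_fun[OF assms]) blast
  have fr: "fold (\<lambda>_. Suc) ys n = n + length ys" for ys :: "'b list" and n by (induction ys arbitrary: n) auto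
  have "pt D (\<lambda>s. fold (\<lambda>_. Suc) (xs s) 0)"
  proof (rule pt_fold[where E = UNIV and p = "\<lambda>s. (s + 2) ^ e + 1" and f = "\<lambda>_ _. Suc" and i = "\<lambda>_. 0", OF assms pt_const])
    fix s us zs assume s: "s \<in> D" "xs s = us @ zs"
    have "length us \<le> sz (xs s)" using length_le_sz[of "xs s"] s by simp
    thus "sz (fold (\<lambda>_. Suc) us 0) \<le> (sz s + 2) ^ e + 1"
      using e[OF s(1)] sz_nat_le[of "length us"] by (simp add: fr)
  qed (auto intro!: pt_intros polyb_power polyb_add polyb_Suc)
  thus ?thesis by (simp add: fr)
qed

lemma sz_concat: "sz (concat xss) \<le> sz xss"
  by (induction xss) (auto intro: le_trans[OF sz_append])

lemma pt_concat [pt_intros]: assumes "pt D xs" shows "pt D (\<lambda>s. concat (xs s))"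
proof -
  obtain e where e: "\<And>x. x \<in> D \<Longrightarrow> sz (xs x) \<le> (sz x + 2) ^ e" by (rule pt_size_fun[OF assms]) blast
  have fr: "fold (\<lambda>x a. a @ x) ys n = n @ concat ys" for ys :: "'b list list" and n by (induction ys arbitrary: n) auto
  have "pt D (\<lambda>s. fold (\<lambda>x a. a @ x) (xs s) [])"
  proof (rule pt_fold[where E = UNIV and p = "\<lambda>s. (s + 2) ^ e" and f = "\<lambda>_ x a. a @ x" and i = "\<lambda>_. []", OF assms pt_const])
    fix s us zs assume s: "s \<in> D" "xs s = us @ zs"
    have "sz (concat us) \<le> sz us" by (rule sz_concat)
    also have "\<dots> \<le> sz (xs s)" using s by (simp add: sz_list)
    finally show "sz (fold (\<lambda>x a. a @ x) us []) \<le> (sz s + 2) ^ e"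
      using e[OF s(1)] by (simp add: fr)
  qed (auto intro!: pt_intros polyb_power polyb_add polyb_Suc)
  thus ?thesis by (simp add: fr)
qed

lemma sz_enumerate: "sz (List.enumerate n xs) \<le> length xs * (n + length xs + 1 + sz xs + 1 + 4) + 3"
proof -
  have "sz (List.enumerate n xs) \<le> length (List.enumerate n xs) * ((n + length xs + 1 + sz xs + 1) + 4) + 3"
  proof (rule sz_list_le)
    fix p assume "p \<in> set (List.enumerate n xs)"
    hence e: "fst p < n + length xs" "fst p - n < length xs" "snd p = xs ! (fst p - n)"
      by (auto simp: in_set_enumerate_eq)
    hence p: "fst p < n + length xs" "snd p \<in> set xs" by simp_all
    show "sz p \<le> n + length xs + 1 + sz xs + 1"
      using sz_nat_le[of "fst p"] sz_member[OF p(2)] p(1) by (simp add: sz_prod)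
  qed
  thus ?thesis by simp
qed

lemma pt_enumerate [pt_intros]: assumes "pt D xs" shows "pt D (\<lambda>s. List.enumerate 0 (xs s))"
proof -
  obtain e where e: "\<And>x. x \<in> D \<Longrightarrow> sz (xs x) \<le> (sz x + 2) ^ e" by (rule pt_size_fun[OF assms]) blast
  have fr: "fold (\<lambda>x a. (Suc (fst a), (fst a, x) # snd a)) ys (n, b) = (n + length ys, rev (List.enumerate n ys) @ b)"
    for ys :: "'b list" and n b by (induction ys arbitrary: n b) auto
  define q where "q = (\<lambda>s::nat. (s + 2) ^ e + 1 + ((s + 2) ^ e * ((s + 2) ^ e + 1 + (s + 2) ^ e + 1 + 4) + 3) + 1)"
  have "pt D (\<lambda>s. fold (\<lambda>x a. (Suc (fst a), (fst a, x) # snd a)) (xs s) (0, []))"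
  proof (rule pt_fold[where E = UNIV and p = q and f = "\<lambda>_ x a. (Suc (fst a), (fst a, x) # snd a)" and i = "\<lambda>_. (0, [])", OF assms pt_const])
    fix s us zs assume s: "s \<in> D" "xs s = us @ zs"
    have u: "sz us \<le> (sz s + 2) ^ e" using s e[OF s(1)] by (simp add: sz_list)
    have l: "length us \<le> (sz s + 2) ^ e" using length_le_sz[of us] u by simp
    have "sz (List.enumerate 0 us) \<le> (sz s + 2) ^ e * ((sz s + 2) ^ e + 1 + (sz s + 2) ^ e + 1 + 4) + 3"
      by (rule order.trans[OF sz_enumerate]) (intro add_mono mult_mono, use u l in auto)
    thus "sz (fold (\<lambda>x a. (Suc (fst a), (fst a, x) # snd a)) us (0, [])) \<le> q (sz s)"
      using l sz_nat_le[of "length us"] unfolding q_def fr by simp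
  qed (auto simp: q_def intro!: pt_intros polyb_power polyb_add polyb_mult polyb_Suc)
  hence "pt D (\<lambda>s. rev (snd (fold (\<lambda>x a. (Suc (fst a), (fst a, x) # snd a)) (xs s) (0, []))))"
    by (intro pt_intros)
  thus ?thesis by (simp add: fr)
qed

text \<open>Numbers are stored in binary, so counting up to \<open>m\<close> would not be
  polynomial. Filtering the numbered list takes only as many rounds as the list has
  elements.\<close>

lemma take_enumerate: "map snd (filter (\<lambda>p. fst p < m) (List.enumerate n xs)) = take (m - n) xs"
proof (induction xs arbitrary: n)
  case (Cons x xs)
  show ?case
  proof (cases "n < m")
    case True
    then obtain k where "m - n = Suc k" "m - Suc n = k" by (metis Suc_diff_Suc)
    thus ?thesis using Cons[of "Suc n"] True by simp
  next
    case False
    thus ?thesis using Cons[of "Suc n"] by simp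
  qed
qed simp

lemma drop_enumerate: "map snd (filter (\<lambda>p. m \<le> fst p) (List.enumerate n xs)) = drop (m - n) xs"
proof (induction xs arbitrary: n)
  case (Cons x xs)
  show ?case
  proof (cases "n < m")
    case True
    then obtain k where "m - n = Suc k" "m - Suc n = k" by (metis Suc_diff_Suc)
    thus ?thesis using Cons[of "Suc n"] True by simp
  next
    case False
    thus ?thesis using Cons[of "Suc n"] by simp
  qed
qed simp

lemma pt_take [pt_intros]: assumes "pt D m" "pt D xs" shows "pt D (\<lambda>s. take (m s) (xs s))"
proof -
  have "pt D (\<lambda>s. map snd (filter (\<lambda>p. fst p < m s) (List.enumerate 0 (xs s))))"
    by (intro pt_intros assms pt_comp[OF assms(1)]) auto
  thus ?thesis by (simp add: take_enumerate)
qed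

lemma pt_drop [pt_intros]: assumes "pt D m" "pt D xs" shows "pt D (\<lambda>s. drop (m s) (xs s))"
proof -
  have "pt D (\<lambda>s. map snd (filter (\<lambda>p. m s \<le> fst p) (List.enumerate 0 (xs s))))"
    by (intro pt_intros assms pt_comp[OF assms(1)]) auto
  thus ?thesis by (simp add: drop_enumerate)
qed

lemma pt_nth: assumes "pt D m" "pt D xs" "\<And>s. s \<in> D \<Longrightarrow> m s < length (xs s)" shows "pt D (\<lambda>s. xs s ! m s)"
proof -
  have "pt D (\<lambda>s. hd (drop (m s) (xs s)))" by (intro pt_hd pt_intros assms(1,2)) (simp add: assms(3) not_le)
  thus ?thesis by (rule pt_cong) (simp add: assms(3) hd_drop_conv_nth)
qed

lemma zip_enumerate: "zip xs ys = map (\<lambda>p. (snd p, ys ! fst p)) (filter (\<lambda>p. fst p < length ys) (List.enumerate 0 xs))"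
proof -
  have "map (\<lambda>p. (snd p, ys ! (fst p - n))) (filter (\<lambda>p. fst p < n + length ys) (List.enumerate n xs)) = zip xs ys" for n
  proof (induction xs ys arbitrary: n rule: list_induct2')
    case (4 x xs y ys)
    have *: "map (\<lambda>p. (snd p, (y # ys) ! (fst p - n))) (filter (\<lambda>p. fst p < n + length (y # ys)) (List.enumerate (Suc n) xs))
       = map (\<lambda>p. (snd p, ys ! (fst p - Suc n))) (filter (\<lambda>p. fst p < Suc n + length ys) (List.enumerate (Suc n) xs))"
      by (rule map_cong) (auto simp: in_set_enumerate_eq nth_Cons' )
    show ?case using 4[of "Suc n"] * by simp
  next
    case (2 x xs)
    show ?case by (auto simp: filter_empty_conv in_set_enumerate_eq)
  qed (auto simp: filter_empty_conv in_set_enumerate_eq)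
  from this[of 0] show ?thesis by simp
qed

lemma pt_zip [pt_intros]: assumes "pt D xs" "pt D ys" shows "pt D (\<lambda>s. zip (xs s) (ys s))"
  unfolding zip_enumerate by (intro pt_intros pt_nth assms pt_comp[OF assms(2)]) auto

lemma pt_vec_of_list [pt_intros]: "pt D xs \<Longrightarrow> pt D (\<lambda>s. vec_of_list (xs s))"
  by (erule pt_recode) (simp add: enc_vec_def list_vec)

lemma pt_list_of_vec [pt_intros]: "pt D xs \<Longrightarrow> pt D (\<lambda>s. list_of_vec (xs s))"
  by (erule pt_recode) (simp add: enc_vec_def)

section \<open>Rational arithmetic and the size of fractions\<close>

lemma rat_quotient:
  obtains p q where "quotient_of r = (p, q)" "r = of_int p / of_int q" "q > 0" "coprime p q"
  using quotient_of_div quotient_of_denom_pos quotient_of_coprime by (metis surj_pair)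

lemma sz_int [simp]: "sz (z::int) = bits z" by (simp add: enc_int_def)

text \<open>The reduced denominator divides any other denominator of the number, and likewise for a
  nonzero numerator. Hence any convenient fraction bounds the size.\<close>

lemma rat_size:
  fixes r :: rat
  assumes r: "r = of_int z / of_int D" and D: "D \<noteq> 0"
  shows "sz r \<le> bits z + bits D + 1"
proof -
  obtain p q where pq: "quotient_of r = (p, q)" "r = of_int p / of_int q" "q > 0" "coprime p q"
    by (rule rat_quotient)
  have "of_int p * of_int D = (of_int z * of_int q :: rat)" using r D pq(2,3) by (simp add: field_simps)
  hence eq: "p * D = z * q" by (simp only: of_int_mult[symmetric] of_int_eq_iff)
  have "q dvd p * D" unfolding eq by simp
  hence "q dvd D" using pq(4) by (simp add: coprime_dvd_mult_right_iff coprime_commute)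
  hence 1: "\<bar>q\<bar> \<le> \<bar>D\<bar>" using D by (rule dvd_imp_le_int[rotated])
  have "p dvd z * q" unfolding eq[symmetric] by simp
  hence "p dvd z" using pq(4) by (simp add: coprime_dvd_mult_left_iff)
  hence "\<bar>p\<bar> \<le> \<bar>z\<bar>" using dvd_imp_le_int[of z p] eq D by (cases "z = 0") auto
  thus ?thesis using bits_mono[OF 1] bits_mono[of p z] by (simp add: enc_rat_def pq(1))
qed

lemma rat_parts:
  obtains p q where "r = of_int p / of_int q" "q > 0" "sz r = bits p + bits q + 1" "quotient_of r = (p, q)"
proof -
  obtain p q where pq: "quotient_of r = (p, q)" "r = of_int p / of_int q" "q > 0" "coprime p q"
    by (rule rat_quotient)
  thus ?thesis by (intro that[of p q]) (auto simp: enc_rat_def)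
qed

lemma gcd_while: "0 \<le> a \<Longrightarrow> 0 \<le> b \<Longrightarrow> while (\<lambda>p. snd p \<noteq> 0) (\<lambda>p. (snd p, fst p mod snd p)) (a, b) = (gcd a b, 0)"
  for a b :: int
proof (induction "nat b" arbitrary: a b rule: less_induct)
  case less
  show ?case
  proof (cases "b = 0")
    case False
    hence "0 \<le> a mod b" "nat (a mod b) < nat b" using less.prems by auto
    from less.hyps[OF this(2) less.prems(2) this(1)] show ?thesis
      using False by (subst while_unfold) (simp add: gcd_red_int[of a b])
  qed (use less.prems in \<open>subst while_unfold, simp\<close>)
qed

lemma bits_half: "0 < x \<Longrightarrow> 2 * y \<le> x \<Longrightarrow> 0 \<le> y \<Longrightarrow> bits y < bits x"
proof -
  assume a: "0 < x" "2 * y \<le> x" "0 \<le> y"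
  have b: "2 \<le> bits x" using bits_mono[of 1 x] a by simp
  define k where "k = bits x - 2"
  have k: "bits x = Suc (Suc k)" using b unfolding k_def by simp
  have "\<bar>x\<bar> < 2 ^ Suc k" using bits_le_Suc_iff[of x "Suc k"] unfolding k by blast
  hence "x < 2 * 2 ^ k" by simp
  hence "y < 2 ^ k" using a(2) by linarith
  hence "\<bar>y\<bar> < 2 ^ k" using a(3) by linarith
  hence "bits y \<le> Suc k" by (simp only: bits_le_Suc_iff)
  thus "bits y < bits x" unfolding k by simp
qed

text \<open>Euclid's algorithm, measured by the length of the product of the two numbers. If the
  first is at least the second, its remainder is at most half of it and the product loses a bit. If
  it is smaller, the step only swaps the two, which the additional 1 in the measure pays
  for.\<close>

lemma pt_gcd_nonneg: "pt {p. 0 \<le> fst p \<and> 0 \<le> snd p} (\<lambda>p. gcd (fst p) (snd p) :: int)"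
proof -
  let ?E = "{p :: int \<times> int. 0 \<le> fst p \<and> 0 \<le> snd p}"
  have "pt ?E (while (\<lambda>p. snd p \<noteq> 0) (\<lambda>p. (snd p, fst p mod snd p :: int)))"
  proof (rule pt_while[where E = ?E and p = "\<lambda>s. 2 * s + 1"
      and I = "\<lambda>x y. 0 \<le> fst y \<and> 0 \<le> snd y \<and> fst y + snd y \<le> fst x + snd x"
      and \<mu> = "\<lambda>x y. bits (fst y * snd y) + (if fst y < snd y then 1 else 0)"])
    fix x :: "int \<times> int" assume x: "x \<in> ?E"
    show "(0 \<le> fst x \<and> 0 \<le> snd x \<and> fst x + snd x \<le> fst x + snd x) \<and>
        bits (fst x * snd x) + (if fst x < snd x then 1 else 0) \<le> 2 * sz x + 1"
      using x bits_mult[of "fst x" "snd x"] by (simp add: sz_prod)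
  next
    fix x y :: "int \<times> int" assume "x \<in> ?E" and y: "0 \<le> fst y \<and> 0 \<le> snd y \<and> fst y + snd y \<le> fst x + snd x" and ne: "snd y \<noteq> 0"
    obtain a b where ab: "y = (a, b)" by (cases y)
    have a: "0 \<le> a" "0 < b" using y ne ab by auto
    have m: "0 \<le> a mod b" "a mod b < b" using a by auto
    have ma: "a mod b \<le> a" using a by (simp add: zmod_le_nonneg_dividend)
    have dec: "bits (b * (a mod b)) < bits (a * b) + (if a < b then 1 else 0)"
    proof (cases "a < b")
      case True thus ?thesis using a by (simp add: mult.commute)
    next
      case False
      have "1 \<le> a div b" using False a by (simp add: pos_imp_zdiv_pos_iff int_one_le_iff_zero_less)
      hence "b * 1 \<le> b * (a div b)" using a by (intro mult_left_mono) auto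
      hence "2 * (a mod b) \<le> a" using m minus_mult_div_eq_mod[of a b] by linarith
      hence "b * (2 * (a mod b)) \<le> b * a" using a by (intro mult_left_mono) auto
      hence "2 * (b * (a mod b)) \<le> a * b" by (simp add: mult.commute mult.left_commute)
      moreover have "0 < a * b" using False a by auto
      ultimately show ?thesis using False a m by (simp add: bits_half)
    qed
    show "(0 \<le> fst (snd y, fst y mod snd y) \<and> 0 \<le> snd (snd y, fst y mod snd y) \<and>
        fst (snd y, fst y mod snd y) + snd (snd y, fst y mod snd y) \<le> fst x + snd x) \<and>
      bits (fst (snd y, fst y mod snd y) * snd (snd y, fst y mod snd y)) +
        (if fst (snd y, fst y mod snd y) < snd (snd y, fst y mod snd y) then 1 else 0)
      < bits (fst y * snd y) + (if fst y < snd y then 1 else 0)"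
      using dec m ma a y ab leD[OF less_imp_le[OF m(2)]] by auto
  next
    fix x y :: "int \<times> int" assume x: "x \<in> ?E" and y: "0 \<le> fst y \<and> 0 \<le> snd y \<and> fst y + snd y \<le> fst x + snd x"
    have "bits (fst y) \<le> bits (fst x + snd x)" "bits (snd y) \<le> bits (fst x + snd x)" using x y by (auto intro!: bits_mono)
    thus "y \<in> ?E \<and> sz y \<le> 2 * sz x + 1" using y bits_add[of "fst x" "snd x"] by (simp add: sz_prod)
  qed (intro pt_intros polyb_add polyb_mult polyb_const polyb_id)+
  hence "pt ?E (\<lambda>p. fst (while (\<lambda>p. snd p \<noteq> 0) (\<lambda>p. (snd p, fst p mod snd p :: int)) p))" by (intro pt_intros)
  thus ?thesis by (rule pt_cong) (use gcd_while in force)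
qed

lemma pt_gcd [pt_intros]: assumes "pt D f" "pt D g" shows "pt D (\<lambda>s. gcd (f s) (g s) :: int)"
proof -
  have "pt D (\<lambda>s. gcd (if f s < 0 then - f s else f s) (if g s < 0 then - g s else g s))"
    by (rule pt_comp2[OF pt_gcd_nonneg]) (auto intro!: pt_intros assms)
  thus ?thesis by (rule pt_cong) auto
qed

lemma pt_normalize [pt_intros]: "pt D f \<Longrightarrow> pt D (\<lambda>s. Rat.normalize (f s))"
  unfolding Rat.normalize_def Let_def by (intro pt_intros)

lemma pt_quotient_of [pt_intros]: "pt D f \<Longrightarrow> pt D (\<lambda>s. quotient_of (f s))"
  by (erule pt_recode) (simp add: enc_rat_def)

lemma pt_by_quotient: "pt D (\<lambda>s. quotient_of (f s)) \<Longrightarrow> pt D f"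
  by (erule pt_recode) (simp add: enc_rat_def)

lemma pt_rat_add [pt_intros]: "pt D f \<Longrightarrow> pt D g \<Longrightarrow> pt D (\<lambda>s. f s + g s :: rat)"
  by (rule pt_by_quotient) (simp only: rat_plus_code Let_def split_beta, intro pt_intros)
lemma pt_rat_diff [pt_intros]: "pt D f \<Longrightarrow> pt D g \<Longrightarrow> pt D (\<lambda>s. f s - g s :: rat)"
  by (rule pt_by_quotient) (simp only: rat_minus_code Let_def split_beta, intro pt_intros)
lemma pt_rat_mult [pt_intros]: "pt D f \<Longrightarrow> pt D g \<Longrightarrow> pt D (\<lambda>s. f s * g s :: rat)"
  by (rule pt_by_quotient) (simp only: rat_times_code Let_def split_beta, intro pt_intros)
lemma pt_rat_divide [pt_intros]: "pt D f \<Longrightarrow> pt D g \<Longrightarrow> pt D (\<lambda>s. f s / g s :: rat)"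
  by (rule pt_by_quotient) (simp only: rat_divide_code Let_def split_beta, intro pt_intros)
lemma pt_rat_less [pt_intros]: "pt D f \<Longrightarrow> pt D g \<Longrightarrow> pt D (\<lambda>s. f s < (g s :: rat))"
  by (simp only: rat_less_code Let_def split_beta, intro pt_intros)
lemma pt_rat_le [pt_intros]: "pt D f \<Longrightarrow> pt D g \<Longrightarrow> pt D (\<lambda>s. f s \<le> (g s :: rat))"
  by (simp only: not_less[symmetric], intro pt_intros)
lemma pt_rat_eq [pt_intros]: "pt D f \<Longrightarrow> pt D g \<Longrightarrow> pt D (\<lambda>s. f s = (g s :: rat))"
  unfolding order_eq_iff by (intro pt_intros)
lemma pt_rat_of_int [pt_intros]: "pt D f \<Longrightarrow> pt D (\<lambda>s. rat_of_int (f s))"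
  by (rule pt_by_quotient) (simp only: quotient_of_rat_of_int, intro pt_intros)
lemma pt_rat_of_nat [pt_intros]: "pt D f \<Longrightarrow> pt D (\<lambda>s. rat_of_nat (f s))"
  using pt_rat_of_int[OF pt_of_nat] by simp

text \<open>The product of all denominators serves as common denominator; its length is at most the
  total size of the summands. This bounds every partial sum directly by the summands, as a fold
  requires.\<close>

lemma sum_list_frac:
  "\<exists>z D. sum_list xs = of_int z / (of_int D :: rat) \<and> D \<noteq> 0 \<and> bits D \<le> sz xs \<and> bits z \<le> (length xs + 1) * sz xs"
proof (induction xs)
  case Nil
  show ?case by (intro exI[of _ "0::int"] exI[of _ "1::int"]) simp
next
  case (Cons x xs)
  then obtain z D where zD: "sum_list xs = of_int z / of_int D" "D \<noteq> 0" "bits D \<le> sz xs" "bits z \<le> (length xs + 1) * sz xs" by blast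
  obtain p q where pq: "x = of_int p / of_int q" "q > 0" "sz x = bits p + bits q + 1" by (rule rat_parts[of x])
  have "sum_list (x # xs) = of_int (z * q + p * D) / of_int (D * q)" using zD(1,2) pq(1,2) by (simp add: field_simps)
  moreover have "D * q \<noteq> 0" using zD pq by simp
  moreover have s: "sz xs + bits p + bits q \<le> sz (x # xs)" using pq by simp
  have "bits (D * q) \<le> sz (x # xs)" using bits_mult[of D q] zD(3) s by linarith
  moreover have "bits (z * q + p * D) \<le> (length (x # xs) + 1) * sz (x # xs)"
  proof -
    have "bits (z * q + p * D) \<le> (length xs + 1) * sz xs + bits q + (bits p + sz xs)"
      using bits_add[of "z * q" "p * D"] bits_mult[of z q] bits_mult[of p D] zD(3,4) by linarith
    also have "\<dots> \<le> (length xs + 1) * sz (x # xs) + sz (x # xs)"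
    proof -
      have "(length xs + 1) * sz xs \<le> (length xs + 1) * sz (x # xs)" by (rule mult_left_mono) auto
      thus ?thesis using s by linarith
    qed
    finally show ?thesis by simp
  qed
  ultimately show ?case by blast
qed

lemma sz_sum_list: "sz (sum_list xs :: rat) \<le> (length xs + 2) * sz xs + 1"
proof -
  obtain z D where zD: "sum_list xs = of_int z / of_int D" "D \<noteq> 0" "bits D \<le> sz xs" "bits z \<le> (length xs + 1) * sz xs"
    using sum_list_frac[of xs] by blast
  show ?thesis using rat_size[OF zD(1,2)] zD(3,4) by simp
qed

lemma pt_sum_list [pt_intros]: assumes "pt D xs" shows "pt D (\<lambda>s. sum_list (xs s) :: rat)"
proof -
  obtain e where e: "\<And>x. x \<in> D \<Longrightarrow> sz (xs x) \<le> (sz x + 2) ^ e" by (rule pt_size_fun[OF assms]) blast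
  have fr: "fold (+) ys 0 = (sum_list ys :: rat)" for ys
    using fun_cong[OF fold_plus_sum_list_rev[of ys], of 0] by (simp add: sum_list_rev)
  have "pt D (\<lambda>s. fold (+) (xs s) 0)"
  proof (rule pt_fold[where E = UNIV and p = "\<lambda>s. ((s + 2) ^ e + 2) * (s + 2) ^ e + 1" and f = "\<lambda>_. (+)" and i = "\<lambda>_. 0", OF assms pt_const])
    fix s us zs assume s: "s \<in> D" "xs s = us @ zs"
    have u: "sz us \<le> (sz s + 2) ^ e" using s e[OF s(1)] by (simp add: sz_list)
    have l: "length us \<le> (sz s + 2) ^ e" using length_le_sz[of us] u by simp
    show "sz (fold (+) us 0) \<le> ((sz s + 2) ^ e + 2) * (sz s + 2) ^ e + 1"
      unfolding fr by (rule order.trans[OF sz_sum_list]) (intro add_mono mult_mono, use u l in auto)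
  qed (auto intro!: pt_intros polyb_power polyb_add polyb_mult polyb_Suc)
  thus ?thesis by (simp add: fr)
qed

text \<open>The exponent comes in unary, as the length of a list, since the length of the power is
  proportional to it.\<close>

lemma pt_rat_power [pt_intros]: assumes x: "pt D x" and xs: "pt D xs"
  shows "pt D (\<lambda>s. (x s :: rat) ^ length (xs s))"
proof -
  obtain e where e: "\<And>s. s \<in> D \<Longrightarrow> sz (xs s) \<le> (sz s + 2) ^ e" by (rule pt_size_fun[OF xs]) blast
  obtain e' where e': "\<And>s. s \<in> D \<Longrightarrow> sz (x s) \<le> (sz s + 2) ^ e'" by (rule pt_size_fun[OF x]) blast
  have fr: "fold (\<lambda>_ a. a * r) ys b = b * r ^ length ys" for ys :: "'b list" and r b :: rat
    by (induction ys arbitrary: b) auto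
  have "pt D (\<lambda>s. fold (\<lambda>_ a. a * x s) (xs s) 1)"
  proof (rule pt_fold[where E = "{p. fst p \<in> D}" and p = "\<lambda>s. (s + 2) ^ e * (s + 2) ^ e' + 5" and f = "\<lambda>s _ a. a * x s" and i = "\<lambda>_. 1", OF xs pt_const])
    show "pt {p :: 'a \<times> 'b \<times> rat. fst p \<in> D} (\<lambda>p. snd (snd p) * x (fst p))"
      by (intro pt_intros pt_comp[OF x]) auto
    fix s us zs assume s: "s \<in> D" "xs s = us @ zs"
    have l: "length us \<le> (sz s + 2) ^ e" using length_le_sz[of "xs s"] e[OF s(1)] s by simp
    obtain p q where pq: "x s = of_int p / of_int q" "q > 0" "sz (x s) = bits p + bits q + 1" by (rule rat_parts[of "x s"])
    have "sz (x s ^ length us) \<le> bits (p ^ length us) + bits (q ^ length us) + 1"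
      by (rule rat_size) (use pq in \<open>auto simp: power_divide\<close>)
    also have "\<dots> \<le> length us * bits p + 2 + (length us * bits q + 2) + 1"
      using bits_power[of p "length us"] bits_power[of q "length us"] by linarith
    also have "\<dots> \<le> length us * sz (x s) + 5" using pq(3) by (simp add: algebra_simps)
    also have "\<dots> \<le> (sz s + 2) ^ e * (sz s + 2) ^ e' + 5"
      by (intro add_mono mult_mono) (use l e'[OF s(1)] in auto)
    finally show "sz (fold (\<lambda>_ a. a * x s) us 1) \<le> (sz s + 2) ^ e * (sz s + 2) ^ e' + 5" by (simp add: fr)
  qed (auto intro!: polyb_power polyb_add polyb_mult polyb_Suc)
  thus ?thesis by (simp add: fr)
qed

definition dot :: "rat list \<Rightarrow> rat list \<Rightarrow> rat" where
  "dot xs ys = sum_list (map2 (*) xs ys)"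

lemma pt_dot [pt_intros]: "pt D f \<Longrightarrow> pt D g \<Longrightarrow> pt D (\<lambda>s. dot (f s) (g s))"
  unfolding dot_def split_beta' by (intro pt_intros)

section \<open>Determinants and the size of solutions of integer systems\<close>

lemma det_bound:
  fixes A :: "int mat"
  assumes A: "A \<in> carrier_mat N N" and B: "\<And>i j. i < N \<Longrightarrow> j < N \<Longrightarrow> \<bar>A $$ (i, j)\<bar> \<le> B"
  shows "\<bar>det A\<bar> \<le> (int N * B) ^ N"
proof -
  let ?P = "{p. p permutes {0..<N}}"
  have "\<bar>det A\<bar> \<le> (\<Sum>p\<in>?P. \<bar>signof p * (\<Prod>i = 0..<N. A $$ (i, p i))\<bar>)"
    unfolding det_def'[OF A] by (rule sum_abs)
  also have "\<dots> \<le> (\<Sum>p\<in>?P. B ^ N)"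
  proof (rule sum_mono)
    fix p assume "p \<in> ?P"
    hence p: "p permutes {0..<N}" by simp
    have "\<bar>signof p * (\<Prod>i = 0..<N. A $$ (i, p i))\<bar> = (\<Prod>i = 0..<N. \<bar>A $$ (i, p i)\<bar>)"
      by (simp add: abs_mult abs_prod sign_def)
    also have "\<dots> \<le> (\<Prod>i = 0..<N. B)"
      by (rule prod_mono) (use B permutes_in_image[OF p] in auto)
    finally show "\<bar>signof p * (\<Prod>i = 0..<N. A $$ (i, p i))\<bar> \<le> B ^ N" by simp
  qed
  also have "\<dots> = fact N * B ^ N" by (simp add: card_permutations)
  also have "\<dots> \<le> (int N * B) ^ N"
  proof (cases "N = 0")
    case False
    have "0 \<le> B" using B[of 0 0] False by linarith
    moreover have "(fact N :: int) \<le> int N ^ N" using fact_le_power[of N, where 'a = int] by simp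
    ultimately show ?thesis by (simp add: power_mult_distrib mult_right_mono)
  qed simp
  finally show ?thesis .
qed

text \<open>All solution entries share the denominator \<open>\<Delta>\<close>, the determinant of
  the system. Regularity is stated as injectivity over the rationals because in the applications it
  follows from positive definiteness and not from a computed determinant.\<close>

lemma cramer_bound:
  fixes A :: "nat \<Rightarrow> nat \<Rightarrow> int" and b :: "nat \<Rightarrow> int" and x :: "nat \<Rightarrow> rat"
  assumes B: "\<And>i j. i < N \<Longrightarrow> j < N \<Longrightarrow> \<bar>A i j\<bar> \<le> B" "\<And>i. i < N \<Longrightarrow> \<bar>b i\<bar> \<le> B"
    and inj: "\<And>z :: nat \<Rightarrow> rat. (\<And>i. i < N \<Longrightarrow> (\<Sum>j<N. of_int (A i j) * z j) = 0) \<Longrightarrow> (\<And>j. j < N \<Longrightarrow> z j = 0)"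
    and x: "\<And>i. i < N \<Longrightarrow> (\<Sum>j<N. of_int (A i j) * x j) = of_int (b i)"
  shows "\<exists>\<Delta>::int. \<Delta> \<noteq> 0 \<and> \<bar>\<Delta>\<bar> \<le> (int N * B) ^ N \<and>
     (\<forall>j<N. \<exists>y::int. of_int \<Delta> * x j = of_int y \<and> \<bar>y\<bar> \<le> (int N * B) ^ N)"
proof -
  define M where "M = mat N N (\<lambda>(i, j). A i j)"
  define R :: "rat mat" where "R = map_mat of_int M"
  define v where "v = vec N x"
  have M: "M \<in> carrier_mat N N" and R: "R \<in> carrier_mat N N" and v: "v \<in> carrier_vec N"
    unfolding M_def R_def v_def by auto
  have mv: "(R *\<^sub>v vec N z) $ i = (\<Sum>j<N. of_int (A i j) * z j)" if "i < N" for z i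
    using that unfolding R_def M_def by (auto simp: scalar_prod_def lessThan_atLeast0 intro!: sum.cong)
  have Rv: "R *\<^sub>v v = map_vec of_int (vec N b)"
  proof (rule eq_vecI)
    fix i assume "i < dim_vec (map_vec rat_of_int (vec N b))"
    thus "(R *\<^sub>v v) $ i = map_vec of_int (vec N b) $ i" using mv[of i x] x[of i] unfolding v_def by simp
  qed (use R in auto)
  have dR: "det R = of_int (det M)" unfolding R_def by (rule of_int_hom.hom_det)
  have "det R \<noteq> 0"
  proof
    assume "det R = 0"
    then obtain w where w: "w \<in> carrier_vec N" "w \<noteq> 0\<^sub>v N" "R *\<^sub>v w = 0\<^sub>v N"
      using det_0_iff_vec_prod_zero_field[OF R] by blast
    have wz: "w = vec N (\<lambda>i. w $ i)" using w(1) by auto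
    have "(\<Sum>j<N. of_int (A i j) * w $ j) = 0" if "i < N" for i
      using mv[OF that, of "\<lambda>i. w $ i"] w(3) that wz[symmetric] by simp
    hence "\<And>j. j < N \<Longrightarrow> w $ j = 0" using inj[of "\<lambda>i. w $ i"] by blast
    hence "w = 0\<^sub>v N" using w(1) by auto
    thus False using w(2) by simp
  qed
  hence d0: "det M \<noteq> 0" using dR by simp
  show ?thesis
  proof (rule exI[of _ "det M"], intro conjI allI impI)
    show "\<bar>det M\<bar> \<le> (int N * B) ^ N" by (rule det_bound[OF M]) (use B in \<open>simp add: M_def\<close>)
    fix k assume k: "k < N"
    let ?C = "replace_col M (vec N b) k"
    have C: "?C \<in> carrier_mat N N" using M by (simp add: replace_col_def)
    have "replace_col R (R *\<^sub>v v) k = map_mat of_int ?C"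
      unfolding Rv by (rule eq_matI) (use M R in \<open>auto simp: replace_col_def R_def\<close>)
    hence "rat_of_int (det ?C) = x k * det R"
      using cramer_lemma_mat[OF R v k] k by (simp add: v_def of_int_hom.hom_det)
    hence "of_int (det M) * x k = of_int (det ?C)" unfolding dR by (simp add: mult.commute)
    moreover have "\<bar>det ?C\<bar> \<le> (int N * B) ^ N"
      by (rule det_bound[OF C]) (use B M in \<open>auto simp: replace_col_def M_def\<close>)
    ultimately show "\<exists>y::int. of_int (det M) * x k = of_int y \<and> \<bar>y\<bar> \<le> (int N * B) ^ N" by blast
  qed (rule d0)
qed

section \<open>Homogeneous linear inequalities\<close>

definition ip :: "nat \<Rightarrow> (nat \<Rightarrow> rat) \<Rightarrow> (nat \<Rightarrow> rat) \<Rightarrow> rat" where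
  "ip n x y = (\<Sum>l<n. x l * y l)"

lemma ip_commute: "ip n x y = ip n y x" by (simp add: ip_def mult.commute)
lemma ip_cong: "(\<And>l. l < n \<Longrightarrow> x l = x' l) \<Longrightarrow> (\<And>l. l < n \<Longrightarrow> y l = y' l) \<Longrightarrow> ip n x y = ip n x' y'"
  unfolding ip_def by (rule sum.cong) auto
lemma ip_add: "ip n x (\<lambda>l. y l + z l) = ip n x y + ip n x z"
  by (simp add: ip_def distrib_left sum.distrib)
lemma ip_diff: "ip n x (\<lambda>l. y l - z l) = ip n x y - ip n x z"
  by (simp add: ip_def right_diff_distrib sum_subtractf)
lemma ip_scale: "ip n x (\<lambda>l. c * y l) = c * ip n x y"
  by (simp add: ip_def sum_distrib_left ac_simps)
lemma ip_add': "ip n (\<lambda>l. y l + z l) x = ip n y x + ip n z x"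
  using ip_add[of n x y z] by (simp add: ip_commute)
lemma ip_diff': "ip n (\<lambda>l. y l - z l) x = ip n y x - ip n z x"
  using ip_diff[of n x y z] by (simp add: ip_commute)
lemma ip_scale': "ip n (\<lambda>l. c * y l) x = c * ip n y x"
  using ip_scale[of n x c y] by (simp add: ip_commute)
lemma ip_sum: "ip n x (\<lambda>l. \<Sum>j\<in>S. y j * f j l) = (\<Sum>j\<in>S. y j * ip n x (f j))"
proof -
  have "ip n x (\<lambda>l. \<Sum>j\<in>S. y j * f j l) = (\<Sum>l<n. \<Sum>j\<in>S. y j * (x l * f j l))"
    unfolding ip_def sum_distrib_left by (intro sum.cong refl) (simp add: ac_simps)
  also have "\<dots> = (\<Sum>j\<in>S. y j * ip n x (f j))"
    unfolding ip_def sum_distrib_left by (rule sum.swap)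
  finally show ?thesis .
qed
lemma ip_nonneg: "0 \<le> ip n x x" unfolding ip_def by (intro sum_nonneg) auto
lemma ip_zero: "ip n x x = 0 \<Longrightarrow> l < n \<Longrightarrow> x l = 0"
  unfolding ip_def by (subst (asm) sum_nonneg_eq_0_iff) auto
lemma ip_unit: "i < n \<Longrightarrow> ip n (\<lambda>l. of_bool (l = i)) x = x i"
proof -
  assume "i < n"
  have "ip n (\<lambda>l. of_bool (l = i)) x = (\<Sum>l<n. if l = i then x l else 0)"
    unfolding ip_def by (intro sum.cong) auto
  thus ?thesis using \<open>i < n\<close> by simp
qed

text \<open>The discriminant argument, stated for an arbitrary function of two vectors so that it
  covers the standard inner product as well as the weighted form \<open>Gf\<close>.\<close>

lemma cs_form:
  fixes f :: "'v \<Rightarrow> 'v \<Rightarrow> rat"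
  assumes "\<And>s t. 0 \<le> s * s * f x x + 2 * s * t * f x y + t * t * f y y"
  shows "f x y * f x y \<le> f x x * f y y"
proof (cases "f y y = 0")
  case True
  have "f x y = 0"
  proof (rule ccontr)
    assume n: "f x y \<noteq> 0"
    have "0 \<le> f x x + 2 * t * f x y" for t using assms[of 1 t] True by (simp add: algebra_simps)
    \<comment> \<open>For this \<open>t\<close> the right-hand side equals -1.\<close>
    from this[of "- (f x x + 1) / (2 * f x y)"] show False using n by (simp add: field_simps)
  qed
  thus ?thesis using True by simp
next
  case False
  have y: "0 < f y y" using assms[of 0 1] False by simp
  have "0 \<le> f y y * (f y y * f x x - f x y * f x y)"
    using assms[of "f y y" "- f x y"] by (simp add: algebra_simps)
  hence "0 \<le> f y y * f x x - f x y * f x y" using y by (simp add: zero_le_mult_iff)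
  thus ?thesis by (simp add: mult.commute)
qed

lemma ip_cs: "ip n x y * ip n x y \<le> ip n x x * ip n y y"
proof (rule cs_form[of "ip n"])
  fix s t
  have "s * s * ip n x x + 2 * s * t * ip n x y + t * t * ip n y y = ip n (\<lambda>l. s * x l + t * y l) (\<lambda>l. s * x l + t * y l)"
    by (simp add: ip_add ip_add' ip_scale ip_scale' ip_commute[of n y x] algebra_simps)
  thus "0 \<le> s * s * ip n x x + 2 * s * t * ip n x y + t * t * ip n y y" using ip_nonneg by simp
qed

text \<open>The aim is a point of the cone \<open>C\<close> of all \<open>v\<close> with \<open>a j \<bullet> v \<ge> 0\<close> for \<open>j < m\<close>, with as many of these
  values positive as possible. Every row has a scale \<open>d j\<close>, a power of \<open>2\<close> with
  \<open>d j * (a j \<bullet> v) \<le> 1\<close> on the part \<open>K0\<close> of \<open>C\<close> in a small cube, or \<open>0\<close> once the row is known to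
  vanish on \<open>C\<close>. With weights \<open>y j\<close> and \<open>w = (\<Sum>j. d j * y j * a j)\<close> the candidate point is \<open>H w\<close>,
  where \<open>H\<close> inverts the form \<open>lam * I + (\<Sum>j. ((d j)\<^sup>2 - 1) * a j * (a j)\<^sup>T)\<close> on the subspace where the rows of scale
  \<open>0\<close> vanish. As long as the candidate violates some row \<open>k\<close> of positive scale, \<open>y k\<close> is
  increased; this preserves \<open>w \<bullet> H w \<le> (\<Sum>j. y j)\<close>. When the weights are large, the latter inequality
  shows \<open>d i * (a i \<bullet> v) \<le> 1 / 2\<close> on \<open>K0\<close> for a row \<open>i\<close> of large weight, so that \<open>d i\<close> can be
  doubled, with a rank one update of \<open>H\<close>. If \<open>d i\<close> exceeds \<open>Lam\<close>, then row \<open>i\<close> vanishes on \<open>C\<close>, because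
  otherwise Cramer's rule yields a point of \<open>K0\<close> where it is at least \<open>1 / Lam\<close>.\<close>

locale cone =
  fixes n m :: nat and z :: "nat \<Rightarrow> nat \<Rightarrow> int"
begin

definition a :: "nat \<Rightarrow> nat \<Rightarrow> rat" where "a j l = of_int (z j l)"
text \<open>One quantity that dominates every entry, every squared row norm and every entry of the
  Gram matrix of the rows. The summand 1 keeps it positive when there are no rows or only zero
  rows.\<close>

definition lamz :: int where "lamz = 1 + (\<Sum>j<m. \<Sum>l<n. z j l * z j l)"
definition lam :: rat where "lam = of_int lamz"

lemma lamz_pos: "1 \<le> lamz" unfolding lamz_def by (simp add: sum_nonneg)
lemma lam_pos: "1 \<le> lam" using lamz_pos unfolding lam_def by simp

lemma square_le_lamz: "j < m \<Longrightarrow> l < n \<Longrightarrow> z j l * z j l \<le> lamz - 1"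
proof -
  assume j: "j < m" "l < n"
  have "z j l * z j l \<le> (\<Sum>l<n. z j l * z j l)" using j by (intro member_le_sum) auto
  also have "\<dots> \<le> (\<Sum>j<m. \<Sum>l<n. z j l * z j l)" using j
    by (intro member_le_sum[of j "{..<m}" "\<lambda>j. \<Sum>l<n. z j l * z j l"]) (auto intro: sum_nonneg)
  finally show ?thesis unfolding lamz_def by simp
qed

lemma abs_le_square: "\<bar>x\<bar> \<le> x * x" for x :: int
proof (cases "x = 0")
  case False
  hence "\<bar>x\<bar> * 1 \<le> \<bar>x\<bar> * \<bar>x\<bar>" by (intro mult_left_mono) auto
  thus ?thesis by simp
qed simp

lemma abs_le_lamz: "j < m \<Longrightarrow> l < n \<Longrightarrow> \<bar>z j l\<bar> \<le> lamz"
  using square_le_lamz[of j l] abs_le_square[of "z j l"] by linarith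

lemma ip_a_le_lam: "j < m \<Longrightarrow> ip n (a j) (a j) \<le> lam"
proof -
  assume j: "j < m"
  have "(\<Sum>l<n. z j l * z j l) \<le> (\<Sum>j<m. \<Sum>l<n. z j l * z j l)" using j
    by (intro member_le_sum[of j "{..<m}" "\<lambda>j. \<Sum>l<n. z j l * z j l"]) (auto intro: sum_nonneg)
  hence "(\<Sum>l<n. z j l * z j l) \<le> lamz" unfolding lamz_def by simp
  hence "rat_of_int (\<Sum>l<n. z j l * z j l) \<le> lam" unfolding lam_def by (simp only: of_int_le_iff)
  thus ?thesis unfolding ip_def a_def by simp
qed

lemma sum_abs_prod_le_lamz: "k < n \<Longrightarrow> l < n \<Longrightarrow> (\<Sum>j<m. \<bar>z j k * z j l\<bar>) \<le> lamz - 1"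
proof -
  assume kl: "k < n" "l < n"
  have "\<bar>z j k * z j l\<bar> \<le> (\<Sum>l<n. z j l * z j l)" for j
  proof (cases "k = l")
    case True thus ?thesis using kl by (simp add: abs_mult) (intro member_le_sum, auto)
  next
    case False
    have "2 * \<bar>z j k * z j l\<bar> \<le> z j k * z j k + z j l * z j l"
      using zero_le_square[of "\<bar>z j k\<bar> - \<bar>z j l\<bar>"] by (simp add: algebra_simps abs_mult)
    also have "\<dots> = (\<Sum>i\<in>{k, l}. z j i * z j i)" using False by simp
    also have "\<dots> \<le> (\<Sum>l<n. z j l * z j l)" using kl by (intro sum_mono2) auto
    finally show ?thesis by linarith
  qed
  thus ?thesis unfolding lamz_def using sum_mono[of "{..<m}" "\<lambda>j. \<bar>z j k * z j l\<bar>"] by simp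
qed

section \<open>The weighted Gram form, its inverse on a subspace, and rank one updates\<close>

definition Gop :: "(nat \<Rightarrow> rat) \<Rightarrow> (nat \<Rightarrow> rat) \<Rightarrow> nat \<Rightarrow> rat" where
  "Gop g v = (\<lambda>l. lam * v l + (\<Sum>j<m. (g j * ip n (a j) v) * a j l))"
definition Gf :: "(nat \<Rightarrow> rat) \<Rightarrow> (nat \<Rightarrow> rat) \<Rightarrow> (nat \<Rightarrow> rat) \<Rightarrow> rat" where
  "Gf g x v = lam * ip n x v + (\<Sum>j<m. g j * ip n (a j) x * ip n (a j) v)"
definition Hop :: "(nat \<Rightarrow> nat \<Rightarrow> rat) \<Rightarrow> (nat \<Rightarrow> rat) \<Rightarrow> nat \<Rightarrow> rat" where
  "Hop H x = (\<lambda>i. ip n (H i) x)"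

lemma ip_Gop: "ip n x (Gop g v) = Gf g x v"
  unfolding Gop_def Gf_def ip_add ip_scale ip_sum by (simp add: ac_simps ip_commute[of n x])

lemma Gf_commute: "Gf g x y = Gf g y x"
  unfolding Gf_def by (simp add: ip_commute ac_simps)

lemma Gf_ge: "(\<And>j. j < m \<Longrightarrow> 0 \<le> g j) \<Longrightarrow> lam * ip n x x \<le> Gf g x x"
proof -
  assume g: "\<And>j. j < m \<Longrightarrow> 0 \<le> g j"
  have "0 \<le> g j * (ip n (a j) x * ip n (a j) x)" if "j < m" for j by (rule mult_nonneg_nonneg[OF g[OF that]]) simp
  thus ?thesis unfolding Gf_def by (auto simp: mult.assoc intro!: sum_nonneg)
qed

lemma Gf_ge1: "(\<And>j. j < m \<Longrightarrow> 0 \<le> g j) \<Longrightarrow> k < m \<Longrightarrow>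
  lam * ip n x x + g k * (ip n (a k) x * ip n (a k) x) \<le> Gf g x x"
proof -
  assume "\<And>j. j < m \<Longrightarrow> 0 \<le> g j" "k < m"
  hence "g k * ip n (a k) x * ip n (a k) x \<le> (\<Sum>j<m. g j * ip n (a j) x * ip n (a j) x)"
    by (intro member_le_sum) (auto simp: mult.assoc)
  thus ?thesis unfolding Gf_def by (simp add: mult.assoc)
qed

lemma Gf_nonneg: "(\<And>j. j < m \<Longrightarrow> 0 \<le> g j) \<Longrightarrow> 0 \<le> Gf g x x"
  by (rule order.trans[OF _ Gf_ge[of g x]]) (use lam_pos ip_nonneg[of n x] in auto)

lemma Gf_cs: assumes g: "\<And>j. j < m \<Longrightarrow> 0 \<le> g j" shows "Gf g x y * Gf g x y \<le> Gf g x x * Gf g y y"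
proof (rule cs_form[of "Gf g"])
  fix s t
  have e: "Gf g (\<lambda>l. s * x l + t * y l) (\<lambda>l. s * x l + t * y l)
    = s * s * Gf g x x + 2 * s * t * Gf g x y + t * t * Gf g y y"
    unfolding Gf_def
    by (simp add: ip_add ip_add' ip_scale ip_scale' ip_commute[of n y x] algebra_simps sum.distrib sum_distrib_left)
  show "0 \<le> s * s * Gf g x x + 2 * s * t * Gf g x y + t * t * Gf g y y"
    unfolding e[symmetric] by (rule Gf_nonneg) (rule g)
qed

text \<open>\<open>H\<close> maps into the subspace where the rows in \<open>Z\<close> vanish, and
  there it inverts \<open>Gop g\<close> up to combinations of the rows in \<open>J\<close>, which
  act as Lagrange multipliers. \<open>J\<close> is a linearly independent set of rows with the same
  span as \<open>Z\<close>; independence makes the multipliers unique, which \<open>H_size\<close>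
  exploits. The size of \<open>J\<close> never has to be computed.\<close>

definition Hinv :: "(nat \<Rightarrow> rat) \<Rightarrow> nat set \<Rightarrow> nat set \<Rightarrow> (nat \<Rightarrow> nat \<Rightarrow> rat) \<Rightarrow> bool" where
  "Hinv g J Z H \<longleftrightarrow> (\<forall>j<m. 0 \<le> g j) \<and> J \<subseteq> Z \<and> Z \<subseteq> {..<m} \<and>
     (\<forall>i<n. \<forall>j<n. H i j = H j i) \<and>
     (\<forall>j\<in>Z. \<forall>x. ip n (a j) (Hop H x) = 0) \<and>
     (\<forall>x. \<exists>y. \<forall>l<n. Gop g (Hop H x) l = x l + (\<Sum>j\<in>J. y j * a j l)) \<and>
     (\<forall>y. (\<forall>l<n. (\<Sum>j\<in>J. y j * a j l) = 0) \<longrightarrow> (\<forall>j\<in>J. y j = 0))"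

lemma HinvD:
  assumes "Hinv g J Z H"
  shows "\<And>j. j < m \<Longrightarrow> 0 \<le> g j" "J \<subseteq> Z" "Z \<subseteq> {..<m}" "\<forall>i<n. \<forall>j<n. H i j = H j i"
    "\<And>j x. j \<in> Z \<Longrightarrow> ip n (a j) (Hop H x) = 0"
    "\<And>y. (\<And>l. l < n \<Longrightarrow> (\<Sum>j\<in>J. y j * a j l) = 0) \<Longrightarrow> \<forall>j\<in>J. y j = 0"
proof -
  note D = assms[unfolded Hinv_def]
  show "\<And>j. j < m \<Longrightarrow> 0 \<le> g j" "J \<subseteq> Z" "Z \<subseteq> {..<m}" using D by auto
  show "\<forall>i<n. \<forall>j<n. H i j = H j i" using D by (elim conjE)
  have "\<forall>j\<in>Z. \<forall>x. ip n (a j) (Hop H x) = 0" using D by (elim conjE)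
  thus "\<And>j x. j \<in> Z \<Longrightarrow> ip n (a j) (Hop H x) = 0" by blast
  have *: "\<forall>y. (\<forall>l<n. (\<Sum>j\<in>J. y j * a j l) = 0) \<longrightarrow> (\<forall>j\<in>J. y j = 0)" using D by (elim conjE)
  show "\<forall>j\<in>J. y j = 0" if "\<And>l. l < n \<Longrightarrow> (\<Sum>j\<in>J. y j * a j l) = 0" for y
    using *[THEN spec, of y] that by blast
qed

lemma HinvI:
  assumes "\<And>j. j < m \<Longrightarrow> 0 \<le> g j" "J \<subseteq> Z" "Z \<subseteq> {..<m}" "\<forall>i<n. \<forall>j<n. H i j = H j i"
    "\<And>j x. j \<in> Z \<Longrightarrow> ip n (a j) (Hop H x) = 0"
    "\<And>x. \<exists>y. \<forall>l<n. Gop g (Hop H x) l = x l + (\<Sum>j\<in>J. y j * a j l)"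
    "\<And>y. (\<And>l. l < n \<Longrightarrow> (\<Sum>j\<in>J. y j * a j l) = 0) \<Longrightarrow> \<forall>j\<in>J. y j = 0"
  shows "Hinv g J Z H"
  unfolding Hinv_def
proof (intro conjI)
  show "\<forall>y. (\<forall>l<n. (\<Sum>j\<in>J. y j * a j l) = 0) \<longrightarrow> (\<forall>j\<in>J. y j = 0)"
  proof (intro allI impI)
    fix y assume "\<forall>l<n. (\<Sum>j\<in>J. y j * a j l) = 0"
    thus "\<forall>j\<in>J. y j = 0" by (intro assms(7)) simp
  qed
  show "\<forall>j<m. 0 \<le> g j" "\<forall>j\<in>Z. \<forall>x. ip n (a j) (Hop H x) = 0"
    "\<forall>x. \<exists>y. \<forall>l<n. Gop g (Hop H x) l = x l + (\<Sum>j\<in>J. y j * a j l)"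
    using assms(1,5,6) by simp_all
qed (rule assms)+

lemma HinvE:
  assumes "Hinv g J Z H"
  obtains y where "\<And>l. l < n \<Longrightarrow> Gop g (Hop H x) l = x l + (\<Sum>j\<in>J. y j * a j l)"
proof -
  have "\<exists>y. \<forall>l<n. Gop g (Hop H x) l = x l + (\<Sum>j\<in>J. y j * a j l)" using assms unfolding Hinv_def by simp
  thus ?thesis using that by blast
qed

lemma Hop_sym: assumes "\<forall>i<n. \<forall>j<n. H i j = H j i" shows "ip n x (Hop H y) = ip n y (Hop H x)"
proof -
  have "ip n x (Hop H y) = (\<Sum>i<n. \<Sum>j<n. x i * (H i j * y j))"
    unfolding ip_def Hop_def by (simp add: sum_distrib_left)
  also have "\<dots> = (\<Sum>j<n. \<Sum>i<n. x i * (H i j * y j))" by (rule sum.swap)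
  also have "\<dots> = (\<Sum>j<n. \<Sum>i<n. y j * (H j i * x i))"
    using assms by (intro sum.cong refl) (auto simp: ac_simps)
  also have "\<dots> = ip n y (Hop H x)" unfolding ip_def Hop_def by (simp add: sum_distrib_left)
  finally show ?thesis .
qed

lemma Hinv_init: "Hinv (\<lambda>_. 0) {} {} (\<lambda>i j. if i = j then 1 / lam else 0)"
proof -
  have "Hop (\<lambda>i j. if i = j then 1 / lam else 0) x l = x l / lam" if "l < n" for x l
  proof -
    have "Hop (\<lambda>i j. if i = j then 1 / lam else 0) x l = (\<Sum>j<n. if j = l then x j / lam else 0)"
      unfolding Hop_def ip_def by (intro sum.cong) auto
    thus ?thesis using that by simp
  qed
  thus ?thesis unfolding Hinv_def Gop_def using lam_pos by auto
qed

text \<open>By symmetry of \<open>H\<close> and of the form, the i-th entry is the product of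
  \<open>v\<close> with \<open>Gop g (Hop H e)\<close> for the i-th unit vector \<open>e\<close>.
  The latter is \<open>e\<close> plus rows from \<open>J\<close>, to which \<open>v\<close> is
  orthogonal.\<close>

lemma Hinv_solve:
  assumes H: "Hinv g J Z H" and v: "\<And>j. j \<in> J \<Longrightarrow> ip n (a j) v = 0" and i: "i < n"
  shows "Hop H (Gop g v) i = v i"
proof -
  let ?e = "\<lambda>l. of_bool (l = i)"
  have sym: "\<forall>i<n. \<forall>j<n. H i j = H j i" using HinvD(4)[OF H] .
  obtain y where y: "\<And>l. l < n \<Longrightarrow> Gop g (Hop H ?e) l = ?e l + (\<Sum>j\<in>J. y j * a j l)"
    by (rule HinvE[OF H, of "?e"]) blast
  have "Hop H (Gop g v) i = ip n ?e (Hop H (Gop g v))" using ip_unit[OF i] by simp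
  also have "\<dots> = ip n (Gop g v) (Hop H ?e)" by (rule Hop_sym[OF sym])
  also have "\<dots> = ip n v (Gop g (Hop H ?e))" by (metis ip_commute ip_Gop Gf_commute)
  also have "\<dots> = ip n v (\<lambda>l. ?e l + (\<Sum>j\<in>J. y j * a j l))" using y by (intro ip_cong) auto
  also have "\<dots> = ip n v ?e + (\<Sum>j\<in>J. y j * ip n v (a j))" unfolding ip_add ip_sum ..
  also have "\<dots> = v i" using v ip_unit[OF i, of v] by (simp add: ip_commute)
  finally show ?thesis .
qed

lemma Hinv_Gf:
  assumes H: "Hinv g J Z H" shows "Gf g (Hop H x) (Hop H x) = ip n x (Hop H x)"
proof -
  obtain y where y: "\<And>l. l < n \<Longrightarrow> Gop g (Hop H x) l = x l + (\<Sum>j\<in>J. y j * a j l)"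
    by (rule HinvE[OF H, of "x"]) blast
  have 0: "ip n (Hop H x) (a j) = 0" if "j \<in> J" for j using HinvD(2,5)[OF H] that by (simp add: ip_commute[of n "Hop H x"] subset_iff)
  have "Gf g (Hop H x) (Hop H x) = ip n (Hop H x) (\<lambda>l. x l + (\<Sum>j\<in>J. y j * a j l))"
    unfolding ip_Gop[symmetric] using y by (intro ip_cong) auto
  also have "\<dots> = ip n (Hop H x) x" unfolding ip_add ip_sum using 0 by simp
  finally show ?thesis by (simp add: ip_commute)
qed

lemma Hinv_nonneg: assumes H: "Hinv g J Z H" shows "0 \<le> ip n x (Hop H x)"
  unfolding Hinv_Gf[OF H, symmetric] by (rule Gf_nonneg) (rule HinvD(1)[OF H])

text \<open>On the subspace, \<open>ip n b v\<close> is the value of the form at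
  \<open>Hop H b\<close> and \<open>v\<close>, so this is Cauchy-Schwarz for the form. It connects
  the potential \<open>w \<bullet> H w\<close> with points of the cone.\<close>

lemma Hinv_cs:
  assumes H: "Hinv g J Z H" and v: "\<And>j. j \<in> J \<Longrightarrow> ip n (a j) v = 0"
  shows "ip n b v * ip n b v \<le> ip n b (Hop H b) * Gf g v v"
proof -
  have sym: "\<forall>i<n. \<forall>j<n. H i j = H j i" and g: "\<And>j. j < m \<Longrightarrow> 0 \<le> g j" using HinvD(1,4)[OF H] by auto
  have "ip n b v = ip n b (Hop H (Gop g v))" using Hinv_solve[OF H v] by (intro ip_cong) auto
  also have "\<dots> = ip n (Gop g v) (Hop H b)" by (rule Hop_sym[OF sym])
  also have "\<dots> = Gf g (Hop H b) v" by (metis ip_commute ip_Gop)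
  finally have e: "ip n b v = Gf g (Hop H b) v" .
  have "Gf g (Hop H b) v * Gf g (Hop H b) v \<le> Gf g (Hop H b) (Hop H b) * Gf g v v"
    by (rule Gf_cs) (rule g)
  thus ?thesis unfolding e by (simp only: Hinv_Gf[OF H])
qed

text \<open>Because \<open>lam\<close> dominates the squared norm of row \<open>k\<close>, the form
  at any vector is at least \<open>1 + g k\<close> times the squared row value. At
  \<open>h = Hop H (a k)\<close> the form equals the row value \<open>s\<close> itself, so
  \<open>(1 + g k) * s * s \<le> s\<close>.\<close>

lemma Hinv_row:
  assumes H: "Hinv g J Z H" and k: "k < m"
  shows "(1 + g k) * ip n (a k) (Hop H (a k)) \<le> 1"
proof -
  let ?h = "Hop H (a k)" let ?s = "ip n (a k) ?h"
  have g: "\<And>j. j < m \<Longrightarrow> 0 \<le> g j" using HinvD(1)[OF H] .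
  have "?s * ?s \<le> ip n (a k) (a k) * ip n ?h ?h" by (rule ip_cs)
  also have "\<dots> \<le> lam * ip n ?h ?h" by (rule mult_right_mono[OF ip_a_le_lam[OF k] ip_nonneg])
  finally have "?s * ?s + g k * (?s * ?s) \<le> Gf g ?h ?h" using Gf_ge1[where g = g and x = ?h, OF g k] by linarith
  hence "?s * ((1 + g k) * ?s) \<le> ?s * 1" unfolding Hinv_Gf[OF H] by (simp add: algebra_simps)
  moreover have "0 \<le> ?s" by (rule Hinv_nonneg[OF H])
  ultimately show ?thesis by (cases "?s = 0") (auto simp: mult_le_cancel_left)
qed

text \<open>The Sherman-Morrison formula. With \<open>r = 1 / c + s\<close>, where \<open>s\<close>
  is the value of row \<open>k\<close> at \<open>Hop H (a k)\<close>, the factor of row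
  \<open>k\<close> in the form grows by \<open>c\<close>; with \<open>r = s\<close>, the limit for
  infinite \<open>c\<close>, row \<open>k\<close> is forced to vanish.\<close>

definition upd :: "(nat \<Rightarrow> nat \<Rightarrow> rat) \<Rightarrow> nat \<Rightarrow> rat \<Rightarrow> nat \<Rightarrow> nat \<Rightarrow> rat" where
  "upd H k r = (\<lambda>i j. H i j - Hop H (a k) i * Hop H (a k) j / r)"

lemma Hop_upd: "Hop (upd H k r) x = (\<lambda>l. Hop H x l - (ip n (Hop H (a k)) x / r) * Hop H (a k) l)"
proof
  fix l
  have "upd H k r l = (\<lambda>j. H l j - (Hop H (a k) l / r) * Hop H (a k) j)" by (simp add: upd_def)
  hence "Hop (upd H k r) x l = ip n (\<lambda>j. H l j - (Hop H (a k) l / r) * Hop H (a k) j) x"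
    unfolding Hop_def[of "upd H k r"] by simp
  also have "\<dots> = Hop H x l - (Hop H (a k) l / r) * ip n (Hop H (a k)) x"
    unfolding ip_diff' ip_scale' by (simp add: Hop_def)
  finally show "Hop (upd H k r) x l = Hop H x l - (ip n (Hop H (a k)) x / r) * Hop H (a k) l" by (simp add: ac_simps)
qed

lemma Gop_add: "Gop g (\<lambda>l. x l - c * y l) l = Gop g x l - c * Gop g y l"
  unfolding Gop_def ip_diff ip_scale by (simp add: algebra_simps sum_subtractf sum_distrib_left)

lemma Gop_upd: "k < m \<Longrightarrow> Gop (g(k := g k + c)) v l = Gop g v l + c * ip n (a k) v * a k l"
proof -
  assume k: "k < m"
  have "(\<Sum>j<m. ((g(k := g k + c)) j * ip n (a j) v) * a j l)
     = (\<Sum>j<m. (g j * ip n (a j) v) * a j l + (if j = k then c * ip n (a k) v * a k l else 0))"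
    by (intro sum.cong) (auto simp: algebra_simps)
  thus ?thesis using k unfolding Gop_def by (simp add: sum.distrib)
qed

lemma Hinv_finite_update:
  assumes H: "Hinv g J Z H" and k: "k < m" and c: "0 < c"
  shows "Hinv (g(k := g k + c)) J Z (upd H k (1 / c + ip n (a k) (Hop H (a k))))"
proof -
  let ?h = "Hop H (a k)" let ?s = "ip n (a k) ?h" let ?r = "1 / c + ?s"
  have s: "0 \<le> ?s" by (rule Hinv_nonneg[OF H])
  have r: "?r > 0" using s c by (simp add: add_pos_nonneg)
  have sym: "\<forall>i<n. \<forall>j<n. H i j = H j i" using HinvD(4)[OF H] .
  have Z: "ip n (a j) (Hop H x) = 0" if "j \<in> Z" for j x using HinvD(5)[OF H that] .
  have "\<exists>y. \<forall>l<n. Gop (g(k := g k + c)) (Hop (upd H k ?r) x) l = x l + (\<Sum>j\<in>J. y j * a j l)" for x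
  proof -
    obtain y1 where y1: "\<And>l. l < n \<Longrightarrow> Gop g (Hop H x) l = x l + (\<Sum>j\<in>J. y1 j * a j l)"
      by (rule HinvE[OF H, of "x"]) blast
    obtain y2 where y2: "\<And>l. l < n \<Longrightarrow> Gop g ?h l = a k l + (\<Sum>j\<in>J. y2 j * a j l)"
      by (rule HinvE[OF H, of "a k"]) blast
    define t where "t = ip n ?h x / ?r"
    have xh: "ip n (a k) (Hop H x) = ip n ?h x" using Hop_sym[OF sym] by (simp add: ip_commute)
    have "Gop (g(k := g k + c)) (Hop (upd H k ?r) x) l = x l + (\<Sum>j\<in>J. (y1 j - t * y2 j) * a j l)" if l: "l < n" for l
    proof -
      have hu: "Hop (upd H k ?r) x = (\<lambda>l. Hop H x l - t * ?h l)" unfolding Hop_upd t_def ..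
      have e: "c * (ip n ?h x - t * ?s) = t"
        using r c unfolding t_def by (simp add: field_simps)
      have "Gop (g(k := g k + c)) (Hop (upd H k ?r) x) l
        = Gop g (Hop H x) l - t * Gop g ?h l + c * (ip n ?h x - t * ?s) * a k l"
        unfolding hu Gop_upd[OF k] Gop_add ip_diff ip_scale xh by (simp add: algebra_simps)
      also have "\<dots> = x l + (\<Sum>j\<in>J. y1 j * a j l) - t * (\<Sum>j\<in>J. y2 j * a j l)"
        unfolding e y1[OF l] y2[OF l] by (simp add: algebra_simps)
      also have "\<dots> = x l + (\<Sum>j\<in>J. (y1 j - t * y2 j) * a j l)"
        by (simp add: algebra_simps sum_subtractf sum_distrib_left)
      finally show ?thesis .
    qed
    thus ?thesis by (intro exI[of _ "\<lambda>j. y1 j - t * y2 j"] allI impI)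
  qed
  note ex = this
  show ?thesis
  proof (rule HinvI[OF _ HinvD(2,3)[OF H] _ _ ex HinvD(6)[OF H]])
    show "\<forall>i<n. \<forall>j<n. upd H k ?r i j = upd H k ?r j i" using sym by (simp add: upd_def mult.commute)
    show "ip n (a j) (Hop (upd H k ?r) x) = 0" if "j \<in> Z" for j x
      unfolding Hop_upd ip_diff ip_scale using Z[OF that] by simp
    show "0 \<le> (g(k := g k + c)) j" if "j < m" for j using HinvD(1)[OF H] that k c by (simp add: add_nonneg_nonneg)
  qed
qed

text \<open>If the denominator is 0, then \<open>Hop H (a k)\<close> is zero and row
  \<open>k\<close> already vanishes on the range of \<open>H\<close>; division by 0 yields 0, so the
  update leaves \<open>H\<close> as it is, and \<open>J\<close> stays. Otherwise row
  \<open>k\<close> is independent of the rows in \<open>J\<close> and joins them.\<close>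

lemma Hinv_infinite_update:
  assumes H: "Hinv g J Z H" and k: "k < m" "k \<notin> Z"
  shows "\<exists>J'. Hinv g J' (insert k Z) (upd H k (ip n (a k) (Hop H (a k))))"
proof -
  let ?h = "Hop H (a k)" let ?s = "ip n (a k) ?h"
  have g: "\<And>j. j < m \<Longrightarrow> 0 \<le> g j" using HinvD(1)[OF H] .
  have sym: "\<forall>i<n. \<forall>j<n. H i j = H j i" using HinvD(4)[OF H] .
  have Z: "ip n (a j) (Hop H x) = 0" if "j \<in> Z" for j x using HinvD(5)[OF H that] .
  have JZ: "J \<subseteq> Z" "Z \<subseteq> {..<m}" using HinvD(2,3)[OF H] by auto
  have xh: "ip n (a k) (Hop H x) = ip n ?h x" for x using Hop_sym[OF sym] by (simp add: ip_commute)
  have symu: "\<forall>i<n. \<forall>j<n. upd H k ?s i j = upd H k ?s j i" using sym by (simp add: upd_def mult.commute)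
  show ?thesis
  proof (cases "?s = 0")
    case True
    have "lam * ip n ?h ?h \<le> 0" using Gf_ge[where g = g and x = ?h, OF g] Hinv_Gf[OF H, of "a k"] True by simp
    hence "ip n ?h ?h \<le> 0" using lam_pos by (simp add: mult_le_0_iff)
    hence "ip n ?h ?h = 0" using ip_nonneg[of n ?h] by simp
    hence h0: "\<And>l. l < n \<Longrightarrow> ?h l = 0" by (rule ip_zero)
    hence "ip n ?h x = 0" for x unfolding ip_def by simp
    hence k0: "ip n (a k) (Hop H x) = 0" for x using xh by simp
    have u: "upd H k ?s = H" unfolding True by (simp add: upd_def)
    have "Hinv g J (insert k Z) H"
    proof (rule HinvI[OF _ _ _ sym _ _ HinvD(6)[OF H]])
      show "ip n (a j) (Hop H x) = 0" if "j \<in> insert k Z" for j x using that k0 Z by blast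
      show "\<exists>y. \<forall>l<n. Gop g (Hop H x) l = x l + (\<Sum>j\<in>J. y j * a j l)" for x
        using H unfolding Hinv_def by simp
    qed (use g JZ k in auto)
    thus ?thesis unfolding u ..
  next
    case False
    have kJ: "k \<notin> J" and fJ: "finite J" using k JZ finite_subset[of J "{..<m}"] by auto
    have Z': "\<forall>j\<in>insert k Z. \<forall>x. ip n (a j) (Hop (upd H k ?s) x) = 0"
      unfolding Hop_upd ip_diff ip_scale using Z False by (simp add: xh)
    have ex: "\<exists>y. \<forall>l<n. Gop g (Hop (upd H k ?s) x) l = x l + (\<Sum>j\<in>insert k J. y j * a j l)" for x
    proof -
      obtain y1 where y1: "\<And>l. l < n \<Longrightarrow> Gop g (Hop H x) l = x l + (\<Sum>j\<in>J. y1 j * a j l)"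
        by (rule HinvE[OF H, of "x"]) blast
      obtain y2 where y2: "\<And>l. l < n \<Longrightarrow> Gop g ?h l = a k l + (\<Sum>j\<in>J. y2 j * a j l)"
        by (rule HinvE[OF H, of "a k"]) blast
      define t where "t = ip n ?h x / ?s"
      define y where "y = (\<lambda>j. if j = k then - t else y1 j - t * y2 j)"
      have "Gop g (Hop (upd H k ?s) x) l = x l + (\<Sum>j\<in>insert k J. y j * a j l)" if l: "l < n" for l
      proof -
        have "Gop g (Hop (upd H k ?s) x) l = Gop g (Hop H x) l - t * Gop g ?h l"
          unfolding Hop_upd Gop_add t_def ..
        also have "\<dots> = x l - t * a k l + (\<Sum>j\<in>J. (y1 j - t * y2 j) * a j l)"
          unfolding y1[OF l] y2[OF l] by (simp add: algebra_simps sum_subtractf sum_distrib_left)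
        also have "(\<Sum>j\<in>J. (y1 j - t * y2 j) * a j l) = (\<Sum>j\<in>J. y j * a j l)"
          using kJ by (intro sum.cong) (auto simp: y_def)
        finally show ?thesis using kJ fJ by (simp add: y_def)
      qed
      thus ?thesis by (intro exI[of _ y] allI impI)
    qed
    have ind: "\<forall>j\<in>insert k J. y j = 0" if y: "\<And>l. l < n \<Longrightarrow> (\<Sum>j\<in>insert k J. y j * a j l) = 0" for y
    proof -
      have s0: "y k * a k l + (\<Sum>j\<in>J. y j * a j l) = 0" if "l < n" for l using y that kJ fJ by simp
      have "0 = ip n ?h (\<lambda>l. y k * a k l + (\<Sum>j\<in>J. y j * a j l))"
        using ip_cong[of n ?h ?h "\<lambda>l. y k * a k l + (\<Sum>j\<in>J. y j * a j l)" "\<lambda>_. 0"] s0 by (simp add: ip_def)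
      also have "\<dots> = y k * ip n ?h (a k) + (\<Sum>j\<in>J. y j * ip n ?h (a j))" unfolding ip_add ip_scale ip_sum ..
      also have "(\<Sum>j\<in>J. y j * ip n ?h (a j)) = 0"
        using Z JZ by (intro sum.neutral) (auto simp: ip_commute[of n ?h])
      finally have yk: "y k = 0" using False by (simp add: ip_commute)
      moreover have "\<forall>j\<in>J. y j = 0" by (rule HinvD(6)[OF H]) (use s0 yk in simp)
      ultimately show ?thesis by simp
    qed
    have "Hinv g (insert k J) (insert k Z) (upd H k ?s)"
      by (rule HinvI[OF _ _ _ symu _ ex ind]) (use g Z' JZ k in auto)
    thus ?thesis ..
  qed
qed

end

section \<open>Potential argument, vertices of the cone, and size bounds\<close>

lemma sum_lessThan_add: "sum f {..<n + m} = sum f {..<n} + (\<Sum>j<m. f (n + j))" for f :: "nat \<Rightarrow> 'a::comm_monoid_add"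
  by (induction m) (auto simp: add.assoc)

context cone
begin

definition inC :: "(nat \<Rightarrow> rat) \<Rightarrow> bool" where "inC v \<longleftrightarrow> (\<forall>j<m. 0 \<le> ip n (a j) v)"
definition K0 :: "(nat \<Rightarrow> rat) \<Rightarrow> bool" where "K0 v \<longleftrightarrow> inC v \<and> (\<forall>l<n. \<bar>v l\<bar> \<le> 1 / lam)"

lemma Hop_linear: "Hop H (\<lambda>l. x l + c * y l) = (\<lambda>i. Hop H x i + c * Hop H y i)"
  unfolding Hop_def ip_add ip_scale ..

text \<open>The side length \<open>1 / lam\<close> of the cube is chosen for this: entries are
  integers, so the sum of absolute values of a row is at most its squared norm, hence at most
  \<open>lam\<close>. It makes the initial scale 1 admissible for every row.\<close>

lemma K0_row_le_1: assumes "K0 v" "j < m" shows "ip n (a j) v \<le> 1"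
proof -
  have "ip n (a j) v \<le> (\<Sum>l<n. a j l * a j l * (1 / lam))"
    unfolding ip_def
  proof (rule sum_mono)
    fix l assume l: "l \<in> {..<n}"
    have "a j l * v l \<le> \<bar>a j l\<bar> * \<bar>v l\<bar>" by (metis abs_ge_self abs_mult)
    also have "\<dots> \<le> (a j l * a j l) * (1 / lam)"
    proof (rule mult_mono)
      have "rat_of_int \<bar>z j l\<bar> \<le> of_int (z j l * z j l)" by (simp only: of_int_le_iff abs_le_square)
      thus "\<bar>a j l\<bar> \<le> a j l * a j l" unfolding a_def by simp
    qed (use assms(1) l lam_pos in \<open>auto simp: K0_def\<close>)
    finally show "a j l * v l \<le> a j l * a j l * (1 / lam)" .
  qed
  also have "\<dots> = ip n (a j) (a j) / lam" unfolding ip_def by (simp add: sum_divide_distrib)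
  also have "\<dots> \<le> 1" using ip_a_le_lam[OF assms(2)] lam_pos by simp
  finally show ?thesis .
qed

text \<open>The mixed term has the right sign because row \<open>k\<close> is violated, and the
  quadratic term is at most 1 by \<open>Hinv_row\<close>. Thus the potential grows at most as fast
  as the sum of the weights.\<close>

lemma pot_step:
  assumes H: "Hinv g J Z H" and k: "k < m" and g: "d * d = 1 + g k" and d: "0 \<le> d"
    and neg: "ip n (a k) (Hop H w) \<le> 0"
  shows "ip n (\<lambda>l. w l + d * a k l) (Hop H (\<lambda>l. w l + d * a k l)) \<le> ip n w (Hop H w) + 1"
proof -
  have s: "ip n w (Hop H (a k)) = ip n (a k) (Hop H w)" by (rule Hop_sym[OF HinvD(4)[OF H]])
  have "ip n (\<lambda>l. w l + d * a k l) (Hop H (\<lambda>l. w l + d * a k l))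
    = ip n w (Hop H w) + 2 * (d * ip n (a k) (Hop H w)) + (d * d) * ip n (a k) (Hop H (a k))"
    unfolding Hop_linear ip_add ip_add' ip_scale ip_scale' s by (simp add: algebra_simps)
  moreover have "d * ip n (a k) (Hop H w) \<le> 0" using d neg by (rule mult_nonneg_nonpos)
  moreover have "(d * d) * ip n (a k) (Hop H (a k)) \<le> 1" unfolding g by (rule Hinv_row[OF H k])
  ultimately show ?thesis by linarith
qed

text \<open>Let \<open>t = d i * ip n (a i) v\<close>. On \<open>K0\<close> the form at
  \<open>v\<close> is at most \<open>n + m\<close>: the multiple of the identity contributes at most
  \<open>n\<close>, each row at most 1. Cauchy-Schwarz bounds the square of \<open>ip n w v\<close>
  by \<open>Y * (n + m)\<close>. All terms of \<open>ip n w v\<close> are nonnegative and the one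
  for row \<open>i\<close> is \<open>y i * t \<ge> Y * t / m\<close>. Hence
  \<open>Y * t * t \<le> m * m * (n + m)\<close>, and the lower bound on \<open>Y\<close> is exactly
  what gives \<open>t \<le> 1 / 2\<close>.\<close>

lemma halving:
  assumes H: "Hinv g J Z H"
    and d: "\<And>j. j < m \<Longrightarrow> j \<notin> Z \<Longrightarrow> g j = d j * d j - 1 \<and> 0 \<le> d j"
    and K: "\<And>j. j < m \<Longrightarrow> j \<notin> Z \<Longrightarrow> d j * ip n (a j) v \<le> 1"
    and KZ: "\<And>j. j \<in> Z \<Longrightarrow> ip n (a j) v = 0"
    and y: "\<And>j. j < m \<Longrightarrow> 0 \<le> y j" "\<And>j. j \<in> Z \<Longrightarrow> y j = 0"
    and pot: "ip n (\<lambda>l. \<Sum>j<m. (d j * y j) * a j l) (Hop H (\<lambda>l. \<Sum>j<m. (d j * y j) * a j l)) \<le> Y"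
    and Y: "4 * of_nat m * of_nat m * (of_nat n + of_nat m) \<le> Y"
    and i: "i < m" "i \<notin> Z" "Y \<le> of_nat m * y i" and v: "K0 v"
  shows "2 * d i * ip n (a i) v \<le> 1"
proof -
  define w where "w = (\<lambda>l. \<Sum>j<m. (d j * y j) * a j l)"
  define t where "t = d i * ip n (a i) v"
  define q :: rat where "q = of_nat n + of_nat m"
  have JZ: "J \<subseteq> Z" "Z \<subseteq> {..<m}" using HinvD(2,3)[OF H] by auto
  have nn: "0 \<le> ip n (a j) v" if "j < m" for j using v that unfolding K0_def inC_def by blast
  have q: "0 < q" unfolding q_def using i(1) by simp
  have m0: "(0::rat) < of_nat m" using i(1) by simp
  have Y0: "0 < Y"
  proof -
    have "0 < 4 * of_nat m * of_nat m * q" using q m0 by simp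
    thus ?thesis using Y unfolding q_def by linarith
  qed
  have t0: "0 \<le> t" unfolding t_def using d[OF i(1,2)] nn[OF i(1)] by simp
  have "Gf g v v \<le> q"
  proof -
    have "ip n v v \<le> (\<Sum>l<n. 1 / lam)"
      unfolding ip_def
    proof (rule sum_mono)
      fix l assume "l \<in> {..<n}"
      hence "\<bar>v l\<bar> \<le> 1 / lam" using v unfolding K0_def by auto
      moreover have "1 / lam \<le> 1" using lam_pos by simp
      ultimately have "\<bar>v l\<bar> * \<bar>v l\<bar> \<le> 1 / lam * 1"
        using order.trans[of "\<bar>v l\<bar>" "1 / lam" 1] lam_pos by (intro mult_mono) simp_all
      thus "v l * v l \<le> 1 / lam" by simp
    qed
    hence "lam * ip n v v \<le> lam * (of_nat n * (1 / lam))" using lam_pos by (intro mult_left_mono) auto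
    hence 1: "lam * ip n v v \<le> of_nat n" using lam_pos by simp
    have "(\<Sum>j<m. g j * ip n (a j) v * ip n (a j) v) \<le> (\<Sum>j<m. 1)"
    proof (rule sum_mono)
      fix j assume j: "j \<in> {..<m}"
      show "g j * ip n (a j) v * ip n (a j) v \<le> 1"
      proof (cases "j \<in> Z")
        case False
        let ?p = "d j * ip n (a j) v"
        have p: "0 \<le> ?p" "?p \<le> 1" using d[of j] nn[of j] K[of j] j False by auto
        have "?p * ?p \<le> 1 * 1" by (rule mult_mono) (use p in auto)
        moreover have gj: "g j = d j * d j - 1" using d[of j] j False by auto
        have "g j * ip n (a j) v * ip n (a j) v = ?p * ?p - ip n (a j) v * ip n (a j) v"
          unfolding gj by (simp add: algebra_simps)
        ultimately show ?thesis using zero_le_square[of "ip n (a j) v"] by linarith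
      qed (simp add: KZ)
    qed
    thus ?thesis using 1 unfolding Gf_def q_def by simp
  qed
  hence "ip n w (Hop H w) * Gf g v v \<le> Y * q"
    using pot Y0 Gf_nonneg[where g = g and x = v, OF HinvD(1)[OF H]] unfolding w_def by (intro mult_mono) auto
  moreover have "ip n w v * ip n w v \<le> ip n w (Hop H w) * Gf g v v"
    by (rule Hinv_cs[OF H]) (use JZ KZ in auto)
  ultimately have a1: "ip n w v * ip n w v \<le> Y * q" by linarith
  have "ip n w v = (\<Sum>j<m. (d j * y j) * ip n (a j) v)"
    unfolding w_def by (subst ip_commute) (simp add: ip_sum ip_commute)
  also have "\<dots> \<ge> (d i * y i) * ip n (a i) v"
  proof (rule member_le_sum)
    fix j assume j: "j \<in> {..<m} - {i}"
    show "0 \<le> d j * y j * ip n (a j) v"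
    proof (cases "j \<in> Z")
      case False thus ?thesis using d[of j] y(1)[of j] nn[of j] j by simp
    qed (simp add: KZ)
  qed (use i in auto)
  finally have a2: "y i * t \<le> ip n w v" unfolding t_def by (simp add: ac_simps)
  have "0 \<le> y i * t" using y(1)[OF i(1)] t0 by simp
  hence "(y i * t) * (y i * t) \<le> Y * q" using a1 a2 mult_mono[OF a2 a2] by linarith
  hence "of_nat m * of_nat m * ((y i * t) * (y i * t)) \<le> of_nat m * of_nat m * (Y * q)" using m0 by (intro mult_left_mono) auto
  moreover have "(Y * t) * (Y * t) \<le> (of_nat m * y i * t) * (of_nat m * y i * t)"
    using i(3) t0 Y0 by (intro mult_mono) (auto intro: mult_right_mono)
  ultimately have "(Y * t) * (Y * t) \<le> of_nat m * of_nat m * (Y * q)" by (simp add: ac_simps)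
  hence "Y * (Y * (t * t)) \<le> Y * (of_nat m * of_nat m * q)" by (simp add: ac_simps)
  hence a3: "Y * (t * t) \<le> of_nat m * of_nat m * q" using Y0 by simp
  have "4 * of_nat m * of_nat m * q * (t * t) \<le> Y * (t * t)" using Y unfolding q_def by (intro mult_right_mono) auto
  hence "(of_nat m * of_nat m * q) * (4 * (t * t)) \<le> (of_nat m * of_nat m * q) * 1" using a3 by (simp add: ac_simps)
  hence "4 * (t * t) \<le> 1" using m0 q by simp
  hence "(2 * t)\<^sup>2 \<le> 1\<^sup>2" by (simp add: power2_eq_square)
  hence "2 * t \<le> 1" by (rule power2_le_imp_le) simp
  thus ?thesis unfolding t_def by simp
qed

text \<open>Among the points of the cone with value 1 at row \<open>i\<close>, take one with the
  largest number of vanishing rows and vanishing coordinates. A nonzero direction respecting all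
  these zeros would lead to a point with one more. Coordinates are counted too because the cone may
  contain lines, on which no row ever becomes zero.\<close>

lemma vertex:
  assumes "inC v0" and i: "i < m" and "0 < ip n (a i) v0"
  shows "\<exists>v. inC v \<and> ip n (a i) v = 1 \<and>
    (\<forall>u. (\<forall>j<m. ip n (a j) v = 0 \<longrightarrow> ip n (a j) u = 0) \<and> (\<forall>l<n. v l = 0 \<longrightarrow> u l = 0) \<and> ip n (a i) u = 0
      \<longrightarrow> (\<forall>l<n. u l = 0))"
proof -
  define P where "P v \<longleftrightarrow> inC v \<and> ip n (a i) v = 1" for v
  define tr where "tr v = {j. j < m \<and> ip n (a j) v = 0}" for v
  define zr where "zr v = {l. l < n \<and> v l = 0}" for v :: "nat \<Rightarrow> rat"
  define f where "f v = card (tr v) + card (zr v)" for v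
  have fin: "finite (tr v)" "finite (zr v)" for v unfolding tr_def zr_def by auto
  have "P (\<lambda>l. (1 / ip n (a i) v0) * v0 l)" using assms unfolding P_def inC_def ip_scale by auto
  moreover have "\<forall>v. P v \<longrightarrow> f v < m + n + 1"
  proof (intro allI impI)
    fix v
    have "card (tr v) \<le> card {..<m}" "card (zr v) \<le> card {..<n}"
      unfolding tr_def zr_def by (intro card_mono; auto)+
    thus "f v < m + n + 1" unfolding f_def by simp
  qed
  ultimately obtain v where v: "P v" and mx: "\<And>u. P u \<Longrightarrow> f u \<le> f v"
    using ex_has_greatest_nat[of P _ f "m + n + 1"] by blast
  have "\<forall>l<n. u l = 0" if u: "\<forall>j<m. ip n (a j) v = 0 \<longrightarrow> ip n (a j) u = 0" "\<forall>l<n. v l = 0 \<longrightarrow> u l = 0" "ip n (a i) u = 0" for u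
  proof (rule ccontr)
    assume "\<not> (\<forall>l<n. u l = 0)"
    then obtain l0 where l0: "l0 < n" "u l0 \<noteq> 0" by blast
    define T1 where "T1 = (\<lambda>l. - v l / u l) ` {l. l < n \<and> u l \<noteq> 0}"
    define T2 where "T2 = (\<lambda>j. - ip n (a j) v / ip n (a j) u) ` {j. j < m \<and> ip n (a j) u \<noteq> 0}"
    have fT: "finite (T1 \<union> T2)" "T1 \<union> T2 \<noteq> {}" unfolding T1_def T2_def using l0 by auto
    \<comment> \<open>\<open>T1\<close> and \<open>T2\<close> collect the parameters at which a
      further coordinate or row becomes zero; \<open>T1\<close> is nonempty since
      \<open>u l0\<close> is nonzero. With the smallest absolute value, no row changes its sign on
      the way.\<close>
    define t where "t = arg_min_on abs (T1 \<union> T2)"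
    have tT: "t \<in> T1 \<union> T2" and tm: "\<And>s. s \<in> T1 \<union> T2 \<Longrightarrow> \<bar>t\<bar> \<le> \<bar>s\<bar>"
      using arg_min_if_finite[OF fT, of abs] unfolding t_def by (auto simp: not_less)
    define v' where "v' = (\<lambda>l. v l + t * u l)"
    have iv: "ip n (a j) v' = ip n (a j) v + t * ip n (a j) u" for j unfolding v'_def ip_add ip_scale ..
    have "0 \<le> ip n (a j) v'" if j: "j < m" for j
    proof (cases "ip n (a j) u = 0")
      case True thus ?thesis using v j unfolding iv P_def inC_def by simp
    next
      case False
      have v0: "0 \<le> ip n (a j) v" using v j unfolding P_def inC_def by blast
      have "\<bar>t\<bar> \<le> \<bar>- ip n (a j) v / ip n (a j) u\<bar>" using False j by (intro tm) (auto simp: T2_def)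
      hence "\<bar>t\<bar> * \<bar>ip n (a j) u\<bar> \<le> ip n (a j) v" using v0 False by (simp add: abs_divide pos_le_divide_eq)
      hence "\<bar>t * ip n (a j) u\<bar> \<le> ip n (a j) v" by (simp add: abs_mult)
      thus ?thesis unfolding iv by linarith
    qed
    hence "P v'" using v u(3) iv[of i] unfolding P_def inC_def by simp
    hence fv: "f v' \<le> f v" by (rule mx)
    have s1: "tr v \<subseteq> tr v'" using u(1) iv unfolding tr_def by auto
    have s2: "zr v \<subseteq> zr v'" using u(2) unfolding zr_def v'_def by auto
    have "\<exists>x. (x \<in> tr v' \<and> x \<notin> tr v) \<or> (x \<in> zr v' \<and> x \<notin> zr v)"
    proof (cases "t \<in> T1")
      case True
      then obtain l where l: "l < n" "u l \<noteq> 0" "t = - v l / u l" unfolding T1_def by auto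
      hence "l \<in> zr v'" "l \<notin> zr v" using u(2) unfolding zr_def v'_def by auto
      thus ?thesis by blast
    next
      case False
      then obtain j where j: "j < m" "ip n (a j) u \<noteq> 0" "t = - ip n (a j) v / ip n (a j) u" using tT unfolding T2_def by auto
      hence "j \<in> tr v'" "j \<notin> tr v" using u(1) unfolding tr_def by (auto simp: iv)
      thus ?thesis by blast
    qed
    hence "tr v \<subset> tr v' \<or> zr v \<subset> zr v'" using s1 s2 by blast
    hence "f v < f v'" unfolding f_def
    proof
      assume "tr v \<subset> tr v'"
      thus "card (tr v) + card (zr v) < card (tr v') + card (zr v')"
        using psubset_card_mono[OF fin(1)] card_mono[OF fin(2) s2] by (intro add_less_le_mono) auto
    next
      assume "zr v \<subset> zr v'"
      thus "card (tr v) + card (zr v) < card (tr v') + card (zr v')"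
        using psubset_card_mono[OF fin(2)] card_mono[OF fin(1) s1] by (intro add_le_less_mono) auto
    qed
    thus False using fv by simp
  qed
  thus ?thesis using v unfolding P_def by blast
qed

text \<open>The system in \<open>small_solution\<close> has entries of size at most
  \<open>2 * lam\<close>, so Cramer's rule bounds its solution by \<open>(2 * n * lam) ^ n\<close>.
  One more factor pays for shrinking the solution into the cube, and \<open>n + 1\<close> in place
  of \<open>n\<close> keeps the value at least 1 for \<open>n = 0\<close>.\<close>

definition Lam :: rat where "Lam = (2 * (of_nat n + 1) * lam) ^ (n + 1)"

lemma Lam_ge_1: "1 \<le> Lam"
proof -
  have "1 * 1 \<le> (2 * (rat_of_nat n + 1)) * lam" by (rule mult_mono) (use lam_pos in auto)
  thus ?thesis unfolding Lam_def by (intro one_le_power) simp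
qed

text \<open>Instead of selecting \<open>n\<close> independent constraints at the vertex, all of them
  enter the symmetric matrix \<open>F\<close>: the sum of \<open>a j\<close> times its transpose
  over the vanishing rows and row \<open>i\<close>, plus a diagonal part for the vanishing
  coordinates. The vertex satisfies \<open>F v = a i\<close>. If \<open>F u = 0\<close>, then
  \<open>u \<bullet> F u\<close> is a vanishing sum of squares, so \<open>u\<close> respects every
  constraint and is zero by the choice of the vertex.\<close>

lemma small_solution:
  assumes v0: "inC v0" "0 < ip n (a i) v0" and i: "i < m"
  shows "\<exists>v. K0 v \<and> 1 \<le> Lam * ip n (a i) v"
proof -
  obtain v where v: "inC v" "ip n (a i) v = 1" and uniq: "\<And>u. (\<forall>j<m. ip n (a j) v = 0 \<longrightarrow> ip n (a j) u = 0) \<Longrightarrow>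
      (\<forall>l<n. v l = 0 \<longrightarrow> u l = 0) \<Longrightarrow> ip n (a i) u = 0 \<Longrightarrow> \<forall>l<n. u l = 0"
    using vertex[OF v0(1) i v0(2)] by blast
  have n0: "n \<noteq> 0" using v(2) unfolding ip_def by (cases "n = 0") auto
  define tr where "tr j = (of_bool (ip n (a j) v = 0) :: int)" for j
  define zr where "zr k = (of_bool (v k = 0) :: int)" for k
  define F where "F k l = (\<Sum>j<m. tr j * (z j k * z j l)) + zr k * of_bool (k = l) + z i k * z i l" for k l
  have Fv: "(\<Sum>l<n. of_int (F k l) * u l) = (\<Sum>j<m. of_int (tr j) * ip n (a j) u * a j k) + of_int (zr k) * u k + ip n (a i) u * a i k"
    if k: "k < n" for u k
  proof -
    have "(\<Sum>l<n. of_int (F k l) * u l) = (\<Sum>l<n. (\<Sum>j<m. of_int (tr j) * (a j k * a j l)) * u l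
       + (if l = k then of_int (zr k) * u l else 0) + a i k * (a i l * u l))"
      by (intro sum.cong refl) (auto simp: F_def a_def algebra_simps)
    also have "\<dots> = (\<Sum>l<n. \<Sum>j<m. of_int (tr j) * (a j k * a j l) * u l) + of_int (zr k) * u k + a i k * ip n (a i) u"
      using k by (simp add: sum.distrib sum_distrib_right sum_distrib_left ip_def)
    also have "(\<Sum>l<n. \<Sum>j<m. of_int (tr j) * (a j k * a j l) * u l) = (\<Sum>j<m. \<Sum>l<n. of_int (tr j) * (a j k * a j l) * u l)"
      by (rule sum.swap)
    also have "\<dots> = (\<Sum>j<m. of_int (tr j) * ip n (a j) u * a j k)"
      unfolding ip_def sum_distrib_left sum_distrib_right by (intro sum.cong refl) (simp add: ac_simps)
    finally show ?thesis by (simp add: mult.commute)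
  qed
  have "\<exists>\<Delta>::int. \<Delta> \<noteq> 0 \<and> \<bar>\<Delta>\<bar> \<le> (int n * (2 * lamz)) ^ n \<and>
     (\<forall>j<n. \<exists>y::int. of_int \<Delta> * v j = of_int y \<and> \<bar>y\<bar> \<le> (int n * (2 * lamz)) ^ n)"
  proof (rule cramer_bound[where A = F and b = "\<lambda>k. z i k"])
    fix k l assume kl: "k < n" "l < n"
    have "\<bar>\<Sum>j<m. tr j * (z j k * z j l)\<bar> \<le> (\<Sum>j<m. \<bar>z j k * z j l\<bar>)"
      by (rule order.trans[OF sum_abs]) (intro sum_mono, simp add: tr_def)
    moreover have "\<bar>zr k * of_bool (k = l)\<bar> \<le> 1" by (simp add: zr_def)
    moreover have "\<bar>z i k * z i l\<bar> \<le> (\<Sum>j<m. \<bar>z j k * z j l\<bar>)"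
      using i by (intro member_le_sum[of i "{..<m}" "\<lambda>j. \<bar>z j k * z j l\<bar>"]) auto
    ultimately show "\<bar>F k l\<bar> \<le> 2 * lamz" using sum_abs_prod_le_lamz[OF kl] unfolding F_def by linarith
  next
    fix k assume k: "k < n"
    show "\<bar>z i k\<bar> \<le> 2 * lamz" using abs_le_lamz[OF i k] lamz_pos by linarith
    have "(\<Sum>j<m. of_int (tr j) * ip n (a j) v * a j k) = 0" by (intro sum.neutral) (auto simp: tr_def)
    thus "(\<Sum>l<n. of_int (F k l) * v l) = of_int (z i k)"
      unfolding Fv[OF k] v(2) by (simp add: zr_def a_def)
  next
    fix u k assume u: "\<And>k. k < n \<Longrightarrow> (\<Sum>l<n. of_int (F k l) * u l) = (0::rat)" and k: "k < n"
    have "0 = (\<Sum>k<n. u k * (\<Sum>l<n. of_int (F k l) * u l))" using u by simp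
    also have "\<dots> = (\<Sum>k<n. u k * (\<Sum>j<m. (of_int (tr j) * ip n (a j) u) * a j k) + of_int (zr k) * (u k * u k) + ip n (a i) u * (u k * a i k))"
      by (intro sum.cong refl, subst Fv, simp, simp add: algebra_simps)
    also have "\<dots> = ip n u (\<lambda>k. \<Sum>j<m. (of_int (tr j) * ip n (a j) u) * a j k) + (\<Sum>k<n. of_int (zr k) * (u k * u k)) + ip n (a i) u * ip n u (a i)"
      unfolding ip_def by (simp add: sum.distrib sum_distrib_left)
    also have "ip n u (\<lambda>k. \<Sum>j<m. (of_int (tr j) * ip n (a j) u) * a j k) = (\<Sum>j<m. of_int (tr j) * (ip n (a j) u * ip n (a j) u))"
      unfolding ip_sum by (simp add: ac_simps ip_commute[of n u])
    finally have s0: "0 = (\<Sum>j<m. of_int (tr j) * (ip n (a j) u * ip n (a j) u)) + (\<Sum>k<n. of_int (zr k) * (u k * u k)) + ip n (a i) u * ip n (a i) u"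
      by (simp add: ip_commute[of n u])
    have p1: "0 \<le> of_int (tr j) * (ip n (a j) u * ip n (a j) u)" for j by (simp add: tr_def)
    have p2: "0 \<le> of_int (zr k) * (u k * u k)" for k by (simp add: zr_def)
    have q: "0 \<le> (\<Sum>j<m. of_int (tr j) * (ip n (a j) u * ip n (a j) u))" "0 \<le> (\<Sum>k<n. of_int (zr k) * (u k * u k))"
      "0 \<le> ip n (a i) u * ip n (a i) u" using p1 p2 by (auto intro!: sum_nonneg)
    have z: "(\<Sum>j<m. of_int (tr j) * (ip n (a j) u * ip n (a j) u)) = 0" "(\<Sum>k<n. of_int (zr k) * (u k * u k)) = 0"
      "ip n (a i) u * ip n (a i) u = 0" using s0 q by linarith+
    have "\<forall>j\<in>{..<m}. of_int (tr j) * (ip n (a j) u * ip n (a j) u) = 0"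
      using z(1) p1 by (subst (asm) sum_nonneg_eq_0_iff) auto
    hence "\<forall>j<m. ip n (a j) v = 0 \<longrightarrow> ip n (a j) u = 0" by (auto simp: tr_def)
    moreover have "\<forall>k\<in>{..<n}. of_int (zr k) * (u k * u k) = 0"
      using z(2) p2 by (subst (asm) sum_nonneg_eq_0_iff) auto
    hence "\<forall>l<n. v l = 0 \<longrightarrow> u l = 0" by (auto simp: zr_def)
    moreover have "ip n (a i) u = 0" using z(3) by simp
    ultimately show "u k = 0" using uniq k by blast
  qed
  then obtain \<Delta> :: int where \<Delta>: "\<Delta> \<noteq> 0" and y: "\<And>j. j < n \<Longrightarrow> \<exists>y::int. of_int \<Delta> * v j = of_int y \<and> \<bar>y\<bar> \<le> (int n * (2 * lamz)) ^ n"
    by blast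
  define \<Theta> :: rat where "\<Theta> = of_int ((int n * (2 * lamz)) ^ n)"
  have vb: "\<bar>v j\<bar> \<le> \<Theta>" if j: "j < n" for j
  proof -
    obtain y :: int where y: "of_int \<Delta> * v j = of_int y" "\<bar>y\<bar> \<le> (int n * (2 * lamz)) ^ n" using y[OF j] by blast
    have "1 * \<bar>v j\<bar> \<le> \<bar>rat_of_int \<Delta>\<bar> * \<bar>v j\<bar>" using \<Delta> by (intro mult_right_mono) auto
    also have "\<dots> = \<bar>of_int y\<bar>" using y(1) by (metis abs_mult)
    also have "\<dots> = of_int \<bar>y\<bar>" by simp
    also have "\<dots> \<le> \<Theta>" unfolding \<Theta>_def using y(2) by (simp only: of_int_le_iff)
    finally show ?thesis by simp
  qed
  have "1 * 1 \<le> int n * (2 * lamz)" using n0 lamz_pos by (intro mult_mono) auto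
  hence "1 \<le> (int n * (2 * lamz)) ^ n" by (intro one_le_power) simp
  hence \<Theta>1: "1 \<le> \<Theta>" unfolding \<Theta>_def by (simp only: of_int_1_le_iff)
  have \<Theta>p: "0 < lam * \<Theta>" using \<Theta>1 lam_pos by simp
  have "\<Theta> = (of_nat n * 2 * lam) ^ n" unfolding \<Theta>_def lam_def by (simp add: mult.assoc)
  also have "\<dots> \<le> (2 * (of_nat n + 1) * lam) ^ n" by (rule power_mono) (use lam_pos in auto)
  finally have "\<Theta> \<le> (2 * (of_nat n + 1) * lam) ^ n" .
  moreover have "1 * lam \<le> 2 * (of_nat n + 1) * lam" using lam_pos by (intro mult_right_mono) auto
  ultimately have "lam * \<Theta> \<le> Lam" unfolding Lam_def using lam_pos \<Theta>1 by (simp del: distrib_left_numeral add: mult_mono)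
  show ?thesis
  \<comment> \<open>The entries of \<open>v\<close> are at most \<open>\<Theta>\<close>, so this
    multiple lies in the cube, and row \<open>i\<close> has the value
    \<open>1 / (lam * \<Theta>)\<close> on it.\<close>
  proof (intro exI[of _ "\<lambda>l. (1 / (lam * \<Theta>)) * v l"] conjI)
    show "K0 (\<lambda>l. (1 / (lam * \<Theta>)) * v l)"
      unfolding K0_def inC_def ip_scale
    proof (intro conjI allI impI)
      fix l assume l: "l < n"
      have "\<bar>1 / (lam * \<Theta>) * v l\<bar> = \<bar>v l\<bar> / (lam * \<Theta>)" using lam_pos \<Theta>1 by (simp add: abs_mult)
      also have "\<dots> \<le> \<Theta> / (lam * \<Theta>)" using vb[OF l] \<Theta>p by (intro divide_right_mono) auto
      also have "\<dots> = 1 / lam" using \<Theta>1 by simp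
      finally show "\<bar>1 / (lam * \<Theta>) * v l\<bar> \<le> 1 / lam" .
    qed (use v(1) \<Theta>p in \<open>auto simp: inC_def\<close>)
    show "1 \<le> Lam * ip n (a i) (\<lambda>l. (1 / (lam * \<Theta>)) * v l)"
      unfolding ip_scale v(2) using \<open>lam * \<Theta> \<le> Lam\<close> \<Theta>p by (simp add: pos_le_divide_eq)
  qed
qed

text \<open>A column of \<open>H\<close>, together with its multipliers for \<open>J\<close>, solves
  the saddle point system with blocks \<open>Gop\<close>, the rows in \<open>J\<close> and their
  negative transpose. Indices outside \<open>J\<close> get unit rows, so the dimension is
  \<open>n + m\<close> whatever \<open>J\<close> is. The kernel is zero since the form is definite
  and \<open>J\<close> is independent. The bound does not depend on the number of updates that
  produced \<open>H\<close>.\<close>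

lemma H_size:
  assumes H: "Hinv (\<lambda>j. of_int (gz j)) J Z H" and G: "\<And>j. j < m \<Longrightarrow> \<bar>gz j\<bar> \<le> \<Gamma>" "0 \<le> \<Gamma>" and c: "c < n"
  shows "\<exists>\<Delta>::int. \<Delta> \<noteq> 0 \<and> \<bar>\<Delta>\<bar> \<le> (int (n + m) * (lamz * (\<Gamma> + 1))) ^ (n + m) \<and>
     (\<forall>i<n. \<exists>y::int. of_int \<Delta> * H i c = of_int y \<and> \<bar>y\<bar> \<le> (int (n + m) * (lamz * (\<Gamma> + 1))) ^ (n + m))"
proof -
  let ?g = "\<lambda>j. of_int (gz j) :: rat"
  let ?e = "\<lambda>l. of_bool (l = c) :: rat"
  define K where "K r s = (if r < n then (if s < n then lamz * of_bool (r = s) + (\<Sum>j<m. gz j * (z j r * z j s))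
       else (if s - n \<in> J then - z (s - n) r else 0))
     else (if r - n \<in> J then (if s < n then z (r - n) s else 0) else of_bool (s = r)))" for r s
  have JZ: "J \<subseteq> Z" "Z \<subseteq> {..<m}" using HinvD(2,3)[OF H] by auto
  have sumJ: "(\<Sum>j<m. if j \<in> J then f j else 0) = sum f J" for f :: "nat \<Rightarrow> rat"
  proof -
    have "(\<Sum>j<m. if j \<in> J then f j else 0) = sum f ({..<m} \<inter> J)" by (rule sum.inter_restrict[symmetric]) simp
    also have "{..<m} \<inter> J = J" using JZ by auto
    finally show ?thesis .
  qed
  have row1: "(\<Sum>s<n + m. of_int (K r s) * x s) = Gop ?g x r - (\<Sum>j\<in>J. x (n + j) * a j r)" if r: "r < n" for x r
  proof -
    have "(\<Sum>s<n. of_int (K r s) * x s) = (\<Sum>s<n. (if s = r then lam * x s else 0) + (\<Sum>j<m. ?g j * (a j r * a j s)) * x s)"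
      using r by (intro sum.cong refl) (auto simp: K_def lam_def a_def algebra_simps)
    also have "\<dots> = lam * x r + (\<Sum>s<n. \<Sum>j<m. ?g j * (a j r * a j s) * x s)" using r by (simp add: sum.distrib sum_distrib_right)
    also have "(\<Sum>s<n. \<Sum>j<m. ?g j * (a j r * a j s) * x s) = (\<Sum>j<m. \<Sum>s<n. ?g j * (a j r * a j s) * x s)" by (rule sum.swap)
    also have "\<dots> = (\<Sum>j<m. (?g j * ip n (a j) x) * a j r)"
      unfolding ip_def sum_distrib_left sum_distrib_right by (intro sum.cong refl) (simp add: ac_simps)
    finally have 1: "(\<Sum>s<n. of_int (K r s) * x s) = Gop ?g x r" unfolding Gop_def .
    have "(\<Sum>j<m. of_int (K r (n + j)) * x (n + j)) = (\<Sum>j<m. if j \<in> J then - (x (n + j) * a j r) else 0)"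
      using r by (intro sum.cong refl) (auto simp: K_def a_def)
    also have "\<dots> = - (\<Sum>j\<in>J. x (n + j) * a j r)" unfolding sumJ by (simp add: sum_negf)
    finally show ?thesis unfolding sum_lessThan_add 1 by simp
  qed
  have row2: "(\<Sum>s<n + m. of_int (K (n + j) s) * x s) = (if j \<in> J then ip n (a j) x else x (n + j))" if j: "j < m" for x j
  proof (cases "j \<in> J")
    case True
    thus ?thesis unfolding sum_lessThan_add by (simp add: K_def ip_def a_def)
  next
    case False
    have "(\<Sum>s<n + m. of_int (K (n + j) s) * x s) = (\<Sum>s<n + m. if s = n + j then x s else 0)"
      using False by (intro sum.cong refl) (auto simp: K_def)
    thus ?thesis using False j by simp
  qed
  obtain y where y: "\<And>l. l < n \<Longrightarrow> Gop ?g (Hop H ?e) l = ?e l + (\<Sum>j\<in>J. y j * a j l)"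
    by (rule HinvE[OF H, of ?e]) blast
  define x where "x s = (if s < n then Hop H ?e s else if s - n \<in> J then y (s - n) else 0)" for s
  have xH: "x i = H i c" if "i < n" for i
    using that ip_unit[OF c, of "H i"] by (simp add: x_def Hop_def ip_commute)
  have ipx: "ip n b x = ip n b (Hop H ?e)" for b by (rule ip_cong) (auto simp: x_def)
  have Gx: "Gop ?g x r = Gop ?g (Hop H ?e) r" if "r < n" for r unfolding Gop_def ipx using that by (simp add: x_def)
  have B1: "1 \<le> lamz * (\<Gamma> + 1)" "lamz \<le> lamz * (\<Gamma> + 1)"
    using mult_mono[of 1 lamz 1 "\<Gamma> + 1"] mult_left_mono[of 1 "\<Gamma> + 1" lamz] lamz_pos G(2) by auto
  have "\<exists>\<Delta>::int. \<Delta> \<noteq> 0 \<and> \<bar>\<Delta>\<bar> \<le> (int (n + m) * (lamz * (\<Gamma> + 1))) ^ (n + m) \<and>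
     (\<forall>j<n + m. \<exists>y::int. of_int \<Delta> * x j = of_int y \<and> \<bar>y\<bar> \<le> (int (n + m) * (lamz * (\<Gamma> + 1))) ^ (n + m))"
  proof (rule cramer_bound[where b = "\<lambda>r. of_bool (r = c)" and A = K])
    fix r s assume rs: "r < n + m" "s < n + m"
    show "\<bar>K r s\<bar> \<le> lamz * (\<Gamma> + 1)"
    proof (cases "r < n \<and> s < n")
      case True
      have "\<bar>\<Sum>j<m. gz j * (z j r * z j s)\<bar> \<le> (\<Sum>j<m. \<Gamma> * \<bar>z j r * z j s\<bar>)"
        by (rule order.trans[OF sum_abs], rule sum_mono) (auto simp: abs_mult[of "gz _"] intro!: mult_right_mono G)
      also have "\<dots> = \<Gamma> * (\<Sum>j<m. \<bar>z j r * z j s\<bar>)" by (simp add: sum_distrib_left)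
      also have "\<dots> \<le> \<Gamma> * lamz" using sum_abs_prod_le_lamz[of r s] True G(2) by (intro mult_left_mono) auto
      finally have "\<bar>\<Sum>j<m. gz j * (z j r * z j s)\<bar> \<le> \<Gamma> * lamz" .
      moreover have "\<bar>lamz * of_bool (r = s)\<bar> \<le> lamz" using lamz_pos by simp
      ultimately have "\<bar>K r s\<bar> \<le> lamz + \<Gamma> * lamz" using True by (simp add: K_def)
      thus ?thesis by (simp add: algebra_simps)
    next
      case False
      have "\<bar>K r s\<bar> \<le> lamz" using False rs abs_le_lamz[of "s - n" r] abs_le_lamz[of "r - n" s] lamz_pos
        by (auto simp: K_def)
      thus ?thesis using B1 by linarith
    qed
  next
    fix r assume "r < n + m"
    show "\<bar>of_bool (r = c)\<bar> \<le> lamz * (\<Gamma> + 1)" using B1 by simp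
    show "(\<Sum>s<n + m. of_int (K r s) * x s) = of_int (of_bool (r = c))"
    proof (cases "r < n")
      case True
      have "(\<Sum>j\<in>J. x (n + j) * a j r) = (\<Sum>j\<in>J. y j * a j r)" by (rule sum.cong) (auto simp: x_def)
      thus ?thesis unfolding row1[OF True] Gx[OF True] y[OF True] by simp
    next
      case False
      then obtain j where j: "r = n + j" "j < m" using \<open>r < n + m\<close> by (metis le_Suc_ex nat_add_left_cancel_less not_le)
      have "ip n (a j) x = 0" if "j \<in> J" unfolding ipx using HinvD(5)[OF H] JZ that by blast
      moreover have "x (n + j) = 0" if "j \<notin> J" using that by (simp add: x_def)
      ultimately show ?thesis unfolding j(1) row2[OF j(2)] using c by auto
    qed
  next
    fix u r assume u: "\<And>r. r < n + m \<Longrightarrow> (\<Sum>s<n + m. of_int (K r s) * u s) = (0::rat)" and r: "r < n + m"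
    have u1: "Gop ?g u r = (\<Sum>j\<in>J. u (n + j) * a j r)" if "r < n" for r using u[of r] row1[OF that, of u] that by simp
    have u2: "ip n (a j) u = 0" if "j \<in> J" for j using u[of "n + j"] row2[of j u] that JZ by auto
    have u3: "u (n + j) = 0" if "j < m" "j \<notin> J" for j using u[of "n + j"] row2[of j u] that by auto
    have "Gf ?g u u = ip n u (\<lambda>l. \<Sum>j\<in>J. u (n + j) * a j l)" unfolding ip_Gop[symmetric] using u1 by (intro ip_cong) auto
    also have "\<dots> = 0" unfolding ip_sum using u2 by (simp add: ip_commute[of n u])
    finally have "lam * ip n u u \<le> 0" using Gf_ge[where g = ?g and x = u] HinvD(1)[OF H] by simp
    hence "ip n u u \<le> 0" using lam_pos by (simp add: mult_le_0_iff)
    hence "ip n u u = 0" using ip_nonneg[of n u] by simp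
    hence u0: "\<And>l. l < n \<Longrightarrow> u l = 0" by (rule ip_zero)
    have "ip n b u = 0" for b unfolding ip_def using u0 by simp
    hence "\<And>l. l < n \<Longrightarrow> (\<Sum>j\<in>J. u (n + j) * a j l) = 0" unfolding u1[symmetric] Gop_def using u0 by simp
    hence "\<forall>j\<in>J. u (n + j) = 0" by (rule HinvD(6)[OF H])
    thus "u r = 0" using u0 u3 r by (metis le_Suc_ex nat_add_left_cancel_less not_le)
  qed
  thus ?thesis using xH by (metis trans_less_add1)
qed

end

section \<open>The perceptron algorithm with rescaling on lists, and its correctness\<close>

fun updf :: "('a \<Rightarrow> bool) \<Rightarrow> ('a \<Rightarrow> 'a) \<Rightarrow> 'a list \<Rightarrow> 'a list" where
  "updf P f [] = []"
| "updf P f (x # xs) = (if P x then f x # xs else x # updf P f xs)"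

text \<open>The quantifiers over \<open>f\<close> and \<open>ds\<close> are inside so that one index
  \<open>k\<close> serves both the update of the first element with \<open>P\<close> and its
  retrieval by \<open>hd\<close>.\<close>

lemma updf_first:
  assumes "\<exists>x\<in>set xs. P x"
  shows "\<exists>k<length xs. P (xs ! k) \<and> (\<forall>f. updf P f xs = xs[k := f (xs ! k)]) \<and> (\<forall>ds. hd (filter P xs @ ds) = xs ! k)"
  using assms
proof (induction xs)
  case (Cons x xs)
  show ?case
  proof (cases "P x")
    case True thus ?thesis by (intro exI[of _ 0]) auto
  next
    case False
    then obtain k where "k < length xs" "P (xs ! k)" "\<forall>f. updf P f xs = xs[k := f (xs ! k)]"
      "\<forall>ds. hd (filter P xs @ ds) = xs ! k" using Cons by auto
    thus ?thesis using False by (intro exI[of _ "Suc k"]) auto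
  qed
qed simp

definition nth0 :: "rat list \<Rightarrow> nat \<Rightarrow> rat" where "nth0 xs i = (if i < length xs then xs ! i else 0)"

text \<open>A row consists of its coefficients, its scale and its weight.\<close>

type_synonym row = "rat list \<times> rat \<times> rat"

abbreviation rowa :: "row \<Rightarrow> rat list" where "rowa r \<equiv> fst r"
abbreviation rowd :: "row \<Rightarrow> rat" where "rowd r \<equiv> fst (snd r)"
abbreviation rowy :: "row \<Rightarrow> rat" where "rowy r \<equiv> snd (snd r)"

text \<open>The combination \<open>w\<close> of the rows. \<open>H\<close> only supplies the list of
  column indices.\<close>

definition comb :: "row list \<Rightarrow> rat list list \<Rightarrow> rat list" where
  "comb R H = map (\<lambda>p. sum_list (map (\<lambda>r. rowd r * rowy r * nth0 (rowa r) (fst p)) R)) (List.enumerate 0 H)"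

definition mv :: "rat list list \<Rightarrow> rat list \<Rightarrow> rat list" where
  "mv H x = map (\<lambda>r. dot r x) H"

definition cand :: "row list \<Rightarrow> rat list list \<Rightarrow> rat list" where
  "cand R H = mv H (comb R H)"

definition bad :: "rat list \<Rightarrow> row \<Rightarrow> bool" where
  "bad v r \<longleftrightarrow> 0 < rowd r \<and> dot (rowa r) v \<le> 0"

definition rank1 :: "rat list list \<Rightarrow> rat list \<Rightarrow> rat \<Rightarrow> rat list list" where
  "rank1 H h c = map (\<lambda>p. map (\<lambda>q. fst q - snd p * snd q / c) (zip (fst p) h)) (zip H h)"

type_synonym lpstate = "(rat \<times> rat) \<times> row list \<times> rat list list"

definition big :: "rat \<Rightarrow> row list \<Rightarrow> row \<Rightarrow> bool" where
  "big T R r \<longleftrightarrow> T \<le> of_nat (length R) * rowy r"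

text \<open>The appended row makes \<open>hd\<close> total. Under the loop invariant the filtered
  list is nonempty whenever a rescaling takes place, since some weight is at least the
  average.\<close>

definition pivot :: "rat \<Rightarrow> row list \<Rightarrow> row" where
  "pivot T R = hd (filter (big T R) R @ [([], 1, 0)])"

definition lp_loop :: "lpstate \<Rightarrow> bool" where
  "lp_loop S \<longleftrightarrow> (\<exists>r\<in>set (fst (snd S)). bad (cand (fst (snd S)) (snd (snd S))) r)"

text \<open>Doubling the scale \<open>d\<close> changes the factor of the row in the form from
  \<open>d * d - 1\<close> to \<open>4 * d * d - 1\<close>, whence the constant
  \<open>3 * d * d\<close> in the rank one update. After a rescaling all weights restart at 0, which
  makes the potential inequality trivial for the new matrix.\<close>

definition lp_step :: "lpstate \<Rightarrow> lpstate" where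
  "lp_step S = (let T = fst (fst S); L = snd (fst S); R = fst (snd S); H = snd (snd S); v = cand R H in
     if sum_list (map rowy R) < T
     then (fst S, updf (bad v) (\<lambda>r. (rowa r, rowd r, rowy r + 1)) R, H)
     else let r = pivot T R; h = mv H (rowa r); s = dot (rowa r) h in
       if 2 * rowd r \<le> L
       then (fst S, map (\<lambda>r. (rowa r, rowd r, 0)) (updf (big T R) (\<lambda>r. (rowa r, 2 * rowd r, 0)) R),
          rank1 H h (1 / (3 * rowd r * rowd r) + s))
       else (fst S, map (\<lambda>r. (rowa r, rowd r, 0)) (updf (big T R) (\<lambda>r. (rowa r, 0, 0)) R), rank1 H h s))"

text \<open>Of \<open>us\<close> only the length, the number of variables, is used; loops run over lists.\<close>

definition lp_init :: "rat list \<Rightarrow> rat list list \<Rightarrow> lpstate" where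
  "lp_init us M = (let l = 1 + sum_list (map (\<lambda>a. dot a a) M); m = of_nat (length M); n = of_nat (length us) in
     ((4 * m * m * (n + m), (2 * (n + 1) * l) ^ length (0 # us)), map (\<lambda>a. (a, 1, 0)) M,
      map (\<lambda>p. map (\<lambda>q. if fst p = fst q then 1 / l else 0) (List.enumerate 0 us)) (List.enumerate 0 us)))"

definition lp :: "rat list \<Rightarrow> rat list list \<Rightarrow> rat list" where
  "lp us M = (let S = while lp_loop lp_step (lp_init us M) in cand (fst (snd S)) (snd (snd S)))"

lemma dot_ip: "length xs = n \<Longrightarrow> length ys = n \<Longrightarrow> dot xs ys = ip n (nth xs) (nth ys)"
  unfolding dot_def ip_def by (simp add: sum_list_sum_nth atLeast0LessThan)

lemma Hop_cong: assumes "\<And>j. j < n \<Longrightarrow> H i j = H' i j" "\<And>j. j < n \<Longrightarrow> x j = x' j"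
  shows "cone.Hop n H x i = cone.Hop n H' x' i"
  unfolding cone.Hop_def by (rule ip_cong) (use assms in auto)

locale lpm = cone n m z for n m z +
  fixes M :: "rat list list"
  assumes lenM: "length M = m" and lenrow: "\<And>j. j < m \<Longrightarrow> length (M ! j) = n"
    and Mz: "\<And>j l. j < m \<Longrightarrow> l < n \<Longrightarrow> M ! j ! l = of_int (z j l)"
begin

lemma a_nth: "j < m \<Longrightarrow> l < n \<Longrightarrow> M ! j ! l = a j l" by (simp add: Mz a_def)

lemma ip_row: "j < m \<Longrightarrow> ip n (nth (M ! j)) x = ip n (a j) x" by (rule ip_cong) (auto simp: a_nth)

abbreviation Hf :: "rat list list \<Rightarrow> nat \<Rightarrow> nat \<Rightarrow> rat" where "Hf H \<equiv> (\<lambda>i j. H ! i ! j)"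

definition dims :: "rat list list \<Rightarrow> bool" where "dims H \<longleftrightarrow> length H = n \<and> (\<forall>i<n. length (H ! i) = n)"

lemma dot_row: "j < m \<Longrightarrow> length x = n \<Longrightarrow> dot (M ! j) x = ip n (a j) (nth x)"
  using dot_ip[of "M ! j" n x] lenrow ip_row by simp

lemma mv_nth: assumes "dims H" "length x = n"
  shows "length (mv H x) = n" "\<And>i. i < n \<Longrightarrow> mv H x ! i = Hop (Hf H) (nth x) i"
  using assms dot_ip unfolding mv_def dims_def Hop_def by auto

lemma rank1_nth: assumes "dims H" "length h = n"
  shows "dims (rank1 H h c)" "\<And>i j. i < n \<Longrightarrow> j < n \<Longrightarrow> rank1 H h c ! i ! j = H ! i ! j - h ! i * h ! j / c"
  using assms unfolding rank1_def dims_def by auto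

definition wf :: "row list \<Rightarrow> rat list list \<Rightarrow> bool" where
  "wf R H \<longleftrightarrow> length R = m \<and> (\<forall>j<m. rowa (R ! j) = M ! j) \<and> dims H"

definition wt :: "row list \<Rightarrow> nat \<Rightarrow> rat" where
  "wt R = (\<lambda>l. \<Sum>j<m. (rowd (R ! j) * rowy (R ! j)) * a j l)"

lemma comb_nth: assumes "wf R H"
  shows "length (comb R H) = n" "\<And>l. l < n \<Longrightarrow> comb R H ! l = wt R l"
proof -
  have l: "length H = n" "length R = m" using assms unfolding wf_def dims_def by auto
  show "length (comb R H) = n" by (simp add: comb_def l)
  fix i assume i: "i < n"
  have "comb R H ! i = (\<Sum>j<m. (map (\<lambda>r. rowd r * rowy r * nth0 (rowa r) i) R) ! j)"
    using i l by (simp add: comb_def nth_enumerate_eq sum_list_sum_nth atLeast0LessThan)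
  also have "\<dots> = wt R i" unfolding wt_def
    using assms i lenrow by (intro sum.cong refl) (auto simp: wf_def nth0_def a_nth)
  finally show "comb R H ! i = wt R i" .
qed

lemma cand_nth: assumes "wf R H"
  shows "length (cand R H) = n" "\<And>i. i < n \<Longrightarrow> cand R H ! i = Hop (Hf H) (wt R) i"
proof -
  have d: "dims H" using assms unfolding wf_def by simp
  show "length (cand R H) = n" unfolding cand_def by (rule mv_nth[OF d comb_nth(1)[OF assms]])
  fix i assume i: "i < n"
  have "cand R H ! i = Hop (Hf H) (nth (comb R H)) i"
    unfolding cand_def by (rule mv_nth(2)[OF d comb_nth(1)[OF assms] i])
  also have "\<dots> = Hop (Hf H) (wt R) i" by (rule Hop_cong) (use comb_nth(2)[OF assms] in auto)
  finally show "cand R H ! i = Hop (Hf H) (wt R) i" .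
qed

lemma dot_cand: assumes "wf R H" "j < m" shows "dot (M ! j) (cand R H) = ip n (a j) (Hop (Hf H) (wt R))"
  unfolding dot_row[OF assms(2) cand_nth(1)[OF assms(1)]]
  by (rule ip_cong) (use cand_nth(2)[OF assms(1)] in auto)

lemma Hinv_cong:
  assumes H: "Hinv g J Z H" and eq: "\<And>i j. i < n \<Longrightarrow> j < n \<Longrightarrow> H' i j = H i j"
  shows "Hinv g J Z H'"
proof -
  have h: "Hop H' x l = Hop H x l" if "l < n" for x l by (rule Hop_cong) (use eq that in auto)
  have ipe: "ip n b (Hop H' x) = ip n b (Hop H x)" for b x by (rule ip_cong) (use h in auto)
  have G: "Gop g (Hop H' x) l = Gop g (Hop H x) l" if "l < n" for x l unfolding Gop_def ipe h[OF that] ..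
  show ?thesis
  proof (rule HinvI[OF HinvD(1)[OF H] HinvD(2,3)[OF H] _ _ _ HinvD(6)[OF H]])
    show "\<forall>i<n. \<forall>j<n. H' i j = H' j i" using HinvD(4)[OF H] eq by simp
    show "ip n (a j) (Hop H' x) = 0" if "j \<in> Z" for j x unfolding ipe by (rule HinvD(5)[OF H that])
    show "\<exists>y. \<forall>l<n. Gop g (Hop H' x) l = x l + (\<Sum>j\<in>J. y j * a j l)" for x
    proof -
      obtain y where "\<And>l. l < n \<Longrightarrow> Gop g (Hop H x) l = x l + (\<Sum>j\<in>J. y j * a j l)"
        by (rule HinvE[OF H, of x]) blast
      thus ?thesis by (intro exI[of _ y]) (simp add: G)
    qed
  qed
qed

definition Lz :: int where "Lz = (2 * (int n + 1) * lamz) ^ (n + 1)"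

lemma Lam_Lz: "Lam = of_int Lz" unfolding Lam_def Lz_def lam_def by simp

definition Tn :: nat where "Tn = 4 * m * m * (n + m)"

text \<open>A row whose scale has dropped to 0 keeps its last factor in the form; therefore
  \<open>gz\<close> is tied to the scale only for the other rows and merely bounded for all. Scales
  are powers of 2 and weights are naturals, so both the numbers and the number of rounds stay under
  control.\<close>

definition LI :: "row list \<Rightarrow> rat list list \<Rightarrow> bool" where
  "LI R H \<longleftrightarrow> wf R H \<and>
     (\<forall>j<m. rowd (R ! j) = 0 \<or> (\<exists>e. rowd (R ! j) = 2 ^ e \<and> rowd (R ! j) \<le> Lam)) \<and>
     (\<forall>j<m. \<exists>k. rowy (R ! j) = of_nat k \<and> (rowd (R ! j) = 0 \<longrightarrow> k = 0)) \<and>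
     (\<Sum>j<m. rowy (R ! j)) \<le> of_nat Tn \<and>
     (\<exists>gz J. Hinv (\<lambda>j. of_int (gz j)) J {j. j < m \<and> rowd (R ! j) = 0} (Hf H) \<and>
        (\<forall>j<m. rowd (R ! j) \<noteq> 0 \<longrightarrow> of_int (gz j) = rowd (R ! j) * rowd (R ! j) - 1) \<and>
        (\<forall>j<m. of_int (gz j) \<le> Lam * Lam)) \<and>
     (\<forall>v. K0 v \<longrightarrow> (\<forall>j<m. rowd (R ! j) \<noteq> 0 \<longrightarrow> rowd (R ! j) * ip n (a j) v \<le> 1)) \<and>
     (\<forall>v. inC v \<longrightarrow> (\<forall>j<m. rowd (R ! j) = 0 \<longrightarrow> ip n (a j) v = 0)) \<and>
     ip n (wt R) (Hop (Hf H) (wt R)) \<le> (\<Sum>j<m. rowy (R ! j))"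

lemma LID:
  assumes "LI R H"
  shows "wf R H" "\<And>j. j < m \<Longrightarrow> rowd (R ! j) = 0 \<or> (\<exists>e. rowd (R ! j) = 2 ^ e \<and> rowd (R ! j) \<le> Lam)"
    "\<And>j. j < m \<Longrightarrow> \<exists>k. rowy (R ! j) = of_nat k \<and> (rowd (R ! j) = 0 \<longrightarrow> k = 0)"
    "(\<Sum>j<m. rowy (R ! j)) \<le> of_nat Tn"
    "\<And>v j. K0 v \<Longrightarrow> j < m \<Longrightarrow> rowd (R ! j) \<noteq> 0 \<Longrightarrow> rowd (R ! j) * ip n (a j) v \<le> 1"
    "\<And>v j. inC v \<Longrightarrow> j < m \<Longrightarrow> rowd (R ! j) = 0 \<Longrightarrow> ip n (a j) v = 0"
    "ip n (wt R) (Hop (Hf H) (wt R)) \<le> (\<Sum>j<m. rowy (R ! j))"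
proof -
  note D = assms[unfolded LI_def]
  show "wf R H" "(\<Sum>j<m. rowy (R ! j)) \<le> of_nat Tn" "ip n (wt R) (Hop (Hf H) (wt R)) \<le> (\<Sum>j<m. rowy (R ! j))"
    using D by - (elim conjE, assumption)+
  have *: "\<forall>j<m. rowd (R ! j) = 0 \<or> (\<exists>e. rowd (R ! j) = 2 ^ e \<and> rowd (R ! j) \<le> Lam)"
    "\<forall>j<m. \<exists>k. rowy (R ! j) = of_nat k \<and> (rowd (R ! j) = 0 \<longrightarrow> k = 0)"
    "\<forall>v. K0 v \<longrightarrow> (\<forall>j<m. rowd (R ! j) \<noteq> 0 \<longrightarrow> rowd (R ! j) * ip n (a j) v \<le> 1)"
    "\<forall>v. inC v \<longrightarrow> (\<forall>j<m. rowd (R ! j) = 0 \<longrightarrow> ip n (a j) v = 0)"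
    using D by - (elim conjE, assumption)+
  show "rowd (R ! j) = 0 \<or> (\<exists>e. rowd (R ! j) = 2 ^ e \<and> rowd (R ! j) \<le> Lam)" if "j < m" for j using *(1) that by blast
  show "\<exists>k. rowy (R ! j) = of_nat k \<and> (rowd (R ! j) = 0 \<longrightarrow> k = 0)" if "j < m" for j using *(2) that by blast
  show "rowd (R ! j) * ip n (a j) v \<le> 1" if "K0 v" "j < m" "rowd (R ! j) \<noteq> 0" for v j using *(3) that by blast
  show "ip n (a j) v = 0" if "inC v" "j < m" "rowd (R ! j) = 0" for v j using *(4) that by blast
qed

lemma LIE:
  assumes "LI R H"
  obtains gz J where "Hinv (\<lambda>j. of_int (gz j)) J {j. j < m \<and> rowd (R ! j) = 0} (Hf H)"
    "\<And>j. j < m \<Longrightarrow> rowd (R ! j) \<noteq> 0 \<Longrightarrow> of_int (gz j) = rowd (R ! j) * rowd (R ! j) - 1"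
    "\<And>j. j < m \<Longrightarrow> of_int (gz j) \<le> Lam * Lam"
proof -
  have "\<exists>gz J. Hinv (\<lambda>j. of_int (gz j)) J {j. j < m \<and> rowd (R ! j) = 0} (Hf H) \<and>
        (\<forall>j<m. rowd (R ! j) \<noteq> 0 \<longrightarrow> of_int (gz j) = rowd (R ! j) * rowd (R ! j) - 1) \<and>
        (\<forall>j<m. of_int (gz j) \<le> Lam * Lam)" using assms[unfolded LI_def] by (elim conjE)
  thus ?thesis using that by blast
qed

lemma LII:
  assumes "wf R H" "\<And>j. j < m \<Longrightarrow> rowd (R ! j) = 0 \<or> (\<exists>e. rowd (R ! j) = 2 ^ e \<and> rowd (R ! j) \<le> Lam)"
    "\<And>j. j < m \<Longrightarrow> \<exists>k. rowy (R ! j) = of_nat k \<and> (rowd (R ! j) = 0 \<longrightarrow> k = 0)"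
    "(\<Sum>j<m. rowy (R ! j)) \<le> of_nat Tn"
    "\<And>v j. K0 v \<Longrightarrow> j < m \<Longrightarrow> rowd (R ! j) \<noteq> 0 \<Longrightarrow> rowd (R ! j) * ip n (a j) v \<le> 1"
    "\<And>v j. inC v \<Longrightarrow> j < m \<Longrightarrow> rowd (R ! j) = 0 \<Longrightarrow> ip n (a j) v = 0"
    "ip n (wt R) (Hop (Hf H) (wt R)) \<le> (\<Sum>j<m. rowy (R ! j))"
    "Hinv (\<lambda>j. of_int (gz j)) J {j. j < m \<and> rowd (R ! j) = 0} (Hf H)"
    "\<And>j. j < m \<Longrightarrow> rowd (R ! j) \<noteq> 0 \<Longrightarrow> of_int (gz j) = rowd (R ! j) * rowd (R ! j) - 1"
    "\<And>j. j < m \<Longrightarrow> of_int (gz j) \<le> Lam * Lam"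
  shows "LI R H"
  unfolding LI_def
proof (intro conjI)
  show "\<exists>gz J. Hinv (\<lambda>j. of_int (gz j)) J {j. j < m \<and> rowd (R ! j) = 0} (Hf H) \<and>
        (\<forall>j<m. rowd (R ! j) \<noteq> 0 \<longrightarrow> of_int (gz j) = rowd (R ! j) * rowd (R ! j) - 1) \<and>
        (\<forall>j<m. of_int (gz j) \<le> Lam * Lam)"
    by (rule exI[of _ gz], rule exI[of _ J]) (use assms(8-10) in blast)
qed (use assms(1-7) in blast)+

text \<open>The progress made by a row: the length of its scale, where the scale 0 ranks above every
  admissible positive one. In \<open>tot\<close> it takes precedence over the weights because their
  sum is at most \<open>Tn\<close>.\<close>

definition rho :: "row list \<Rightarrow> nat \<Rightarrow> nat" where
  "rho R j = (if rowd (R ! j) = 0 then bits Lz + 1 else bits \<lfloor>rowd (R ! j)\<rfloor>)"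

definition tot :: "row list \<Rightarrow> nat" where
  "tot R = (\<Sum>j<m. rho R j) * (Tn + 1) + nat \<lfloor>\<Sum>j<m. rowy (R ! j)\<rfloor>"

lemma sum_rowy_nat: assumes "LI R H" obtains k where "(\<Sum>j<m. rowy (R ! j)) = of_nat k" "k \<le> Tn"
proof -
  obtain f where f: "\<And>j. j < m \<Longrightarrow> rowy (R ! j) = of_nat (f j)" using LID(3)[OF assms] by metis
  have e: "(\<Sum>j<m. rowy (R ! j)) = of_nat (\<Sum>j<m. f j)" using f by simp
  show ?thesis by (rule that[OF e]) (use LID(4)[OF assms] e in \<open>simp only: of_nat_le_iff\<close>)
qed

lemma rho_le: assumes "LI R H" "j < m" shows "rho R j \<le> bits Lz + 1"
proof (cases "rowd (R ! j) = 0")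
  case False
  then obtain e where "rowd (R ! j) = 2 ^ e" "rowd (R ! j) \<le> of_int Lz"
    using LID(2)[OF assms] unfolding Lam_Lz by blast
  hence "0 \<le> \<lfloor>rowd (R ! j)\<rfloor>" "\<lfloor>rowd (R ! j)\<rfloor> \<le> Lz" by (auto simp: floor_le_iff)
  hence "bits \<lfloor>rowd (R ! j)\<rfloor> \<le> bits Lz" by (intro bits_mono) auto
  thus ?thesis by (simp add: rho_def)
qed (simp add: rho_def)

lemma tot_le: assumes "LI R H" shows "tot R \<le> m * (bits Lz + 1) * (Tn + 1) + Tn"
proof -
  obtain k where k: "(\<Sum>j<m. rowy (R ! j)) = of_nat k" "k \<le> Tn" by (rule sum_rowy_nat[OF assms])
  have "(\<Sum>j<m. rho R j) \<le> (\<Sum>j<m. bits Lz + 1)" by (rule sum_mono) (use rho_le[OF assms] in auto)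
  thus ?thesis unfolding tot_def k(1) using k(2) by (auto intro!: add_mono mult_right_mono)
qed

lemma wf_upd: "wf R H \<Longrightarrow> k < m \<Longrightarrow> rowa x = M ! k \<Longrightarrow> wf (R[k := x]) H"
  unfolding wf_def by (auto simp: nth_list_update)

lemma perceptron_step:
  assumes L: "LI R H" and k: "k < m" "0 < rowd (R ! k)" "dot (M ! k) (cand R H) \<le> 0"
    and lt: "(\<Sum>j<m. rowy (R ! j)) < of_nat Tn"
  shows "LI (R[k := (rowa (R ! k), rowd (R ! k), rowy (R ! k) + 1)]) H \<and>
    tot R < tot (R[k := (rowa (R ! k), rowd (R ! k), rowy (R ! k) + 1)])"
proof -
  define R' where "R' = R[k := (rowa (R ! k), rowd (R ! k), rowy (R ! k) + 1)]"
  have w: "wf R H" by (rule LID(1)[OF L])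
  have lR: "length R = m" using w unfolding wf_def by simp
  have d: "rowd (R' ! j) = rowd (R ! j)" if "j < m" for j using that lR k(1) by (auto simp: R'_def nth_list_update)
  have y: "rowy (R' ! j) = rowy (R ! j) + of_bool (j = k)" if "j < m" for j using that lR k(1) by (auto simp: R'_def nth_list_update)
  have S: "(\<Sum>j<m. rowy (R' ! j)) = (\<Sum>j<m. rowy (R ! j)) + 1"
  proof -
    have "(\<Sum>j<m. rowy (R' ! j)) = (\<Sum>j<m. rowy (R ! j) + (if j = k then 1 else 0))" using y by (intro sum.cong) auto
    thus ?thesis using k(1) by (simp add: sum.distrib)
  qed
  have W: "wt R' = (\<lambda>l. wt R l + rowd (R ! k) * a k l)"
  proof
    fix l
    have "wt R' l = (\<Sum>j<m. (rowd (R ! j) * rowy (R ! j)) * a j l + (if j = k then rowd (R ! k) * a k l else 0))"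
      unfolding wt_def using d y by (intro sum.cong refl) (auto simp: algebra_simps)
    thus "wt R' l = wt R l + rowd (R ! k) * a k l" using k(1) by (simp add: sum.distrib wt_def)
  qed
  obtain gz J where G: "Hinv (\<lambda>j. of_int (gz j)) J {j. j < m \<and> rowd (R ! j) = 0} (Hf H)"
    "\<And>j. j < m \<Longrightarrow> rowd (R ! j) \<noteq> 0 \<Longrightarrow> of_int (gz j) = rowd (R ! j) * rowd (R ! j) - 1"
    "\<And>j. j < m \<Longrightarrow> of_int (gz j) \<le> Lam * Lam" by (rule LIE[OF L]) blast
  obtain K where K: "(\<Sum>j<m. rowy (R ! j)) = of_nat K" "K \<le> Tn" by (rule sum_rowy_nat[OF L])
  have "LI R' H"
  proof (rule LII)
    show "wf R' H" unfolding R'_def by (rule wf_upd[OF w k(1)]) (use w k(1) in \<open>simp add: wf_def\<close>)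
    show "rowd (R' ! j) = 0 \<or> (\<exists>e. rowd (R' ! j) = 2 ^ e \<and> rowd (R' ! j) \<le> Lam)" if "j < m" for j
      unfolding d[OF that] by (rule LID(2)[OF L that])
    show "\<exists>i. rowy (R' ! j) = of_nat i \<and> (rowd (R' ! j) = 0 \<longrightarrow> i = 0)" if j: "j < m" for j
    proof -
      obtain i where i: "rowy (R ! j) = of_nat i" "rowd (R ! j) = 0 \<longrightarrow> i = 0" using LID(3)[OF L j] by blast
      show ?thesis by (rule exI[of _ "i + of_bool (j = k)"]) (use i y[OF j] d[OF j] k in auto)
    qed
    show "(\<Sum>j<m. rowy (R' ! j)) \<le> of_nat Tn" using lt unfolding S K(1)
      by (metis Suc_leI of_nat_Suc of_nat_le_iff of_nat_less_iff add.commute)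
    show "rowd (R' ! j) * ip n (a j) v \<le> 1" if "K0 v" "j < m" "rowd (R' ! j) \<noteq> 0" for v j
      using LID(5)[OF L that(1,2)] that d by simp
    show "ip n (a j) v = 0" if "inC v" "j < m" "rowd (R' ! j) = 0" for v j
      using LID(6)[OF L that(1,2)] that d by simp
    have "ip n (wt R') (Hop (Hf H) (wt R')) \<le> ip n (wt R) (Hop (Hf H) (wt R)) + 1"
      unfolding W
    proof (rule pot_step[OF G(1) k(1)])
      show "rowd (R ! k) * rowd (R ! k) = 1 + of_int (gz k)" using G(2)[OF k(1)] k(2) by simp
      show "0 \<le> rowd (R ! k)" using k(2) by simp
      show "ip n (a k) (Hop (Hf H) (wt R)) \<le> 0" using k(3) unfolding dot_cand[OF w k(1)] .
    qed
    thus "ip n (wt R') (Hop (Hf H) (wt R')) \<le> (\<Sum>j<m. rowy (R' ! j))" using LID(7)[OF L] S by linarith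
    have "{j. j < m \<and> rowd (R' ! j) = 0} = {j. j < m \<and> rowd (R ! j) = 0}" using d by auto
    thus "Hinv (\<lambda>j. of_int (gz j)) J {j. j < m \<and> rowd (R' ! j) = 0} (Hf H)" using G(1) by simp
    show "of_int (gz j) = rowd (R' ! j) * rowd (R' ! j) - 1" if "j < m" "rowd (R' ! j) \<noteq> 0" for j
      using G(2) that d by simp
  qed (rule G(3))
  moreover have "(\<Sum>j<m. rho R' j) = (\<Sum>j<m. rho R j)" using d by (intro sum.cong) (auto simp: rho_def)
  hence "tot R < tot R'" unfolding tot_def S K(1) by simp
  ultimately show ?thesis unfolding R'_def by blast
qed

text \<open>Both cases rest on \<open>halving\<close>: the doubled scale is still valid on
  \<open>K0\<close>. If it exceeds \<open>Lam\<close>, a point of the cone where row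
  \<open>k\<close> is positive would yield one of \<open>K0\<close> at which the doubled scale is
  violated.\<close>

lemma rescale_step:
  assumes L: "LI R H" and k: "k < m" "of_nat Tn \<le> of_nat m * rowy (R ! k)"
    and ge: "of_nat Tn \<le> (\<Sum>j<m. rowy (R ! j))"
    and h: "h = mv H (rowa (R ! k))" and s: "s = dot (rowa (R ! k)) h"
    and b: "(2 * rowd (R ! k) \<le> Lam \<and> d' = 2 * rowd (R ! k) \<and> c = 1 / (3 * rowd (R ! k) * rowd (R ! k)) + s) \<or>
      (\<not> 2 * rowd (R ! k) \<le> Lam \<and> d' = 0 \<and> c = s)"
    and R': "R' = map (\<lambda>r. (rowa r, rowd r, 0)) (R[k := (rowa (R ! k), d', 0)])"
  shows "LI R' (rank1 H h c) \<and> tot R < tot R'"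
proof -
  have w: "wf R H" by (rule LID(1)[OF L])
  have lR: "length R = m" and ra: "\<And>j. j < m \<Longrightarrow> rowa (R ! j) = M ! j" and dH: "dims H" using w unfolding wf_def by auto
  have lh: "length h = n" unfolding h ra[OF k(1)] by (rule mv_nth[OF dH lenrow[OF k(1)]])
  have hn: "h ! i = Hop (Hf H) (a k) i" if "i < n" for i
    unfolding h ra[OF k(1)] mv_nth(2)[OF dH lenrow[OF k(1)] that]
    by (rule Hop_cong) (use a_nth k(1) in auto)
  have sn: "s = ip n (a k) (Hop (Hf H) (a k))"
    unfolding s ra[OF k(1)] dot_row[OF k(1) lh] by (rule ip_cong) (use hn in auto)
  have wf': "wf R' (rank1 H h c)" using rank1_nth(1)[OF dH lh] lR ra k(1) unfolding wf_def R'
    by (auto simp: nth_list_update)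
  have d: "rowd (R' ! j) = (if j = k then d' else rowd (R ! j))" if "j < m" for j using that lR k(1) by (auto simp: R' nth_list_update)
  have y: "rowy (R' ! j) = 0" if "j < m" for j using that lR k(1) by (auto simp: R' nth_list_update)
  have wt0: "wt R' = (\<lambda>_. 0)" unfolding wt_def using y by auto
  have eqH: "rank1 H h c ! i ! j = upd (Hf H) k c i j" if "i < n" "j < n" for i j
    using rank1_nth(2)[OF dH lh that] hn that by (simp add: upd_def)
  obtain gz J where G: "Hinv (\<lambda>j. of_int (gz j)) J {j. j < m \<and> rowd (R ! j) = 0} (Hf H)"
    "\<And>j. j < m \<Longrightarrow> rowd (R ! j) \<noteq> 0 \<Longrightarrow> of_int (gz j) = rowd (R ! j) * rowd (R ! j) - 1"
    "\<And>j. j < m \<Longrightarrow> of_int (gz j) \<le> Lam * Lam" by (rule LIE[OF L]) blast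
  have m0: "0 < m" using k(1) by simp
  have T0: "0 < Tn" unfolding Tn_def using m0 by simp
  have yk: "0 < rowy (R ! k)"
  proof -
    have "(0::rat) < of_nat Tn" using T0 by simp
    hence "0 < of_nat m * rowy (R ! k)" using k(2) by linarith
    thus ?thesis using m0 by (simp add: zero_less_mult_iff)
  qed
  \<comment> \<open>By the invariant a row of scale 0 has weight 0, so the row chosen for its large
    weight has a positive scale.\<close>
  have dk0: "rowd (R ! k) \<noteq> 0" using LID(3)[OF L k(1)] yk by auto
  then obtain e where e: "rowd (R ! k) = 2 ^ e" "rowd (R ! k) \<le> Lam" using LID(2)[OF L k(1)] by blast
  have dk: "1 \<le> rowd (R ! k)" unfolding e(1) by simp
  have YT: "(\<Sum>j<m. rowy (R ! j)) = of_nat Tn" using LID(4)[OF L] ge by simp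
  have half: "2 * rowd (R ! k) * ip n (a k) v \<le> 1" if v: "K0 v" for v
  proof (rule halving[OF G(1), where y = "\<lambda>j. rowy (R ! j)" and d = "\<lambda>j. rowd (R ! j)" and Y = "of_nat Tn"])
    have iv: "inC v" using v unfolding K0_def by simp
    show "of_int (gz j) = rowd (R ! j) * rowd (R ! j) - 1 \<and> 0 \<le> rowd (R ! j)"
      if "j < m" "j \<notin> {j. j < m \<and> rowd (R ! j) = 0}" for j
      using G(2)[OF that(1)] LID(2)[OF L that(1)] that by auto
    show "rowd (R ! j) * ip n (a j) v \<le> 1" if "j < m" "j \<notin> {j. j < m \<and> rowd (R ! j) = 0}" for j
      using LID(5)[OF L v that(1)] that by auto
    show "ip n (a j) v = 0" if "j \<in> {j. j < m \<and> rowd (R ! j) = 0}" for j using LID(6)[OF L iv] that by auto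
    show "0 \<le> rowy (R ! j)" if "j < m" for j using LID(3)[OF L that] by auto
    show "rowy (R ! j) = 0" if "j \<in> {j. j < m \<and> rowd (R ! j) = 0}" for j using LID(3)[OF L, of j] that by auto
    show "ip n (\<lambda>l. \<Sum>j<m. (rowd (R ! j) * rowy (R ! j)) * a j l)
      (Hop (Hf H) (\<lambda>l. \<Sum>j<m. (rowd (R ! j) * rowy (R ! j)) * a j l)) \<le> of_nat Tn"
      using LID(7)[OF L] unfolding wt_def YT .
    show "4 * of_nat m * of_nat m * (of_nat n + of_nat m) \<le> (of_nat Tn :: rat)" unfolding Tn_def by simp
  qed (use k dk0 v in auto)
  have rest: "(\<Sum>j<m. rowy (R' ! j)) \<le> of_nat Tn" "ip n (wt R') (Hop (Hf (rank1 H h c)) (wt R')) \<le> (\<Sum>j<m. rowy (R' ! j))"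
    unfolding wt0 using y by (simp_all add: ip_def)
  have yex: "\<exists>i. rowy (R' ! j) = of_nat i \<and> (rowd (R' ! j) = 0 \<longrightarrow> i = 0)" if "j < m" for j
    by (rule exI[of _ 0]) (use y[OF that] in simp)
  have "LI R' (rank1 H h c) \<and> rho R k < rho R' k"
  proof (cases "2 * rowd (R ! k) \<le> Lam")
    case True
    hence dc: "d' = 2 * rowd (R ! k)" "c = 1 / (3 * rowd (R ! k) * rowd (R ! k)) + s" using b by auto
    have d0: "d' \<noteq> 0" using dc dk by simp
    define gz' where "gz' = gz(k := gz k + 3 * 2 ^ e * 2 ^ e)"
    have gz': "(\<lambda>j. of_int (gz' j)) = (\<lambda>j. rat_of_int (gz j))(k := of_int (gz k) + 3 * rowd (R ! k) * rowd (R ! k))"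
      by (auto simp: gz'_def e(1))
    have Zeq: "{j. j < m \<and> rowd (R' ! j) = 0} = {j. j < m \<and> rowd (R ! j) = 0}" using d d0 dk0 by (auto split: if_splits)
    have "LI R' (rank1 H h c)"
    proof (rule LII[OF wf' _ yex rest(1) _ _ rest(2), where gz = gz' and J = J])
      show "rowd (R' ! j) = 0 \<or> (\<exists>e. rowd (R' ! j) = 2 ^ e \<and> rowd (R' ! j) \<le> Lam)" if j: "j < m" for j
      proof (cases "j = k")
        case True
        thus ?thesis using d[OF j] dc(1) e(1) \<open>2 * rowd (R ! k) \<le> Lam\<close> by (intro disjI2 exI[of _ "Suc e"]) auto
      qed (use d[OF j] LID(2)[OF L j] in simp)
      show "rowd (R' ! j) * ip n (a j) v \<le> 1" if "K0 v" "j < m" "rowd (R' ! j) \<noteq> 0" for v j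
        using LID(5)[OF L that(1,2)] half[OF that(1)] that d dc(1) by (cases "j = k") auto
      show "ip n (a j) v = 0" if "inC v" "j < m" "rowd (R' ! j) = 0" for v j
        using LID(6)[OF L that(1,2)] that d d0 by (cases "j = k") auto
      have "Hinv (\<lambda>j. of_int (gz' j)) J {j. j < m \<and> rowd (R ! j) = 0} (upd (Hf H) k c)"
        unfolding gz' dc(2) sn by (rule Hinv_finite_update[OF G(1) k(1)]) (use dk in simp)
      thus "Hinv (\<lambda>j. of_int (gz' j)) J {j. j < m \<and> rowd (R' ! j) = 0} (Hf (rank1 H h c))"
        unfolding Zeq by (rule Hinv_cong) (rule eqH)
      show g: "of_int (gz' j) = rowd (R' ! j) * rowd (R' ! j) - 1" if "j < m" "rowd (R' ! j) \<noteq> 0" for j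
      proof (cases "j = k")
        case True
        have "rat_of_int (gz' k) = of_int (gz k) + 3 * rowd (R ! k) * rowd (R ! k)" by (simp add: gz'_def e(1))
        thus ?thesis using True d[OF k(1)] dc(1) G(2)[OF k(1) dk0] by simp
      qed (use G(2) that d in \<open>simp add: gz'_def\<close>)
      show "of_int (gz' j) \<le> Lam * Lam" if j: "j < m" for j
      proof (cases "j = k")
        case True
        have "of_int (gz' k) = d' * d' - 1" using g[OF k(1)] d[OF k(1)] d0 by simp
        also have "\<dots> \<le> Lam * Lam" using mult_mono[of d' Lam d' Lam] dc(1) dk \<open>2 * rowd (R ! k) \<le> Lam\<close> by simp
        finally show ?thesis using True by simp
      qed (use G(3)[OF j] in \<open>simp add: gz'_def\<close>)
    qed
    moreover have "bits \<lfloor>rowd (R ! k)\<rfloor> < bits \<lfloor>d'\<rfloor>"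
    proof -
      have "\<lfloor>rowd (R ! k)\<rfloor> = 2 ^ e" "\<lfloor>d'\<rfloor> = 2 * 2 ^ e" unfolding dc(1) e(1)
        by (metis floor_of_int of_int_numeral of_int_power, metis floor_of_int of_int_mult of_int_numeral of_int_power)
      thus ?thesis using bits_half[of "2 * 2 ^ e" "2 ^ e"] by simp
    qed
    hence "rho R k < rho R' k" using d[OF k(1)] d0 dk0 by (simp add: rho_def)
    ultimately show ?thesis by blast
  next
    case False
    hence dc: "d' = 0" "c = s" using b by auto
    have Zeq: "{j. j < m \<and> rowd (R' ! j) = 0} = insert k {j. j < m \<and> rowd (R ! j) = 0}" using d dc(1) k(1) by (auto split: if_splits)
    obtain J' where J': "Hinv (\<lambda>j. of_int (gz j)) J' (insert k {j. j < m \<and> rowd (R ! j) = 0}) (upd (Hf H) k c)"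
      unfolding dc(2) sn using Hinv_infinite_update[OF G(1) k(1)] dk0 by auto
    have "LI R' (rank1 H h c)"
    proof (rule LII[OF wf' _ yex rest(1) _ _ rest(2), where gz = gz and J = J'])
      show "rowd (R' ! j) = 0 \<or> (\<exists>e. rowd (R' ! j) = 2 ^ e \<and> rowd (R' ! j) \<le> Lam)" if j: "j < m" for j
        using d[OF j] LID(2)[OF L j] dc(1) by (cases "j = k") auto
      show "rowd (R' ! j) * ip n (a j) v \<le> 1" if "K0 v" "j < m" "rowd (R' ! j) \<noteq> 0" for v j
        using LID(5)[OF L that(1,2)] that d dc(1) by (cases "j = k") auto
      show "ip n (a j) v = 0" if v: "inC v" "j < m" "rowd (R' ! j) = 0" for v j
      proof (cases "j = k")
        case True
        show ?thesis
        proof (rule ccontr)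
          assume "ip n (a j) v \<noteq> 0"
          hence "0 < ip n (a k) v" using v(1) k(1) True unfolding inC_def by (simp add: order.not_eq_order_implies_strict)
          from small_solution[OF v(1) this k(1)] obtain u where u: "K0 u" "1 \<le> Lam * ip n (a k) u" by blast
          have "0 < ip n (a k) u"
          proof (rule ccontr)
            assume "\<not> 0 < ip n (a k) u"
            hence "Lam * ip n (a k) u \<le> 0" using Lam_ge_1 by (intro mult_nonneg_nonpos) auto
            thus False using u(2) by linarith
          qed
          hence "Lam * ip n (a k) u < 2 * rowd (R ! k) * ip n (a k) u" using False by (intro mult_strict_right_mono) auto
          thus False using half[OF u(1)] u(2) by linarith
        qed
      qed (use LID(6)[OF L v(1,2)] v d in simp)
      show "Hinv (\<lambda>j. of_int (gz j)) J' {j. j < m \<and> rowd (R' ! j) = 0} (Hf (rank1 H h c))"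
        unfolding Zeq by (rule Hinv_cong[OF J']) (rule eqH)
      show "of_int (gz j) = rowd (R' ! j) * rowd (R' ! j) - 1" if "j < m" "rowd (R' ! j) \<noteq> 0" for j
        using G(2) that d dc(1) by (cases "j = k") auto
    qed (use G(3) in auto)
    moreover have "rho R k < rho R' k"
    proof -
      have "0 \<le> \<lfloor>rowd (R ! k)\<rfloor>" "\<lfloor>rowd (R ! k)\<rfloor> \<le> Lz" using e dk unfolding Lam_Lz by (auto simp: floor_le_iff)
      hence "bits \<lfloor>rowd (R ! k)\<rfloor> \<le> bits Lz" by (intro bits_mono) auto
      thus ?thesis using d[OF k(1)] dc(1) dk0 by (simp add: rho_def)
    qed
    ultimately show ?thesis by blast
  qed
  moreover have "tot R < tot R'" if r: "rho R k < rho R' k"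
  proof -
    have "(\<Sum>j<m. rho R j) < (\<Sum>j<m. rho R' j)"
    proof (rule sum_strict_mono_ex1)
      show "\<forall>j\<in>{..<m}. rho R j \<le> rho R' j"
      proof
        fix j assume "j \<in> {..<m}"
        thus "rho R j \<le> rho R' j" using r d[of j] by (cases "j = k") (auto simp: rho_def)
      qed
    qed (use r k(1) in auto)
    hence "((\<Sum>j<m. rho R j) + 1) * (Tn + 1) \<le> (\<Sum>j<m. rho R' j) * (Tn + 1)" by (intro mult_right_mono) auto
    thus ?thesis unfolding tot_def YT by simp
  qed
  ultimately show ?thesis by blast
qed

lemma lp_step_LI:
  assumes L: "LI R H" and c: "lp_loop ((of_nat Tn, Lam), R, H)"
  shows "\<exists>R' H'. lp_step ((of_nat Tn, Lam), R, H) = ((of_nat Tn, Lam), R', H') \<and> LI R' H' \<and> tot R < tot R'"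
proof -
  have w: "wf R H" by (rule LID(1)[OF L])
  have lR: "length R = m" and ra: "\<And>j. j < m \<Longrightarrow> rowa (R ! j) = M ! j" using w unfolding wf_def by auto
  have sy: "sum_list (map rowy R) = (\<Sum>j<m. rowy (R ! j))"
    using lR by (simp add: sum_list_sum_nth atLeast0LessThan)
  obtain k where k: "k < m" "bad (cand R H) (R ! k)" "\<And>f. updf (bad (cand R H)) f R = R[k := f (R ! k)]"
    using updf_first[of R "bad (cand R H)"] c lR unfolding lp_loop_def by auto
  show ?thesis
  proof (cases "sum_list (map rowy R) < of_nat Tn")
    case True
    have "lp_step ((of_nat Tn, Lam), R, H) = ((of_nat Tn, Lam), R[k := (rowa (R ! k), rowd (R ! k), rowy (R ! k) + 1)], H)"
      using True by (simp add: lp_step_def Let_def k(3))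
    thus ?thesis using perceptron_step[OF L k(1)] k(2) True ra[OF k(1)] unfolding bad_def sy by simp
  next
    case False
    have "\<exists>r\<in>set R. big (of_nat Tn) R r"
    proof (rule ccontr)
      assume "\<not> ?thesis"
      hence "of_nat m * rowy (R ! j) < of_nat Tn" if "j < m" for j using that lR by (auto simp: big_def not_le)
      hence "(\<Sum>j<m. of_nat m * rowy (R ! j)) < (\<Sum>j<m. of_nat Tn)" using k(1) by (intro sum_strict_mono) auto
      hence "of_nat m * (\<Sum>j<m. rowy (R ! j)) < of_nat m * of_nat Tn" by (simp add: sum_distrib_left)
      thus False using False k(1) unfolding sy by (simp add: not_less)
    qed
    from updf_first[OF this] obtain i where i: "i < m" "big (of_nat Tn) R (R ! i)"
      "\<And>f. updf (big (of_nat Tn) R) f R = R[i := f (R ! i)]" "pivot (of_nat Tn) R = R ! i"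
      unfolding lR pivot_def by blast
    let ?h = "mv H (rowa (R ! i))" let ?s = "dot (rowa (R ! i)) ?h"
    have bi: "of_nat Tn \<le> of_nat m * rowy (R ! i)" using i(2) lR by (simp add: big_def)
    have ge: "of_nat Tn \<le> (\<Sum>j<m. rowy (R ! j))" using False unfolding sy by simp
    show ?thesis
    proof (cases "2 * rowd (R ! i) \<le> Lam")
      case True
      show ?thesis
        using rescale_step[OF L i(1) bi ge refl refl _ refl, of "2 * rowd (R ! i)" "1 / (3 * rowd (R ! i) * rowd (R ! i)) + ?s"]
          True \<open>\<not> sum_list (map rowy R) < of_nat Tn\<close> by (simp add: lp_step_def Let_def i(3,4))
    next
      case 2: False
      show ?thesis
        using rescale_step[OF L i(1) bi ge refl refl _ refl, of 0 ?s]
          2 False by (simp add: lp_step_def Let_def i(3,4))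
    qed
  qed
qed

lemma lp_init_LI: assumes "length us = n"
  shows "\<exists>R H. lp_init us M = ((of_nat Tn, Lam), R, H) \<and> LI R H"
proof -
  define R :: "row list" where "R = map (\<lambda>a. (a, 1, 0)) M"
  define H where "H = map (\<lambda>p. map (\<lambda>q. if fst p = fst q then 1 / lam else 0) (List.enumerate 0 us)) (List.enumerate 0 us)"
  have lam: "1 + sum_list (map (\<lambda>a. dot a a) M) = lam"
  proof -
    have "sum_list (map (\<lambda>a. dot a a) M) = (\<Sum>j<m. dot (M ! j) (M ! j))"
      using lenM by (simp add: sum_list_sum_nth atLeast0LessThan)
    also have "\<dots> = (\<Sum>j<m. \<Sum>l<n. of_int (z j l * z j l))"
    proof (rule sum.cong[OF refl])
      fix j assume "j \<in> {..<m}"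
      hence j: "j < m" by simp
      have "dot (M ! j) (M ! j) = ip n (a j) (nth (M ! j))" using dot_row[OF j lenrow[OF j]] .
      also have "\<dots> = ip n (a j) (a j)" by (rule ip_cong) (use a_nth j in auto)
      finally show "dot (M ! j) (M ! j) = (\<Sum>l<n. of_int (z j l * z j l))" by (simp add: ip_def a_def)
    qed
    finally show ?thesis by (simp add: lam_def lamz_def)
  qed
  have init: "lp_init us M = ((of_nat Tn, Lam), R, H)"
    unfolding lp_init_def Let_def lam R_def H_def using assms lenM by (simp add: Tn_def Lam_def)
  have Rn: "R ! j = (M ! j, 1, 0)" if "j < m" for j using that lenM by (simp add: R_def)
  have dH: "dims H" unfolding dims_def H_def using assms by (simp add: nth_enumerate_eq)
  have Hn: "H ! i ! j = (if i = j then 1 / lam else 0)" if "i < n" "j < n" for i j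
    using that assms by (simp add: H_def nth_enumerate_eq)
  have wt0: "wt R = (\<lambda>_. 0)" unfolding wt_def using Rn by auto
  have "LI R H"
  proof (rule LII[where gz = "\<lambda>_. 0" and J = "{}"])
    show "wf R H" unfolding wf_def using dH Rn lenM by (simp add: R_def)
    show "rowd (R ! j) = 0 \<or> (\<exists>e. rowd (R ! j) = 2 ^ e \<and> rowd (R ! j) \<le> Lam)" if "j < m" for j
      using Rn[OF that] Lam_ge_1 by (intro disjI2 exI[of _ 0]) simp
    show "\<exists>k. rowy (R ! j) = of_nat k \<and> (rowd (R ! j) = 0 \<longrightarrow> k = 0)" if "j < m" for j
      using Rn[OF that] by (intro exI[of _ 0]) simp
    show "rowd (R ! j) * ip n (a j) v \<le> 1" if "K0 v" "j < m" for v j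
      using K0_row_le_1[OF that] Rn[OF that(2)] by simp
    have Z: "{j. j < m \<and> rowd (R ! j) = 0} = {}" using Rn by auto
    have "Hinv (\<lambda>j. 0) {} {} (Hf H)"
      by (rule Hinv_cong[OF Hinv_init]) (simp add: Hn)
    thus "Hinv (\<lambda>j. of_int 0) {} {j. j < m \<and> rowd (R ! j) = 0} (Hf H)" unfolding Z of_int_0 .
    show "of_int 0 \<le> Lam * Lam" using Lam_ge_1 by simp
  qed (use Rn wt0 in \<open>auto simp: ip_def\<close>)
  thus ?thesis using init by blast
qed

text \<open>A row of positive scale that is not violated is strictly positive at the candidate. A
  row of scale 0 vanishes on the range of \<open>H\<close> and on the whole cone. Hence the support
  is maximal.\<close>

lemma lp_exit:
  assumes L: "LI R H" and c: "\<not> lp_loop ((of_nat Tn, Lam), R, H)" and j: "j < m"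
  shows "0 < dot (M ! j) (cand R H) \<or> (dot (M ! j) (cand R H) = 0 \<and> (\<forall>v. inC v \<longrightarrow> ip n (a j) v = 0))"
proof (cases "rowd (R ! j) = 0")
  case True
  obtain gz J where G: "Hinv (\<lambda>j. of_int (gz j)) J {j. j < m \<and> rowd (R ! j) = 0} (Hf H)" by (rule LIE[OF L]) blast
  have "dot (M ! j) (cand R H) = 0" unfolding dot_cand[OF LID(1)[OF L] j]
    by (rule HinvD(5)[OF G]) (use True j in simp)
  thus ?thesis using LID(6)[OF L _ j True] by blast
next
  case False
  have "0 < rowd (R ! j)" using LID(2)[OF L j] False by auto
  moreover have "R ! j \<in> set R" "rowa (R ! j) = M ! j" using LID(1)[OF L] j unfolding wf_def by auto
  ultimately show ?thesis using c unfolding lp_loop_def bad_def by force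
qed

end

section \<open>Polynomial time of the perceptron algorithm\<close>

lemma pt_nth0 [pt_intros]: assumes "pt D f" "pt D g" shows "pt D (\<lambda>s. nth0 (f s) (g s))"
  unfolding nth0_def
proof (rule pt_If)
  show "pt {x \<in> D. g x < length (f x)} (\<lambda>x. f x ! g x)"
    by (rule pt_nth) (use assms in \<open>auto elim: pt_subset\<close>)
qed (intro pt_intros assms)+

text \<open>Being the first element with \<open>P\<close> is expressed by comparing positions, which
  turns the recursion into a map, to which the closure rules apply.\<close>

lemma updf_enumerate:
  "updf P f xs = map (\<lambda>p. if P (snd p) \<and> (\<forall>q\<in>set (List.enumerate 0 xs). \<not> (fst q < fst p \<and> P (snd q)))
     then f (snd p) else snd p) (List.enumerate 0 xs)"
proof -
  have "map (\<lambda>p. if P (snd p) \<and> (\<forall>q\<in>set (List.enumerate n xs). \<not> (fst q < fst p \<and> P (snd q)))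
     then f (snd p) else snd p) (List.enumerate n xs) = updf P f xs" for n
  proof (induction xs arbitrary: n)
    case (Cons x xs)
    show ?case
    proof (cases "P x")
      case True
      have "map (\<lambda>p. if P (snd p) \<and> (\<forall>q\<in>set (List.enumerate n (x # xs)). \<not> (fst q < fst p \<and> P (snd q)))
         then f (snd p) else snd p) (List.enumerate (Suc n) xs) = map snd (List.enumerate (Suc n) xs)"
        using True by (intro map_cong refl) (auto simp: in_set_enumerate_eq)
      moreover have "\<forall>q\<in>set (List.enumerate n (x # xs)). \<not> (fst q < n \<and> P (snd q))"
        by (auto simp: in_set_enumerate_eq)
      ultimately show ?thesis using True by simp
    next
      case False
      have "map (\<lambda>p. if P (snd p) \<and> (\<forall>q\<in>set (List.enumerate n (x # xs)). \<not> (fst q < fst p \<and> P (snd q)))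
         then f (snd p) else snd p) (List.enumerate (Suc n) xs) = updf P f xs"
        unfolding Cons[of "Suc n", symmetric] using False by (intro map_cong refl) auto
      thus ?thesis using False by simp
    qed
  qed simp
  from this[of 0] show ?thesis ..
qed

lemma pt_comb [pt_intros]: assumes "pt D f" "pt D g" shows "pt D (\<lambda>s. comb (f s) (g s))"
proof -
  have "pt UNIV (\<lambda>s. comb (fst s) (snd s))" unfolding comb_def by (intro pt_intros)
  from pt_comp2[OF this assms] show ?thesis by simp
qed

lemma pt_mv [pt_intros]: assumes "pt D f" "pt D g" shows "pt D (\<lambda>s. mv (f s) (g s))"
proof -
  have "pt UNIV (\<lambda>s. mv (fst s) (snd s))" unfolding mv_def by (intro pt_intros)
  from pt_comp2[OF this assms] show ?thesis by simp
qed

lemma pt_cand [pt_intros]: "pt D f \<Longrightarrow> pt D g \<Longrightarrow> pt D (\<lambda>s. cand (f s) (g s))"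
  unfolding cand_def by (intro pt_intros)

lemma pt_bad [pt_intros]: "pt D f \<Longrightarrow> pt D g \<Longrightarrow> pt D (\<lambda>s. bad (f s) (g s))"
  unfolding bad_def by (intro pt_intros)

lemma pt_big [pt_intros]: "pt D f \<Longrightarrow> pt D g \<Longrightarrow> pt D h \<Longrightarrow> pt D (\<lambda>s. big (f s) (g s) (h s))"
  unfolding big_def by (intro pt_intros)

lemma pt_pivot [pt_intros]: assumes "pt D f" "pt D g" shows "pt D (\<lambda>s. pivot (f s) (g s))"
proof -
  have "pt UNIV (\<lambda>s. pivot (fst s) (snd s))" unfolding pivot_def by (intro pt_hd pt_intros) auto
  from pt_comp2[OF this assms] show ?thesis by simp
qed

lemma pt_rank1 [pt_intros]: assumes "pt D f" "pt D g" "pt D h" shows "pt D (\<lambda>s. rank1 (f s) (g s) (h s))"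
proof -
  have "pt UNIV (\<lambda>s. rank1 (fst s) (fst (snd s)) (snd (snd s)))" unfolding rank1_def by (intro pt_intros)
  from pt_comp[OF this pt_Pair[OF assms(1) pt_Pair[OF assms(2,3)]]] show ?thesis by simp
qed

lemma pt_lp_loop: "pt D lp_loop"
  unfolding lp_loop_def[abs_def] by (intro pt_intros)

lemma pt_lp_step: "pt D lp_step"
  unfolding lp_step_def[abs_def] Let_def updf_enumerate by (intro pt_intros)

lemma pt_lp_init: "pt D (\<lambda>p. lp_init (fst p) (snd p))"
  unfolding lp_init_def Let_def by (intro pt_intros)

definition lp_wf :: "rat list \<Rightarrow> rat list list \<Rightarrow> bool" where
  "lp_wf us M \<longleftrightarrow> (\<forall>a\<in>set M. length a = length us \<and> (\<forall>x\<in>set a. x \<in> \<int>))"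

definition zof :: "rat list list \<Rightarrow> nat \<Rightarrow> nat \<Rightarrow> int" where "zof M j l = \<lfloor>M ! j ! l\<rfloor>"

lemma lp_wf_lpm: assumes "lp_wf us M" shows "lpm (length us) (length M) (zof M) M"
proof
  fix j l assume j: "j < length M"
  show "length (M ! j) = length us" using assms j unfolding lp_wf_def by auto
  assume "l < length us"
  hence "M ! j ! l \<in> \<int>" using assms j unfolding lp_wf_def by (metis nth_mem)
  thus "M ! j ! l = of_int (zof M j l)" unfolding zof_def by (elim Ints_cases) simp
qed simp

definition hsz :: "nat \<Rightarrow> nat" where
  "hsz s = 2 * ((s + s) * ((2 * s + 1) + s + (2 * s + 2)) + 2) + 1"

text \<open>The first line of summands bounds the size of a state, with room for the threshold pair,
  the rows and the matrix; the second bounds the number of rounds. The rule for loops asks for one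
  polynomial serving both purposes.\<close>

definition lpsz :: "nat \<Rightarrow> nat" where
  "lpsz s = s + (s * ((s + (s + 4) + (8 * s * s * s + 4) + 2) + 4) + 3) + (s * ((s * (hsz s + 4) + 3) + 4) + 3) + 2
     + s * (s + 1) * (8 * s * s * s + 1) + 8 * s * s * s + 1"

lemma polyb_lpsz: "polyb lpsz"
  unfolding lpsz_def[abs_def] hsz_def by (intro polyb_add polyb_mult polyb_id polyb_const)

context lpm
begin

lemma lamz_le_Lz: "lamz \<le> Lz"
proof -
  have "1 * lamz \<le> 2 * (int n + 1) * lamz" using lamz_pos by (intro mult_right_mono) auto
  also have "\<dots> \<le> (2 * (int n + 1) * lamz) ^ (n + 1)"
  proof (rule self_le_power)
    have "1 * 1 \<le> (2 * (int n + 1)) * lamz" by (rule mult_mono) (use lamz_pos in auto)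
    thus "1 \<le> 2 * (int n + 1) * lamz" by (simp only: mult_1)
  qed simp
  finally show ?thesis unfolding Lz_def by simp
qed

lemma Tn_le: assumes "m \<le> s" "n \<le> s" shows "Tn \<le> 8 * s * s * s"
proof -
  have "4 * m * m * (n + m) \<le> 4 * s * s * (s + s)" using assms by (intro mult_mono) auto
  also have "\<dots> = 8 * s * s * s" by (simp add: algebra_simps)
  finally show ?thesis unfolding Tn_def .
qed

lemma H_entry_size:
  assumes L: "LI R H" and s: "m \<le> s" "n \<le> s" "bits Lz \<le> s" and ij: "i < n" "j < n"
  shows "sz (H ! i ! j) \<le> hsz s"
proof -
  obtain gz J where G: "Hinv (\<lambda>j. of_int (gz j)) J {j. j < m \<and> rowd (R ! j) = 0} (Hf H)"
    "\<And>j. j < m \<Longrightarrow> rat_of_int (gz j) \<le> Lam * Lam" by (rule LIE[OF L]) blast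
  have gb: "\<bar>gz j\<bar> \<le> Lz * Lz" if "j < m" for j
  proof -
    have "0 \<le> gz j" using HinvD(1)[OF G(1) that] by simp
    moreover have "rat_of_int (gz j) \<le> of_int (Lz * Lz)" using G(2)[OF that] unfolding Lam_Lz by simp
    hence "gz j \<le> Lz * Lz" by (simp only: of_int_le_iff)
    ultimately show ?thesis by simp
  qed
  define Bd where "Bd = (int (n + m) * (lamz * (Lz * Lz + 1))) ^ (n + m)"
  obtain \<Delta> :: int where \<Delta>: "\<Delta> \<noteq> 0" "\<bar>\<Delta>\<bar> \<le> Bd" "\<forall>i<n. \<exists>y::int. of_int \<Delta> * H ! i ! j = of_int y \<and> \<bar>y\<bar> \<le> Bd"
    using H_size[OF G(1) gb _ ij(2)] unfolding Bd_def by auto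
  obtain y :: int where y: "of_int \<Delta> * H ! i ! j = of_int y" "\<bar>y\<bar> \<le> Bd" using \<Delta>(3) ij(1) by blast
  have "H ! i ! j = of_int y / of_int \<Delta>" using y(1) \<Delta>(1) by (simp add: field_simps)
  hence 1: "sz (H ! i ! j) \<le> bits y + bits \<Delta> + 1" using \<Delta>(1) by (rule rat_size)
  have 2: "bits y \<le> bits Bd" "bits \<Delta> \<le> bits Bd" using y(2) \<Delta>(2) by (auto intro!: bits_mono)
  have 3: "bits lamz \<le> s" using bits_mono[of lamz Lz] lamz_le_Lz lamz_pos s(3) by linarith
  have "bits (int (n + m) * (lamz * (Lz * Lz + 1))) \<le> bits (int (n + m)) + (bits lamz + (bits Lz + bits Lz + bits 1))"
    using bits_mult[of "int (n + m)" "lamz * (Lz * Lz + 1)"] bits_mult[of lamz "Lz * Lz + 1"] bits_add[of "Lz * Lz" 1]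
      bits_mult[of Lz Lz] by linarith
  also have "\<dots> \<le> (2 * s + 1) + s + (2 * s + 2)"
    using bits_of_nat_le[of "n + m"] s 3 bits_1 by linarith
  finally have 4: "bits (int (n + m) * (lamz * (Lz * Lz + 1))) \<le> (2 * s + 1) + s + (2 * s + 2)" .
  have "bits Bd \<le> (n + m) * bits (int (n + m) * (lamz * (Lz * Lz + 1))) + 2" unfolding Bd_def by (rule bits_power)
  also have "\<dots> \<le> (s + s) * ((2 * s + 1) + s + (2 * s + 2)) + 2" by (intro add_mono mult_mono 4) (use s in auto)
  finally have 5: "bits Bd \<le> (s + s) * ((2 * s + 1) + s + (2 * s + 2)) + 2" .
  have "sz (H ! i ! j) \<le> 2 * bits Bd + 1" using 1 2 by linarith
  also have "\<dots> \<le> hsz s" unfolding hsz_def by (rule add_mono[OF mult_left_mono[OF 5]]) auto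
  finally show ?thesis .
qed

lemma state_size:
  assumes L: "LI R H" and s: "m \<le> s" "n \<le> s" "bits Lz \<le> s" "\<And>j. j < m \<Longrightarrow> sz (M ! j) \<le> s" "sz c \<le> s"
  shows "sz (c, R, H) \<le> lpsz s"
proof -
  have w: "wf R H" by (rule LID(1)[OF L])
  have l: "length R = m" "length H = n" using w unfolding wf_def dims_def by auto
  have "sz R \<le> length R * ((s + (s + 4) + (8 * s * s * s + 4) + 2) + 4) + 3"
  proof (rule sz_list_le)
    fix r assume "r \<in> set R"
    then obtain j where j: "j < m" "r = R ! j" using l by (auto simp: in_set_conv_nth)
    have 1: "sz (rowa r) \<le> s" using s(4)[OF j(1)] w j unfolding wf_def by simp
    have 2: "sz (rowd r) \<le> s + 4"
    proof (cases "rowd r = 0")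
      case True thus ?thesis using rat_size[of 0 0 1] by simp
    next
      case False
      then obtain e where e: "rowd r = 2 ^ e" "rowd r \<le> of_int Lz" using LID(2)[OF L j(1)] j(2) unfolding Lam_Lz by auto
      have i: "rowd r = of_int (2 ^ e)" using e(1) by simp
      have "(2::int) ^ e \<le> Lz" "0 \<le> (2::int) ^ e" using e(2) unfolding i by (simp_all only: of_int_le_iff) simp
      hence "\<bar>(2::int) ^ e\<bar> \<le> \<bar>Lz\<bar>" by linarith
      hence "bits (2 ^ e) \<le> s" by (rule order.trans[OF bits_mono s(3)])
      thus ?thesis using rat_size[of "rowd r" "2 ^ e" 1] i by simp
    qed
    have 3: "sz (rowy r) \<le> 8 * s * s * s + 4"
    proof -
      obtain k where k: "rowy r = of_nat k" using LID(3)[OF L j(1)] j(2) by blast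
      have "rowy r \<le> (\<Sum>j<m. rowy (R ! j))" unfolding j(2)
        using j(1) LID(3)[OF L] by (intro member_le_sum[of j "{..<m}" "\<lambda>j. rowy (R ! j)"]) fastforce+
      hence "rat_of_nat k \<le> of_nat Tn" using LID(4)[OF L] k by linarith
      hence "k \<le> 8 * s * s * s" using Tn_le[OF s(1,2)] by simp
      moreover have "sz (rowy r) \<le> bits (int k) + bits 1 + 1" by (rule rat_size) (simp_all add: k)
      ultimately show ?thesis using bits_of_nat_le[of k] bits_1 by linarith
    qed
    show "sz r \<le> s + (s + 4) + (8 * s * s * s + 4) + 2" using 1 2 3 by (simp add: sz_prod)
  qed
  also have "\<dots> \<le> s * ((s + (s + 4) + (8 * s * s * s + 4) + 2) + 4) + 3" using l s(1) by (intro add_mono mult_right_mono) auto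
  finally have R: "sz R \<le> s * ((s + (s + 4) + (8 * s * s * s + 4) + 2) + 4) + 3" .
  have "sz H \<le> length H * ((s * (hsz s + 4) + 3) + 4) + 3"
  proof (rule sz_list_le)
    fix h assume "h \<in> set H"
    then obtain i where i: "i < n" "h = H ! i" using l by (auto simp: in_set_conv_nth)
    have lh: "length h = n" using w i unfolding wf_def dims_def by simp
    have "sz h \<le> length h * (hsz s + 4) + 3"
    proof (rule sz_list_le)
      fix x assume "x \<in> set h"
      then obtain j where "j < n" "x = H ! i ! j" using lh i by (auto simp: in_set_conv_nth)
      thus "sz x \<le> hsz s" using H_entry_size[OF L s(1-3) i(1)] by simp
    qed
    also have "\<dots> \<le> s * (hsz s + 4) + 3" using lh s(2) by (intro add_mono mult_right_mono) auto
    finally show "sz h \<le> s * (hsz s + 4) + 3" .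
  qed
  also have "\<dots> \<le> s * ((s * (hsz s + 4) + 3) + 4) + 3" using l s(2) by (intro add_mono mult_right_mono) auto
  finally have "sz H \<le> s * ((s * (hsz s + 4) + 3) + 4) + 3" .
  thus ?thesis using R s(5) unfolding lpsz_def by simp
qed

lemma init_sizes:
  assumes L: "LI R H"
  shows "m \<le> sz ((of_nat Tn :: rat, Lam), R, H)" "n \<le> sz ((of_nat Tn :: rat, Lam), R, H)"
    "bits Lz \<le> sz ((of_nat Tn :: rat, Lam), R, H)" "\<And>j. j < m \<Longrightarrow> sz (M ! j) \<le> sz ((of_nat Tn :: rat, Lam), R, H)"
    "sz (of_nat Tn :: rat, Lam) \<le> sz ((of_nat Tn :: rat, Lam), R, H)"
proof -
  have w: "length R = m" "length H = n" "\<And>j. j < m \<Longrightarrow> rowa (R ! j) = M ! j"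
    using LID(1)[OF L] unfolding wf_def dims_def by auto
  show "m \<le> sz ((of_nat Tn :: rat, Lam), R, H)" "n \<le> sz ((of_nat Tn :: rat, Lam), R, H)"
    using length_le_sz[of R] length_le_sz[of H] w by simp_all
  have "sz Lam = bits Lz + bits 1 + 1" unfolding Lam_Lz by (simp add: enc_rat_def enc_prod_def enc_int_def)
  thus "bits Lz \<le> sz ((of_nat Tn :: rat, Lam), R, H)" by simp
  show "sz (M ! j) \<le> sz ((of_nat Tn :: rat, Lam), R, H)" if "j < m" for j
  proof -
    have "sz (M ! j) \<le> sz (R ! j)" using w(3)[OF that] by (simp add: sz_prod[of "R ! j"])
    also have "\<dots> \<le> sz R" using that w(1) by (intro sz_member) simp
    finally show ?thesis by simp
  qed
qed simp

lemma lp_while: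
  assumes L: "LI R H"
  shows "\<exists>R' H'. while lp_loop lp_step ((of_nat Tn, Lam), R, H) = ((of_nat Tn, Lam), R', H') \<and>
    LI R' H' \<and> \<not> lp_loop ((of_nat Tn, Lam), R', H')"
  using L
proof (induction "m * (bits Lz + 1) * (Tn + 1) + Tn + 1 - tot R" arbitrary: R H rule: less_induct)
  case less
  show ?case
  proof (cases "lp_loop ((of_nat Tn, Lam), R, H)")
    case True
    obtain R' H' where S: "lp_step ((of_nat Tn, Lam), R, H) = ((of_nat Tn, Lam), R', H')" "LI R' H'" "tot R < tot R'"
      using lp_step_LI[OF less.prems True] by blast
    have "m * (bits Lz + 1) * (Tn + 1) + Tn + 1 - tot R' < m * (bits Lz + 1) * (Tn + 1) + Tn + 1 - tot R"
      using S(3) tot_le[OF S(2)] by linarith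
    from less.hyps[OF this S(2)] show ?thesis using True S(1) by (subst while_unfold) simp
  next
    case False
    thus ?thesis using less.prems by (subst while_unfold) auto
  qed
qed

lemma lp_correct:
  assumes "length us = n"
  shows "length (lp us M) = n" "\<And>j. j < m \<Longrightarrow> 0 < dot (M ! j) (lp us M) \<or>
    (dot (M ! j) (lp us M) = 0 \<and> (\<forall>v. inC v \<longrightarrow> ip n (a j) v = 0))"
proof -
  obtain R H where i: "lp_init us M = ((of_nat Tn, Lam), R, H)" "LI R H" using lp_init_LI[OF assms] by blast
  obtain R' H' where w: "while lp_loop lp_step ((of_nat Tn, Lam), R, H) = ((of_nat Tn, Lam), R', H')"
    and L: "LI R' H'" "\<not> lp_loop ((of_nat Tn, Lam), R', H')" using lp_while[OF i(2)] by blast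
  have e: "lp us M = cand R' H'" unfolding lp_def Let_def i(1) w by simp
  show "length (lp us M) = n" unfolding e by (rule cand_nth(1)[OF LID(1)[OF L(1)]])
  show "0 < dot (M ! j) (lp us M) \<or> (dot (M ! j) (lp us M) = 0 \<and> (\<forall>v. inC v \<longrightarrow> ip n (a j) v = 0))" if "j < m" for j
    unfolding e by (rule lp_exit[OF L that])
qed

end

theorem lp_max_support:
  assumes "lp_wf us M"
  shows "length (lp us M) = length us"
    "\<And>r. r \<in> set M \<Longrightarrow> 0 \<le> dot r (lp us M)"
    "\<And>r x. r \<in> set M \<Longrightarrow> length x = length us \<Longrightarrow> (\<And>b. b \<in> set M \<Longrightarrow> 0 \<le> dot b x) \<Longrightarrow> 0 < dot r x \<Longrightarrow> 0 < dot r (lp us M)"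
proof -
  interpret lpm "length us" "length M" "zof M" M by (rule lp_wf_lpm[OF assms])
  note c = lp_correct[OF refl]
  show "length (lp us M) = length us" by (rule c(1))
  show "0 \<le> dot r (lp us M)" if rM: "r \<in> set M" for r
  proof -
    obtain j where j: "j < length M" "r = M ! j" using rM by (auto simp: in_set_conv_nth)
    show ?thesis using c(2)[OF j(1)] unfolding j(2) by linarith
  qed
  fix r x assume a: "r \<in> set M" and x: "length x = length us" "\<And>b. b \<in> set M \<Longrightarrow> 0 \<le> dot b x" "0 < dot r x"
  obtain j where j: "j < length M" "r = M ! j" using a by (auto simp: in_set_conv_nth)
  have "inC (nth x)" unfolding inC_def
  proof (intro allI impI)
    fix i assume i: "i < length M"
    show "0 \<le> ip (length us) (a i) (nth x)" using x(2)[OF nth_mem[OF i]] dot_row[OF i x(1)] by simp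
  qed
  moreover have "ip (length us) (a j) (nth x) \<noteq> 0" using x(3) dot_row[OF j(1) x(1)] j(2) by simp
  ultimately show "0 < dot r (lp us M)" using c(2)[OF j(1)] j(2) by blast
qed

lemma pt_lp: "pt {p. lp_wf (fst p) (snd p)} (\<lambda>p. lp (fst p) (snd p))"
proof -
  define D where "D = (\<lambda>p. lp_init (fst p) (snd p)) ` {p. lp_wf (fst p) (snd p)}"
  \<comment> \<open>The loop sees only states, whereas invariant and measure mention the matrix of
    the system; \<open>W\<close> recovers some input with initial state \<open>x\<close>.\<close>
  define W where "W x = (SOME p. lp_wf (fst p) (snd p) \<and> x = lp_init (fst p) (snd p))" for x
  have W: "lp_wf (fst (W x)) (snd (W x)) \<and> x = lp_init (fst (W x)) (snd (W x))" if x: "x \<in> D" for x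
  proof -
    obtain p where p: "lp_wf (fst p) (snd p) \<and> x = lp_init (fst p) (snd p)" using x unfolding D_def by blast
    show ?thesis unfolding W_def by (rule someI[of "\<lambda>p. lp_wf (fst p) (snd p) \<and> x = lp_init (fst p) (snd p)", OF p])
  qed
  define n where "n x = length (fst (W x))" for x
  define m where "m x = length (snd (W x))" for x
  define M where "M x = snd (W x)" for x
  define I where "I x y \<longleftrightarrow> fst y = fst x \<and> lpm.LI (n x) (m x) (zof (M x)) (M x) (fst (snd y)) (snd (snd y))" for x y
  define \<mu> where "\<mu> x y = m x * (bits (lpm.Lz (n x) (m x) (zof (M x))) + 1) * (lpm.Tn (n x) (m x) + 1) + lpm.Tn (n x) (m x) + 1
     - lpm.tot (n x) (m x) (zof (M x)) (fst (snd y))" for x and y :: lpstate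
  have "pt D (while lp_loop lp_step)"
  proof (rule pt_while[where E = UNIV and p = lpsz and I = I and \<mu> = \<mu>])
    fix x assume x: "x \<in> D"
    interpret lpm "n x" "m x" "zof (M x)" "M x" unfolding n_def m_def M_def by (rule lp_wf_lpm) (use W[OF x] in simp)
    obtain R H where RH: "x = ((of_nat Tn, Lam), R, H)" "LI R H"
      using lp_init_LI[of "fst (W x)"] W[OF x] unfolding n_def M_def by auto
    note s = init_sizes[OF RH(2), folded RH(1)]
    have fx: "fst x = (of_nat Tn, Lam)" "fst (snd x) = R" "snd (snd x) = H" by (subst RH(1), simp)+
    have "\<mu> x x \<le> m x * (bits Lz + 1) * (Tn + 1) + Tn + 1" unfolding \<mu>_def by simp
    also have "\<dots> \<le> sz x * (sz x + 1) * (8 * sz x * sz x * sz x + 1) + 8 * sz x * sz x * sz x + 1"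
      using s Tn_le[OF s(1,2)] by (intro add_mono mult_mono) auto
    also have "\<dots> \<le> lpsz (sz x)" unfolding lpsz_def by simp
    finally show "I x x \<and> \<mu> x x \<le> lpsz (sz x)" using RH(2) unfolding I_def fx by simp
    fix y assume y: "I x y"
    have yL: "LI (fst (snd y)) (snd (snd y))" using y unfolding I_def by simp
    have yy: "y = ((of_nat Tn, Lam), fst (snd y), snd (snd y))" using y unfolding I_def fx(1) by (metis prod.collapse)
    show "y \<in> UNIV \<and> sz y \<le> lpsz (sz x)"
      using state_size[OF yL s(1,2,3,4,5)] by (subst yy) simp
    assume c: "lp_loop y"
    obtain R' H' where S: "lp_step y = ((of_nat Tn, Lam), R', H')" "LI R' H'" "tot (fst (snd y)) < tot R'"
      using lp_step_LI[OF yL] c yy[symmetric] by auto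
    show "I x (lp_step y) \<and> \<mu> x (lp_step y) < \<mu> x y"
      using S tot_le[OF S(2)] unfolding I_def \<mu>_def fx(1) by auto
  qed (auto intro: pt_lp_loop pt_lp_step polyb_lpsz)
  hence "pt {p. lp_wf (fst p) (snd p)} (\<lambda>p. while lp_loop lp_step (lp_init (fst p) (snd p)))"
    by (rule pt_comp[OF _ pt_lp_init]) (auto simp: D_def)
  thus ?thesis unfolding lp_def Let_def by (intro pt_intros)
qed

section \<open>Strongly connected components\<close>

abbreviation src :: "'q transition \<Rightarrow> 'q" where "src e \<equiv> fst e"
abbreviation eff :: "'q transition \<Rightarrow> int vec" where "eff e \<equiv> fst (snd e)"
abbreviation tgt :: "'q transition \<Rightarrow> 'q" where "tgt e \<equiv> snd (snd e)"

definition edges :: "'q transition set \<Rightarrow> ('q \<times> 'q) set" where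
  "edges T = {(r, s). \<exists>u. (r, u, s) \<in> T}"

lemma edges_mono: "T \<subseteq> T' \<Longrightarrow> edges T \<subseteq> edges T'" unfolding edges_def by auto

lemma in_edges_iff: "(p, q) \<in> edges T \<longleftrightarrow> (\<exists>e\<in>T. src e = p \<and> tgt e = q)" unfolding edges_def by force

text \<open>With the irreflexive closure a state on no cycle has an empty class. This matches the
  requirement that a component has an outgoing transition at each of its states.\<close>

definition mutual :: "'q transition set \<Rightarrow> 'q \<Rightarrow> 'q set" where
  "mutual T q = {r. (q, r) \<in> (edges T)\<^sup>+ \<and> (r, q) \<in> (edges T)\<^sup>+}"

definition component :: "'q transition set \<Rightarrow> 'q \<Rightarrow> 'q vass" where
  "component T q = (mutual T q, {e \<in> T. src e \<in> mutual T q \<and> tgt e \<in> mutual T q})"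

text \<open>Every state on a path between two members of the class reaches \<open>q\<close> and is
  reached from \<open>q\<close>, so the path never leaves the class.\<close>

lemma trancl_in_mutual:
  assumes "(x, y) \<in> (edges T)\<^sup>+" "x \<in> mutual T q" "y \<in> mutual T q"
  shows "(x, y) \<in> (edges (snd (component T q)))\<^sup>+"
proof -
  let ?E = "(edges T)\<^sup>+"
  have "(y, q) \<in> ?E \<Longrightarrow> (x, y) \<in> (edges (snd (component T q)))\<^sup>+" using assms(1)
  proof (induction rule: trancl_induct)
    case (base y)
    have "(q, y) \<in> ?E" using assms(2) base(1) unfolding mutual_def by (auto intro: trancl_into_trancl)
    hence "(x, y) \<in> edges (snd (component T q))"
      using assms(2) base unfolding component_def in_edges_iff by (fastforce simp: mutual_def in_edges_iff)
    thus ?case by blast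
  next
    case (step y s)
    have ys: "(y, q) \<in> ?E" using step(2,4) by (meson trancl_into_trancl2)
    have qx: "(q, x) \<in> ?E" using assms(2) unfolding mutual_def by simp
    have "(q, y) \<in> ?E" using trancl_trans[OF qx step(1)] .
    moreover have "(q, s) \<in> ?E" using trancl_into_trancl[OF calculation step(2)] .
    ultimately have "y \<in> mutual T q" "s \<in> mutual T q" using ys step(4) unfolding mutual_def by auto
    hence "(y, s) \<in> edges (snd (component T q))" using step(2) unfolding component_def by (auto simp: in_edges_iff)
    thus ?case using step(3)[OF ys] by (rule trancl_into_trancl[rotated])
  qed
  thus ?thesis using assms(3) unfolding mutual_def by blast
qed

lemma comp_scc:
  assumes G: "finite Q" "finite T" "T \<subseteq> Q \<times> carrier_vec d \<times> Q" and q: "(q, q) \<in> (edges T)\<^sup>+"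
  shows "sub_vass d (component T q) (Q, T)" "strongly_connected (component T q)" "q \<in> mutual T q"
proof -
  let ?E = "(edges T)\<^sup>+"
  have EQ: "?E \<subseteq> Q \<times> Q"
  proof (rule trancl_subset_Sigma)
    show "edges T \<subseteq> Q \<times> Q" using G(3) unfolding edges_def by auto
  qed
  show qm: "q \<in> mutual T q" using q unfolding mutual_def by simp
  have mQ: "mutual T q \<subseteq> Q" using EQ unfolding mutual_def by auto
  have out: "\<exists>u s. (r, u, s) \<in> snd (component T q)" if r: "r \<in> mutual T q" for r
  proof -
    have "(r, q) \<in> ?E" using r unfolding mutual_def by simp
    then obtain s where s: "(r, s) \<in> edges T" "(s, q) \<in> (edges T)\<^sup>*" by (auto dest: tranclD)
    have "(q, s) \<in> ?E" using r s(1) unfolding mutual_def by (auto intro: trancl_into_trancl)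
    moreover have "(s, q) \<in> ?E" using s(2) q by (meson rtrancl_trancl_trancl)
    ultimately have "s \<in> mutual T q" unfolding mutual_def by simp
    thus ?thesis using r s(1) unfolding edges_def component_def by auto
  qed
  show "sub_vass d (component T q) (Q, T)"
    unfolding sub_vass_def is_vass_def component_def
    using G mQ qm out finite_subset[OF mQ G(1)] by (fastforce simp: component_def)
  show "strongly_connected (component T q)"
    unfolding strongly_connected_def component_def prod.case
  proof (intro ballI)
    fix r s assume rs: "r \<in> mutual T q" "s \<in> mutual T q"
    have "(r, s) \<in> ?E" using rs unfolding mutual_def by (auto intro: trancl_trans)
    from trancl_in_mutual[OF this rs] show "(r, s) \<in> {(r, s). \<exists>u. (r, u, s) \<in> {e \<in> T. src e \<in> mutual T q \<and> tgt e \<in> mutual T q}}\<^sup>+"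
      unfolding edges_def component_def by simp
  qed
qed

lemma connected_sub_comp:
  assumes C: "sub_vass d C (Q, T)" "strongly_connected C" and q: "q \<in> fst C"
  shows "(q, q) \<in> (edges T)\<^sup>+" "fst C \<subseteq> mutual T q" "snd C \<subseteq> snd (component T q)"
proof -
  have sub: "edges (snd C) \<subseteq> edges T" using C(1) unfolding sub_vass_def by (intro edges_mono) simp
  have con: "(r, s) \<in> (edges T)\<^sup>+" if "r \<in> fst C" "s \<in> fst C" for r s
  proof -
    have "(r, s) \<in> (edges (snd C))\<^sup>+" using C(2) that unfolding strongly_connected_def edges_def by (cases C) auto
    thus ?thesis using trancl_mono sub by blast
  qed
  show "(q, q) \<in> (edges T)\<^sup>+" using con q by blast
  show m: "fst C \<subseteq> mutual T q" using con q unfolding mutual_def by blast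
  have "snd C \<subseteq> fst C \<times> carrier_vec d \<times> fst C" "snd C \<subseteq> T"
    using C(1) unfolding sub_vass_def is_vass_def by (auto split: prod.splits)
  thus "snd C \<subseteq> snd (component T q)" using m unfolding component_def by fastforce
qed

theorem sccs_eq:
  assumes G: "finite Q" "finite T" "T \<subseteq> Q \<times> carrier_vec d \<times> Q"
  shows "sccs d (Q, T) = component T ` {q \<in> Q. (q, q) \<in> (edges T)\<^sup>+}"
proof (intro equalityI subsetI)
  fix B assume B: "B \<in> sccs d (Q, T)"
  hence b: "sub_vass d B (Q, T)" "strongly_connected B"
    "\<And>C. sub_vass d C (Q, T) \<Longrightarrow> strongly_connected C \<Longrightarrow> sub_vass d B C \<Longrightarrow> C = B" unfolding sccs_def by auto
  obtain q where q: "q \<in> fst B" "q \<in> Q" using b(1) unfolding sub_vass_def is_vass_def by (cases B) auto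
  note c = connected_sub_comp[OF b(1,2) q(1)]
  note s = comp_scc[OF G c(1)]
  have "sub_vass d B (component T q)" using b(1) c(2,3) unfolding sub_vass_def component_def by simp
  hence "component T q = B" by (rule b(3)[OF s(1,2)])
  thus "B \<in> component T ` {q \<in> Q. (q, q) \<in> (edges T)\<^sup>+}" using q(2) c(1) by blast
next
  fix B assume "B \<in> component T ` {q \<in> Q. (q, q) \<in> (edges T)\<^sup>+}"
  then obtain q where q: "(q, q) \<in> (edges T)\<^sup>+" and B: "B = component T q" by blast
  note s = comp_scc[OF G q]
  have "C = component T q" if C: "sub_vass d C (Q, T)" "strongly_connected C" "sub_vass d (component T q) C" for C
  proof -
    have "fst (component T q) \<subseteq> fst C" "snd (component T q) \<subseteq> snd C" using C(3) unfolding sub_vass_def by auto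
    moreover from this have "q \<in> fst C" using s(3) unfolding component_def by auto
    note connected_sub_comp[OF C(1,2) this]
    ultimately show ?thesis by (intro prod_eqI) (auto simp: component_def)
  qed
  thus "B \<in> sccs d (Q, T)" unfolding B sccs_def using s by blast
qed

section \<open>Computing the components by repeated extension of paths\<close>

definition pairs :: "nat list \<Rightarrow> (nat \<times> nat) list" where
  "pairs Qs = concat (map (\<lambda>p. map (\<lambda>q. (p, q)) Qs) Qs)"

definition linked :: "nat transition list \<Rightarrow> nat \<times> nat \<Rightarrow> bool" where
  "linked Ts r \<longleftrightarrow> (\<exists>e\<in>set Ts. src e = fst r \<and> tgt e = snd r)"

definition has :: "(nat \<times> nat) list \<Rightarrow> nat \<Rightarrow> nat \<Rightarrow> bool" where
  "has R p q \<longleftrightarrow> (\<exists>r\<in>set R. fst r = p \<and> snd r = q)"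

definition extend :: "nat list \<Rightarrow> nat transition list \<Rightarrow> (nat \<times> nat) list \<Rightarrow> (nat \<times> nat) list" where
  "extend Qs Ts R = filter (\<lambda>r. has R (fst r) (snd r) \<or> (\<exists>e\<in>set Ts. has R (fst r) (src e) \<and> tgt e = snd r)) (pairs Qs)"

definition reach :: "nat list \<Rightarrow> nat transition list \<Rightarrow> (nat \<times> nat) list" where
  "reach Qs Ts = fold (\<lambda>_. extend Qs Ts) Ts (filter (linked Ts) (pairs Qs))"

definition cls :: "nat list \<Rightarrow> (nat \<times> nat) list \<Rightarrow> nat \<Rightarrow> nat list" where
  "cls Qs R q = filter (\<lambda>r. has R q r \<and> has R r q) Qs"

definition restr :: "nat transition list \<Rightarrow> nat list \<Rightarrow> nat transition list" where
  "restr Ts C = filter (\<lambda>e. (\<exists>q\<in>set C. q = src e) \<and> (\<exists>q\<in>set C. q = tgt e)) Ts"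

text \<open>A component is listed only for that one of its states which comes first in
  \<open>Qs\<close>, so none is repeated. The appended \<open>[q]\<close> merely makes
  \<open>hd\<close> total.\<close>

definition scc_list :: "nat list \<Rightarrow> nat transition list \<Rightarrow> (nat list \<times> nat transition list) list" where
  "scc_list Qs Ts = (let R = reach Qs Ts in
     map (\<lambda>q. (cls Qs R q, restr Ts (cls Qs R q))) (filter (\<lambda>q. has R q q \<and> hd (cls Qs R q @ [q]) = q) Qs))"

lemma set_pairs: "set (pairs Qs) = set Qs \<times> set Qs" unfolding pairs_def by auto

lemma has_iff [simp]: "has R p q \<longleftrightarrow> (p, q) \<in> set R" unfolding has_def by force

text \<open>After \<open>k\<close> rounds the list contains the pairs joined by a path of at most
  \<open>k + 1\<close> edges. A shortest path has no more edges than there are in the graph, so one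
  round per listed transition suffices.\<close>

lemma set_reach:
  assumes T: "set Ts \<subseteq> set Qs \<times> UNIV \<times> set Qs"
  shows "set (reach Qs Ts) = (edges (set Ts))\<^sup>+"
proof -
  let ?E = "edges (set Ts)"
  have EQ: "?E \<subseteq> set Qs \<times> set Qs" using T unfolding edges_def by auto
  have TQ: "ntrancl k ?E \<subseteq> set Qs \<times> set Qs" for k
  proof -
    have "ntrancl k ?E \<subseteq> ?E\<^sup>+" unfolding ntrancl_def by (auto simp: trancl_power)
    thus ?thesis using trancl_subset_Sigma[OF EQ] by blast
  qed
  have lk: "linked Ts r \<longleftrightarrow> r \<in> ?E" for r by (cases r) (simp add: linked_def in_edges_iff)
  have r0: "set (filter (linked Ts) (pairs Qs)) = ntrancl 0 ?E"
    using EQ unfolding ntrancl_Zero by (auto simp: set_pairs lk)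
  have st: "set (extend Qs Ts R) = ntrancl (Suc k) ?E" if "set R = ntrancl k ?E" for R k
  proof -
    have "set (extend Qs Ts R) = (set Qs \<times> set Qs) \<inter> (ntrancl k ?E \<union> ntrancl k ?E O ?E)"
    proof -
      have *: "(\<exists>e\<in>set Ts. (p, src e) \<in> N \<and> tgt e = q) \<longleftrightarrow> (p, q) \<in> N O ?E" for p q N
        by (auto simp: relcomp_unfold in_edges_iff)
      show ?thesis unfolding extend_def set_filter has_iff * that set_pairs by auto
    qed
    moreover have "ntrancl (Suc k) ?E = ntrancl k ?E \<union> ntrancl k ?E O ?E" unfolding ntrancl_Suc by auto
    ultimately show ?thesis using TQ[of "Suc k"] by auto
  qed
  have "set (fold (\<lambda>_. extend Qs Ts) xs R) = ntrancl (k + length xs) ?E" if "set R = ntrancl k ?E"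
    for xs :: "nat transition list" and R k
    using that
  proof (induction xs arbitrary: R k)
    case (Cons x xs)
    from Cons.IH[OF st[OF Cons.prems]] show ?case by simp
  qed simp
  from this[OF r0] have 1: "set (reach Qs Ts) = ntrancl (length Ts) ?E" unfolding reach_def by simp
  have fE: "finite ?E" using EQ finite_subset by blast
  have "?E = (\<lambda>e. (src e, tgt e)) ` set Ts" unfolding edges_def by force
  hence "card ?E \<le> length Ts" using card_image_le[of "set Ts" "\<lambda>e. (src e, tgt e)"] card_length[of Ts] by simp
  hence "ntrancl (card ?E - 1) ?E \<subseteq> ntrancl (length Ts) ?E" unfolding ntrancl_def by auto
  moreover have "ntrancl (length Ts) ?E \<subseteq> ?E\<^sup>+" unfolding ntrancl_def by (auto simp: trancl_power)
  ultimately show ?thesis using finite_trancl_ntranl[OF fE] 1 by blast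
qed

lemma scc_list_correct:
  assumes Q: "distinct Qs" and T: "distinct Ts" "set Ts \<subseteq> set Qs \<times> carrier_vec d \<times> set Qs"
  shows "map (\<lambda>B. (set (fst B), set (snd B))) (scc_list Qs Ts) = map (component (set Ts)) (filter (\<lambda>q. has (reach Qs Ts) q q \<and> hd (cls Qs (reach Qs Ts) q @ [q]) = q) Qs)"
    and "(\<lambda>B. (set (fst B), set (snd B))) ` set (scc_list Qs Ts) = sccs d (set Qs, set Ts)"
    and "distinct (map (\<lambda>B. (set (fst B), set (snd B))) (scc_list Qs Ts))"
    and "\<And>B. B \<in> set (scc_list Qs Ts) \<Longrightarrow> distinct (fst B) \<and> distinct (snd B)"
proof -
  let ?E = "(edges (set Ts))\<^sup>+"
  have R: "set (reach Qs Ts) = ?E" by (rule set_reach) (use T in auto)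
  have EQ: "?E \<subseteq> set Qs \<times> set Qs"
    by (rule trancl_subset_Sigma) (use T in \<open>auto simp: edges_def\<close>)
  have sc: "set (cls Qs (reach Qs Ts) q) = mutual (set Ts) q" for q
    using EQ unfolding cls_def mutual_def by (auto simp: R)
  have sr: "set (restr Ts (cls Qs (reach Qs Ts) q)) = snd (component (set Ts) q)" for q
    unfolding restr_def component_def by (auto simp: sc)
  let ?S = "filter (\<lambda>q. has (reach Qs Ts) q q \<and> hd (cls Qs (reach Qs Ts) q @ [q]) = q) Qs"
  show m: "map (\<lambda>B. (set (fst B), set (snd B))) (scc_list Qs Ts) = map (component (set Ts)) ?S"
    unfolding scc_list_def Let_def by (simp add: sc sr) (simp add: component_def)
  have clsq: "cls Qs (reach Qs Ts) r = cls Qs (reach Qs Ts) q" if "r \<in> mutual (set Ts) q" for q r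
  proof -
    have "mutual (set Ts) r = mutual (set Ts) q" using that unfolding mutual_def by (auto intro: trancl_trans)
    moreover have "cls Qs (reach Qs Ts) q = filter (\<lambda>s. s \<in> mutual (set Ts) q) Qs" for q
      unfolding cls_def by (rule filter_cong) (auto simp: R mutual_def)
    ultimately show ?thesis by simp
  qed
  have S: "component (set Ts) ` set ?S = component (set Ts) ` {q \<in> set Qs. (q, q) \<in> ?E}"
  proof (intro equalityI subsetI)
    fix B assume "B \<in> component (set Ts) ` {q \<in> set Qs. (q, q) \<in> ?E}"
    then obtain q where q: "q \<in> set Qs" "(q, q) \<in> ?E" "B = component (set Ts) q" by blast
    have qm: "q \<in> mutual (set Ts) q" using q(2) unfolding mutual_def by simp
    define r where "r = hd (cls Qs (reach Qs Ts) q)"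
    have ne: "cls Qs (reach Qs Ts) q \<noteq> []" using qm sc[of q] by (metis empty_iff set_empty)
    have rm: "r \<in> mutual (set Ts) q" unfolding r_def using hd_in_set[OF ne] sc by simp
    have mm: "mutual (set Ts) r = mutual (set Ts) q" using rm unfolding mutual_def by (auto intro: trancl_trans)
    have "r \<in> set ?S" using rm EQ clsq[OF rm] ne unfolding r_def[symmetric]
      by (auto simp: R mutual_def intro: trancl_trans simp flip: r_def)
    moreover have "B = component (set Ts) r" unfolding q(3) component_def mm ..
    ultimately show "B \<in> component (set Ts) ` set ?S" by blast
  qed (auto simp: R)
  show "(\<lambda>B. (set (fst B), set (snd B))) ` set (scc_list Qs Ts) = sccs d (set Qs, set Ts)"
    using sccs_eq[of "set Qs" "set Ts" d] T(2) S arg_cong[OF m, of set] by (simp add: image_image)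
  have inj: "inj_on (component (set Ts)) (set ?S)"
  proof (rule inj_onI)
    fix q r assume q: "q \<in> set ?S" and r: "r \<in> set ?S" and e: "component (set Ts) q = component (set Ts) r"
    have rr: "(r, r) \<in> ?E" using r by (simp add: R)
    have "r \<in> mutual (set Ts) r" using rr unfolding mutual_def by simp
    hence "r \<in> mutual (set Ts) q" using e unfolding component_def by simp
    from clsq[OF this] have c: "cls Qs (reach Qs Ts) r = cls Qs (reach Qs Ts) q" .
    have ne: "cls Qs (reach Qs Ts) r \<noteq> []" using \<open>r \<in> mutual (set Ts) r\<close> sc[of r] by (metis empty_iff set_empty)
    show "q = r" using q r c ne by auto
  qed
  show "distinct (map (\<lambda>B. (set (fst B), set (snd B))) (scc_list Qs Ts))"
    unfolding m distinct_map using Q inj by simp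
  show "distinct (fst B) \<and> distinct (snd B)" if "B \<in> set (scc_list Qs Ts)" for B
    using that Q T(1) unfolding scc_list_def Let_def cls_def restr_def by auto
qed

lemma pt_has [pt_intros]: assumes "pt D f" "pt D g" "pt D h" shows "pt D (\<lambda>s. has (f s) (g s) (h s))"
proof -
  have "pt UNIV (\<lambda>s. has (fst s) (fst (snd s)) (snd (snd s)))" unfolding has_def by (intro pt_intros)
  from pt_comp[OF this pt_Pair[OF assms(1) pt_Pair[OF assms(2,3)]]] show ?thesis by simp
qed

lemma pt_pairs [pt_intros]: assumes "pt D f" shows "pt D (\<lambda>s. pairs (f s))"
proof -
  have "pt UNIV pairs" unfolding pairs_def[abs_def] by (intro pt_intros)
  from pt_comp[OF this assms] show ?thesis by simp
qed

lemma pt_extend: "pt D (\<lambda>s. extend (fst s) (fst (snd s)) (snd (snd s)))"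
  unfolding extend_def by (intro pt_intros)

lemma pt_reach [pt_intros]: assumes "pt D f" "pt D g" shows "pt D (\<lambda>s. reach (f s) (g s))"
proof -
  have base: "pt UNIV (\<lambda>s. filter (linked (snd s)) (pairs (fst s)))"
    unfolding linked_def[abs_def] by (intro pt_intros)
  obtain e where e: "\<And>s :: nat list. sz (pairs s) \<le> (sz s + 2) ^ e"
    by (rule pt_size_fun[of UNIV pairs]) (auto intro: pt_intros)
  have "pt UNIV (\<lambda>s. fold (\<lambda>_. extend (fst s) (snd s)) (snd s) (filter (linked (snd s)) (pairs (fst s))))"
  proof (rule pt_fold[where E = UNIV and p = "\<lambda>s. (s + 2) ^ e" and f = "\<lambda>s _. extend (fst s) (snd s)" and xs = snd
        and i = "\<lambda>s. filter (linked (snd s)) (pairs (fst s))", OF _ base])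
    have "pt UNIV (\<lambda>p :: (nat list \<times> nat transition list) \<times> nat transition \<times> (nat \<times> nat) list. (fst (fst p), snd (fst p), snd (snd p)))"
      by (intro pt_intros)
    from pt_comp[OF pt_extend[of UNIV] this]
    show "pt UNIV (\<lambda>p :: (nat list \<times> nat transition list) \<times> nat transition \<times> (nat \<times> nat) list. extend (fst (fst p)) (snd (fst p)) (snd (snd p)))" by simp
    fix s :: "nat list \<times> nat transition list" and ys zs
    have "sz (fold (\<lambda>_. extend (fst s) (snd s)) ys (filter (linked (snd s)) (pairs (fst s)))) \<le> sz (pairs (fst s))"
    proof (cases ys rule: rev_cases)
      case Nil thus ?thesis by (simp add: sz_filter)
    next
      case (snoc ys' y) thus ?thesis by (simp add: extend_def sz_filter)
    qed
    also have "\<dots> \<le> (sz (fst s) + 2) ^ e" by (rule e)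
    also have "\<dots> \<le> (sz s + 2) ^ e" by (rule power_mono) (auto simp: sz_prod)
    finally show "sz (fold (\<lambda>_. extend (fst s) (snd s)) ys (filter (linked (snd s)) (pairs (fst s)))) \<le> (sz s + 2) ^ e" .
  qed (auto intro!: pt_intros polyb_power polyb_add polyb_Suc)
  hence "pt UNIV (\<lambda>s. reach (fst s) (snd s))" unfolding reach_def .
  from pt_comp2[OF this assms] show ?thesis by simp
qed

lemma pt_cls [pt_intros]: assumes "pt D f" "pt D g" "pt D h" shows "pt D (\<lambda>s. cls (f s) (g s) (h s))"
proof -
  have "pt UNIV (\<lambda>s. cls (fst s) (fst (snd s)) (snd (snd s)))" unfolding cls_def by (intro pt_intros)
  from pt_comp[OF this pt_Pair[OF assms(1) pt_Pair[OF assms(2,3)]]] show ?thesis by simp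
qed

lemma pt_restr [pt_intros]: assumes "pt D f" "pt D g" shows "pt D (\<lambda>s. restr (f s) (g s))"
proof -
  have "pt UNIV (\<lambda>s. restr (fst s) (snd s))" unfolding restr_def by (intro pt_intros)
  from pt_comp2[OF this assms] show ?thesis by simp
qed

lemma pt_scc_list [pt_intros]: assumes "pt D f" "pt D g" shows "pt D (\<lambda>s. scc_list (f s) (g s))"
proof -
  have "pt UNIV (\<lambda>s. scc_list (fst s) (snd s))" unfolding scc_list_def Let_def
    by (intro pt_intros pt_hd) auto
  from pt_comp2[OF this assms] show ?thesis by simp
qed

section \<open>Maximal quasi-ranking functions\<close>

text \<open>The coefficients \<open>c\<close> and the weights \<open>w\<close>, in the order of \<open>Qs\<close>, form one vector. The row
  \<open>trow Qs e\<close> yields the decrease of the linear map along \<open>e\<close>, and \<open>urow\<close> an entry of \<open>c\<close>. The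
  dimension is represented by a list \<open>ds\<close> of that length.\<close>

definition trow :: "nat list \<Rightarrow> nat transition \<Rightarrow> rat list" where
  "trow Qs e = map (\<lambda>x. 0 - rat_of_int x) (list_of_vec (eff e)) @
     map (\<lambda>s. (if s = src e then 1 else 0) - (if s = tgt e then 1 else 0)) Qs"

definition urow :: "nat list \<Rightarrow> nat list \<Rightarrow> nat \<Rightarrow> rat list" where
  "urow ds Qs i = map (\<lambda>q. if fst q = i then 1 else 0) (List.enumerate 0 ds) @ map (\<lambda>_. 0) Qs"

definition rows :: "nat list \<Rightarrow> nat list \<Rightarrow> nat transition list \<Rightarrow> rat list list" where
  "rows ds Qs Ts = map (trow Qs) Ts @ map (\<lambda>p. urow ds Qs (fst p)) (List.enumerate 0 ds)"

definition vars :: "nat list \<Rightarrow> nat list \<Rightarrow> rat list" where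
  "vars ds Qs = map (\<lambda>_. 0) ds @ map (\<lambda>_. 0) Qs"

text \<open>The factor makes every positive row value at least \<open>1\<close>; rows of value \<open>0\<close> contribute
  \<open>1 / 0 = 0\<close> to it.\<close>

definition scale :: "rat list list \<Rightarrow> rat list \<Rightarrow> rat list" where
  "scale M v = (let c = 1 + sum_list (map (\<lambda>r. 1 / dot r v) M) in map (\<lambda>x. c * x) v)"

definition qrf :: "nat list \<Rightarrow> nat list \<Rightarrow> nat transition list \<Rightarrow> rat list" where
  "qrf ds Qs Ts = scale (rows ds Qs Ts) (lp (vars ds Qs) (rows ds Qs Ts))"

lemma dot_append: "length xs = length xs' \<Longrightarrow> dot (xs @ ys) (xs' @ ys') = dot xs xs' + dot ys ys'"
  unfolding dot_def by simp

lemma dot_scale: "dot r (map (\<lambda>x. c * x) v) = c * dot r v"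
proof (induction r arbitrary: v)
  case (Cons a r)
  show ?case
  proof (cases v)
    case (Cons x xs) thus ?thesis using Cons.IH[of xs] by (simp add: dot_def algebra_simps)
  qed (simp add: dot_def)
qed (simp add: dot_def)

lemma dot_indicator:
  assumes "distinct Qs" "p \<in> set Qs"
  shows "dot (map (\<lambda>s. if s = p then 1 else 0) Qs) (map w Qs) = w p"
proof -
  have "dot (map (\<lambda>s. if s = p then 1 else 0) Qs) (map w Qs) = (\<Sum>s\<leftarrow>Qs. if s = p then w s else 0)"
    unfolding dot_def by (induction Qs) auto
  also have "\<dots> = (\<Sum>s\<in>set Qs. if s = p then w s else 0)" using assms(1) by (simp add: sum_list_distinct_conv_sum_set)
  also have "\<dots> = w p" using assms(2) by simp
  finally show ?thesis .
qed

lemma dot_map_diff: "dot (map (\<lambda>s. f s - g s) Qs) v = dot (map f Qs) v - dot (map g Qs) v"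
proof (induction Qs arbitrary: v)
  case (Cons q Qs)
  show ?case
  proof (cases v)
    case (Cons x xs) thus ?thesis using Cons.IH[of xs] by (simp add: dot_def algebra_simps)
  qed (simp add: dot_def)
qed (simp add: dot_def)

lemma dot_list_of_vec:
  assumes "c \<in> carrier_vec d" "u \<in> carrier_vec d"
  shows "dot (list_of_vec u) (list_of_vec c) = c \<bullet> u"
proof -
  have "dot (list_of_vec u) (list_of_vec c) = ip d (nth (list_of_vec u)) (nth (list_of_vec c))"
    by (rule dot_ip) (use assms in auto)
  also have "\<dots> = c \<bullet> u" using assms unfolding ip_def scalar_prod_def
    by (auto simp: list_of_vec_index lessThan_atLeast0 mult.commute intro!: sum.cong)
  finally show ?thesis .
qed

lemma dot_trow:
  assumes "c \<in> carrier_vec d" "u \<in> carrier_vec d" "distinct Qs" "p \<in> set Qs" "q \<in> set Qs"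
  shows "dot (trow Qs (p, u, q)) (list_of_vec c @ map w Qs) = w p - w q - c \<bullet> map_vec rat_of_int u"
proof -
  have l: "length (map (\<lambda>x. 0 - rat_of_int x) (list_of_vec u)) = length (list_of_vec c)" using assms(1,2) by simp
  have "map (\<lambda>x. 0 - rat_of_int x) (list_of_vec u) = list_of_vec (map_vec (\<lambda>x. 0 - rat_of_int x) u)"
    by (rule nth_equalityI) (auto simp: list_of_vec_index)
  hence "dot (map (\<lambda>x. 0 - rat_of_int x) (list_of_vec u)) (list_of_vec c) = c \<bullet> map_vec (\<lambda>x. 0 - rat_of_int x) u"
    using dot_list_of_vec[of c d "map_vec (\<lambda>x. 0 - rat_of_int x) u"] assms(1,2) by simp
  also have "\<dots> = - (c \<bullet> map_vec rat_of_int u)"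
    using assms(1,2) by (simp add: scalar_prod_def sum_negf)
  finally show ?thesis unfolding trow_def
    by (simp only: fst_conv snd_conv dot_append[OF l] dot_map_diff dot_indicator[OF assms(3,4)] dot_indicator[OF assms(3,5)])
qed

lemma dot_urow:
  assumes "c \<in> carrier_vec d" "length ds = d" "i < d"
  shows "dot (urow ds Qs i) (list_of_vec c @ map w Qs) = c $ i"
proof -
  let ?x = "map (\<lambda>q. if fst q = i then 1 else 0 :: rat) (List.enumerate 0 ds)"
  have l: "length ?x = length (list_of_vec c)" using assms by simp
  have z: "dot (map (\<lambda>_. 0) Qs) v = 0" for v
    by (induction Qs arbitrary: v) (auto simp: dot_def zip_Cons1 split: list.splits)
  have "dot ?x (list_of_vec c) = ip d (nth ?x) (nth (list_of_vec c))" by (rule dot_ip) (use assms in auto)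
  also have "\<dots> = ip d (\<lambda>l. of_bool (l = i)) (nth (list_of_vec c))"
    by (rule ip_cong) (use assms in \<open>auto simp: nth_enumerate_eq\<close>)
  also have "\<dots> = c $ i" using ip_unit[OF assms(3)] assms by (simp add: list_of_vec_index)
  finally show ?thesis unfolding urow_def dot_append[OF l] by (simp add: z)
qed

definition qc :: "nat \<Rightarrow> rat list \<Rightarrow> rat vec" where "qc d x = vec_of_list (take d x)"
text \<open>The product with the indicator of \<open>q\<close> reads off the weight stored at the
  position of \<open>q\<close> in \<open>Qs\<close>, without searching for that position.\<close>

definition qw :: "nat \<Rightarrow> nat list \<Rightarrow> rat list \<Rightarrow> nat \<Rightarrow> rat" where
  "qw d Qs x q = dot (map (\<lambda>s. if s = q then 1 else 0) Qs) (drop d x)"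

lemma map_qw:
  assumes "distinct Qs" "length x = d + length Qs"
  shows "map (qw d Qs x) Qs = drop d x"
proof (rule nth_equalityI)
  fix i assume "i < length (map (qw d Qs x) Qs)"
  hence i: "i < length Qs" by simp
  have "qw d Qs x (Qs ! i) = ip (length Qs) (\<lambda>l. of_bool (l = i)) (nth (drop d x))"
    unfolding qw_def using assms i
    by (subst dot_ip[of _ "length Qs"]) (auto simp: nth_eq_iff_index_eq intro!: ip_cong)
  also have "\<dots> = drop d x ! i" by (rule ip_unit[OF i])
  finally show "map (qw d Qs x) Qs ! i = drop d x ! i" using i by simp
qed (use assms in simp)

lemma qc_qw: assumes "distinct Qs" "length x = d + length Qs"
  shows "x = list_of_vec (qc d x) @ map (qw d Qs x) Qs" "qc d x \<in> carrier_vec d"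
  using map_qw[OF assms] assms unfolding qc_def by (auto simp: list_vec intro!: carrier_vecI)

text \<open>Every QRF is a point of the cone, and each transition it ranks gives a row positive at
  that point. By maximal support the row is positive at the computed solution, and after scaling at
  least 1, so that the transition is ranked by it too. The set of ranked transitions thus contains
  that of any other QRF. The same reasoning for the rows of the coefficients settles the existence
  of a positive QRF.\<close>

theorem qrf_maximal:
  fixes A :: "nat vass"
  assumes ds: "length ds = d" and A: "listing A Qs Ts" "snd A \<subseteq> fst A \<times> carrier_vec d \<times> fst A"
  defines "x \<equiv> qrf ds Qs Ts"
  shows "length x = d + length Qs"
    "maximal_QRF d A (qc d x, qw d Qs x)"
    "neutral_transitions A (qc d x, qw d Qs x) = {e \<in> set Ts. dot (trow Qs e) x = 0}"
    "(\<exists>f. positive_QRF d A f) \<longleftrightarrow> (\<forall>y\<in>set (take d x). 0 < y)"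
proof -
  define M where "M = rows ds Qs Ts"
  define v where "v = lp (vars ds Qs) M"
  have L: "distinct Qs" "set Qs = fst A" "distinct Ts" "set Ts = snd A" using A(1) unfolding listing_def by auto
  have T: "set Ts \<subseteq> set Qs \<times> carrier_vec d \<times> set Qs" using A(2) L by simp
  have wf: "lp_wf (vars ds Qs) M"
    unfolding lp_wf_def M_def rows_def vars_def using T ds
    by (auto simp: trow_def urow_def)
  note m = lp_max_support[OF wf, folded v_def]
  define c where "c = 1 + sum_list (map (\<lambda>r. 1 / dot r v) M)"
  have x: "x = map (\<lambda>y. c * y) v" unfolding x_def qrf_def scale_def Let_def M_def[symmetric] v_def[symmetric] c_def[symmetric] ..
  show lx: "length x = d + length Qs" unfolding x using m(1) ds by (simp add: vars_def)
  note q = qc_qw[OF L(1) lx]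
  have ge: "1 \<le> c * dot r v" if "r \<in> set M" "0 < dot r v" for r
  proof -
    have "1 / dot r v \<le> sum_list (map (\<lambda>r. 1 / dot r v) M)"
      using that m(2) by (intro member_le_sum_list) auto
    hence "1 / dot r v \<le> c" unfolding c_def by linarith
    thus ?thesis using that(2) by (simp add: pos_divide_le_eq)
  qed
  have c1: "1 \<le> c" unfolding c_def using m(2) by (auto intro!: sum_list_nonneg)
  have rx: "dot r x = c * dot r v" for r unfolding x by (rule dot_scale)
  have row: "1 \<le> dot r x \<or> dot r x = 0" if "r \<in> set M" for r
    using m(2)[OF that] ge[OF that] unfolding rx by (cases "dot r v = 0") auto
  have te: "trow Qs e \<in> set M" if "e \<in> set Ts" for e using that unfolding M_def rows_def by simp
  have ue: "urow ds Qs i \<in> set M" if "i < d" for i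
  proof -
    have "i \<in> set (map fst (List.enumerate 0 ds))" unfolding map_fst_enumerate using that ds by simp
    hence "i \<in> fst ` set (List.enumerate 0 ds)" by (simp only: set_map)
    then obtain p where "p \<in> set (List.enumerate 0 ds)" "i = fst p" by (rule imageE)
    thus ?thesis unfolding M_def rows_def by auto
  qed
  have tr: "dot (trow Qs (p, u, q)) (list_of_vec cc @ map w Qs) = w p - w q - cc \<bullet> map_vec rat_of_int u"
    if "cc \<in> carrier_vec d" "(p, u, q) \<in> set Ts" for cc w p u q
    using that T by (intro dot_trow[OF that(1) _ L(1)]) auto
  have nx: "neutral (qc d x, qw d Qs x) e \<longleftrightarrow> dot (trow Qs e) x = 0"
    and rkx: "ranked (qc d x, qw d Qs x) e \<longleftrightarrow> 1 \<le> dot (trow Qs e) x" if "e \<in> set Ts" for e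
    using tr[OF q(2), of "src e" "eff e" "tgt e" "qw d Qs x"] that
    by (cases e; subst (2) q(1); auto simp: neutral_def ranked_def)+
  have QR: "QRF d A (qc d x, qw d Qs x)"
    unfolding QRF_def
  proof (intro conjI ballI)
    show "0\<^sub>v d \<le> fst (qc d x, qw d Qs x)" unfolding less_eq_vec_def
    proof (simp only: fst_conv, intro conjI allI impI)
      fix i assume "i < dim_vec (qc d x)"
      hence i: "i < d" using q(2) by simp
      have "qc d x $ i = dot (urow ds Qs i) x" using dot_urow[OF q(2) ds i, of Qs "qw d Qs x"] q(1) by simp
      thus "0\<^sub>v d $ i \<le> qc d x $ i" using row[OF ue[OF i]] i by auto
    qed (use q(2) in simp)
    fix e assume "e \<in> snd A"
    hence e: "e \<in> set Ts" using L by simp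
    show "ranked (qc d x, qw d Qs x) e \<or> neutral (qc d x, qw d Qs x) e" using row[OF te[OF e]] nx[OF e] rkx[OF e] by blast
  qed (use q in simp)
  have cone: "0 \<le> dot r (list_of_vec (fst g) @ map (snd g) Qs)" "length (list_of_vec (fst g) @ map (snd g) Qs) = length (vars ds Qs)"
    if g: "QRF d A g" and r: "r \<in> set M" for g r
  proof -
    have gc: "fst g \<in> carrier_vec d" "0\<^sub>v d \<le> fst g" using g unfolding QRF_def by auto
    show "length (list_of_vec (fst g) @ map (snd g) Qs) = length (vars ds Qs)" using gc(1) ds by (simp add: vars_def)
    consider e where "e \<in> set Ts" "r = trow Qs e" | i where "i < d" "r = urow ds Qs i"
      using r ds unfolding M_def rows_def by (auto simp: in_set_enumerate_eq)
    thus "0 \<le> dot r (list_of_vec (fst g) @ map (snd g) Qs)"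
    proof cases
      case 1
      obtain p u q where e: "e = (p, u, q)" by (cases e)
      have "ranked g e \<or> neutral g e" using g 1(1) L unfolding QRF_def by simp
      thus ?thesis using tr[OF gc(1), of p u q "snd g"] 1 e by (cases g) (auto simp: ranked_def neutral_def)
    next
      case 2
      thus ?thesis using dot_urow[OF gc(1) ds 2(1)] gc 2(1) unfolding less_eq_vec_def by auto
    qed
  qed
  have pos: "0 < dot r x" if g: "QRF d A g" and r: "r \<in> set M" "0 < dot r (list_of_vec (fst g) @ map (snd g) Qs)" for g r
    using m(3)[OF r(1) cone(2)[OF g r(1)] cone(1)[OF g] r(2)] c1 unfolding rx by simp
  show "maximal_QRF d A (qc d x, qw d Qs x)"
    unfolding maximal_QRF_def
  proof (intro conjI allI impI QR)
    fix g assume g: "QRF d A g"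
    have gc: "fst g \<in> carrier_vec d" using g unfolding QRF_def by auto
    show "card {e \<in> snd A. ranked g e} \<le> card {e \<in> snd A. ranked (qc d x, qw d Qs x) e}"
    proof (rule card_mono)
      show "finite {e \<in> snd A. ranked (qc d x, qw d Qs x) e}" unfolding L(4)[symmetric] by simp
      show "{e \<in> snd A. ranked g e} \<subseteq> {e \<in> snd A. ranked (qc d x, qw d Qs x) e}"
      proof (intro subsetI CollectI conjI)
        fix e assume "e \<in> {e \<in> snd A. ranked g e}"
        hence e: "e \<in> set Ts" "ranked g e" using L by auto
        obtain p u q where pq: "e = (p, u, q)" by (cases e)
        have "0 < dot (trow Qs e) (list_of_vec (fst g) @ map (snd g) Qs)"
          using tr[OF gc, of p u q "snd g"] e pq by (cases g) (auto simp: ranked_def)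
        hence "0 < dot (trow Qs e) x" by (rule pos[OF g te[OF e(1)]])
        hence "1 \<le> dot (trow Qs e) x" using row[OF te[OF e(1)]] by auto
        thus "ranked (qc d x, qw d Qs x) e" using rkx[OF e(1)] by simp
      qed auto
    qed
  qed
  show "neutral_transitions A (qc d x, qw d Qs x) = {e \<in> set Ts. dot (trow Qs e) x = 0}"
    unfolding neutral_transitions_def using nx L by auto
  have ci: "qc d x $ i = dot (urow ds Qs i) x" if "i < d" for i
    using dot_urow[OF q(2) ds that, of Qs "qw d Qs x"] q(1) by simp
  have tk: "(\<forall>y\<in>set (take d x). 0 < y) \<longleftrightarrow> (\<forall>i<d. 0 < qc d x $ i)"
    unfolding qc_def using lx by (auto simp: all_set_conv_all_nth vec_of_list_index)
  show "(\<exists>f. positive_QRF d A f) \<longleftrightarrow> (\<forall>y\<in>set (take d x). 0 < y)"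
    unfolding tk
  proof
    assume "\<exists>f. positive_QRF d A f"
    then obtain g where g: "QRF d A g" "\<forall>i<d. 0 < fst g $ i" unfolding positive_QRF_def by blast
    have gc: "fst g \<in> carrier_vec d" using g unfolding QRF_def by auto
    show "\<forall>i<d. 0 < qc d x $ i"
    proof (intro allI impI)
      fix i assume i: "i < d"
      have "0 < dot (urow ds Qs i) (list_of_vec (fst g) @ map (snd g) Qs)"
        using dot_urow[OF gc ds i, of Qs "snd g"] g(2) i by simp
      thus "0 < qc d x $ i" unfolding ci[OF i] by (rule pos[OF g(1) ue[OF i]])
    qed
  next
    assume "\<forall>i<d. 0 < qc d x $ i"
    thus "\<exists>f. positive_QRF d A f" using QR unfolding positive_QRF_def by auto
  qed
qed

section \<open>Polynomial time of computing maximal QRFs\<close>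

lemma pt_trow [pt_intros]: assumes "pt D f" "pt D g" shows "pt D (\<lambda>s. trow (f s) (g s))"
proof -
  have "pt UNIV (\<lambda>s. trow (fst s) (snd s))" unfolding trow_def by (intro pt_intros)
  from pt_comp2[OF this assms] show ?thesis by simp
qed

lemma pt_rows [pt_intros]: assumes "pt D f" "pt D g" "pt D h" shows "pt D (\<lambda>s. rows (f s) (g s) (h s))"
proof -
  have "pt UNIV (\<lambda>s. rows (fst s) (fst (snd s)) (snd (snd s)))" unfolding rows_def urow_def by (intro pt_intros)
  from pt_comp[OF this pt_Pair[OF assms(1) pt_Pair[OF assms(2,3)]]] show ?thesis by simp
qed

lemma pt_vars [pt_intros]: assumes "pt D f" "pt D g" shows "pt D (\<lambda>s. vars (f s) (g s))"
  unfolding vars_def by (intro pt_intros assms)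

lemma pt_scale [pt_intros]: assumes "pt D f" "pt D g" shows "pt D (\<lambda>s. scale (f s) (g s))"
proof -
  have "pt UNIV (\<lambda>s. scale (fst s) (snd s))" unfolding scale_def Let_def by (intro pt_intros)
  from pt_comp2[OF this assms] show ?thesis by simp
qed

definition wf_item :: "nat list \<Rightarrow> nat list \<Rightarrow> nat transition list \<Rightarrow> bool" where
  "wf_item ds Qs Ts \<longleftrightarrow> (\<forall>e\<in>set Ts. eff e \<in> carrier_vec (length ds))"

lemma pt_qrf:
  assumes "pt D f" "pt D g" "pt D h" "\<And>s. s \<in> D \<Longrightarrow> wf_item (f s) (g s) (h s)"
  shows "pt D (\<lambda>s. qrf (f s) (g s) (h s))"
proof -
  have "pt D (\<lambda>s. lp (vars (f s) (g s)) (rows (f s) (g s) (h s)))"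
  proof (rule pt_comp2[OF pt_lp])
    fix s assume "s \<in> D"
    from assms(4)[OF this] show "(vars (f s) (g s), rows (f s) (g s) (h s)) \<in> {p. lp_wf (fst p) (snd p)}"
      unfolding lp_wf_def rows_def vars_def wf_item_def by (auto simp: trow_def urow_def)
  qed (intro pt_intros assms)+
  thus ?thesis unfolding qrf_def by (intro pt_intros assms)
qed

text \<open>Without a component the neutral transitions form an acyclic graph. A large multiple of
  \<open>f\<close> plus a height function on that graph would then rank all transitions,
  contradicting maximality as soon as one is neutral.\<close>

lemma maximal_QRF_sccs_nonempty:
  fixes A :: "'q vass"
  assumes A: "is_vass d A" and f: "maximal_QRF d A f" and N: "neutral_transitions A f \<noteq> {}"
  shows "sccs d (fst A, neutral_transitions A f) \<noteq> {}"
proof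
  let ?N = "neutral_transitions A f"
  assume e: "sccs d (fst A, ?N) = {}"
  obtain Q T where QT: "A = (Q, T)" by (cases A)
  obtain c w where cw: "f = (c, w)" by (cases f)
  have V: "finite Q" "finite T" "T \<subseteq> Q \<times> carrier_vec d \<times> Q" using A unfolding is_vass_def QT by auto
  have NT: "?N \<subseteq> T" unfolding neutral_transitions_def QT by auto
  have NG: "finite ?N" "?N \<subseteq> Q \<times> carrier_vec d \<times> Q" using V NT finite_subset by auto
  have acyc: "(q, q) \<notin> (edges ?N)\<^sup>+" if "q \<in> Q" for q
    using e sccs_eq[OF V(1) NG] that unfolding QT by auto
  have EQ: "(edges ?N)\<^sup>+ \<subseteq> Q \<times> Q" by (rule trancl_subset_Sigma) (use NG(2) in \<open>auto simp: edges_def\<close>)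
  \<comment> \<open>The number of states reachable along neutral transitions. It strictly decreases
    along each of them, since \<open>q\<close> is reachable from \<open>p\<close> but not from
    itself.\<close>
  define h where "h p = card {r. (p, r) \<in> (edges ?N)\<^sup>+}" for p
  have fin: "finite {r. (p, r) \<in> (edges ?N)\<^sup>+}" for p using EQ V(1) by (auto intro: finite_subset[of _ Q])
  have hQ: "h p \<le> card Q" for p unfolding h_def using EQ V(1) by (intro card_mono) auto
  have hdec: "h q < h p" if "(p, u, q) \<in> ?N" for p u q
  proof -
    have pq: "(p, q) \<in> edges ?N" using that unfolding edges_def by auto
    have "{r. (q, r) \<in> (edges ?N)\<^sup>+} \<subseteq> {r. (p, r) \<in> (edges ?N)\<^sup>+}" using pq by (auto intro: trancl_into_trancl2)
    moreover have "q \<in> {r. (p, r) \<in> (edges ?N)\<^sup>+}" using pq by auto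
    moreover have "q \<notin> {r. (q, r) \<in> (edges ?N)\<^sup>+}" using acyc[of q] that NG(2) by auto
    ultimately show ?thesis unfolding h_def using fin by (intro psubset_card_mono) auto
  qed
  \<comment> \<open>Transitions ranked by \<open>f\<close> drop by at least \<open>K\<close> under
    the multiple; the heights, at most \<open>card Q\<close>, give back at most
    \<open>K - 1\<close>, and a drop of at least 1 remains.\<close>
  define K where "K = rat_of_nat (card Q) + 1"
  define g where "g = (K \<cdot>\<^sub>v c, \<lambda>q. K * w q + of_nat (h q))"
  have q: "QRF d A f" using f unfolding maximal_QRF_def by blast
  have c: "c \<in> carrier_vec d" "0\<^sub>v d \<le> c" using q unfolding QRF_def cw by auto
  have K1: "1 \<le> K" unfolding K_def by simp
  have rg: "ranked g e" if eT: "e \<in> T" for e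
  proof -
    obtain p u q' where pq: "e = (p, u, q')" by (cases e)
    have uc: "u \<in> carrier_vec d" using eT V(3) pq by auto
    have s: "(K \<cdot>\<^sub>v c) \<bullet> map_vec rat_of_int u = K * (c \<bullet> map_vec rat_of_int u)" using c uc by simp
    show ?thesis
    proof (cases "neutral f e")
      case True
      hence "e \<in> ?N" using eT unfolding neutral_transitions_def QT by simp
      hence h: "of_nat (h q') + 1 \<le> rat_of_nat (h p)" using hdec[of p u q'] pq by (metis Suc_leI of_nat_Suc of_nat_le_iff add.commute)
      have "K * (c \<bullet> map_vec rat_of_int u + w q') = K * w p" using True unfolding cw pq by (simp add: neutral_def)
      thus ?thesis unfolding g_def pq ranked_def using h by (simp add: s distrib_left)
    next
      case False
      hence "ranked f e" using q eT unfolding QRF_def QT by auto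
      hence "c \<bullet> map_vec rat_of_int u + w q' \<le> w p - 1" unfolding cw pq by (simp add: ranked_def)
      hence "K * (c \<bullet> map_vec rat_of_int u + w q') \<le> K * (w p - 1)" using K1 by (intro mult_left_mono) auto
      moreover have "rat_of_nat (h q') \<le> K - 1" unfolding K_def using hQ[of q'] by simp
      ultimately show ?thesis unfolding g_def pq ranked_def by (simp add: s algebra_simps)
    qed
  qed
  have "QRF d A g" unfolding QRF_def
  proof (intro conjI ballI disjI1)
    show "0\<^sub>v d \<le> fst g" using c K1 unfolding g_def less_eq_vec_def by auto
  qed (use c rg in \<open>auto simp: g_def QT\<close>)
  hence "card {e \<in> snd A. ranked g e} \<le> card {e \<in> snd A. ranked f e}" using f unfolding maximal_QRF_def by blast
  moreover have "{e \<in> snd A. ranked g e} = T" using rg unfolding QT by auto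
  moreover obtain e where e: "e \<in> T" "neutral f e" using N unfolding neutral_transitions_def QT by auto
  have "\<not> ranked f e" using e(2) unfolding cw by (cases e) (auto simp: ranked_def neutral_def)
  hence "{e \<in> snd A. ranked f e} \<subset> T" using e(1) unfolding QT by auto
  hence "card {e \<in> snd A. ranked f e} < card T" using V(2) by (intro psubset_card_mono)
  ultimately show False by simp
qed

section \<open>Return values as heights of call trees\<close>

fun hgt :: "'q call \<Rightarrow> nat" where
  "hgt (Call A f ts) = foldr (\<lambda>t a. max (Suc (hgt t)) a) ts 0"

fun diverges :: "'q call \<Rightarrow> bool" where
  "diverges (Call A f ts) \<longleftrightarrow> neutral_transitions A f = snd A \<or> (\<exists>t\<in>set ts. diverges t)"

lemma Max_enat_list:
  assumes "ts \<noteq> []" "\<And>t. t \<in> set ts \<Longrightarrow> f t = enat (Suc (g t))"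
  shows "Max (f ` set ts) = enat (foldr (\<lambda>t a. max (Suc (g t)) a) ts 0)"
  using assms
proof (induction ts)
  case (Cons t ts)
  show ?case
  proof (cases "ts = []")
    case True thus ?thesis using Cons.prems by simp
  next
    case False
    hence "Max (f ` set ts) = enat (foldr (\<lambda>t a. max (Suc (g t)) a) ts 0)" using Cons by auto
    moreover have "Max (f ` set (t # ts)) = max (f t) (Max (f ` set ts))" using False by (simp add: Max_insert)
    ultimately show ?thesis using Cons.prems(2) by (simp add: max_def)
  qed
qed simp

text \<open>The side condition rules out \<open>Max {}\<close> in the definition of the return value.\<close>

fun proper :: "'q call \<Rightarrow> bool" where
  "proper (Call A f ts) \<longleftrightarrow> (neutral_transitions A f = snd A \<or> neutral_transitions A f = {} \<or> ts \<noteq> []) \<and>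
     (neutral_transitions A f = snd A \<or> neutral_transitions A f = {} \<longrightarrow> ts = []) \<and> (\<forall>t\<in>set ts. proper t)"

text \<open>The nested maxima of extended naturals are split into a height and a flag, both of which
  can be accumulated while the calls are visited in sequence.\<close>

lemma return_value_eq: "proper t \<Longrightarrow> return_value t = (if diverges t then \<infinity> else enat (Suc (hgt t)))"
proof (induction t)
  case (Call A f ts)
  let ?N = "neutral_transitions A f"
  consider "?N = snd A" | "?N \<noteq> snd A" "?N = {}" | "?N \<noteq> snd A" "?N \<noteq> {}" by blast
  thus ?case
  proof cases
    case 2
    hence "ts = []" using Call.prems by simp
    thus ?thesis using 2 by (simp add: one_enat_def)
  next
    case 3
    hence ne: "ts \<noteq> []" using Call.prems by simp
    have IH: "return_value t = (if diverges t then \<infinity> else enat (Suc (hgt t)))" if "t \<in> set ts" for t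
      using Call.IH[OF that] Call.prems that by simp
    show ?thesis
    proof (cases "\<exists>t\<in>set ts. diverges t")
      case True
      then obtain t where t: "t \<in> set ts" "return_value t = \<infinity>" using IH by auto
      have "return_value t \<le> Max (return_value ` set ts)" using t(1) by (intro Max_ge) auto
      hence "Max (return_value ` set ts) = \<infinity>" using t(2) by simp
      thus ?thesis using True 3 by (simp add: Let_def)
    next
      case False
      have "Max (return_value ` set ts) = enat (foldr (\<lambda>t a. max (Suc (hgt t)) a) ts 0)"
        by (rule Max_enat_list[OF ne]) (use IH False in auto)
      thus ?thesis using False 3 by (simp add: Let_def one_enat_def)
    qed
  qed simp
qed

text \<open>The translation from heights of subtrees to depths measured from the root; the work list
  keeps the latter.\<close>

lemma foldr_max_shift:
  "foldr (\<lambda>t a. max (Suc j + h t) a) ts (max x j) = max x (j + foldr (\<lambda>t a. max (Suc (h t)) a) ts 0)" for j :: nat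
  by (induction ts) auto

section \<open>Recursion depth\<close>

text \<open>A triangular system of \<open>j\<close> covectors and vectors in dimension \<open>d\<close> forces \<open>j \<le> d\<close>:
  padded with zeros to size \<open>d + 1\<close>, the two matrices would have a product of nonzero determinant.\<close>

lemma triangular_le_dim:
  fixes c u :: "nat \<Rightarrow> rat vec"
  assumes c: "\<And>i. i < k \<Longrightarrow> c i \<in> carrier_vec d" and u: "\<And>i. i < k \<Longrightarrow> u i \<in> carrier_vec d"
    and diag: "\<And>i. i < k \<Longrightarrow> c i \<bullet> u i \<noteq> 0" and tri: "\<And>l i. l < i \<Longrightarrow> i < k \<Longrightarrow> c l \<bullet> u i = 0"
  shows "k \<le> d"
proof (rule ccontr)
  assume "\<not> k \<le> d"
  hence k: "d < k" by simp
  define N where "N = Suc d"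
  define C where "C = mat N N (\<lambda>(i, j). if j < d then c i $ j else 0)"
  define U where "U = mat N N (\<lambda>(j, i). if j < d then u i $ j else 0)"
  have CU: "C \<in> carrier_mat N N" "U \<in> carrier_mat N N" unfolding C_def U_def by auto
  have e: "(C * U) $$ (l, i) = c l \<bullet> u i" if "l < N" "i < N" for l i
  proof -
    have li: "l < k" "i < k" using that k unfolding N_def by auto
    have "(C * U) $$ (l, i) = (\<Sum>j = 0..<N. (if j < d then c l $ j else 0) * (if j < d then u i $ j else 0))"
      using that unfolding C_def U_def by (auto simp: scalar_prod_def intro!: sum.cong)
    also have "\<dots> = (\<Sum>j = 0..<d. c l $ j * u i $ j)" unfolding N_def by (simp add: sum.atLeast0_lessThan_Suc)
    also have "\<dots> = c l \<bullet> u i" using u[OF li(2)] by (auto simp: scalar_prod_def)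
    finally show ?thesis .
  qed
  have "det (C * U) = prod_list (diag_mat (C * U))"
    by (rule det_lower_triangular[of N]) (use e tri k CU in \<open>auto simp: N_def\<close>)
  moreover have "0 \<notin> set (diag_mat (C * U))"
    using e diag k CU unfolding diag_mat_def by (auto simp: N_def)
  ultimately have "det (C * U) \<noteq> 0" by (simp add: prod_list_zero_iff)
  \<comment> \<open>The last column of \<open>C\<close> is padding, so the corresponding unit vector
    lies in its kernel.\<close>
  moreover have "det C = 0"
  proof (rule ccontr)
    assume "det C \<noteq> 0"
    hence "\<not> (\<exists>v. v \<in> carrier_vec N \<and> v \<noteq> 0\<^sub>v N \<and> C *\<^sub>v v = 0\<^sub>v N)" using det_0_iff_vec_prod_zero_field[OF CU(1)] by blast
    moreover have "unit_vec N d \<in> carrier_vec N" "unit_vec N d \<noteq> (0\<^sub>v N :: rat vec)" unfolding N_def by auto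
    moreover have "C *\<^sub>v unit_vec N d = 0\<^sub>v N"
      by (rule eq_vecI) (auto simp: C_def N_def scalar_prod_def unit_vec_def)
    ultimately show False by blast
  qed
  ultimately show False using det_mult[OF CU] by simp
qed

text \<open>The effect is chosen before the linear map. The same vector can therefore be tested
  against the covectors of the call and of all its ancestors.\<close>

lemma path_effect:
  assumes "(p, q) \<in> (edges T)\<^sup>+" "\<And>p u q. (p, u, q) \<in> T \<Longrightarrow> u \<in> carrier_vec d"
  shows "\<exists>u\<in>carrier_vec d. \<forall>c w. c \<in> carrier_vec d \<longrightarrow>
    ((\<forall>e\<in>T. neutral (c, w) e) \<longrightarrow> c \<bullet> u + w q = w p) \<and>
    ((\<forall>e\<in>T. ranked (c, w) e \<or> neutral (c, w) e) \<longrightarrow> c \<bullet> u + w q \<le> w p)"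
  using assms(1)
proof (induction rule: trancl_induct)
  case (base q)
  then obtain u where u: "(p, u, q) \<in> T" unfolding edges_def by auto
  show ?case
    by (rule bexI[of _ "map_vec rat_of_int u"])
      (use u assms(2)[OF u] in \<open>force simp: neutral_def ranked_def\<close>)+
next
  case (step q s)
  then obtain u v where u: "u \<in> carrier_vec d" "\<And>c w. c \<in> carrier_vec d \<Longrightarrow>
    ((\<forall>e\<in>T. neutral (c, w) e) \<longrightarrow> c \<bullet> u + w q = w p) \<and>
    ((\<forall>e\<in>T. ranked (c, w) e \<or> neutral (c, w) e) \<longrightarrow> c \<bullet> u + w q \<le> w p)"
    and v: "(q, v, s) \<in> T" unfolding edges_def by auto
  have vc: "map_vec rat_of_int v \<in> carrier_vec d" using assms(2)[OF v] by simp
  show ?case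
  proof (intro bexI[of _ "u + map_vec rat_of_int v"] allI impI conjI)
    fix c :: "rat vec" and w :: "'a \<Rightarrow> rat" assume c: "c \<in> carrier_vec d"
    have e: "c \<bullet> (u + map_vec rat_of_int v) = c \<bullet> u + c \<bullet> map_vec rat_of_int v"
      using c u(1) vc by (simp add: scalar_prod_add_distrib)
    { assume n: "\<forall>e\<in>T. neutral (c, w) e"
      have "c \<bullet> map_vec rat_of_int v + w s = w q" using bspec[OF n v] by (simp add: neutral_def)
      thus "c \<bullet> (u + map_vec rat_of_int v) + w s = w p" using u(2)[OF c, of w] n unfolding e by auto }
    { assume n: "\<forall>e\<in>T. ranked (c, w) e \<or> neutral (c, w) e"
      have "c \<bullet> map_vec rat_of_int v + w s \<le> w q" using bspec[OF n v] by (auto simp: neutral_def ranked_def)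
      thus "c \<bullet> (u + map_vec rat_of_int v) + w s \<le> w p" using u(2)[OF c, of w] n unfolding e by auto }
  qed (use u(1) vc in auto)
qed

text \<open>Strong connectivity closes the transition to a cycle. Along the way back the map does
  not increase, and along \<open>e\<close> it decreases by at least 1, so the effect of the cycle
  has negative product with \<open>c\<close>. For a map that is neutral throughout, the weights
  cancel around the cycle.\<close>

lemma ranked_cycle:
  assumes A: "is_vass d A" "strongly_connected A" and f: "QRF d A (c, w)" and e: "e \<in> snd A" "\<not> neutral (c, w) e"
  shows "\<exists>u\<in>carrier_vec d. c \<bullet> u \<noteq> 0 \<and>
    (\<forall>c' w'. c' \<in> carrier_vec d \<longrightarrow> (\<forall>e\<in>snd A. neutral (c', w') e) \<longrightarrow> c' \<bullet> u = 0)"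
proof -
  obtain Q T where QT: "A = (Q, T)" by (cases A)
  obtain p v q where pq: "e = (p, v, q)" by (cases e)
  have T: "T \<subseteq> Q \<times> carrier_vec d \<times> Q" using A(1) unfolding is_vass_def QT by auto
  have pe: "(p, v, q) \<in> T" using e(1) QT pq by simp
  have "(q, p) \<in> (edges T)\<^sup>+" using A(2) T pe unfolding strongly_connected_def QT edges_def by auto
  from path_effect[OF this, of d] T obtain u where u: "u \<in> carrier_vec d" "\<And>c w. c \<in> carrier_vec d \<Longrightarrow>
    ((\<forall>e\<in>T. neutral (c, w) e) \<longrightarrow> c \<bullet> u + w p = w q) \<and>
    ((\<forall>e\<in>T. ranked (c, w) e \<or> neutral (c, w) e) \<longrightarrow> c \<bullet> u + w p \<le> w q)" by blast
  have vc: "map_vec rat_of_int v \<in> carrier_vec d" using T pe by auto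
  have d: "c' \<bullet> (u + map_vec rat_of_int v) = c' \<bullet> u + c' \<bullet> map_vec rat_of_int v" if "c' \<in> carrier_vec d" for c'
    using that u(1) vc by (simp add: scalar_prod_add_distrib)
  have cc: "c \<in> carrier_vec d" and rn: "\<forall>e\<in>T. ranked (c, w) e \<or> neutral (c, w) e" using f unfolding QRF_def QT by auto
  show ?thesis
  proof (intro bexI[of _ "u + map_vec rat_of_int v"] conjI allI impI)
    have "ranked (c, w) (p, v, q)" using rn pe e(2) pq by blast
    hence "c \<bullet> map_vec rat_of_int v + w q \<le> w p - 1" by (simp add: ranked_def)
    moreover have "c \<bullet> u + w p \<le> w q" using u(2)[OF cc, of w] rn by blast
    ultimately show "c \<bullet> (u + map_vec rat_of_int v) \<noteq> 0" unfolding d[OF cc] by simp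
    fix c' w' assume c': "c' \<in> carrier_vec d" and n: "\<forall>e\<in>snd A. neutral (c', w') e"
    have "c' \<bullet> map_vec rat_of_int v + w' q = w' p" using n pe unfolding QT by (force simp: neutral_def)
    moreover have "c' \<bullet> u + w' p = w' q" using u(2)[OF c', of w'] n unfolding QT by auto
    ultimately show "c' \<bullet> (u + map_vec rat_of_int v) = 0" unfolding d[OF c'] by simp
  qed (use u(1) vc in auto)
qed

text \<open>\<open>fs\<close> lists the covectors chosen by the ancestors of the call, outermost first.\<close>

lemma calls_depth_aux:
  assumes "decompose_run d t" "is_vass d (arg t)" "strongly_connected (arg t)"
    and "\<And>i. i < length fs \<Longrightarrow> fst (fs ! i) \<in> carrier_vec d"
    and "\<And>i e. i < length fs \<Longrightarrow> e \<in> snd (arg t) \<Longrightarrow> neutral (fs ! i) e"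
    and "length us = length fs" "\<And>i. i < length us \<Longrightarrow> us ! i \<in> carrier_vec d"
    and "\<And>i. i < length fs \<Longrightarrow> fst (fs ! i) \<bullet> us ! i \<noteq> 0"
    and "\<And>l i. l < i \<Longrightarrow> i < length fs \<Longrightarrow> fst (fs ! l) \<bullet> us ! i = 0"
    and "(j, s) \<in> calls_at t"
  shows "length fs + j < d \<or> length fs + j = d \<and> neutral_transitions (arg s) (chosen s) = snd (arg s)"
  using assms
proof (induction t arbitrary: fs us j)
  case (Call A f ts)
  obtain c w where f: "f = (c, w)" by (cases f)
  have q: "QRF d A f" using Call.prems(1) by (simp add: maximal_QRF_def)
  have c: "c \<in> carrier_vec d" using q unfolding QRF_def f by simp
  have A: "is_vass d A" "strongly_connected A" using Call.prems(2,3) by auto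
  let ?N = "neutral_transitions A f"
  \<comment> \<open>The pairs contributed by the ancestors alone bound the depth by
    \<open>d\<close>; this covers a call that answers infinity at once.\<close>
  have len: "length fs \<le> d"
    by (rule triangular_le_dim[of _ "\<lambda>i. fst (fs ! i)" d "\<lambda>i. us ! i"]) (use Call.prems(4-9) in auto)
  show ?case
  proof (cases "?N = snd A")
    case True
    hence "ts = []" using Call.prems(1) by (simp add: Let_def)
    thus ?thesis using Call.prems(10) True len by auto
  next
    case False
    then obtain e where e: "e \<in> snd A" "\<not> neutral f e" unfolding neutral_transitions_def by auto
    obtain u where u: "u \<in> carrier_vec d" "c \<bullet> u \<noteq> 0"
      "\<And>c' w'. c' \<in> carrier_vec d \<Longrightarrow> (\<forall>e\<in>snd A. neutral (c', w') e) \<Longrightarrow> c' \<bullet> u = 0"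
      using ranked_cycle[OF A q[unfolded f] e(1) e(2)[unfolded f]] by blast
    have fu: "fst (fs ! l) \<bullet> u = 0" if "l < length fs" for l
      by (rule u(3)[of _ "snd (fs ! l)"]) (use Call.prems(4,5) that in auto)
    let ?fs = "fs @ [f]" and ?us = "us @ [u]"
    have F1: "fst (?fs ! i) \<in> carrier_vec d" if "i < length ?fs" for i
      using that Call.prems(4)[of i] c f by (cases "i < length fs") (auto simp: nth_append less_Suc_eq)
    have F2: "?us ! i \<in> carrier_vec d" if "i < length ?us" for i
      using that Call.prems(7)[of i] u(1) by (cases "i < length us") (auto simp: nth_append less_Suc_eq)
    have F3: "fst (?fs ! i) \<bullet> ?us ! i \<noteq> 0" if "i < length ?fs" for i
      using that Call.prems(6) Call.prems(8)[of i] u(2) f by (cases "i < length fs") (auto simp: nth_append less_Suc_eq)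
    have F4: "fst (?fs ! l) \<bullet> ?us ! i = 0" if "l < i" "i < length ?fs" for l i
      using that Call.prems(6) Call.prems(9)[of l i] fu[of l] by (cases "i < length fs") (auto simp: nth_append less_Suc_eq)
    \<comment> \<open>A call that ranks some transition contributes a further pair, which leaves at
      most \<open>d - 1\<close> ancestors.\<close>
    have len': "length ?fs \<le> d"
      by (rule triangular_le_dim[of _ "\<lambda>i. fst (?fs ! i)" d "\<lambda>i. ?us ! i"]) (use F1 F2 F3 F4 Call.prems(6) in auto)
    show ?thesis
    proof (cases "(j, s) = (0, Call A f ts)")
      case True
      thus ?thesis using len' by simp
    next
      case 2: False
      then obtain i t where t: "t \<in> set ts" "(i, s) \<in> calls_at t" "j = Suc i" using Call.prems(10) by auto
      hence ne: "?N \<noteq> {}" using Call.prems(1) False by (auto simp: Let_def)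
      have "arg t \<in> sccs d (fst A, ?N)" and run: "decompose_run d t"
        using Call.prems(1) False ne t(1) by (auto simp: Let_def)
      hence s: "sub_vass d (arg t) (fst A, ?N)" "strongly_connected (arg t)" unfolding sccs_def by auto
      have sub: "snd (arg t) \<subseteq> ?N" and v: "is_vass d (arg t)" using s(1) unfolding sub_vass_def by auto
      have "length ?fs + i < d \<or> length ?fs + i = d \<and> neutral_transitions (arg s) (chosen s) = snd (arg s)"
      proof (rule Call.IH[OF t(1) run v s(2) F1 _ _ F2 F3 F4 t(2)])
        fix i e assume i: "i < length ?fs" and e: "e \<in> snd (arg t)"
        have eA: "e \<in> snd A" "neutral f e" using e sub unfolding neutral_transitions_def by auto
        show "neutral (?fs ! i) e"
          using i eA Call.prems(5)[of i e] by (cases "i < length fs") (auto simp: nth_append less_Suc_eq)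
      qed (use Call.prems(6) in auto)
      thus ?thesis using t(3) by simp
    qed
  qed
qed

lemma finite_calls_at: "finite (calls_at t)"
  by (induction t) auto

lemma return_value_infinity:
  "(j, s) \<in> calls_at t \<Longrightarrow> decompose_run d t \<Longrightarrow>
    neutral_transitions (arg s) (chosen s) = snd (arg s) \<Longrightarrow> return_value t = \<infinity>"
proof (induction t arbitrary: j)
  case (Call A f ts)
  let ?N = "neutral_transitions A f"
  show ?case
  proof (cases "?N = snd A")
    case False
    hence "(j, s) \<noteq> (0, Call A f ts)" using Call.prems(3) by auto
    then obtain i t where t: "t \<in> set ts" "(i, s) \<in> calls_at t" using Call.prems(1) by auto
    hence ne: "?N \<noteq> {}" using Call.prems(2) False by (auto simp: Let_def)
    have "decompose_run d t" using Call.prems(2) False ne t(1) by (auto simp: Let_def)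
    hence "return_value t = \<infinity>" using Call.IH[OF t(1,2)] Call.prems(3) by blast
    moreover have "return_value t \<le> Max (set (map return_value ts))" using t(1) by (intro Max_ge) auto
    ultimately have "Max (set (map return_value ts)) = \<infinity>" by simp
    thus ?thesis using False ne by (simp add: Let_def)
  qed simp
qed

theorem recursion_depth_bound:
  fixes A :: "'q vass"
  assumes "is_vass d A" "strongly_connected A" "algorithm_run d A t r"
  shows "(r \<noteq> Non_terminating \<longrightarrow> recursion_depth t < d) \<and>
     (\<forall>(j, s) \<in> calls_at t. j < d \<or> j = d \<and> neutral_transitions (arg s) (chosen s) = snd (arg s))"
proof -
  have t: "arg t = A" "decompose_run d t"
    and r: "r = (case return_value t of \<infinity> \<Rightarrow> Non_terminating | enat k \<Rightarrow> Bound k (\<exists>f. positive_QRF d A f))"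
    using assms(3) unfolding algorithm_run_def by auto
  have all: "j < d \<or> j = d \<and> neutral_transitions (arg s) (chosen s) = snd (arg s)" if "(j, s) \<in> calls_at t" for j s
    using calls_depth_aux[OF t(2), of "[]" "[]" j s] assms(1,2) t(1) that by simp
  have "recursion_depth t < d" if "r \<noteq> Non_terminating"
  proof -
    have ni: "return_value t \<noteq> \<infinity>"
    proof
      assume "return_value t = \<infinity>"
      thus False using \<open>r \<noteq> Non_terminating\<close> r by simp
    qed
    have "j < d" if "(j, s) \<in> calls_at t" for j s
      using all[OF that] return_value_infinity[OF that t(2)] ni by blast
    moreover have "calls_at t \<noteq> {}" by (cases t) auto
    ultimately show ?thesis unfolding recursion_depth_def using finite_calls_at[of t]
      by (subst Max_less_iff) auto
  qed
  thus ?thesis using all by auto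
qed

section \<open>The decomposition algorithm\<close>

definition flat :: "nat list \<Rightarrow> nat transition list \<Rightarrow> rat list \<Rightarrow> bool" where
  "flat Qs Ts x \<longleftrightarrow> (\<forall>e\<in>set Ts. dot (trow Qs e) x = 0)"

definition subs :: "nat list \<Rightarrow> nat transition list \<Rightarrow> rat list \<Rightarrow> (nat list \<times> nat transition list) list" where
  "subs Qs Ts x = (let N = filter (\<lambda>e. dot (trow Qs e) x = 0) Ts in
     if flat Qs Ts x \<or> N = [] then [] else scc_list Qs N)"

text \<open>The segment of the encoding of a call that precedes its subcalls. The vector
  \<open>x\<close> already lists coefficients and weights in the required order.\<close>

definition chunk :: "nat list \<Rightarrow> nat list \<Rightarrow> nat transition list \<Rightarrow> rat list \<Rightarrow> int list" where
  "chunk ds Qs Ts x = encode_listing (length ds) Qs Ts @ concat (map encode_rat x) @ [int (length (subs Qs Ts x))]"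

text \<open>The recursion is run with a stack of pending calls, each with its depth. A state further has the
  protocol written so far (call trees are encoded in preorder, so that it only grows at the end), the
  largest depth reached, and whether some call answered \<open>\<infinity>\<close>.\<close>

type_synonym item = "nat \<times> nat list \<times> nat transition list"
type_synonym wstate = "nat list \<times> item list \<times> int list \<times> nat \<times> bool"

definition wl_loop :: "wstate \<Rightarrow> bool" where "wl_loop S \<longleftrightarrow> fst (snd S) \<noteq> []"

definition wl_exp :: "nat list \<Rightarrow> item \<Rightarrow> item list \<times> int list \<times> bool" where
  "wl_exp ds it = (let Qs = fst (snd it); Ts = snd (snd it); x = qrf ds Qs Ts in
     (map (\<lambda>B. (Suc (fst it), B)) (subs Qs Ts x), chunk ds Qs Ts x, flat Qs Ts x))"

definition wl_step :: "wstate \<Rightarrow> wstate" where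
  "wl_step S = (let it = hd (fst (snd S)); r = wl_exp (fst S) it in
     (fst S, fst r @ tl (fst (snd S)), fst (snd (snd S)) @ fst (snd r), max (fst (snd (snd (snd S)))) (fst it),
      snd (snd (snd (snd S))) \<or> snd (snd r)))"

definition good_item :: "nat \<Rightarrow> nat list \<Rightarrow> nat transition list \<Rightarrow> bool" where
  "good_item d Qs Ts \<longleftrightarrow> distinct Qs \<and> distinct Ts \<and> is_vass d (set Qs, set Ts) \<and>
     strongly_connected (set Qs, set Ts) \<and> Ts \<noteq> []"

lemma good_itemD:
  assumes "good_item d Qs Ts"
  shows "listing (set Qs, set Ts) Qs Ts" "set Ts \<subseteq> set Qs \<times> carrier_vec d \<times> set Qs"
    "distinct Qs" "distinct Ts" "is_vass d (set Qs, set Ts)" "strongly_connected (set Qs, set Ts)"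
  using assms unfolding good_item_def listing_def is_vass_def by auto

text \<open>A common transition of two components puts its source into both classes of mutually
  reachable states, which then coincide. Distinct components therefore share no transition, and
  their lengths add up to at most that of the list.\<close>

lemma restr_disjoint:
  assumes T: "set Ts \<subseteq> set Qs \<times> carrier_vec d \<times> set Qs" "distinct Qs" "distinct Ts"
  shows "length (concat (map snd (scc_list Qs Ts))) \<le> length Ts"
    "\<And>B. B \<in> set (scc_list Qs Ts) \<Longrightarrow> good_item d (fst B) (snd B)"
proof -
  note sl = scc_list_correct[OF T(2,3,1)]
  let ?v = "\<lambda>B. (set (fst B), set (snd B))"
  have scc: "?v B \<in> sccs d (set Qs, set Ts)" if "B \<in> set (scc_list Qs Ts)" for B
    using sl(2) that by blast
  show g: "good_item d (fst B) (snd B)" if B: "B \<in> set (scc_list Qs Ts)" for B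
  proof -
    have s: "sub_vass d (?v B) (set Qs, set Ts)" "strongly_connected (?v B)" using scc[OF B] unfolding sccs_def by auto
    hence v: "is_vass d (?v B)" unfolding sub_vass_def by simp
    hence "snd B \<noteq> []" unfolding is_vass_def by fastforce
    thus ?thesis unfolding good_item_def using s v sl(4)[OF B] by simp
  qed
  have sub: "set (snd B) \<subseteq> set Ts" if "B \<in> set (scc_list Qs Ts)" for B
    using scc[OF that] unfolding sccs_def sub_vass_def by auto
  have dis: "set (snd B) \<inter> set (snd C) = {}"
    if B: "B \<in> set (scc_list Qs Ts)" and C: "C \<in> set (scc_list Qs Ts)" and neq: "?v B \<noteq> ?v C" for B C
  proof (rule ccontr)
    assume "set (snd B) \<inter> set (snd C) \<noteq> {}"
    then obtain e where e: "e \<in> set (snd B)" "e \<in> set (snd C)" by auto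
    obtain q r where q: "?v B = component (set Ts) q" "?v C = component (set Ts) r"
      using scc[OF B] scc[OF C] sccs_eq[of "set Qs" "set Ts" d] T(1) by auto
    have "src e \<in> mutual (set Ts) q" "src e \<in> mutual (set Ts) r" using e q unfolding component_def by auto
    hence "mutual (set Ts) q = mutual (set Ts) r" unfolding mutual_def by (auto intro: trancl_trans)
    thus False using neq q unfolding component_def by auto
  qed
  have ne: "set (snd B) \<noteq> {}" if "B \<in> set (scc_list Qs Ts)" for B using g[OF that] unfolding good_item_def by simp
  have dv: "distinct (map ?v (scc_list Qs Ts))" by (rule sl(3))
  have dl: "distinct (scc_list Qs Ts)" using dv unfolding distinct_map by blast
  have inj: "inj_on ?v (set (scc_list Qs Ts))" using dv by (simp only: distinct_map)
  have "distinct (concat (map snd (scc_list Qs Ts)))"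
  proof (rule distinct_concat)
    show "distinct (map snd (scc_list Qs Ts))"
      unfolding distinct_map
    proof (intro conjI dl inj_onI)
      fix B C assume BC: "B \<in> set (scc_list Qs Ts)" "C \<in> set (scc_list Qs Ts)" "snd B = snd C"
      show "B = C"
      proof (rule inj_onD[OF inj _ BC(1,2)])
        show "?v B = ?v C" using dis[OF BC(1,2)] ne[OF BC(1)] BC(3) by auto
      qed
    qed
    show "distinct ys" if "ys \<in> set (map snd (scc_list Qs Ts))" for ys using that sl(4) by auto
    fix ys zs assume "ys \<in> set (map snd (scc_list Qs Ts))" "zs \<in> set (map snd (scc_list Qs Ts))" "ys \<noteq> zs"
    then obtain B C where BC: "B \<in> set (scc_list Qs Ts)" "ys = snd B" "C \<in> set (scc_list Qs Ts)" "zs = snd C" "snd B \<noteq> snd C" by auto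
    have "?v B \<noteq> ?v C" using inj_onD[OF inj, of B C] BC by auto
    thus "set ys \<inter> set zs = {}" using dis BC by blast
  qed
  hence "length (concat (map snd (scc_list Qs Ts))) = card (set (concat (map snd (scc_list Qs Ts))))" by (simp only: distinct_card)
  also have "\<dots> \<le> card (set Ts)" using sub by (intro card_mono) auto
  also have "\<dots> \<le> length Ts" by (rule card_length)
  finally show "length (concat (map snd (scc_list Qs Ts))) \<le> length Ts" .
qed

lemma subs_props:
  assumes g: "good_item d Qs Ts"
  shows "\<And>B. B \<in> set (subs Qs Ts x) \<Longrightarrow> good_item d (fst B) (snd B) \<and> length (snd B) < length Ts"
    "subs Qs Ts x \<noteq> [] \<Longrightarrow> length (concat (map snd (subs Qs Ts x))) < length Ts"
proof -
  define N where "N = filter (\<lambda>e. dot (trow Qs e) x = 0) Ts"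
  have N: "set N \<subseteq> set Qs \<times> carrier_vec d \<times> set Qs" "distinct N" using good_itemD[OF g] unfolding N_def by auto
  note r = restr_disjoint[OF N(1) good_itemD(3)[OF g] N(2)]
  have s: "subs Qs Ts x = (if flat Qs Ts x \<or> N = [] then [] else scc_list Qs N)" unfolding subs_def N_def Let_def ..
  have lt: "length N < length Ts" if "\<not> flat Qs Ts x"
    using that unfolding flat_def N_def by (auto intro!: length_filter_less)
  show "length (concat (map snd (subs Qs Ts x))) < length Ts" if "subs Qs Ts x \<noteq> []"
    using that r(1) lt unfolding s by (auto split: if_splits)
  fix B assume B: "B \<in> set (subs Qs Ts x)"
  hence f: "\<not> flat Qs Ts x" "subs Qs Ts x = scc_list Qs N" unfolding s by (auto split: if_splits)
  have "length (snd B) \<le> length (concat (map snd (scc_list Qs N)))"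
    using B unfolding f(2) by (auto simp: length_concat intro!: member_le_sum_list)
  thus "good_item d (fst B) (snd B) \<and> length (snd B) < length Ts" using r B lt[OF f(1)] unfolding f(2) by auto
qed

lemma foldr_max_init: "foldr (\<lambda>t a. max (c t) a) ts (max y z) = max z (foldr (\<lambda>t a. max (c t) a) ts y)" for y z :: nat
  by (induction ts) auto

lemma fold_max: "fold (\<lambda>t a. max a (c t)) ts y = foldr (\<lambda>t a. max (c t) a) ts y" for y :: nat
  by (induction ts arbitrary: y) (auto simp: foldr_max_init)

text \<open>Working off one item amounts to performing a complete run of the procedure on it and
  appending its encoding. The claim is an equation between two loops for an arbitrary rest of the
  stack, so that it can be applied to the pushed items one after the other and needs no separate
  proof of termination.\<close>

lemma wl_while_item:
  assumes "good_item (length ds) Qs Ts"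
  shows "\<exists>t ys. arg t = (set Qs, set Ts) \<and> decompose_run (length ds) t \<and> proper t \<and> encodes_call (length ds) t ys \<and>
    (\<forall>j st out mx i. while wl_loop wl_step (ds, (j, Qs, Ts) # st, out, mx, i) =
       while wl_loop wl_step (ds, st, out @ ys, max mx (j + hgt t), i \<or> diverges t))"
  using assms
proof (induction "length Ts" arbitrary: Qs Ts rule: less_induct)
  case less
  note g = less.prems
  define d where "d = length ds"
  define A where "A = (set Qs, set Ts)"
  define x where "x = qrf ds Qs Ts"
  define f where "f = (qc d x, qw d Qs x)"
  define N where "N = filter (\<lambda>e. dot (trow Qs e) x = 0) Ts"
  note gd = good_itemD[OF g, folded d_def A_def]
  have A2: "snd A \<subseteq> fst A \<times> carrier_vec d \<times> fst A" using gd(2) unfolding A_def by simp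
  have q: "length x = d + length Qs" "maximal_QRF d A f" "neutral_transitions A f = {e \<in> set Ts. dot (trow Qs e) x = 0}"
    unfolding f_def x_def by (rule qrf_maximal[OF d_def[symmetric] gd(1) A2])+
  have NN: "neutral_transitions A f = set N" unfolding q(3) N_def by simp
  have fl: "flat Qs Ts x \<longleftrightarrow> neutral_transitions A f = snd A"
  proof -
    have "snd A = set Ts" unfolding A_def by simp
    thus ?thesis unfolding NN flat_def N_def set_filter by auto
  qed
  define Bs where "Bs = subs Qs Ts x"
  have Bs: "Bs = (if neutral_transitions A f = snd A \<or> neutral_transitions A f = {} then [] else scc_list Qs N)"
    unfolding Bs_def subs_def Let_def fl NN N_def[symmetric] by simp
  note sp = subs_props[OF g, where x = x, folded Bs_def]
  have "\<forall>B\<in>set Bs. \<exists>p. arg (fst p) = (set (fst B), set (snd B)) \<and> decompose_run d (fst p) \<and> proper (fst p) \<and> encodes_call d (fst p) (snd p) \<and>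
    (\<forall>j st out mx i. while wl_loop wl_step (ds, (j, fst B, snd B) # st, out, mx, i) =
       while wl_loop wl_step (ds, st, out @ snd p, max mx (j + hgt (fst p)), i \<or> diverges (fst p)))"
  proof
    fix B assume "B \<in> set Bs"
    from less.hyps[OF conjunct2[OF sp(1)[OF this]] conjunct1[OF sp(1)[OF this]]]
    show "\<exists>p. arg (fst p) = (set (fst B), set (snd B)) \<and> decompose_run d (fst p) \<and> proper (fst p) \<and> encodes_call d (fst p) (snd p) \<and>
      (\<forall>j st out mx i. while wl_loop wl_step (ds, (j, fst B, snd B) # st, out, mx, i) =
       while wl_loop wl_step (ds, st, out @ snd p, max mx (j + hgt (fst p)), i \<or> diverges (fst p)))"
      unfolding d_def by force
  qed
  then obtain F where F: "\<forall>B\<in>set Bs. arg (fst (F B)) = (set (fst B), set (snd B)) \<and> decompose_run d (fst (F B)) \<and> proper (fst (F B)) \<and>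
     encodes_call d (fst (F B)) (snd (F B)) \<and>
    (\<forall>j st out mx i. while wl_loop wl_step (ds, (j, fst B, snd B) # st, out, mx, i) =
       while wl_loop wl_step (ds, st, out @ snd (F B), max mx (j + hgt (fst (F B))), i \<or> diverges (fst (F B))))"
    by (rule bchoice[THEN exE])
  define ts where "ts = map (\<lambda>B. fst (F B)) Bs"
  define yss where "yss = map (\<lambda>B. snd (F B)) Bs"
  define t where "t = Call A f ts"
  define ys where "ys = chunk ds Qs Ts x @ concat yss"
  have lp: "while wl_loop wl_step (ds, map (\<lambda>B. (j, B)) Cs @ st, out, mx, i) =
     while wl_loop wl_step (ds, st, out @ concat (map (\<lambda>B. snd (F B)) Cs),
       fold (\<lambda>t a. max a (j + hgt t)) (map (\<lambda>B. fst (F B)) Cs) mx, i \<or> (\<exists>B\<in>set Cs. diverges (fst (F B))))"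
    if "set Cs \<subseteq> set Bs" for Cs j st out mx i
    using that
  proof (induction Cs arbitrary: out mx i)
    case (Cons C Cs)
    have C: "while wl_loop wl_step (ds, (j, fst C, snd C) # st, out, mx, i) =
       while wl_loop wl_step (ds, st, out @ snd (F C), max mx (j + hgt (fst (F C))), i \<or> diverges (fst (F C)))" for j st out mx i
      using F Cons.prems by simp
    show ?case using C[of j "map (\<lambda>B. (j, B)) Cs @ st" out mx i] Cons by (simp add: disj_assoc)
  qed simp
  have args: "map arg ts = map (\<lambda>B. (set (fst B), set (snd B))) Bs" unfolding ts_def using F by simp
  have run: "decompose_run d t"
  proof (cases "neutral_transitions A f = snd A \<or> neutral_transitions A f = {}")
    case True
    hence "ts = []" unfolding ts_def Bs by simp
    thus ?thesis using q(2) True unfolding t_def by (simp add: Let_def)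
  next
    case False
    hence b: "Bs = scc_list Qs N" unfolding Bs by simp
    have NT: "set N \<subseteq> set Qs \<times> carrier_vec d \<times> set Qs" "distinct N" using gd(2,4) unfolding N_def by auto
    note sl = scc_list_correct[OF gd(3) NT(2,1), folded b]
    have fA: "fst A = set Qs" unfolding A_def by simp
    have "distinct (map arg ts)" "set (map arg ts) = sccs d (fst A, neutral_transitions A f)"
      unfolding args NN fA using sl(2,3) by simp_all
    moreover have "\<forall>t\<in>set ts. decompose_run d t" using F unfolding ts_def by auto
    ultimately show ?thesis using q(2) False unfolding t_def by (simp add: Let_def)
  qed
  have pro: "proper t"
  proof -
    have "ts \<noteq> []" if "neutral_transitions A f \<noteq> snd A" "neutral_transitions A f \<noteq> {}"
    proof -
      have "set (map arg ts) = sccs d (fst A, neutral_transitions A f)" using run that unfolding t_def by (simp add: Let_def)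
      moreover have "sccs d (fst A, neutral_transitions A f) \<noteq> {}"
        by (rule maximal_QRF_sccs_nonempty[OF gd(5) q(2) that(2)])
      ultimately show ?thesis by auto
    qed
    moreover have "ts = []" if "neutral_transitions A f = snd A \<or> neutral_transitions A f = {}"
      using that unfolding ts_def Bs by simp
    moreover have "\<forall>t\<in>set ts. proper t" using F unfolding ts_def by auto
    ultimately show ?thesis unfolding t_def proper.simps by blast
  qed
  have encd: "encodes_call d t ys"
  proof -
    note xq = qc_qw[OF gd(3) q(1)]
    have "encodes_call d (Call A (qc d x, qw d Qs x) ts) (encode_listing d Qs Ts @ concat (map encode_rat (list_of_vec (qc d x))) @
      concat (map (\<lambda>q. encode_rat (qw d Qs x q)) Qs) @ [int (length ts)] @ concat yss)"
    proof (rule encodes_call.intros[OF gd(1)])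
      show "length yss = length ts" unfolding yss_def ts_def by simp
      fix i assume "i < length ts"
      thus "encodes_call d (ts ! i) (yss ! i)" using F unfolding ts_def yss_def by simp
    qed
    moreover have "concat (map encode_rat x) = concat (map encode_rat (list_of_vec (qc d x))) @ concat (map (\<lambda>q. encode_rat (qw d Qs x q)) Qs)"
      by (subst (1) xq(1)) (simp add: o_def)
    moreover have "length ts = length (subs Qs Ts x)" unfolding ts_def Bs_def by simp
    ultimately show ?thesis unfolding t_def f_def ys_def chunk_def d_def by simp
  qed
  have wh: "while wl_loop wl_step (ds, (j, Qs, Ts) # st, out, mx, i) =
       while wl_loop wl_step (ds, st, out @ ys, max mx (j + hgt t), i \<or> diverges t)" for j st out mx i
  proof -
    have st: "wl_step (ds, (j, Qs, Ts) # st, out, mx, i) =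
      (ds, map (\<lambda>B. (Suc j, B)) Bs @ st, out @ chunk ds Qs Ts x, max mx j, i \<or> flat Qs Ts x)"
      unfolding wl_step_def wl_exp_def Let_def x_def Bs_def by simp
    have "while wl_loop wl_step (ds, (j, Qs, Ts) # st, out, mx, i)
      = while wl_loop wl_step (ds, map (\<lambda>B. (Suc j, B)) Bs @ st, out @ chunk ds Qs Ts x, max mx j, i \<or> flat Qs Ts x)"
      by (subst while_unfold) (simp add: wl_loop_def st)
    also have "\<dots> = while wl_loop wl_step (ds, st, (out @ chunk ds Qs Ts x) @ concat yss,
       fold (\<lambda>t a. max a (Suc j + hgt t)) ts (max mx j), (i \<or> flat Qs Ts x) \<or> (\<exists>B\<in>set Bs. diverges (fst (F B))))"
      unfolding yss_def ts_def by (rule lp) simp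
    also have "fold (\<lambda>t a. max a (Suc j + hgt t)) ts (max mx j) = max mx (j + hgt t)"
      unfolding fold_max foldr_max_shift t_def by simp
    also have "((i \<or> flat Qs Ts x) \<or> (\<exists>B\<in>set Bs. diverges (fst (F B)))) \<longleftrightarrow> (i \<or> diverges t)"
      unfolding t_def fl ts_def by auto
    finally show ?thesis unfolding ys_def by simp
  qed
  show ?case
    by (rule exI[of _ t], rule exI[of _ ys])
      (use run pro encd wh in \<open>simp add: d_def[symmetric] A_def t_def\<close>)
qed

text \<open>An item with \<open>k\<close> transitions has potential \<open>2 * k - 1\<close>. The
  subcalls have fewer transitions in total than the item, and each loses another 1, so the potential
  drops even if there is a single subcall. Hence fewer than twice as many rounds as transitions. The
  lists themselves only shrink, so their sizes never exceed those of the input.\<close>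

lemma wl_exp_item:
  assumes g: "good_item (length ds) Qs Ts"
  shows "\<And>it. it \<in> set (fst (wl_exp ds (j, Qs, Ts))) \<Longrightarrow>
      fst it = Suc j \<and> good_item (length ds) (fst (snd it)) (snd (snd it)) \<and> sz (fst (snd it)) \<le> sz Qs \<and> sz (snd (snd it)) \<le> sz Ts"
    "(\<Sum>it\<leftarrow>fst (wl_exp ds (j, Qs, Ts)). 2 * length (snd (snd it)) - 1) < 2 * length Ts - 1"
proof -
  define x where "x = qrf ds Qs Ts"
  define N where "N = filter (\<lambda>e. dot (trow Qs e) x = 0) Ts"
  have e: "fst (wl_exp ds (j, Qs, Ts)) = map (\<lambda>B. (Suc j, B)) (subs Qs Ts x)" unfolding wl_exp_def Let_def x_def by simp
  note sp = subs_props[OF g, where x = x]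
  have T0: "0 < length Ts" using g unfolding good_item_def by simp
  show "fst it = Suc j \<and> good_item (length ds) (fst (snd it)) (snd (snd it)) \<and> sz (fst (snd it)) \<le> sz Qs \<and> sz (snd (snd it)) \<le> sz Ts"
    if it: "it \<in> set (fst (wl_exp ds (j, Qs, Ts)))" for it
  proof -
    obtain B where B: "B \<in> set (subs Qs Ts x)" "it = (Suc j, B)" using it unfolding e by auto
    have "B \<in> set (scc_list Qs N)" using B(1) unfolding subs_def Let_def N_def by (auto split: if_splits)
    hence "sz (fst B) \<le> sz Qs" "sz (snd B) \<le> sz N"
      unfolding scc_list_def Let_def cls_def restr_def by (auto simp: sz_filter)
    thus ?thesis using B sp(1)[OF B(1)] sz_filter[of "\<lambda>e. dot (trow Qs e) x = 0" Ts] unfolding N_def by auto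
  qed
  have "(\<Sum>B\<leftarrow>Bs. 2 * length (snd B) - 1) + length Bs \<le> 2 * length (concat (map snd Bs))"
    if "\<And>B. B \<in> set Bs \<Longrightarrow> snd B \<noteq> []" for Bs :: "(nat list \<times> nat transition list) list"
    using that
  proof (induction Bs)
    case (Cons B Bs)
    have "(\<Sum>B\<leftarrow>Bs. 2 * length (snd B) - 1) + length Bs \<le> 2 * length (concat (map snd Bs))" using Cons by auto
    moreover obtain b bs where "snd B = b # bs" using Cons.prems[of B] by (cases "snd B") auto
    ultimately show ?case by simp
  qed simp
  from this[of "subs Qs Ts x"] have "(\<Sum>B\<leftarrow>subs Qs Ts x. 2 * length (snd B) - 1) + length (subs Qs Ts x) \<le> 2 * length (concat (map snd (subs Qs Ts x)))"
    using sp(1) unfolding good_item_def by blast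
  note sm = this
  have "(\<Sum>B\<leftarrow>subs Qs Ts x. 2 * length (snd B) - 1) < 2 * length Ts - 1"
  proof (cases "subs Qs Ts x = []")
    case True
    show ?thesis using T0 unfolding True list.map sum_list.Nil by linarith
  next
    case False
    have "0 < length (subs Qs Ts x)" using False by simp
    thus ?thesis using sp(2)[OF False] sm by linarith
  qed
  thus "(\<Sum>it\<leftarrow>fst (wl_exp ds (j, Qs, Ts)). 2 * length (snd (snd it)) - 1) < 2 * length Ts - 1"
    unfolding e fst_conv map_map o_def snd_conv .
qed

section \<open>Polynomial time of the work list\<close>

lemma pt_encode_rat [pt_intros]: "pt D f \<Longrightarrow> pt D (\<lambda>s. encode_rat (f s))"
  unfolding encode_rat_def by (intro pt_intros)

lemma pt_encode_listing [pt_intros]: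
  assumes "pt D f" "pt D g" "pt D h" shows "pt D (\<lambda>s. encode_listing (f s) (g s) (h s))"
proof -
  have "pt UNIV (\<lambda>s. encode_listing (fst s) (fst (snd s)) (snd (snd s)))"
    unfolding encode_listing_def encode_transition_def split_beta by (intro pt_intros)
  from pt_comp[OF this pt_Pair[OF assms(1) pt_Pair[OF assms(2,3)]]] show ?thesis by simp
qed

lemma pt_flat [pt_intros]: assumes "pt D f" "pt D g" "pt D h" shows "pt D (\<lambda>s. flat (f s) (g s) (h s))"
proof -
  have "pt UNIV (\<lambda>s. flat (fst s) (fst (snd s)) (snd (snd s)))" unfolding flat_def by (intro pt_intros)
  from pt_comp[OF this pt_Pair[OF assms(1) pt_Pair[OF assms(2,3)]]] show ?thesis by simp
qed

lemma pt_subs [pt_intros]: assumes "pt D f" "pt D g" "pt D h" shows "pt D (\<lambda>s. subs (f s) (g s) (h s))"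
proof -
  have "pt UNIV (\<lambda>s. subs (fst s) (fst (snd s)) (snd (snd s)))" unfolding subs_def Let_def by (intro pt_intros)
  from pt_comp[OF this pt_Pair[OF assms(1) pt_Pair[OF assms(2,3)]]] show ?thesis by simp
qed

lemma pt_chunk [pt_intros]:
  assumes "pt D f" "pt D g" "pt D h" "pt D k" shows "pt D (\<lambda>s. chunk (f s) (g s) (h s) (k s))"
proof -
  have "pt UNIV (\<lambda>s. chunk (fst s) (fst (snd s)) (fst (snd (snd s))) (snd (snd (snd s))))" unfolding chunk_def by (intro pt_intros)
  from pt_comp[OF this pt_Pair[OF assms(1) pt_Pair[OF assms(2) pt_Pair[OF assms(3,4)]]]] show ?thesis by simp
qed

lemma pt_wl_exp: "pt {p. wf_item (fst p) (fst (snd (snd p))) (snd (snd (snd p)))} (\<lambda>p. wl_exp (fst p) (snd p))"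
  (is "pt ?E _")
proof -
  have q: "pt ?E (\<lambda>p. qrf (fst p) (fst (snd (snd p))) (snd (snd (snd p))))"
    by (rule pt_qrf) (intro pt_intros, intro pt_intros, intro pt_intros, simp)
  have m: "pt UNIV (\<lambda>s. map (\<lambda>B. (Suc (fst s), B)) (snd s :: (nat list \<times> nat transition list) list))" by (intro pt_intros)
  have "pt ?E (\<lambda>p. map (\<lambda>B. (Suc (fst (snd p)), B)) (subs (fst (snd (snd p))) (snd (snd (snd p))) (qrf (fst p) (fst (snd (snd p))) (snd (snd (snd p))))))"
    by (rule pt_comp2[OF m]) (intro pt_intros q, intro pt_intros q, simp)
  thus ?thesis unfolding wl_exp_def Let_def by (intro pt_intros q)
qed

definition wl_result :: "nat list \<Rightarrow> nat list \<Rightarrow> nat transition list \<Rightarrow> wstate" where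
  "wl_result ds Qs Ts = while wl_loop wl_step (ds, [(0, Qs, Ts)], [], 0, False)"

lemma pt_wl_result:
  "pt {p. good_item (length (fst p)) (fst (snd p)) (snd (snd p))} (\<lambda>p. wl_result (fst p) (fst (snd p)) (snd (snd p)))"
proof -
  define D :: "wstate set" where "D = {(ds, [(0, Qs, Ts)], [], 0, False) | ds Qs Ts. good_item (length ds) Qs Ts}"
  define E :: "wstate set" where "E = {S. \<forall>it\<in>set (fst (snd S)). good_item (length (fst S)) (fst (snd it)) (snd (snd it))}"
  obtain e where e: "\<And>p. wf_item (fst p) (fst (snd (snd p))) (snd (snd (snd p))) \<Longrightarrow> sz (wl_exp (fst p) (snd p)) \<le> (sz p + 2) ^ e"
    by (rule pt_size_fun[OF pt_wl_exp]) blast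
  define pt0 where "pt0 st = (\<Sum>it\<leftarrow>st. 2 * length (snd (snd it)) - 1)" for st :: "item list"
  define ub where "ub s = (s + (2 * s + 1) + s + s + 3 + 2) ^ e" for s :: nat
  \<comment> \<open>\<open>k\<close> counts the rounds so far. It bounds the depths, and each round
    appends at most \<open>ub\<close> to the protocol, where \<open>ub\<close> depends on the
    initial state only; the potential left on the stack bounds \<open>k\<close> in turn.\<close>
  define I where "I x y \<longleftrightarrow> y \<in> E \<and> fst y = fst x \<and> (\<exists>k. pt0 (fst (snd y)) + k \<le> 2 * sz x \<and>
      (\<forall>it\<in>set (fst (snd y)). fst it \<le> k \<and> sz (fst (snd it)) \<le> sz x \<and> sz (snd (snd it)) \<le> sz x) \<and>
      sz (fst (snd (snd y))) \<le> k * ub (sz x) + 3 \<and> fst (snd (snd (snd y))) \<le> k)" for x y :: wstate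
  define p where "p s = s + (2 * s * ((2 * s + 1) + s + s + 2 + 4) + 3) + (2 * s * ub s + 3) + (2 * s + 1) + 2 + 4" for s
  have wfi: "wf_item ds Qs Ts" if "good_item (length ds) Qs Ts" for ds Qs Ts
    using good_itemD(2)[OF that] unfolding wf_item_def by auto
  have len: "length st \<le> pt0 st" if "\<And>it. it \<in> set st \<Longrightarrow> snd (snd it) \<noteq> []" for st
    using that unfolding pt0_def
  proof (induction st)
    case (Cons it st)
    have "1 \<le> 2 * length (snd (snd it)) - 1" using Cons.prems[of it] by (cases "snd (snd it)") auto
    moreover have "length st \<le> (\<Sum>it\<leftarrow>st. 2 * length (snd (snd it)) - 1)" using Cons by auto
    ultimately show ?case by simp
  qed simp
  have "pt D (while wl_loop wl_step)"
  proof (rule pt_while[where E = E and I = I and \<mu> = "\<lambda>x y. pt0 (fst (snd y))" and p = p])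
    show "pt E wl_loop" unfolding wl_loop_def[abs_def] by (intro pt_nonempty pt_intros)
    have h: "pt {x \<in> E. wl_loop x} (\<lambda>S. hd (fst (snd S)))" by (intro pt_hd pt_intros) (auto simp: wl_loop_def)
    have "pt {x \<in> E. wl_loop x} (\<lambda>S. wl_exp (fst S) (hd (fst (snd S))))"
      by (rule pt_comp2[OF pt_wl_exp]) (intro pt_intros, rule h, auto simp: E_def wl_loop_def intro!: wfi)
    thus "pt {x \<in> E. wl_loop x} wl_step" unfolding wl_step_def Let_def by (intro pt_intros h)
    show "polyb p" unfolding p_def[abs_def] ub_def by (intro polyb_add polyb_mult polyb_power polyb_id polyb_const)
  next
    fix x assume "x \<in> D"
    then obtain ds Qs Ts where x: "x = (ds, [(0, Qs, Ts)], [], 0, False)" "good_item (length ds) Qs Ts" unfolding D_def by blast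
    have "length Ts \<le> sz Ts" by (rule length_le_sz)
    hence p0: "pt0 (fst (snd x)) \<le> 2 * sz x" unfolding x pt0_def by simp
    have "x \<in> E" unfolding E_def using x by simp
    thus "I x x \<and> pt0 (fst (snd x)) \<le> p (sz x)" unfolding I_def using p0 by (auto simp: p_def x intro!: exI[of _ 0])
  next
    fix x y assume x: "x \<in> D" and I: "I x y" and c: "wl_loop y"
    obtain ds j Qs Ts st out mx i where y: "y = (ds, (j, Qs, Ts) # st, out, mx, i)" using c unfolding wl_loop_def
      by (cases y) (auto simp: neq_Nil_conv)
    have yE: "y \<in> E" and fx: "ds = fst x" using I unfolding I_def y by auto
    have g: "good_item (length ds) Qs Ts" using yE unfolding E_def y by simp
    obtain k where k: "pt0 ((j, Qs, Ts) # st) + k \<le> 2 * sz x"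
      "\<forall>it\<in>set ((j, Qs, Ts) # st). fst it \<le> k \<and> sz (fst (snd it)) \<le> sz x \<and> sz (snd (snd it)) \<le> sz x"
      "sz out \<le> k * ub (sz x) + 3" "mx \<le> k" using I unfolding I_def y by auto
    define r where "r = wl_exp ds (j, Qs, Ts)"
    have ys: "wl_step y = (ds, fst r @ st, out @ fst (snd r), max mx j, i \<or> snd (snd r))"
      unfolding wl_step_def Let_def y r_def by simp
    have ep: "pt0 (fst r) < 2 * length Ts - 1" unfolding pt0_def by (rule wl_exp_item(2)[OF g, of j, folded r_def])
    have pd: "pt0 (fst r @ st) < pt0 ((j, Qs, Ts) # st)" using ep unfolding pt0_def by simp
    have szr: "sz (fst (snd r)) \<le> ub (sz x)"
    proof -
      have "sz (fst (snd r)) \<le> sz r" by (simp add: sz_prod)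
      also have "\<dots> \<le> (sz (ds, j, Qs, Ts) + 2) ^ e" using e[of "(ds, j, Qs, Ts)"] wfi[OF g] unfolding r_def by simp
      also have "\<dots> \<le> ub (sz x)" unfolding ub_def
      proof (rule power_mono)
        have "sz ds \<le> sz x" unfolding fx by (simp add: sz_prod[of x])
        moreover have "j \<le> 2 * sz x" using k(1,2) by simp
        hence "sz j \<le> 2 * sz x + 1" using sz_nat_le[of j] by simp
        ultimately show "sz (ds, j, Qs, Ts) + 2 \<le> sz x + (2 * sz x + 1) + sz x + sz x + 3 + 2" using k(2) by simp
      qed simp
      finally show ?thesis .
    qed
    have "wl_step y \<in> E" unfolding ys E_def
      using yE[unfolded E_def y] wl_exp_item(1)[OF g, of _ j, folded r_def] by auto
    moreover have "pt0 (fst r @ st) + Suc k \<le> 2 * sz x" using pd k(1) by simp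
    moreover have "\<forall>it\<in>set (fst r @ st). fst it \<le> Suc k \<and> sz (fst (snd it)) \<le> sz x \<and> sz (snd (snd it)) \<le> sz x"
    proof
      fix it assume "it \<in> set (fst r @ st)"
      then consider "it \<in> set (fst r)" | "it \<in> set st" by auto
      thus "fst it \<le> Suc k \<and> sz (fst (snd it)) \<le> sz x \<and> sz (snd (snd it)) \<le> sz x"
      proof cases
        case 1
        from wl_exp_item(1)[OF g, of it j, folded r_def, OF 1] show ?thesis using k(2) by auto
      qed (use k(2) in auto)
    qed
    moreover have "sz (out @ fst (snd r)) \<le> Suc k * ub (sz x) + 3" using sz_append[of out "fst (snd r)"] k(3) szr by simp
    moreover have "max mx j \<le> Suc k" using k(2,4) by simp
    ultimately have "I x (wl_step y)" unfolding I_def using fx unfolding ys fst_conv snd_conv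
      by (intro conjI exI[of _ "Suc k"]) assumption+
    thus "I x (wl_step y) \<and> pt0 (fst (snd (wl_step y))) < pt0 (fst (snd y))" using pd ys unfolding y by simp
  next
    fix x y assume x: "x \<in> D" and I: "I x y"
    obtain ds st out mx i where y: "y = (ds, st, out, mx, i)" by (cases y)
    have yE: "y \<in> E" and fx: "ds = fst x" using I unfolding I_def y by auto
    obtain k where k: "pt0 st + k \<le> 2 * sz x"
      "\<forall>it\<in>set st. fst it \<le> k \<and> sz (fst (snd it)) \<le> sz x \<and> sz (snd (snd it)) \<le> sz x"
      "sz out \<le> k * ub (sz x) + 3" "mx \<le> k" using I unfolding I_def y by auto
    have lst: "length st \<le> 2 * sz x" using len[of st] yE k(1) unfolding E_def y good_item_def by fastforce
    have "sz st \<le> length st * (((2 * sz x + 1) + sz x + sz x + 2) + 4) + 3"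
    proof (rule sz_list_le)
      fix it assume "it \<in> set st"
      hence i: "fst it \<le> 2 * sz x" "sz (fst (snd it)) \<le> sz x" "sz (snd (snd it)) \<le> sz x" using k by fastforce+
      show "sz it \<le> (2 * sz x + 1) + sz x + sz x + 2" using i sz_nat_le[of "fst it"] by (simp add: sz_prod)
    qed
    also have "\<dots> \<le> 2 * sz x * ((2 * sz x + 1) + sz x + sz x + 2 + 4) + 3" using lst by (intro add_mono mult_right_mono) auto
    finally have 1: "sz st \<le> 2 * sz x * ((2 * sz x + 1) + sz x + sz x + 2 + 4) + 3" .
    have "k * ub (sz x) \<le> 2 * sz x * ub (sz x)" using k(1) by (intro mult_right_mono) auto
    hence 2: "sz out \<le> 2 * sz x * ub (sz x) + 3" using k(3) by linarith
    have 3: "sz mx \<le> 2 * sz x + 1" using k(1,4) sz_nat_le[of mx] by simp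
    have 4: "sz i \<le> 2" by (cases i) (simp_all add: enc_bool_def)
    have 5: "sz ds \<le> sz x" unfolding fx by (simp add: sz_prod[of x])
    show "y \<in> E \<and> sz y \<le> p (sz x)" using yE 1 2 3 4 5 unfolding y p_def by simp
  qed
  thus ?thesis unfolding wl_result_def
  proof (rule pt_comp)
    show "pt {p. good_item (length (fst p)) (fst (snd p)) (snd (snd p))}
      (\<lambda>x. (fst x, [(0, fst (snd x), snd (snd x))], [], 0, False))" by (intro pt_intros)
  qed (auto simp: D_def)
qed

section \<open>Parsing the input and assembling the answer\<close>

definition hd0 :: "int list \<Rightarrow> int" where "hd0 xs = hd (xs @ [0])"

lemma hd0_simps [simp]: "hd0 [] = 0" "hd0 (x # xs) = x" by (simp_all add: hd0_def)

lemma pt_hd0 [pt_intros]: "pt D f \<Longrightarrow> pt D (\<lambda>s. hd0 (f s))"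
  unfolding hd0_def by (rule pt_hd) (intro pt_intros, assumption, simp)

definition parse_transition :: "nat \<Rightarrow> int list \<Rightarrow> nat transition" where
  "parse_transition d xs = (nat (hd0 xs), vec_of_list (take d (tl xs)), nat (hd0 (drop (d + 1) xs)))"

text \<open>The dimension and the number of transitions arrive in binary but have to become lists to
  be iterated over, so they are cut off as prefixes of the input. The input is long enough because
  at least one transition, of \<open>d + 2\<close> entries, is listed. Transition number
  \<open>i\<close> starts at offset \<open>i * (d + 2)\<close>.\<close>

definition parse :: "int list \<Rightarrow> nat list \<times> nat list \<times> nat transition list" where
  "parse xs = (let d = nat (hd0 xs); n = nat (hd0 (tl xs)); r = drop n (drop 2 xs) in
     (map (\<lambda>_. 0) (take d xs), map nat (take n (drop 2 xs)),
      map (\<lambda>p. parse_transition d (drop (fst p * (d + 2)) (tl r))) (take (nat (hd0 r)) (List.enumerate 0 (tl r)))))"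

lemma pt_parse: "pt UNIV parse"
  unfolding parse_def[abs_def] parse_transition_def Let_def by (intro pt_intros)

lemma length_encode_transition: "eff e \<in> carrier_vec d \<Longrightarrow> length (encode_transition e) = d + 2"
  unfolding encode_transition_def by (auto split: prod.splits)

lemma parse_encode_transition:
  assumes "eff e \<in> carrier_vec d" shows "parse_transition d (encode_transition e @ xs) = e"
proof -
  obtain p u q where e: "e = (p, u, q)" by (cases e)
  have l: "dim_vec u = d" using assms unfolding e by simp
  have "take d (list_of_vec u) = list_of_vec u" "drop d (list_of_vec u) = []" using l by simp_all
  thus ?thesis unfolding parse_transition_def encode_transition_def e by (simp add: l vec_list)
qed

lemma drop_concat:
  assumes "\<And>x. x \<in> set xs \<Longrightarrow> length (f x) = n"
  shows "drop (i * n) (concat (map f xs)) = concat (map f (drop i xs))"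
  using assms
proof (induction xs arbitrary: i)
  case (Cons x xs)
  have "length (f x) = n" using Cons by simp
  thus ?case using Cons by (cases i) auto
qed simp

lemma parse_encode_listing:
  assumes T: "\<And>e. e \<in> set Ts \<Longrightarrow> eff e \<in> carrier_vec d" and ne: "Ts \<noteq> []"
  shows "parse (encode_listing d Qs Ts) = (replicate d 0, Qs, Ts)"
proof -
  define R where "R = concat (map encode_transition Ts)"
  define xs where "xs = encode_listing d Qs Ts"
  have len: "length (concat (map encode_transition Us)) = length Us * (d + 2)" if "set Us \<subseteq> set Ts" for Us
    using that by (induction Us) (auto simp: length_encode_transition[OF T])
  have lR: "length R = length Ts * (d + 2)" unfolding R_def by (rule len) simp
  have "1 * (d + 2) \<le> length Ts * (d + 2)" using ne by (intro mult_right_mono) (auto simp: Suc_le_eq)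
  hence ld: "d \<le> length R" unfolding lR by simp
  have lT: "length Ts \<le> length R" unfolding lR by simp
  have xs: "xs = int d # int (length Qs) # map int Qs @ int (length Ts) # R"
    unfolding xs_def encode_listing_def R_def by simp
  have h: "hd0 xs = int d" "hd0 (tl xs) = int (length Qs)" "drop 2 xs = map int Qs @ int (length Ts) # R" unfolding xs by simp_all
  have r: "drop (length Qs) (drop 2 xs) = int (length Ts) # R" "take (length Qs) (drop 2 xs) = map int Qs" unfolding h by simp_all
  have "map (\<lambda>_. 0 :: nat) (take d xs) = replicate d 0"
  proof -
    have "length (take d xs) = d" unfolding xs using ld by simp
    thus ?thesis by (metis map_replicate_const)
  qed
  moreover have "map nat (map int Qs) = Qs" by (simp add: o_def)
  moreover have "map (\<lambda>p. parse_transition d (drop (fst p * (d + 2)) R)) (take (length Ts) (List.enumerate 0 R)) = Ts" (is "?l = _")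
  proof (rule nth_equalityI)
    show "length ?l = length Ts" using lT by simp
    fix i assume "i < length ?l"
    hence i: "i < length Ts" using lT by simp
    have "drop (i * (d + 2)) R = concat (map encode_transition (drop i Ts))"
      unfolding R_def by (rule drop_concat) (rule length_encode_transition[OF T])
    also have "drop i Ts = Ts ! i # drop (Suc i) Ts" using i by (simp add: Cons_nth_drop_Suc)
    finally have "parse_transition d (drop (i * (d + 2)) R) = Ts ! i" using parse_encode_transition[OF T[OF nth_mem[OF i]]] by simp
    thus "?l ! i = Ts ! i" using i lT by (simp add: nth_enumerate_eq)
  qed
  ultimately show ?thesis unfolding parse_def xs_def[symmetric] Let_def h(1,2) nat_int r by simp
qed

definition alg :: "int list \<Rightarrow> int list" where
  "alg xs = (let p = parse xs; ds = fst p; Qs = fst (snd p); Ts = snd (snd p); S = wl_result ds Qs Ts in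
     (if snd (snd (snd (snd S))) then [0]
      else [1, int (Suc (fst (snd (snd (snd S))))), if \<forall>y\<in>set (take (length ds) (qrf ds Qs Ts)). 0 < y then 1 else 0])
     @ fst (snd (snd S)))"

lemma alg_correct:
  assumes g: "good_item d Qs Ts"
  shows "\<exists>t r ys. algorithm_run d (set Qs, set Ts) t r \<and> encodes_call d t ys \<and>
    alg (encode_listing d Qs Ts) = encode_verdict r @ ys"
proof -
  let ?A = "(set Qs, set Ts)"
  define ds where "ds = replicate d (0 :: nat)"
  have ld: "length ds = d" unfolding ds_def by simp
  have ne: "Ts \<noteq> []" using g unfolding good_item_def by simp
  have T: "eff e \<in> carrier_vec d" if "e \<in> set Ts" for e using good_itemD(2)[OF g] that by auto
  have ps: "parse (encode_listing d Qs Ts) = (ds, Qs, Ts)" unfolding ds_def by (rule parse_encode_listing[OF T ne])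
  have "\<exists>t ys. arg t = ?A \<and> decompose_run d t \<and> proper t \<and> encodes_call d t ys \<and>
    (\<forall>j st out mx i. while wl_loop wl_step (ds, (j, Qs, Ts) # st, out, mx, i) =
       while wl_loop wl_step (ds, st, out @ ys, max mx (j + hgt t), i \<or> diverges t))"
    using wl_while_item[where ds = ds and Qs = Qs and Ts = Ts] g unfolding ld by blast
  then obtain t ys where t: "arg t = ?A" "decompose_run d t" "proper t" "encodes_call d t ys"
    "\<forall>j st out mx i. while wl_loop wl_step (ds, (j, Qs, Ts) # st, out, mx, i) =
       while wl_loop wl_step (ds, st, out @ ys, max mx (j + hgt t), i \<or> diverges t)" by (elim exE conjE)
  have "wl_result ds Qs Ts = while wl_loop wl_step (ds, [], [] @ ys, max 0 (0 + hgt t), False \<or> diverges t)"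
    unfolding wl_result_def t(5)[rule_format] ..
  also have "\<dots> = (ds, [], ys, hgt t, diverges t)" by (subst while_unfold) (simp add: wl_loop_def)
  finally have w: "wl_result ds Qs Ts = (ds, [], ys, hgt t, diverges t)" .
  have sub: "snd ?A \<subseteq> fst ?A \<times> carrier_vec d \<times> fst ?A" using good_itemD(2)[OF g] by simp
  have q: "(\<exists>f. positive_QRF d ?A f) \<longleftrightarrow> (\<forall>y\<in>set (take d (qrf ds Qs Ts)). 0 < y)"
    by (rule qrf_maximal(4)[OF ld good_itemD(1)[OF g] sub])
  define r where "r = (case return_value t of \<infinity> \<Rightarrow> Non_terminating | enat k \<Rightarrow> Bound k (\<exists>f. positive_QRF d ?A f))"
  have "algorithm_run d ?A t r" unfolding algorithm_run_def r_def using t by simp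
  moreover have "alg (encode_listing d Qs Ts) = encode_verdict r @ ys"
    unfolding alg_def ps Let_def fst_conv snd_conv w ld q[symmetric] r_def return_value_eq[OF t(3)] by simp
  ultimately show ?thesis using t(4) by blast
qed

lemma pt_alg: "pt {encode_listing d Qs Ts | d Qs Ts. good_item d Qs Ts} alg" (is "pt ?D _")
proof -
  have gi: "good_item (length (fst (parse xs))) (fst (snd (parse xs))) (snd (snd (parse xs)))" if xs: "xs \<in> ?D" for xs
  proof -
    obtain d Qs Ts where g: "xs = encode_listing d Qs Ts" "good_item d Qs Ts" using xs by blast
    have ne: "Ts \<noteq> []" using g unfolding good_item_def by simp
    have T: "eff e \<in> carrier_vec d" if "e \<in> set Ts" for e using good_itemD(2)[OF g(2)] that by auto
    have "parse xs = (replicate d 0, Qs, Ts)" unfolding g(1) by (rule parse_encode_listing[OF T ne])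
    thus ?thesis using g(2) by simp
  qed
  have p: "pt ?D parse" by (rule pt_subset[OF pt_parse]) simp
  have w: "pt ?D (\<lambda>xs. wl_result (fst (parse xs)) (fst (snd (parse xs))) (snd (snd (parse xs))))"
    by (rule pt_comp[OF pt_wl_result p]) (use gi in simp)
  have q: "pt ?D (\<lambda>xs. qrf (fst (parse xs)) (fst (snd (parse xs))) (snd (snd (parse xs))))"
  proof (rule pt_qrf)
    fix xs assume "xs \<in> ?D"
    from good_itemD(2)[OF gi[OF this]] show "wf_item (fst (parse xs)) (fst (snd (parse xs))) (snd (snd (parse xs)))"
      unfolding wf_item_def by auto
  qed (intro pt_intros p)+
  show ?thesis unfolding alg_def[abs_def] Let_def by (intro pt_intros w p q)
qed

section \<open>Input and output\<close>

text \<open>Cell 0, the length of the input, doubles as counter and as address of the last unread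
  item; reading backwards, consing restores the order of the list. Four heap cells per item hold the
  tag 1, the address of the inner pair, the item and the rest.\<close>

definition read_item :: program where
  "read_item = Seq (Seq (Seq (Seq (Seq (Seq
     (Store (haddr (rg 0)) (Const 1))
     (Store (haddr (Add (rg 0) (Const 1))) (Add (rg 0) (Const 2))))
     (Store (haddr (Add (rg 0) (Const 2))) (Cell (Cell (Const 0)))))
     (Store (haddr (Add (rg 0) (Const 3))) (rg 1)))
     (Store (Const (ra 1)) (rg 0)))
     (Store (Const (ra 0)) (Add (rg 0) (Const 4))))
     (Store (Const 0) (Sub (Cell (Const 0)) (Const 1)))"

text \<open>Negative addresses initially contain 0. So the heap cells 0 and 1 already form the empty
  list, register 1 already points to it, and only the heap pointer has to be set past them.\<close>

definition read_input :: program where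
  "read_input = Seq (Store (Const (ra 0)) (Const 2)) (While (Cell (Const 0)) read_item)"

lemma neg_addr: "0 \<le> p \<Longrightarrow> 0 \<le> q \<Longrightarrow> q \<noteq> ha p" "0 \<le> q \<Longrightarrow> q \<noteq> ra k" "ha p \<noteq> 0 \<or> p < 0" "ra k \<noteq> 0"
  unfolding ha_def ra_def by auto

lemma bits_reg: "bits (ra 0) \<le> 2" "bits (ra 1) \<le> 4"
  using bits_le_abs[of 1] bits_le_abs[of 3] unfolding ra_def by simp_all

lemma bits_plus_small: "bits (z + 1) \<le> bits z + 2" "bits (z + 2) \<le> bits z + 3" "bits (z + 3) \<le> bits z + 4"
  "bits (z + 4) \<le> bits z + 5" "bits (z - 1) \<le> bits z + 2"
  using bits_add[of z 1] bits_add[of z 2] bits_add[of z 3] bits_add[of z 4] bits_diff[of z 1]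
    bits_le_abs[of 1] bits_le_abs[of 2] bits_le_abs[of 3] bits_le_abs[of 4] by simp_all

lemma bits_numerals: "bits 0 \<le> 1" "bits 1 \<le> 2" "bits 2 \<le> 3" "bits 3 \<le> 4" "bits 4 \<le> 5"
  using bits_le_abs[of 0] bits_le_abs[of 1] bits_le_abs[of 2] bits_le_abs[of 3] bits_le_abs[of 4] by simp_all

lemma ex_read_item:
  assumes m0: "0 < m 0" and h: "0 \<le> m (ra 0)" and v: "rep m (m (ra 1)) v"
    and b: "bits (m 0) \<le> s" "bits (m (m 0)) \<le> s" "bits (m (ra 0)) \<le> s" "bits (m (ra 1)) \<le> s"
  shows "\<exists>m'. ex read_item m (7 * ((10 * s + 100) * (10 * s + 100))) m' \<and> m' 0 = m 0 - 1 \<and> m' (ra 0) = m (ra 0) + 4 \<and>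
    (\<forall>j>0. m' j = m j) \<and> rep m' (m' (ra 1)) (Pr (Num 1) (Pr (Num (m (m 0))) v))"
proof -
  define u where "u = 10 * s + 100"
  define H where "H = m (ra 0)"
  note bb = bits_reg bits_numerals bits_plus_small[of H] b[folded H_def]
  define m1 where "m1 = m(ha H := 1)"
  define m2 where "m2 = m1(ha (H + 1) := H + 2)"
  define m3 where "m3 = m2(ha (H + 2) := m (m 0))"
  define m4 where "m4 = m3(ha (H + 3) := m (ra 1))"
  define m5 where "m5 = m4(ra 1 := H)"
  define m6 where "m6 = m5(ra 0 := H + 4)"
  define m7 where "m7 = m6(0 := m 0 - 1)"
  have r1: "m1 (ra j) = m (ra j)" for j unfolding m1_def by simp
  have r2: "m2 (ra j) = m (ra j)" for j unfolding m2_def by (simp add: r1)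
  have r3: "m3 (ra j) = m (ra j)" for j unfolding m3_def by (simp add: r2)
  have r4: "m4 (ra j) = m (ra j)" for j unfolding m4_def by (simp add: r3)
  have r5: "m5 (ra 0) = H" unfolding m5_def by (simp add: r4 H_def)
  have p2: "m2 p = m p" if "0 \<le> p" for p
    using neg_addr(1)[of H p] neg_addr(1)[of "H + 1" p] that h unfolding m2_def m1_def H_def by simp
  have p4: "m4 p = m p" if "0 \<le> p" for p
    using neg_addr(1)[of "H + 2" p] neg_addr(1)[of "H + 3" p] that h p2[OF that] unfolding m4_def m3_def H_def by simp
  have p6: "m6 p = m p" if "0 \<le> p" for p
    using neg_addr(2)[OF that] p4[OF that] unfolding m6_def m5_def by simp
  have e1: "ex (Store (haddr (rg 0)) (Const 1)) m (u * u) m1"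
    using ex_store[of m "haddr (rg 0)" "Const 1" u] esum_haddr[of m "rg 0"] bb
    unfolding m1_def u_def by (simp add: H_def)
  have e2: "ex (Store (haddr (Add (rg 0) (Const 1))) (Add (rg 0) (Const 2))) m1 (u * u) m2"
    using ex_store[of m1 "haddr (Add (rg 0) (Const 1))" "Add (rg 0) (Const 2)" u]
      esum_haddr[of m1 "Add (rg 0) (Const 1)"] bb
    unfolding m2_def u_def by (simp add: r1 H_def[symmetric])
  have e3: "ex (Store (haddr (Add (rg 0) (Const 2))) (Cell (Cell (Const 0)))) m2 (u * u) m3"
    using ex_store[of m2 "haddr (Add (rg 0) (Const 2))" "Cell (Cell (Const 0))" u]
      esum_haddr[of m2 "Add (rg 0) (Const 2)"] bb p2[of 0] p2[of "m 0"] m0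
    unfolding m3_def u_def by (simp add: r2 H_def[symmetric])
  have e4: "ex (Store (haddr (Add (rg 0) (Const 3))) (rg 1)) m3 (u * u) m4"
    using ex_store[of m3 "haddr (Add (rg 0) (Const 3))" "rg 1" u]
      esum_haddr[of m3 "Add (rg 0) (Const 3)"] bb
    unfolding m4_def u_def by (simp add: r3 H_def[symmetric])
  have e5: "ex (Store (Const (ra 1)) (rg 0)) m4 (u * u) m5"
    using ex_set_reg[of 1 m4 "rg 0" u] bb unfolding m5_def u_def by (simp add: r4 H_def[symmetric])
  have e6: "ex (Store (Const (ra 0)) (Add (rg 0) (Const 4))) m5 (u * u) m6"
    using ex_set_reg[of 0 m5 "Add (rg 0) (Const 4)" u] bb unfolding m6_def u_def by (simp add: r5)
  have e7: "ex (Store (Const 0) (Sub (Cell (Const 0)) (Const 1))) m6 (u * u) m7"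
    using ex_store[of m6 "Const 0" "Sub (Cell (Const 0)) (Const 1)" u] bb bits_plus_small(5)[of "m 0"] p6[of 0]
    unfolding m7_def u_def by simp
  have ex: "ex read_item m (u * u + u * u + u * u + u * u + u * u + u * u + u * u) m7"
    unfolding read_item_def
    by (rule ex_seq[OF ex_seq[OF ex_seq[OF ex_seq[OF ex_seq[OF ex_seq[OF e1 e2] e3] e4] e5] e6] e7])
  have ha7: "m7 (ha p) = m4 (ha p)" if "0 \<le> p" for p
    using neg_addr(1)[OF that, of 0] unfolding m7_def m6_def m5_def by simp
  have kp: "keeps 1 m m7"
    unfolding keeps_def
  proof (intro conjI allI impI)
    show "m (ra 0) \<le> m7 (ra 0)" using neg_addr(4)[of 0] unfolding m7_def m6_def H_def by simp
    fix p assume p: "0 \<le> p \<and> p < m (ra 0)"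
    show "m7 (ha p) = m (ha p)" using p ha7[of p] unfolding m4_def m3_def m2_def m1_def H_def by simp
  qed auto
  have "m7 (ha H) = 1" "m7 (ha (H + 1)) = H + 2" "m7 (ha (H + 2)) = m (m 0)" "m7 (ha (H + 3)) = m (ra 1)"
    using h unfolding H_def[symmetric] by (simp_all add: ha7 m4_def m3_def m2_def m1_def)
  moreover have "m7 (ra 0) = H + 4" "m7 (ra 1) = H" using neg_addr(4)[of 0] neg_addr(4)[of 1] unfolding m7_def m6_def m5_def by simp_all
  ultimately have "rep m7 (m7 (ra 1)) (Pr (Num 1) (Pr (Num (m (m 0))) v))"
    using rep_keeps[OF v kp] h unfolding H_def[symmetric] by (simp add: add.assoc)
  moreover have "\<forall>j>0. m7 j = m j" using p6 unfolding m7_def by simp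
  moreover have "m7 0 = m 0 - 1" unfolding m7_def by simp
  ultimately show ?thesis using ex \<open>m7 (ra 0) = H + 4\<close> unfolding u_def[symmetric] H_def
    by (intro exI[of _ m7]) (auto elim!: ex_mono)
qed

lemma ex_read_loop:
  assumes "m 0 = int i" "i \<le> length xs" "\<forall>j<length xs. m (int j + 1) = xs ! j"
    "m (ra 0) = 2 + 4 * int (length xs - i)" "rep m (m (ra 1)) (enc (drop i xs))"
    "6 * length xs + 4 \<le> s" "\<forall>x\<in>set xs. bits x \<le> s"
  shows "\<exists>m'. ex (While (Cell (Const 0)) read_item) m (Suc i * (8 * ((20 * s + 100) * (20 * s + 100)))) m' \<and>
    m' (ra 0) = 2 + 4 * int (length xs) \<and> rep m' (m' (ra 1)) (enc xs)"
  using assms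
proof (induction i arbitrary: m)
  case 0
  have "1 + esum m (Cell (Const 0)) * esum m (Cell (Const 0)) \<le> 8 * ((20 * s + 100) * (20 * s + 100))"
  proof -
    have "m 0 = 0" using "0.prems"(1) by simp
    hence "esum m (Cell (Const 0)) = bits 0 + bits 0" by simp
    hence "esum m (Cell (Const 0)) \<le> 2" using bits_numerals(1) by linarith
    from mult_mono[OF this this] have "esum m (Cell (Const 0)) * esum m (Cell (Const 0)) \<le> 2 * 2" by simp
    moreover have "100 * 100 \<le> (20 * s + 100) * (20 * s + 100)" by (rule mult_mono) simp_all
    ultimately show ?thesis by linarith
  qed
  thus ?case using 0 by (intro exI[of _ m]) (simp add: ex_while_false)
next
  case (Suc i)
  let ?u = "20 * s + 100"
  let ?v = "enc (drop (Suc i) xs)"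
  have hp: "0 \<le> m (ra 0)" "nat \<bar>m (ra 0)\<bar> \<le> 4 * length xs + 2" using Suc.prems(4) by auto
  have bh: "bits (m (ra 0)) \<le> s" using bits_le_abs[of "m (ra 0)"] hp(2) Suc.prems(2,6) by linarith
  have b0: "bits (m 0) \<le> s" using bits_of_nat_le[of "Suc i"] Suc.prems(1,2,6) by simp
  have it: "m (m 0) = xs ! i" using Suc.prems(3)[rule_format, of i] Suc.prems(1,2) by (simp add: add.commute)
  have b1: "bits (m (m 0)) \<le> s" unfolding it using Suc.prems(2,7) by simp
  have pr: "\<exists>a b. ?v = Pr a b" by (cases "drop (Suc i) xs") auto
  have "\<bar>m (ra 1)\<bar> \<le> \<bar>m (ra 0)\<bar>" using Suc.prems(5) pr by auto
  hence b2: "bits (m (ra 1)) \<le> s" using bits_mono bh le_trans by blast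
  have m0: "0 < m 0" using Suc.prems(1) by simp
  obtain m' where m': "ex read_item m (7 * ((10 * s + 100) * (10 * s + 100))) m'" "m' 0 = m 0 - 1" "m' (ra 0) = m (ra 0) + 4"
    "\<forall>j>0. m' j = m j" "rep m' (m' (ra 1)) (Pr (Num 1) (Pr (Num (m (m 0))) ?v))"
    using ex_read_item[OF m0 hp(1) Suc.prems(5) b0 b1 bh b2] by (elim exE conjE)
  have dr: "drop i xs = xs ! i # drop (Suc i) xs" using Suc.prems(2) by (simp add: Cons_nth_drop_Suc)
  have rp: "rep m' (m' (ra 1)) (enc (drop i xs))" using m'(5) unfolding it dr by (simp add: enc_int_def)
  have h': "m' (ra 0) = 2 + 4 * int (length xs - i)" using m'(3) Suc.prems(2,4) by simp
  have c': "m' 0 = int i" using m'(2) Suc.prems(1) by simp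
  have i': "\<forall>j<length xs. m' (int j + 1) = xs ! j" using m'(4) Suc.prems(3) by simp
  obtain m'' where m'': "ex (While (Cell (Const 0)) read_item) m' (Suc i * (8 * (?u * ?u))) m''"
    "m'' (ra 0) = 2 + 4 * int (length xs)" "rep m'' (m'' (ra 1)) (enc xs)"
    using Suc.IH[OF c' Suc_leD[OF Suc.prems(2)] i' h' rp Suc.prems(6,7)] by (elim exE conjE)
  have es: "1 + esum m (Cell (Const 0)) * esum m (Cell (Const 0)) \<le> ?u * ?u"
  proof -
    have "esum m (Cell (Const 0)) \<le> s + 1" using b0 bits_numerals by simp
    from mult_mono[OF this this] have "esum m (Cell (Const 0)) * esum m (Cell (Const 0)) \<le> (s + 1) * (s + 1)" by simp
    thus ?thesis by (simp add: algebra_simps)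
  qed
  have e1: "ex read_item m (7 * (?u * ?u)) m'" by (rule ex_mono[OF m'(1)]) (simp add: algebra_simps)
  have "ex (While (Cell (Const 0)) read_item) m (?u * ?u + 7 * (?u * ?u) + Suc i * (8 * (?u * ?u))) m''"
    by (rule ex_while_true[OF _ e1 m''(1) es]) (simp add: m0)
  hence "ex (While (Cell (Const 0)) read_item) m (Suc (Suc i) * (8 * (?u * ?u))) m''" by (rule ex_mono) simp
  thus ?case using m''(2,3) by blast
qed

lemma ex_read_input:
  assumes "6 * length xs + 4 \<le> s" "\<forall>x\<in>set xs. bits x \<le> s"
  shows "\<exists>m'. ex read_input (input_memory xs) (Suc (Suc (length xs)) * (8 * ((20 * s + 100) * (20 * s + 100)))) m' \<and>
    m' (ra 0) = 2 + 4 * int (length xs) \<and> rep m' (m' (ra 1)) (enc xs)"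
proof -
  let ?m = "(input_memory xs)(ra 0 := 2)" let ?u = "20 * s + 100"
  have neg: "input_memory xs p = 0" if "p < 0" for p using that unfolding input_memory_def by simp
  have e1: "ex (Store (Const (ra 0)) (Const 2)) (input_memory xs) (?u * ?u) ?m"
    using ex_set_reg[of 0 "input_memory xs" "Const 2" ?u] bits_reg bits_numerals by simp
  have c: "?m 0 = int (length xs)" using neg_addr(4)[of 0] unfolding input_memory_def by simp
  have i: "\<forall>j<length xs. ?m (int j + 1) = xs ! j"
    using neg_addr(2)[of "int _ + 1" 0] unfolding input_memory_def by simp
  have h: "?m (ra 0) = 2 + 4 * int (length xs - length xs)" by simp
  have r: "rep ?m (?m (ra 1)) (enc (drop (length xs) xs))"
    using neg[of "ra 1"] neg[of "ha 0"] neg[of "ha 1"] by (simp add: ra_def ha_def)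
  obtain m' where m': "ex (While (Cell (Const 0)) read_item) ?m (Suc (length xs) * (8 * (?u * ?u))) m'"
    "m' (ra 0) = 2 + 4 * int (length xs)" "rep m' (m' (ra 1)) (enc xs)"
    using ex_read_loop[OF c order_refl i h r assms] by (elim exE conjE)
  show ?thesis
    by (rule exI[of _ m'], intro conjI m'(2,3), rule ex_mono[OF ex_seq[OF e1 m'(1), folded read_input_def]]) simp
qed

section \<open>Writing the output list to consecutive cells\<close>

definition item_ptr :: expr where "item_ptr = Cell (haddr (Add (rg 1) (Const 1)))"

text \<open>Cell 0 is incremented first and then is both the number of items written, including the
  present one, and the address of the cell for it.\<close>

definition write_item :: program where
  "write_item = Seq (Seq
     (Store (Const 0) (Add (Cell (Const 0)) (Const 1)))
     (Store (Cell (Const 0)) (Cell (haddr item_ptr))))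
     (Store (Const (ra 1)) (Cell (haddr (Add item_ptr (Const 1)))))"

definition write_output :: program where
  "write_output = Seq (Store (Const 0) (Const 0)) (While (Cell (haddr (rg 1))) write_item)"

lemma ex_write_item:
  assumes r: "rep m (m (ra 1)) (Pr t (Pr (Num x) v))" and m0: "0 \<le> m 0"
    and b: "bits (m 0) \<le> s" "vsize (Pr t (Pr (Num x) v)) + bits (m (ra 0)) \<le> s"
  shows "\<exists>m'. ex write_item m (3 * ((20 * s + 100) * (20 * s + 100))) m' \<and> m' (ra 0) = m (ra 0) \<and>
    m' 0 = m 0 + 1 \<and> m' (m 0 + 1) = x \<and> (\<forall>j. 0 < j \<and> j \<le> m 0 \<longrightarrow> m' j = m j) \<and> rep m' (m' (ra 1)) v"
proof -
  define u where "u = 20 * s + 100"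
  define W where "W = m (ra 1)"
  define V where "V = m (ha (W + 1))"
  define Z where "Z = m (ha (V + 1))"
  have w: "0 \<le> W" "W + 1 < m (ra 0)" "0 \<le> V" "V + 1 < m (ra 0)" "m (ha V) = x" "rep m Z v"
    using r unfolding W_def V_def Z_def by simp_all
  have le: "bits W \<le> s" "bits (W + 1) \<le> s" "bits V \<le> s" "bits (V + 1) \<le> s"
    using bits_mono[of W "m (ra 0)"] bits_mono[of "W + 1" "m (ra 0)"] bits_mono[of V "m (ra 0)"] bits_mono[of "V + 1" "m (ra 0)"]
      w(1-4) b(2) by simp_all
  have "bits Z \<le> s" "bits x \<le> s" using rep_bits[OF w(6)] b(2) by simp_all
  note bb = bits_reg bits_numerals b(1) le this bits_plus_small(1)[of "m 0"]
  define m1 where "m1 = m(0 := m 0 + 1)"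
  define m2 where "m2 = m1(m 0 + 1 := x)"
  define m3 where "m3 = m2(ra 1 := Z)"
  have h1: "m1 (ha p) = m (ha p)" "m2 (ha p) = m (ha p)" if "0 \<le> p" for p
    using neg_addr(1)[OF that, of 0] neg_addr(1)[OF that, of "m 0 + 1"] m0 unfolding m2_def m1_def by simp_all
  have r1: "m1 (ra k) = m (ra k)" "m2 (ra k) = m (ra k)" for k
    using neg_addr(2)[of 0 k] neg_addr(2)[of "m 0 + 1" k] m0 unfolding m2_def m1_def by simp_all
  have v1: "eval m1 item_ptr = V" "eval m2 item_ptr = V" using h1 w(1) unfolding item_ptr_def
    by (simp_all add: r1 W_def[symmetric] V_def[symmetric] del: One_nat_def)
  have es: "esum m1 item_ptr \<le> 6 * s + 30" "esum m2 item_ptr \<le> 6 * s + 30"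
    using esum_haddr[of m1 "Add (rg 1) (Const 1)"] esum_haddr[of m2 "Add (rg 1) (Const 1)"] bb h1 w(1) unfolding item_ptr_def
    by (simp_all add: r1 W_def[symmetric] V_def[symmetric] del: One_nat_def)
  have e1: "ex (Store (Const 0) (Add (Cell (Const 0)) (Const 1))) m (u * u) m1"
    using ex_store[of m "Const 0" "Add (Cell (Const 0)) (Const 1)" u] bb unfolding m1_def u_def by simp
  have e2: "ex (Store (Cell (Const 0)) (Cell (haddr item_ptr))) m1 (u * u) m2"
    using ex_store[of m1 "Cell (Const 0)" "Cell (haddr item_ptr)" u] esum_haddr[of m1 item_ptr] es bb h1[OF w(3)] w(5)
    unfolding m2_def u_def by (simp add: v1) (simp add: m1_def)
  have e3: "ex (Store (Const (ra 1)) (Cell (haddr (Add item_ptr (Const 1))))) m2 (u * u) m3"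
    using ex_set_reg[of 1 m2 "Cell (haddr (Add item_ptr (Const 1)))" u] esum_haddr[of m2 "Add item_ptr (Const 1)"] es bb h1[of "V + 1"] w(3)
    unfolding m3_def u_def by (simp add: v1 Z_def[symmetric] del: One_nat_def)
  have ex: "ex write_item m (u * u + u * u + u * u) m3"
    unfolding write_item_def by (rule ex_seq[OF ex_seq[OF e1 e2] e3])
  have kp: "keeps 1 m m3" unfolding keeps_def using h1(2) r1(2)[of 0] unfolding m3_def by auto
  have "m3 (ra 0) = m (ra 0)" "m3 (ra 1) = Z" unfolding m3_def by (simp_all add: r1)
  moreover have "m3 p = m2 p" if "0 \<le> p" for p using neg_addr(2)[OF that, of 1] unfolding m3_def by simp
  moreover have "m2 0 = m 0 + 1" "m2 (m 0 + 1) = x" "\<forall>j. 0 < j \<and> j \<le> m 0 \<longrightarrow> m2 j = m j"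
    using m0 unfolding m2_def m1_def by auto
  ultimately show ?thesis using ex rep_keeps[OF w(6) kp] m0 unfolding u_def[symmetric]
    by (intro exI[of _ m3]) (auto elim!: ex_mono)
qed

lemma ex_write_loop:
  assumes "rep m (m (ra 1)) (enc (ys :: int list))" "m 0 = int c" "c + length ys + 2 \<le> s" "sz ys + bits (m (ra 0)) \<le> s"
  shows "\<exists>m'. ex (While (Cell (haddr (rg 1))) write_item) m (Suc (length ys) * (4 * ((20 * s + 100) * (20 * s + 100)))) m' \<and>
    m' 0 = int (c + length ys) \<and> (\<forall>j. 0 < j \<and> j \<le> int c \<longrightarrow> m' j = m j) \<and> (\<forall>i<length ys. m' (int (c + i) + 1) = ys ! i)"
  using assms
proof (induction ys arbitrary: m c)
  case Nil
  let ?u = "20 * s + 100"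
  have es: "esum m (Cell (haddr (rg 1))) \<le> 4 * s + 40"
  proof -
    have "m (ha (m (ra 1))) = 0" using Nil.prems(1) by simp
    hence "esum m (Cell (haddr (rg 1))) = esum m (haddr (rg 1)) + bits 0" by simp
    moreover have "bits (m (ra 1)) \<le> s" using rep_bits[OF Nil.prems(1)] Nil.prems(4) by linarith
    ultimately show ?thesis using esum_haddr[of m "rg 1"] bits_reg(2) bits_numerals(1) unfolding esum_rg eval_rg by linarith
  qed
  from mult_mono[OF this this] have "esum m (Cell (haddr (rg 1))) * esum m (Cell (haddr (rg 1))) \<le> (4 * s + 40) * (4 * s + 40)" by simp
  hence "1 + esum m (Cell (haddr (rg 1))) * esum m (Cell (haddr (rg 1))) \<le> 4 * (?u * ?u)" by (simp add: algebra_simps)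
  from ex_while_false[OF _ this] show ?case using Nil by (intro exI[of _ m]) simp
next
  case (Cons y ys)
  let ?u = "20 * s + 100"
  have es: "esum m (Cell (haddr (rg 1))) \<le> 4 * s + 40"
  proof -
    have "m (ha (m (ra 1))) = 1" using Cons.prems(1) by simp
    hence "esum m (Cell (haddr (rg 1))) = esum m (haddr (rg 1)) + bits 1" by simp
    moreover have "bits (m (ra 1)) \<le> s" using rep_bits[OF Cons.prems(1)] Cons.prems(4) by linarith
    ultimately show ?thesis using esum_haddr[of m "rg 1"] bits_reg(2) bits_numerals(2) unfolding esum_rg eval_rg by linarith
  qed
  from mult_mono[OF this this] have "esum m (Cell (haddr (rg 1))) * esum m (Cell (haddr (rg 1))) \<le> (4 * s + 40) * (4 * s + 40)" by simp
  hence c: "1 + esum m (Cell (haddr (rg 1))) * esum m (Cell (haddr (rg 1))) \<le> ?u * ?u" by (simp add: algebra_simps)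
  have r: "rep m (m (ra 1)) (Pr (Num 1) (Pr (Num y) (enc ys)))" using Cons.prems(1) by (simp add: enc_int_def)
  have b0: "bits (m 0) \<le> s" unfolding Cons.prems(2) using bits_of_nat_le[of c] Cons.prems(3) by linarith
  have bs: "vsize (Pr (Num 1) (Pr (Num y) (enc ys))) + bits (m (ra 0)) \<le> s" using Cons.prems(4) by (simp add: enc_int_def)
  have m0: "0 \<le> m 0" using Cons.prems(2) by simp
  obtain m' where m': "ex write_item m (3 * (?u * ?u)) m'" "m' (ra 0) = m (ra 0)"
    "m' 0 = m 0 + 1" "m' (m 0 + 1) = y" "\<forall>j. 0 < j \<and> j \<le> m 0 \<longrightarrow> m' j = m j" "rep m' (m' (ra 1)) (enc ys)"
    using ex_write_item[OF r m0 b0 bs] by (elim exE conjE)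
  have c': "m' 0 = int (Suc c)" using m'(3) Cons.prems(2) by simp
  have s': "Suc c + length ys + 2 \<le> s" "sz ys + bits (m' (ra 0)) \<le> s" using Cons.prems(3,4) m'(2) by simp_all
  obtain m'' where m'': "ex (While (Cell (haddr (rg 1))) write_item) m' (Suc (length ys) * (4 * (?u * ?u))) m''"
    "m'' 0 = int (Suc c + length ys)" "\<forall>j. 0 < j \<and> j \<le> int (Suc c) \<longrightarrow> m'' j = m' j"
    "\<forall>i<length ys. m'' (int (Suc c + i) + 1) = ys ! i"
    using Cons.IH[OF m'(6) c' s'] by (elim exE conjE)
  have pos: "0 < eval m (Cell (haddr (rg 1)))" using r by simp
  have "ex (While (Cell (haddr (rg 1))) write_item) m (?u * ?u + 3 * (?u * ?u) + Suc (length ys) * (4 * (?u * ?u))) m''"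
    by (rule ex_while_true[OF pos m'(1) m''(1) c])
  hence "ex (While (Cell (haddr (rg 1))) write_item) m (Suc (length (y # ys)) * (4 * (?u * ?u))) m''" by (rule ex_mono) simp
  moreover have "\<forall>j. 0 < j \<and> j \<le> int c \<longrightarrow> m'' j = m j" using m''(3) m'(5) Cons.prems(2) by simp
  moreover have "m'' (int (c + i) + 1) = (y # ys) ! i" if "i < length (y # ys)" for i
  proof (cases i)
    case 0
    thus ?thesis using m''(3) m'(4) Cons.prems(2) by (simp add: add.commute)
  next
    case (Suc k)
    thus ?thesis using m''(4)[rule_format, of k] that by simp
  qed
  ultimately show ?case using m''(2) by (intro exI[of _ m'']) simp
qed

lemma ex_write_output:
  assumes "rep m (m (ra 1)) (enc (ys :: int list))" "sz ys + bits (m (ra 0)) \<le> s"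
  shows "\<exists>m'. ex write_output m (Suc (Suc (length ys)) * (4 * ((20 * s + 100) * (20 * s + 100)))) m' \<and> holds_output m' ys"
proof -
  let ?m = "m(0 := 0)" let ?u = "20 * s + 100"
  have e1: "ex (Store (Const 0) (Const 0)) m (?u * ?u) ?m"
    using ex_store[of m "Const 0" "Const 0" ?u] bits_numerals by simp
  have kp: "keeps 1 m ?m" unfolding keeps_def using neg_addr(1)[of _ 0] neg_addr(4)[of 0] by auto
  have ra: "?m (ra k) = m (ra k)" for k using neg_addr(4)[of k] by simp
  have "length ys + 3 \<le> sz ys" unfolding sz_list by (induction ys) auto
  hence "0 + length ys + 2 \<le> s" using assms(2) by linarith
  then obtain m' where m': "ex (While (Cell (haddr (rg 1))) write_item) ?m (Suc (length ys) * (4 * (?u * ?u))) m'"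
    "m' 0 = int (0 + length ys)" "\<forall>i<length ys. m' (int (0 + i) + 1) = ys ! i"
    using ex_write_loop[where m = ?m and c = 0 and ys = ys and s = s] rep_keeps[OF assms(1) kp] assms(2) ra by auto
  have "ex write_output m (Suc (Suc (length ys)) * (4 * (?u * ?u))) m'"
    by (rule ex_mono[OF ex_seq[OF e1 m'(1), folded write_output_def]]) simp
  thus ?thesis unfolding holds_output_def using m'(2,3) by (intro exI[of _ m']) simp
qed

text \<open>Reading and writing translate between the cells and the heap. The polynomial
  \<open>[:2, 1:] ^ b\<close> has the value \<open>(E + 2) ^ b\<close> at \<open>E\<close>, the form
  in which \<open>polyb\<close> provides its bounds.\<close>

lemma pt_program:
  fixes f :: "int list \<Rightarrow> int list"
  assumes "pt D f"
  shows "\<exists>P (b :: nat poly). \<forall>xs\<in>D. \<exists>n m. exec P (input_memory xs) n m \<and> n \<le> poly b (encoding_size xs) \<and> holds_output m (f xs)"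
proof -
  obtain P e where P: "\<And>xs m. xs \<in> D \<Longrightarrow> good 1 m (enc xs) \<Longrightarrow> runs 1 P (\<lambda>s. (s + 2) ^ e) m (enc xs) (enc (f xs))"
    by (rule ptE[OF assms order_refl]) blast
  obtain g where g: "\<And>xs. xs \<in> D \<Longrightarrow> sz (f xs) \<le> (sz xs + 2) ^ g" by (rule pt_size_fun[OF assms]) blast
  define z where "z E = 5 * E + 3" for E :: nat
  define s1 where "s1 E = 6 * E + 4" for E :: nat
  define s2 where "s2 E = (z E + 2) ^ g + (2 + 4 * E + (z E + 2) ^ e + 1)" for E
  define B where "B E = (E + 2) * (8 * ((20 * s1 E + 100) * (20 * s1 E + 100))) + (z E + (4 * E + 3) + 2) ^ e
    + ((z E + 2) ^ g + 2) * (4 * ((20 * s2 E + 100) * (20 * s2 E + 100)))" for E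
  have "polyb B" unfolding B_def[abs_def] s2_def s1_def z_def
    by (intro polyb_add polyb_mult polyb_power polyb_id polyb_const)
  then obtain b where b: "\<And>E. B E \<le> (E + 2) ^ b" unfolding polyb_def by blast
  have "\<exists>n m. exec (Seq (Seq read_input P) write_output) (input_memory xs) n m \<and> n \<le> poly ([:2, 1:] ^ b) (encoding_size xs) \<and> holds_output m (f xs)"
    if xs: "xs \<in> D" for xs
  proof -
    define E where "E = encoding_size xs"
    have len: "length xs \<le> E" unfolding E_def encoding_size_def
      by (induction xs) (auto simp: add_mono[OF bits_ge_1(2), simplified])
    have "sz xs = E + 4 * length xs + 3" unfolding sz_list E_def encoding_size_def
      by (induction xs) (auto simp: enc_int_def)
    hence szx: "sz xs \<le> z E" using len unfolding z_def by simp
    have bx: "\<forall>x\<in>set xs. bits x \<le> s1 E"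
    proof
      fix x assume "x \<in> set xs"
      thus "bits x \<le> s1 E" using member_le_sum_list[of "bits x" "map bits xs"] unfolding s1_def E_def encoding_size_def by simp
    qed
    have "6 * length xs + 4 \<le> s1 E" using len unfolding s1_def by simp
    from ex_read_input[OF this bx] obtain m1 where
      m1: "ex read_input (input_memory xs) (Suc (Suc (length xs)) * (8 * ((20 * s1 E + 100) * (20 * s1 E + 100)))) m1"
      "m1 (ra 0) = 2 + 4 * int (length xs)" "rep m1 (m1 (ra 1)) (enc xs)" by (elim exE conjE)
    have b1: "bits (m1 (ra 0)) \<le> 4 * E + 3" using bits_le_abs[of "m1 (ra 0)"] m1(2) len by simp
    have "good 1 m1 (enc xs)" unfolding good_def using m1 by simp
    from runsE[OF P[OF xs this]] obtain m2 where
      m2: "ex P m1 ((sz xs + bits (m1 (ra 0)) + 2) ^ e) m2" "m2 (ra 0) \<le> m1 (ra 0) + int ((sz xs + 2) ^ e)" "keeps 1 m1 m2"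
      "rep m2 (m2 (ra 1)) (enc (f xs))" by blast
    have "(sz xs + 2) ^ e \<le> (z E + 2) ^ e" "(sz xs + 2) ^ g \<le> (z E + 2) ^ g" using szx by (auto intro: power_mono)
    note pw = this
    have szf: "sz (f xs) \<le> (z E + 2) ^ g" using g[OF xs] pw(2) by simp
    have "m2 (ra 0) \<le> 2 + 4 * int E + int ((z E + 2) ^ e)" using m2(2) m1(2) pw(1) len by (smt (verit) of_nat_mono)
    moreover have "0 \<le> m2 (ra 0)" using keeps_hp[OF m2(3)] m1(2) by simp
    ultimately have "nat \<bar>m2 (ra 0)\<bar> \<le> 2 + 4 * E + (z E + 2) ^ e" by linarith
    hence "bits (m2 (ra 0)) \<le> 2 + 4 * E + (z E + 2) ^ e + 1" using bits_le_abs[of "m2 (ra 0)"] by linarith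
    hence "sz (f xs) + bits (m2 (ra 0)) \<le> s2 E" using szf unfolding s2_def by linarith
    from ex_write_output[OF m2(4) this] obtain m3 where
      m3: "ex write_output m2 (Suc (Suc (length (f xs))) * (4 * ((20 * s2 E + 100) * (20 * s2 E + 100)))) m3" "holds_output m3 (f xs)"
      by (elim exE conjE)
    have "Suc (Suc (length xs)) * (8 * ((20 * s1 E + 100) * (20 * s1 E + 100))) \<le> (E + 2) * (8 * ((20 * s1 E + 100) * (20 * s1 E + 100)))"
      using len by (intro mult_right_mono) simp_all
    moreover have "(sz xs + bits (m1 (ra 0)) + 2) ^ e \<le> (z E + (4 * E + 3) + 2) ^ e"
      using szx b1 by (intro power_mono) simp_all
    moreover have "length (f xs) \<le> (z E + 2) ^ g" using length_le_sz[of "f xs"] szf by linarith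
    hence "Suc (Suc (length (f xs))) * (4 * ((20 * s2 E + 100) * (20 * s2 E + 100))) \<le> ((z E + 2) ^ g + 2) * (4 * ((20 * s2 E + 100) * (20 * s2 E + 100)))"
      by (intro mult_right_mono) simp_all
    ultimately have "ex (Seq (Seq read_input P) write_output) (input_memory xs) (B E) m3"
      unfolding B_def by (intro ex_mono[OF ex_seq[OF ex_seq[OF m1(1) m2(1)] m3(1)]] add_mono)
    hence "ex (Seq (Seq read_input P) write_output) (input_memory xs) ((E + 2) ^ b) m3" using b ex_mono by blast
    moreover have "poly ([:2, 1:] ^ b) E = (E + 2) ^ b" by (simp add: poly_power add.commute)
    ultimately show ?thesis using m3(2) unfolding ex_def E_def by auto
  qed
  thus ?thesis by blast
qed

theorem mainTheorem3:
  shows "(\<exists>P (b :: nat poly). \<forall>d (A :: nat vass) xs.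
            is_vass d A \<and> strongly_connected A \<and> snd A \<noteq> {} \<and> encodes_vass d A xs \<longrightarrow>
            performs_algorithm P d A xs (poly b (encoding_size xs)))
       \<and> (\<forall>d (A :: 'q vass) t r.
            is_vass d A \<and> strongly_connected A \<and> snd A \<noteq> {} \<and> algorithm_run d A t r \<longrightarrow>
            (r \<noteq> Non_terminating \<longrightarrow> recursion_depth t < d) \<and>
            (\<forall>(j, s) \<in> calls_at t.
               j < d \<or> j = d \<and> neutral_transitions (arg s) (chosen s) = snd (arg s)))"
proof (rule conjI)
  obtain P and b :: "nat poly" where P: "\<forall>xs\<in>{encode_listing d Qs Ts | d Qs Ts. good_item d Qs Ts}.
      \<exists>n m. exec P (input_memory xs) n m \<and> n \<le> poly b (encoding_size xs) \<and> holds_output m (alg xs)"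
    using pt_program[OF pt_alg] by (elim exE)
  have "performs_algorithm P d A xs (poly b (encoding_size xs))"
    if A: "is_vass d A" "strongly_connected A" "snd A \<noteq> {}" and xs: "encodes_vass d A xs" for d A xs
  proof -
    obtain Qs Ts where l: "listing A Qs Ts" "xs = encode_listing d Qs Ts" using xs unfolding encodes_vass_def by blast
    have AQ: "A = (set Qs, set Ts)" using l(1) unfolding listing_def by (cases A) simp
    have g: "good_item d Qs Ts" using A l(1) unfolding good_item_def listing_def AQ by simp
    obtain t r ys where t: "algorithm_run d A t r" "encodes_call d t ys" "alg xs = encode_verdict r @ ys"
      using alg_correct[OF g] unfolding AQ l(2) by (elim exE conjE)
    have "xs \<in> {encode_listing d Qs Ts | d Qs Ts. good_item d Qs Ts}" using g l(2) by blast
    from P[rule_format, OF this] obtain n m where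
      "exec P (input_memory xs) n m" "n \<le> poly b (encoding_size xs)" "holds_output m (alg xs)" by (elim exE conjE)
    thus ?thesis using t unfolding performs_algorithm_def
      by (intro exI[of _ n] exI[of _ m] exI[of _ t] exI[of _ r] exI[of _ ys]) simp
  qed
  thus "\<exists>P (b :: nat poly). \<forall>d (A :: nat vass) xs.
            is_vass d A \<and> strongly_connected A \<and> snd A \<noteq> {} \<and> encodes_vass d A xs \<longrightarrow>
            performs_algorithm P d A xs (poly b (encoding_size xs))" by blast
next
  show "\<forall>d (A :: 'q vass) t r.
            is_vass d A \<and> strongly_connected A \<and> snd A \<noteq> {} \<and> algorithm_run d A t r \<longrightarrow>
            (r \<noteq> Non_terminating \<longrightarrow> recursion_depth t < d) \<and>
            (\<forall>(j, s) \<in> calls_at t.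
               j < d \<or> j = d \<and> neutral_transitions (arg s) (chosen s) = snd (arg s))"
    by (intro allI impI, elim conjE, rule recursion_depth_bound)
qed

end
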